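(* Let $P$ be a bicyclic $2$-group. If the commutator subgroup $P'$ is not cyclic, then every saturated fusion system on $P$ is nilpotent.
   Context: A group $P$ is bicyclic if $P=\langle x\rangle\langle y\rangle$ for some $x,y\in P$. A saturated fusion system $\mathcal{F}$ on $P$ is nilpotent if $\mathcal{F}=\mathcal{F}_P(P)$, i.e. all morphisms are induced by conjugation by elements of $P$. *)

theory Defs
  imports "HOL-Algebra.Algebra"
begin

definition p_group :: "nat \<Rightarrow> ('a, 'b) monoid_scheme \<Rightarrow> bool" where
  "p_group p S \<longleftrightarrow> group S \<and> Factorial_Ring.prime p \<and> finite (carrier S) \<and> (\<exists>n. card (carrier S) = p ^ n)"

definition bicyclic :: "('a, 'b) monoid_scheme \<Rightarrow> bool" where
  "bicyclic S \<longleftrightarrow> (\<exists>x\<in>carrier S. \<exists>y\<in>carrier S.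
     carrier S = generate S {x} <#>\<^bsub>S\<^esub> generate S {y})"

definition cyclic_subgroup :: "('a, 'b) monoid_scheme \<Rightarrow> 'a set \<Rightarrow> bool" where
  "cyclic_subgroup S H \<longleftrightarrow> (\<exists>h\<in>H. H = generate S {h})"

definition centralizer_of :: "('a, 'b) monoid_scheme \<Rightarrow> 'a set \<Rightarrow> 'a set" where
  "centralizer_of S H = {g \<in> carrier S. \<forall>h\<in>H. g \<otimes>\<^bsub>S\<^esub> h = h \<otimes>\<^bsub>S\<^esub> g}"

definition conjmap :: "('a, 'b) monoid_scheme \<Rightarrow> 'a \<Rightarrow> 'a set \<Rightarrow> ('a \<Rightarrow> 'a)" where
  "conjmap S g P = restrict (\<lambda>x. g \<otimes>\<^bsub>S\<^esub> x \<otimes>\<^bsub>S\<^esub> inv\<^bsub>S\<^esub> g) P"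

definition Hom_S :: "('a, 'b) monoid_scheme \<Rightarrow> 'a set \<Rightarrow> 'a set \<Rightarrow> ('a \<Rightarrow> 'a) set" where
  "Hom_S S P Q = {conjmap S g P | g. g \<in> carrier S \<and>
       (\<lambda>x. g \<otimes>\<^bsub>S\<^esub> x \<otimes>\<^bsub>S\<^esub> inv\<^bsub>S\<^esub> g) ` P \<subseteq> Q}"

definition fusion_system ::
  "('a, 'b) monoid_scheme \<Rightarrow> ('a set \<Rightarrow> 'a set \<Rightarrow> ('a \<Rightarrow> 'a) set) \<Rightarrow> bool" where
  "fusion_system S F \<longleftrightarrow>
    (\<forall>P Q. subgroup P S \<longrightarrow> subgroup Q S \<longrightarrow>
       F P Q \<subseteq> {\<phi>. \<phi> \<in> hom (S\<lparr>carrier := P\<rparr>) (S\<lparr>carrier := Q\<rparr>) \<and> inj_on \<phi> P \<and> \<phi> \<in> extensional P}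
       \<and> Hom_S S P Q \<subseteq> F P Q) \<and>
    (\<forall>P Q R \<phi> \<psi>. subgroup P S \<longrightarrow> subgroup Q S \<longrightarrow> subgroup R S \<longrightarrow>
       \<phi> \<in> F P Q \<longrightarrow> \<psi> \<in> F Q R \<longrightarrow> restrict (\<psi> \<circ> \<phi>) P \<in> F P R) \<and>
    (\<forall>P Q \<phi>. subgroup P S \<longrightarrow> subgroup Q S \<longrightarrow> \<phi> \<in> F P Q \<longrightarrow>
       \<phi> \<in> F P (\<phi> ` P) \<and> restrict (inv_into P \<phi>) (\<phi> ` P) \<in> F (\<phi> ` P) P)"

definition F_conjugate ::
  "('a, 'b) monoid_scheme \<Rightarrow> ('a set \<Rightarrow> 'a set \<Rightarrow> ('a \<Rightarrow> 'a) set) \<Rightarrow> 'a set \<Rightarrow> 'a set \<Rightarrow> bool" where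
  "F_conjugate S F P Q \<longleftrightarrow> (\<exists>\<phi>\<in>F P (carrier S). Q = \<phi> ` P)"

definition fully_normalized ::
  "('a, 'b) monoid_scheme \<Rightarrow> ('a set \<Rightarrow> 'a set \<Rightarrow> ('a \<Rightarrow> 'a) set) \<Rightarrow> 'a set \<Rightarrow> bool" where
  "fully_normalized S F P \<longleftrightarrow> subgroup P S \<and>
     (\<forall>Q. F_conjugate S F P Q \<longrightarrow> card (normalizer S Q) \<le> card (normalizer S P))"

definition fully_centralized ::
  "('a, 'b) monoid_scheme \<Rightarrow> ('a set \<Rightarrow> 'a set \<Rightarrow> ('a \<Rightarrow> 'a) set) \<Rightarrow> 'a set \<Rightarrow> bool" where
  "fully_centralized S F P \<longleftrightarrow> subgroup P S \<and>
     (\<forall>Q. F_conjugate S F P Q \<longrightarrow> card (centralizer_of S Q) \<le> card (centralizer_of S P))"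

definition N_phi :: "('a, 'b) monoid_scheme \<Rightarrow> 'a set \<Rightarrow> ('a \<Rightarrow> 'a) \<Rightarrow> 'a set" where
  "N_phi S P \<phi> = {g \<in> normalizer S P. \<exists>h\<in>normalizer S (\<phi> ` P).
      \<forall>x\<in>P. \<phi> (g \<otimes>\<^bsub>S\<^esub> x \<otimes>\<^bsub>S\<^esub> inv\<^bsub>S\<^esub> g) = h \<otimes>\<^bsub>S\<^esub> \<phi> x \<otimes>\<^bsub>S\<^esub> inv\<^bsub>S\<^esub> h}"

text \<open>Saturated fusion system on the p-group S (Roberts--Shpectorov axioms):
  (I) every fully normalized P is fully centralized and Aut_S(P) is a Sylow
  p-subgroup of Aut_F(P) (Aut_S(P) \<le> Aut_F(P) holds by the fusion axioms, and
  Aut_S(P) is a p-group, so Sylow means its index is prime to p);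
  (II) every \<phi> \<in> Hom_F(P,S) with \<phi>(P) fully centralized extends to some
  morphism in Hom_F(N_\<phi>, S).\<close>
definition saturated_fusion_system ::
  "nat \<Rightarrow> ('a, 'b) monoid_scheme \<Rightarrow> ('a set \<Rightarrow> 'a set \<Rightarrow> ('a \<Rightarrow> 'a) set) \<Rightarrow> bool" where
  "saturated_fusion_system p S F \<longleftrightarrow> p_group p S \<and> fusion_system S F \<and>
    (\<forall>P. fully_normalized S F P \<longrightarrow>
        fully_centralized S F P \<and>
        (\<exists>m. card (F P P) = card (Hom_S S P P) * m \<and> \<not> p dvd m)) \<and>
    (\<forall>P \<phi>. subgroup P S \<longrightarrow> \<phi> \<in> F P (carrier S) \<longrightarrow> fully_centralized S F (\<phi> ` P) \<longrightarrow>
        (\<exists>\<psi>\<in>F (N_phi S P \<phi>) (carrier S). \<forall>x\<in>P. \<psi> x = \<phi> x))"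

definition nilpotent_fusion_system ::
  "('a, 'b) monoid_scheme \<Rightarrow> ('a set \<Rightarrow> 'a set \<Rightarrow> ('a \<Rightarrow> 'a) set) \<Rightarrow> bool" where
  "nilpotent_fusion_system S F \<longleftrightarrow>
    (\<forall>P Q. subgroup P S \<longrightarrow> subgroup Q S \<longrightarrow> F P Q = Hom_S S P Q)"

end

theory Submission
  imports Defs
begin

text \<open>
  By Ito's theorem the derived subgroup \<open>D\<close> of the group \<open>G\<close> is abelian. Commutator calculations in a quotient in
  which \<open>D\<close> becomes a four-group give generators \<open>a\<close>, \<open>c\<close> of \<open>G\<close> modulo \<open>D\<close> such that \<open>c\<^sup>2\<close> and
  \<open>a\<^bsup>2^n\<^esup>\<close> (with \<open>n\<close> minimal, \<open>n \<ge> 2\<close>) lie in \<open>D\<close>, the commutators \<open>z = [a,c]\<close> and \<open>l = [a,z]\<close> form a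
  basis of \<open>D\<close> modulo squares, \<open>c\<close> centralizes \<open>D\<close> modulo squares, and \<open>a\<^bsup>2^n\<^esup>\<close> is \<open>l\<close> modulo squares.

  By the extension axiom and downward induction on the order, it is enough to show that a fully normalized
  subgroup \<open>Q\<close> has only inner automorphisms in \<open>F\<close> if all morphisms on larger subgroups are inner.
  Automorphisms acting trivially on the Frattini quotient of \<open>Q\<close> are inner, and so is an automorphism that
  carries the action of an element of \<open>N(Q) - Q\<close> to that of another element of \<open>N(Q)\<close>. Hence if \<open>u\<close> in
  \<open>N(Q) - Q\<close> acts on the Frattini quotient as a transvection with centre \<open>e\<close>, then every noninner \<open>\<alpha>\<close>
  sends \<open>e\<close> to an element on which \<open>u\<close> acts nontrivially, and \<open>Q\<close> has index two in \<open>N(Q)\<close>. For each position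
  of \<open>Q\<close> with respect to the three maximal subgroups of \<open>G\<close>, a suitable \<open>u\<close> among the powers of \<open>l\<close>, of
  \<open>z\<close>, or among \<open>a\<close>, \<open>c\<close> contradicts this.
\<close>

section \<open>Two-groups\<close>

text \<open>The factorization by two cyclic groups serves to put a power of \<open>a\<close> into
  the coset of \<open>l\<close> modulo squares. Then \<open>D\<close> is generated by
  \<open>z\<close> and a power of \<open>a\<close>, so that commutators of \<open>a\<close> with
  elements of \<open>D\<close> depend only on the exponent of \<open>z\<close> and fall into the
  cyclic group of \<open>l\<close>. All finer commutator estimates grow out of this. On the fusion
  side the obstacle is that nothing is known about the automorphisms of \<open>Q\<close> beyond the
  Sylow condition and the extension axiom. The statement on centres of transvections comes from
  using the extension axiom three times: if \<open>u\<close> fixed the image of its centre under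
  \<alpha> modulo the Frattini subgroup, then \<open>u\<close> conjugated by its own
  \<alpha>-conjugate would act as an inner automorphism, hence so would the \<alpha>-conjugate, and
  hence \<alpha> would be inner. Positions of \<open>Q\<close> are studied without any fusion
  system, in locales where the induction hypothesis survives only as a closure property of a set
  \<open>A\<close> of automorphisms. Two maximal subgroups are treated directly; the third is
  reached by replacing \<open>a\<close> with \<open>c \<otimes> a\<close>, which respects all
  structural assumptions.\<close>

lemma fixed_points_mod_prime:
  fixes H (structure)
  assumes H: "group H" and ord: "order H = p ^ k" and p: "Factorial_Ring.prime p"
    and fin: "finite E"
    and cl: "\<And>g x. g \<in> carrier H \<Longrightarrow> x \<in> E \<Longrightarrow> act g x \<in> E"
    and one: "\<And>x. x \<in> E \<Longrightarrow> act \<one> x = x"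
    and mul: "\<And>g h x. g \<in> carrier H \<Longrightarrow> h \<in> carrier H \<Longrightarrow> x \<in> E \<Longrightarrow> act (g \<otimes> h) x = act g (act h x)"
  shows "card {x \<in> E. \<forall>g\<in>carrier H. act g x = x} mod p = card E mod p"
proof -
  define \<phi> where "\<phi> g = (\<lambda>x\<in>E. act g x)" for g
  interpret H: group H by (rule H)
  have cancel: "act g (act (inv g) x) = x" "act (inv g) (act g x) = x"
    if "g \<in> carrier H" "x \<in> E" for g x
    using mul[of g "inv g" x] mul[of "inv g" g x] that one by simp_all
  have bij: "\<phi> g \<in> Bij E" if g: "g \<in> carrier H" for g
  proof -
    have "bij_betw (\<phi> g) E E"
      by (rule bij_betw_byWitness[where f' = "act (inv g)"]) (use g cancel cl in \<open>auto simp: \<phi>_def\<close>)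
    then show ?thesis by (simp add: Bij_def \<phi>_def)
  qed
  have comp: "\<phi> (g \<otimes> h) = compose E (\<phi> g) (\<phi> h)" if "g \<in> carrier H" "h \<in> carrier H" for g h
    by (rule ext) (use that mul cl in \<open>auto simp: \<phi>_def compose_def\<close>)
  have hom: "\<phi> \<in> hom H (BijGroup E)"
    unfolding hom_def BijGroup_def using bij comp by auto
  interpret group_action H E \<phi>
    unfolding group_action_def group_hom_def group_hom_axioms_def
    using H hom group_BijGroup by blast
  let ?O = "orbits H E \<phi>"
  let ?F = "{x \<in> E. \<forall>g\<in>carrier H. act g x = x}"
  have orb: "orbit H \<phi> x = {act g x | g. g \<in> carrier H}" if "x \<in> E" for x
    using that by (auto simp: orbit_def \<phi>_def)
  have finO: "finite ?O" using fin by (simp add: orbits_def)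
  have cardE: "card E = (\<Sum>W\<in>?O. card W)"
    using disjoint_sum[OF fin, of "\<lambda>_. 1::nat"] by simp
  \<comment> \<open>By the orbit-stabilizer theorem orbit lengths divide the order of the group, so
    they are powers of \<open>p\<close>.\<close>
  have dv: "card W = 1 \<or> p dvd card W" if W: "W \<in> ?O" for W
  proof -
    obtain x where "x \<in> E" "W = orbit H \<phi> x" using W by (auto simp: orbits_def)
    then have "card W dvd p ^ k" using orbit_stabilizer_theorem[of x] ord by (metis dvd_triv_left)
    then obtain i where i: "card W = p ^ i" using p divides_primepow_nat by blast
    then show ?thesis by (cases i) auto
  qed
  have "bij_betw (\<lambda>x. {x}) ?F {W\<in>?O. card W = 1}"
  proof (rule bij_betw_imageI)
    show "inj_on (\<lambda>x. {x}) ?F" by simp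
    show "(\<lambda>x. {x}) ` ?F = {W \<in> ?O. card W = 1}"
    proof safe
      fix x assume x: "x \<in> E" "\<forall>g\<in>carrier H. act g x = x"
      then have "orbit H \<phi> x = {x}" unfolding orb[OF x(1)] by (auto intro: exI[of _ "\<one>"])
      then show "{x} \<in> ?O" using x(1) by (auto simp: orbits_def)
    next
      fix W assume W: "W \<in> ?O" "card W = 1"
      then obtain x where x: "x \<in> E" "W = orbit H \<phi> x" by (auto simp: orbits_def)
      have "x \<in> W" using x one unfolding x(2) orb[OF x(1)] by force
      with W(2) have Xx: "W = {x}" by (metis card_1_singletonE singletonD)
      have "act g x = x" if "g \<in> carrier H" for g
        using that Xx x(2) orb[OF x(1)] by blast
      then show "W \<in> (\<lambda>x. {x}) ` ?F" using Xx x(1) by auto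
    qed simp
  qed
  then have cF: "card ?F = card {W\<in>?O. card W = 1}" by (rule bij_betw_same_card)
  have "(\<Sum>W\<in>?O. card W) = (\<Sum>W\<in>{W\<in>?O. card W = 1}. card W) + (\<Sum>W\<in>{W\<in>?O. card W \<noteq> 1}. card W)"
    using finO by (subst sum.union_disjoint[symmetric]) (auto intro!: sum.cong)
  moreover have "(\<Sum>W\<in>{W\<in>?O. card W = 1}. card W) = card ?F" using cF by simp
  moreover have "p dvd (\<Sum>W\<in>{W\<in>?O. card W \<noteq> 1}. card W)"
    using dv by (intro dvd_sum) auto
  ultimately have "card E = card ?F + (\<Sum>W\<in>{W\<in>?O. card W \<noteq> 1}. card W)"
    "(\<Sum>W\<in>{W\<in>?O. card W \<noteq> 1}. card W) mod p = 0" using cardE by auto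
  then show ?thesis by (simp add: mod_add_eq[symmetric, of "card ?F"])
qed

lemma ex_max_card:
  assumes "finite C" "C \<noteq> {}"
  shows "\<exists>M\<in>C. \<forall>M'\<in>C. card M' \<le> card M"
proof -
  have "Max (card ` C) \<in> card ` C" using assms by (intro Max_in) auto
  then obtain M where "M \<in> C" "card M = Max (card ` C)" by auto
  moreover have "card M' \<le> Max (card ` C)" if "M' \<in> C" for M' using that assms by (intro Max_ge) auto
  ultimately show ?thesis by metis
qed

lemma power_of_two_card:
  fixes H (structure)
  assumes H: "group H" and fin: "finite (carrier H)"
    and el: "\<And>x. x \<in> carrier H \<Longrightarrow> \<exists>k. x [^] ((2::nat) ^ k) = \<one>"
  shows "\<exists>k. order H = 2 ^ k"
proof (rule ccontr)
  interpret group H by (rule H)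
  assume no: "\<nexists>k. order H = 2 ^ k"
  have pos: "order H > 0" using fin by (simp add: order_gt_0_iff_finite)
  obtain m where m: "order H = 2 ^ multiplicity 2 (order H) * m" "\<not> 2 dvd m"
    using multiplicity_decompose'[of "order H" 2] pos by (metis not_is_unit_0 not_gr0 odd_one)
  with no have "m \<noteq> 1" by (metis mult.right_neutral)
  then obtain p where p: "Factorial_Ring.prime p" "p dvd m" by (metis prime_factor_nat)
  then have "odd p" using m(2) by (metis dvd_trans)
  have "p dvd order H" using p m(1) by (metis dvd_mult)
  then obtain r where "order H = p ^ 1 * r" by (auto elim: dvdE)
  from sylow_thm[OF p(1) H this fin] obtain K where K: "subgroup K H" "card K = p" by auto
  have "finite K" using K fin by (meson finite_subset subgroup.subset)
  have "\<not> K \<subseteq> {\<one>}"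
    using card_mono[of "{\<one>}" K] K(2) prime_gt_1_nat[OF p(1)] by auto
  then obtain x where x: "x \<in> K" "x \<noteq> \<one>" by blast
  have xc: "x \<in> carrier H" using K x by (meson subgroup.mem_carrier)
  interpret K: group "H\<lparr>carrier := K\<rparr>" using K subgroup_imp_group by blast
  have "x [^]\<^bsub>H\<lparr>carrier := K\<rparr>\<^esub> card K = \<one>\<^bsub>H\<lparr>carrier := K\<rparr>\<^esub>"
    using K.pow_order_eq_1[of x] x \<open>finite K\<close> by (simp add: order_def)
  then have "x [^] p = \<one>" using K by (simp add: nat_pow_consistent[symmetric])
  then have "ord x dvd p" using xc by (simp add: pow_eq_id)
  moreover obtain k where "x [^] ((2::nat)^k) = \<one>" using el xc by blast
  then have "ord x dvd 2 ^ k" using xc by (simp add: pow_eq_id)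
  moreover have "coprime p (2 ^ k)" using \<open>odd p\<close> by (simp add: coprime_commute)
  ultimately have "ord x = 1" by (metis coprime_common_divisor nat_dvd_1_iff_1)
  with x xc show False using ord_eq_1[of x] by simp
qed

context group
begin

section \<open>Conjugation, commutators and normalizers\<close>

definition cj :: "'a \<Rightarrow> 'a \<Rightarrow> 'a" where "cj g x = g \<otimes> x \<otimes> inv g"

text \<open>The order of the factors is that of the generators in \<open>derived_set\<close>. As
  \<open>cj\<close> is a left action, \<open>cm g x\<close> is \<open>cj g x\<close> divided by
  \<open>x\<close> on the right.\<close>

definition cm :: "'a \<Rightarrow> 'a \<Rightarrow> 'a" where "cm g x = g \<otimes> x \<otimes> inv g \<otimes> inv x"

lemma cancel_left_inv: "x \<in> carrier G \<Longrightarrow> y \<in> carrier G \<Longrightarrow> inv x \<otimes> (x \<otimes> y) = y"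
  "x \<in> carrier G \<Longrightarrow> y \<in> carrier G \<Longrightarrow> x \<otimes> (inv x \<otimes> y) = y"
  by (simp_all flip: m_assoc)

lemmas word_simps = cj_def cm_def m_assoc inv_mult_group cancel_left_inv

lemma cj_closed [simp, intro]: "g \<in> carrier G \<Longrightarrow> x \<in> carrier G \<Longrightarrow> cj g x \<in> carrier G"
  and cm_closed [simp, intro]: "g \<in> carrier G \<Longrightarrow> x \<in> carrier G \<Longrightarrow> cm g x \<in> carrier G"
  by (simp_all add: cj_def cm_def)

lemma cj_one [simp]: "g \<in> carrier G \<Longrightarrow> cj g \<one> = \<one>"
  and one_cj [simp]: "x \<in> carrier G \<Longrightarrow> cj \<one> x = x"
  and cm_one [simp]: "g \<in> carrier G \<Longrightarrow> cm g \<one> = \<one>"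
  and one_cm [simp]: "g \<in> carrier G \<Longrightarrow> cm \<one> g = \<one>"
  and cm_self [simp]: "g \<in> carrier G \<Longrightarrow> cm g g = \<one>"
  by (simp_all add: word_simps)

lemma cj_mult: "g \<in> carrier G \<Longrightarrow> x \<in> carrier G \<Longrightarrow> y \<in> carrier G \<Longrightarrow> cj g (x \<otimes> y) = cj g x \<otimes> cj g y"
  and mult_cj: "g \<in> carrier G \<Longrightarrow> h \<in> carrier G \<Longrightarrow> x \<in> carrier G \<Longrightarrow> cj (g \<otimes> h) x = cj g (cj h x)"
  and cj_inv: "g \<in> carrier G \<Longrightarrow> x \<in> carrier G \<Longrightarrow> cj g (inv x) = inv (cj g x)"
  and cj_cj_inv: "g \<in> carrier G \<Longrightarrow> x \<in> carrier G \<Longrightarrow> cj g (cj (inv g) x) = x"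
  and cj_inv_cj: "g \<in> carrier G \<Longrightarrow> x \<in> carrier G \<Longrightarrow> cj (inv g) (cj g x) = x"
  and cm_cj: "g \<in> carrier G \<Longrightarrow> x \<in> carrier G \<Longrightarrow> cm g x = cj g x \<otimes> inv x"
  and cj_cm: "g \<in> carrier G \<Longrightarrow> x \<in> carrier G \<Longrightarrow> cj g x = cm g x \<otimes> x"
  and mult_cm: "g \<in> carrier G \<Longrightarrow> h \<in> carrier G \<Longrightarrow> x \<in> carrier G \<Longrightarrow> cm (g \<otimes> h) x = cj g (cm h x) \<otimes> cm g x"
  and cm_mult: "g \<in> carrier G \<Longrightarrow> x \<in> carrier G \<Longrightarrow> y \<in> carrier G \<Longrightarrow> cm g (x \<otimes> y) = cm g x \<otimes> cj x (cm g y)"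
  and inv_cm: "g \<in> carrier G \<Longrightarrow> x \<in> carrier G \<Longrightarrow> inv (cm g x) = cm x g"
  and cj_cm_distrib: "g \<in> carrier G \<Longrightarrow> h \<in> carrier G \<Longrightarrow> x \<in> carrier G \<Longrightarrow> cj h (cm g x) = cm (cj h g) (cj h x)"
  and cm_inv_left: "g \<in> carrier G \<Longrightarrow> x \<in> carrier G \<Longrightarrow> cm (inv g) x = cj (inv g) (inv (cm g x))"
  and cm_inv_right: "g \<in> carrier G \<Longrightarrow> x \<in> carrier G \<Longrightarrow> cm g (inv x) = cj (inv x) (inv (cm g x))"
  by (simp_all add: word_simps)

lemma cj_eq_iff: "g \<in> carrier G \<Longrightarrow> x \<in> carrier G \<Longrightarrow> y \<in> carrier G \<Longrightarrow> cj g x = cj g y \<longleftrightarrow> x = y"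
  by (simp add: cj_def)

lemma cm_one_iff:
  assumes [simp]: "g \<in> carrier G" "x \<in> carrier G"
  shows "cm g x = \<one> \<longleftrightarrow> g \<otimes> x = x \<otimes> g"
proof -
  have "cm g x = (g \<otimes> x) \<otimes> inv (x \<otimes> g)" by (simp add: word_simps)
  moreover have "(g \<otimes> x) \<otimes> inv (x \<otimes> g) = \<one> \<longleftrightarrow> g \<otimes> x = x \<otimes> g"
    using inv_solve_right[of \<one> "g \<otimes> x" "x \<otimes> g"] by (auto simp: eq_commute)
  ultimately show ?thesis by simp
qed

lemma cj_hom: "g \<in> carrier G \<Longrightarrow> cj g \<in> hom G G"
  by (auto simp: hom_def cj_mult)

lemma cj_int_pow: "g \<in> carrier G \<Longrightarrow> x \<in> carrier G \<Longrightarrow> cj g (x [^] (k::int)) = cj g x [^] k"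
  using hom_int_pow[OF cj_hom, of g x k] group_axioms by simp

lemma normal_cj: "N \<lhd> G \<longleftrightarrow> subgroup N G \<and> (\<forall>g\<in>carrier G. \<forall>x\<in>N. cj g x \<in> N)"
  by (simp add: normal_inv_iff cj_def)

definition nzr :: "'a set \<Rightarrow> 'a set" where "nzr Q = {g \<in> carrier G. cj g ` Q = Q}"

lemma nzr_subgroup: assumes "Q \<subseteq> carrier G" shows "subgroup (nzr Q) G"
proof
  show "nzr Q \<subseteq> carrier G" by (auto simp: nzr_def)
  show "x \<otimes> y \<in> nzr Q" if "x \<in> nzr Q" "y \<in> nzr Q" for x y
  proof -
    have "cj (x \<otimes> y) ` Q = cj x ` cj y ` Q"
      using that assms unfolding image_image by (intro image_cong) (auto simp: nzr_def mult_cj)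
    then show ?thesis using that by (simp add: nzr_def)
  qed
  have "cj \<one> ` Q = id ` Q" using assms by (intro image_cong) auto
  then show "\<one> \<in> nzr Q" by (simp add: nzr_def)
  show "inv x \<in> nzr Q" if "x \<in> nzr Q" for x
  proof -
    have "cj (inv x) ` Q = cj (inv x) ` cj x ` Q" using that by (simp add: nzr_def)
    also have "\<dots> = id ` Q"
      using that assms unfolding image_image by (intro image_cong) (auto simp: nzr_def cj_inv_cj)
    finally show ?thesis using that by (simp add: nzr_def)
  qed
qed

text \<open>Conjugation is injective and \<open>Q\<close> is finite, so being mapped into itself
  suffices.\<close>

lemma nzrI:
  assumes "finite Q" "Q \<subseteq> carrier G" "g \<in> carrier G" "\<And>q. q \<in> Q \<Longrightarrow> cj g q \<in> Q"
  shows "g \<in> nzr Q"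
proof -
  have "inj_on (cj g) Q" using assms by (auto simp: inj_on_def cj_eq_iff subset_iff)
  then have "cj g ` Q = Q" using assms by (intro endo_inj_surj) auto
  then show ?thesis using assms by (simp add: nzr_def)
qed

lemma nzrD: "g \<in> nzr Q \<Longrightarrow> q \<in> Q \<Longrightarrow> cj g q \<in> Q" "g \<in> nzr Q \<Longrightarrow> g \<in> carrier G"
  by (auto simp: nzr_def)

lemma normalizer_eq_nzr: assumes "Q \<subseteq> carrier G" shows "normalizer G Q = nzr Q"
proof -
  have "g <# Q #> inv g = cj g ` Q" for g by (auto simp: l_coset_def r_coset_def cj_def)
  then show ?thesis using assms by (simp add: normalizer_def stabilizer_def nzr_def)
qed

lemma subgroup_nzr: "subgroup Q G \<Longrightarrow> finite Q \<Longrightarrow> Q \<subseteq> nzr Q"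
  by (auto intro!: nzrI simp: cj_def subgroup.m_closed subgroup.m_inv_closed subgroup.mem_carrier subgroup.subset)

text \<open>\<open>K\<close> acts on the right cosets of \<open>S\<close>; the inverse turns right
  multiplication into a left action. By \<open>rcoset_fixed_iff\<close> a fixed coset of
  \<open>x\<close> means that \<open>x\<close> conjugates \<open>K\<close> into \<open>S\<close>.
  With \<open>K = S\<close> this makes normalizers grow; with \<open>S\<close> of odd index it
  conjugates a 2-subgroup into \<open>S\<close>.\<close>

lemma coset_fixed_points:
  assumes fin: "finite (carrier G)" and K: "subgroup K G" and S: "subgroup S G"
    and p: "Factorial_Ring.prime p" and cK: "card K = p ^ k"
  shows "card {W \<in> rcosets S. \<forall>g\<in>K. W #> inv g = W} mod p = card (rcosets S) mod p"
proof -
  interpret K: group "G\<lparr>carrier := K\<rparr>" using K subgroup_imp_group by blast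
  have Kc: "g \<in> carrier G" if "g \<in> K" for g using that K by (meson subgroup.mem_carrier)
  have Sc: "S \<subseteq> carrier G" using S by (rule subgroup.subset)
  have "card {W \<in> rcosets S. \<forall>g\<in>carrier (G\<lparr>carrier := K\<rparr>). (\<lambda>g W. W #> inv g) g W = W} mod p
     = card (rcosets S) mod p"
  proof (rule fixed_points_mod_prime[where p = p and k = k])
    show "group (G\<lparr>carrier := K\<rparr>)" by (rule K.is_group)
    show "order (G\<lparr>carrier := K\<rparr>) = p ^ k" using cK by (simp add: order_def)
    show "finite (rcosets S)" using fin by (simp add: RCOSETS_def)
    show "W #> inv g \<in> rcosets S" if "g \<in> carrier (G\<lparr>carrier := K\<rparr>)" "W \<in> rcosets S" for g W
      using that Kc Sc by (auto simp: RCOSETS_def coset_mult_assoc)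
    show "W #> inv \<one>\<^bsub>G\<lparr>carrier := K\<rparr>\<^esub> = W" if "W \<in> rcosets S" for W
      using that Sc by (auto simp: RCOSETS_def coset_mult_assoc)
    show "W #> inv (g \<otimes>\<^bsub>G\<lparr>carrier := K\<rparr>\<^esub> h) = W #> inv h #> inv g"
      if "g \<in> carrier (G\<lparr>carrier := K\<rparr>)" "h \<in> carrier (G\<lparr>carrier := K\<rparr>)" "W \<in> rcosets S" for g h W
      using that Kc Sc by (auto simp: RCOSETS_def coset_mult_assoc inv_mult_group m_assoc)
  qed (rule p)
  then show ?thesis by simp
qed

lemma rcoset_fixed_iff:
  assumes S: "subgroup S G" and [simp]: "x \<in> carrier G" "g \<in> carrier G"
  shows "S #> x #> inv g = S #> x \<longleftrightarrow> cj x g \<in> S"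
proof -
  interpret S: subgroup S G by (rule S)
  have "S #> x #> inv g = S #> x \<longleftrightarrow> x \<in> S #> (x \<otimes> inv g)"
    using repr_independence[of x S "x \<otimes> inv g"] rcos_self[of x S] S S.subset
    by (auto simp: coset_mult_assoc)
  also have "\<dots> \<longleftrightarrow> x \<otimes> inv (x \<otimes> inv g) \<in> S" by (simp add: S.rcos_module is_group)
  also have "x \<otimes> inv (x \<otimes> inv g) = cj x g" by (simp add: word_simps)
  finally show ?thesis .
qed

lemma card_subgroup_prime_power:
  assumes "Factorial_Ring.prime p" "order G = p ^ n" "subgroup H G"
  shows "\<exists>k. card H = p ^ k"
  using assms lagrange[of H] divides_primepow_nat[of p "card H" n] by (metis dvd_triv_right)

text \<open>\<open>Q\<close> acts on its own cosets. Their number is divisible by \<open>p\<close>,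
  hence so is the number of fixed cosets; \<open>Q\<close> itself is fixed, so there is another one,
  and its representative normalizes \<open>Q\<close>.\<close>

lemma normalizer_grows:
  assumes p: "Factorial_Ring.prime p" and ord: "order G = p ^ n"
    and Q: "subgroup Q G" and ne: "Q \<noteq> carrier G"
  shows "\<exists>x \<in> nzr Q. x \<notin> Q"
proof -
  have fin: "finite (carrier G)" using ord p by (metis order_gt_0_iff_finite prime_gt_0_nat zero_less_power)
  interpret Q: subgroup Q G by (rule Q)
  have finQ: "finite Q" using fin Q.subset by (rule rev_finite_subset)
  obtain k where k: "card Q = p ^ k" using card_subgroup_prime_power[OF p ord Q] by blast
  let ?F = "{W \<in> rcosets Q. \<forall>g\<in>Q. W #> inv g = W}"
  have "card (rcosets Q) * card Q = order G" by (rule lagrange[OF Q])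
  moreover have "card Q < order G" using ne fin Q.subset psubset_card_mono by (auto simp: order_def)
  ultimately have "card (rcosets Q) \<noteq> 1" by auto
  moreover have "card (rcosets Q) dvd p ^ n" using lagrange[OF Q] ord by (metis dvd_triv_left)
  ultimately have "p dvd card (rcosets Q)" using p
    by (metis divides_primepow_nat dvd_power neq0_conv power_0)
  then have dv: "p dvd card ?F" using coset_fixed_points[OF fin Q Q p k] by (simp add: dvd_eq_mod_eq_0)
  have QF: "Q \<in> ?F"
    using rcoset_fixed_iff[OF Q, of \<one>] Q.subset coset_mult_one[of Q] Q.subgroup_in_rcosets[OF is_group]
    by auto
  have finF: "finite ?F" using fin by (simp add: RCOSETS_def)
  have "?F \<noteq> {Q}"
  proof
    assume "?F = {Q}"
    then have "card ?F = 1" by (metis card_1_singleton_iff One_nat_def)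
    then show False using dv p by (metis not_prime_1 nat_dvd_1_iff_1)
  qed
  then obtain W where W: "W \<in> ?F" "W \<noteq> Q" using QF by blast
  then obtain x where x: "x \<in> carrier G" "W = Q #> x" by (auto simp: RCOSETS_def)
  have "cj x g \<in> Q" if "g \<in> Q" for g
    using W that rcoset_fixed_iff[OF Q x(1), of g] x Q.mem_carrier by auto
  then have "x \<in> nzr Q" using x finQ Q.subset by (intro nzrI) auto
  moreover have "x \<notin> Q" using W(2) x(2) Q by (metis coset_join2 x(1))
  ultimately show ?thesis by blast
qed

lemma subgroup_extend_index_two:
  assumes M: "subgroup M G" and x: "x \<in> carrier G" "\<And>m. m \<in> M \<Longrightarrow> cj x m \<in> M" "x \<otimes> x \<in> M"
    and fin: "finite M"
  shows "subgroup (M \<union> (\<lambda>m. x \<otimes> m) ` M) G"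
proof -
  interpret M: subgroup M G by (rule M)
  have "x \<in> nzr M" using x fin M.subset by (intro nzrI)
  then have "inv x \<in> nzr M" using nzr_subgroup[OF M.subset] by (metis subgroup.m_inv_closed)
  then have ix: "cj (inv x) m \<in> M" if "m \<in> M" for m using that by (rule nzrD)
  note [simp] = x(1) M.mem_carrier
  show ?thesis
  proof
    show "M \<union> (\<lambda>m. x \<otimes> m) ` M \<subseteq> carrier G" using M.subset x(1) by blast
    show "\<one> \<in> M \<union> (\<lambda>m. x \<otimes> m) ` M" by simp
    show "u \<otimes> v \<in> M \<union> (\<lambda>m. x \<otimes> m) ` M"
      if "u \<in> M \<union> (\<lambda>m. x \<otimes> m) ` M" "v \<in> M \<union> (\<lambda>m. x \<otimes> m) ` M" for u v
    proof -
      have 1: "m \<otimes> (x \<otimes> m') = x \<otimes> (cj (inv x) m \<otimes> m')" if "m \<in> M" "m' \<in> M" for m m'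
        using that by (simp add: word_simps)
      have 2: "x \<otimes> m \<otimes> (x \<otimes> m') = x \<otimes> x \<otimes> (cj (inv x) m \<otimes> m')" if "m \<in> M" "m' \<in> M" for m m'
        using that by (simp add: word_simps)
      have 3: "x \<otimes> m \<otimes> m' = x \<otimes> (m \<otimes> m')" if "m \<in> M" "m' \<in> M" for m m'
        using that by (simp add: m_assoc)
      have 4: "m \<otimes> v \<in> M \<union> (\<lambda>m. x \<otimes> m) ` M" if m: "m \<in> M" for m
        using \<open>v \<in> _\<close> m 1[of m] ix[OF m] by (elim UnE imageE) simp_all
      have 5: "x \<otimes> m \<otimes> v \<in> M \<union> (\<lambda>m. x \<otimes> m) ` M" if m: "m \<in> M" for m
        using \<open>v \<in> _\<close> m 2[of m] 3[of m] ix[OF m] x(3) by (elim UnE imageE) simp_all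
      show ?thesis using \<open>u \<in> _\<close> 4 5 by (elim UnE imageE) simp_all
    qed
    show "inv u \<in> M \<union> (\<lambda>m. x \<otimes> m) ` M" if "u \<in> M \<union> (\<lambda>m. x \<otimes> m) ` M" for u
    proof -
      have "inv (x \<otimes> m) = x \<otimes> (inv (x \<otimes> x) \<otimes> cj x (inv m))" if "m \<in> M" for m
        using that by (simp add: word_simps)
      moreover have "inv (x \<otimes> x) \<otimes> cj x (inv m) \<in> M" if "m \<in> M" for m
        by (rule M.m_closed[OF M.m_inv_closed[OF x(3)] x(2)[OF M.m_inv_closed[OF that]]])
      ultimately show ?thesis using that by (elim UnE imageE) simp_all
    qed
  qed
qed

lemma two_group_pow:
  assumes "order G = 2 ^ n" "x \<in> carrier G"
  shows "x [^] ((2::nat) ^ n) = \<one>"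
  using assms by (metis pow_order_eq_1)

lemma last_power_outside:
  assumes "order G = 2 ^ n" "subgroup M G" "y \<in> carrier G" "y \<notin> M"
  obtains i where "y [^] ((2::nat) ^ i) \<notin> M" "y [^] ((2::nat) ^ Suc i) \<in> M"
proof -
  define i where "i = (LEAST i. y [^] ((2::nat) ^ i) \<in> M)"
  have "y [^] ((2::nat) ^ n) \<in> M" using assms two_group_pow by (metis subgroup.one_closed)
  then have "y [^] ((2::nat) ^ i) \<in> M" unfolding i_def by (rule LeastI)
  moreover from this have "i \<noteq> 0" using assms by (intro notI) simp
  ultimately show ?thesis using that[of "i - 1"] not_less_Least[of "i - 1" "\<lambda>i. y [^] ((2::nat) ^ i) \<in> M"]
    by (simp add: i_def)
qed

lemma nat_pow_two: "x \<in> carrier G \<Longrightarrow> x [^] ((2::nat) ^ Suc i) = x [^] ((2::nat) ^ i) \<otimes> x [^] ((2::nat) ^ i)"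
  by (simp add: nat_pow_mult mult_2)

text \<open>A maximal proper subgroup above \<open>Q\<close> is normal because normalizers grow.
  Index two is encoded by the rule that the product of two outside elements is inside, which is the
  form in which it is applied.\<close>

lemma index_two_above:
  assumes ord: "order G = 2 ^ n" and Q: "subgroup Q G" and ne: "Q \<noteq> carrier G"
  obtains M where "subgroup M G" "Q \<subseteq> M" "M \<noteq> carrier G"
    "\<And>x y. x \<in> carrier G \<Longrightarrow> y \<in> carrier G \<Longrightarrow> x \<notin> M \<Longrightarrow> y \<notin> M \<Longrightarrow> x \<otimes> y \<in> M"
proof -
  have fin: "finite (carrier G)" using ord by (metis order_gt_0_iff_finite zero_less_numeral zero_less_power)
  let ?C = "{M. subgroup M G \<and> Q \<subseteq> M \<and> M \<noteq> carrier G}"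
  have "?C \<subseteq> Pow (carrier G)" using subgroup.subset by auto
  then have finC: "finite ?C" using fin by (simp add: finite_subset)
  have "Q \<in> ?C" using assms by simp
  then have neC: "?C \<noteq> {}" by blast
  obtain M where M: "M \<in> ?C" "\<forall>M'\<in>?C. card M' \<le> card M"
    using ex_max_card[OF finC neC] by (rule bexE)
  then have Ms: "subgroup M G" "Q \<subseteq> M" "M \<noteq> carrier G" by auto
  interpret M: subgroup M G by (rule Ms)
  have finM: "finite M" using fin M.subset by (rule rev_finite_subset)
  have big: "M' = carrier G" if "subgroup M' G" "M \<subset> M'" for M'
  proof (rule ccontr)
    assume "M' \<noteq> carrier G"
    then have "card M' \<le> card M" using that Ms by (intro M(2)[rule_format]) auto
    moreover have "finite M'" using that fin by (meson finite_subset subgroup.subset)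
    ultimately show False using that(2) by (metis leD psubset_card_mono)
  qed
  obtain x0 where "x0 \<in> nzr M" "x0 \<notin> M" using normalizer_grows[of 2 n M] ord Ms by auto
  then have nM: "nzr M = carrier G"
    using big[OF nzr_subgroup[OF M.subset]] subgroup_nzr[OF Ms(1) finM] by auto
  then have cjM: "cj g m \<in> M" if "g \<in> carrier G" "m \<in> M" for g m using that nzrD by blast
  obtain y where y: "y \<in> carrier G" "y \<notin> M" using Ms(3) M.subset by auto
  obtain i where i: "y [^] ((2::nat) ^ i) \<notin> M" "y [^] ((2::nat) ^ Suc i) \<in> M"
    using last_power_outside[OF ord Ms(1) y] by blast
  \<comment> \<open>The last 2-power of \<open>y\<close> outside \<open>M\<close> has its square in
    \<open>M\<close>, so \<open>M\<close> and its coset by \<open>x\<close> form a subgroup, which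
    must be everything.\<close>
  define x where "x = y [^] ((2::nat) ^ i)"
  have x: "x \<in> carrier G" "x \<notin> M" "x \<otimes> x \<in> M" using i y nat_pow_two by (auto simp: x_def)
  have "M \<union> (\<lambda>m. x \<otimes> m) ` M = carrier G"
  proof (rule big)
    show "subgroup (M \<union> (\<lambda>m. x \<otimes> m) ` M) G"
      using x cjM finM Ms by (intro subgroup_extend_index_two) auto
    have "x \<in> (\<lambda>m. x \<otimes> m) ` M" using x(1) by (force simp: image_iff)
    then show "M \<subset> M \<union> (\<lambda>m. x \<otimes> m) ` M" using x(2) by blast
  qed
  then have cos: "\<exists>m\<in>M. u = x \<otimes> m" if "u \<in> carrier G" "u \<notin> M" for u using that by auto
  have "u \<otimes> v \<in> M" if uv: "u \<in> carrier G" "v \<in> carrier G" "u \<notin> M" "v \<notin> M" for u v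
  proof -
    obtain m where m1: "m \<in> M" "u = x \<otimes> m" using cos[OF uv(1,3)] by (rule bexE)
    obtain m' where m2: "m' \<in> M" "v = x \<otimes> m'" using cos[OF uv(2,4)] by (rule bexE)
    note m = m1(1) m2(1) m1(2) m2(2)
    then have "u \<otimes> v = x \<otimes> x \<otimes> (cj (inv x) m \<otimes> m')" using x(1) M.mem_carrier by (simp add: word_simps)
    then show ?thesis using m x cjM by simp
  qed
  then show ?thesis using that Ms by blast
qed

text \<open>In a finite 2-group the Frattini subgroup is generated by the squares. Commutators
  belong to it by \<open>cm_Frat\<close>, and \<open>subgroup_eq_if_Frat\<close> is the property of
  consisting of nongenerators.\<close>

definition Frat :: "'a set \<Rightarrow> 'a set" where "Frat Q = generate G {x \<otimes> x |x. x \<in> Q}"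

lemma Frat_subgroup: "Q \<subseteq> carrier G \<Longrightarrow> subgroup (Frat Q) G"
  unfolding Frat_def by (intro generate_is_subgroup) auto

lemma Frat_subset: assumes "subgroup Q G" shows "Frat Q \<subseteq> Q"
  unfolding Frat_def using assms by (intro generate_subgroup_incl) (auto simp: subgroup.m_closed)

lemma square_Frat: "x \<in> Q \<Longrightarrow> x \<otimes> x \<in> Frat Q"
  unfolding Frat_def by (rule generate.incl) auto

lemma Frat_normal: assumes "subgroup Q G" "g \<in> nzr Q" "x \<in> Frat Q" shows "cj g x \<in> Frat Q"
proof -
  interpret Q: subgroup Q G by (rule assms(1))
  have g: "g \<in> carrier G" using assms nzrD by blast
  have c: "{x \<otimes> x |x. x \<in> Q} \<subseteq> carrier G" by auto
  show ?thesis using assms(3) unfolding Frat_def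
  proof (induction rule: generate.induct)
    case one then show ?case using g by (simp add: generate.one)
  next
    case (incl h)
    then obtain x where "x \<in> Q" "h = x \<otimes> x" by auto
    then show ?case using assms g nzrD(1)[OF assms(2), of x] by (auto intro!: generate.incl simp: cj_mult)
  next
    case (inv h)
    then obtain x where "x \<in> Q" "h = x \<otimes> x" by auto
    then show ?case using assms g nzrD(1)[OF assms(2), of x] by (auto intro!: generate.inv simp: cj_mult cj_inv)
  next
    case (eng h1 h2)
    then have "h1 \<in> carrier G" "h2 \<in> carrier G" using generate_in_carrier[OF c] by auto
    then show ?case using eng g by (auto simp: cj_mult intro: generate.eng)
  qed
qed

lemma cm_Frat: assumes "subgroup Q G" "x \<in> Q" "y \<in> Q" shows "cm x y \<in> Frat Q"
proof -
  interpret Q: subgroup Q G by (rule assms(1))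
  \<comment> \<open>The commutator as a product of three squares, those of \<open>x\<close>,
    \<open>inv x \<otimes> y\<close> and \<open>inv y\<close>.\<close>
  have "cm x y = (x \<otimes> x) \<otimes> (inv x \<otimes> y \<otimes> (inv x \<otimes> y)) \<otimes> (inv y \<otimes> inv y)"
    using assms(2,3) by (simp add: word_simps)
  also have "\<dots> \<in> Frat Q"
    using Frat_subgroup[OF Q.subset] assms square_Frat[of x Q] square_Frat[of "inv x \<otimes> y" Q] square_Frat[of "inv y" Q]
    by (simp add: subgroup.m_closed)
  finally show ?thesis .
qed

text \<open>A proper \<open>H\<close> would lie in a subgroup of index two in \<open>Q\<close>; that
  subgroup contains all squares, hence \<open>Frat Q\<close>, hence everything.\<close>

lemma subgroup_eq_if_Frat:
  assumes ord: "order G = 2 ^ n" and Q: "subgroup Q G" and H: "subgroup H G" "H \<subseteq> Q"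
    and gen: "\<And>q. q \<in> Q \<Longrightarrow> \<exists>h\<in>H. \<exists>f\<in>Frat Q. q = h \<otimes> f"
  shows "H = Q"
proof (rule ccontr)
  assume ne: "H \<noteq> Q"
  interpret Q: group "G\<lparr>carrier := Q\<rparr>" using Q subgroup_imp_group by blast
  obtain k where k: "card Q = 2 ^ k" using card_subgroup_prime_power[OF _ ord Q] by auto
  have H': "subgroup H (G\<lparr>carrier := Q\<rparr>)" using H Q by (simp add: subgroup_incl)
  obtain M where M: "subgroup M (G\<lparr>carrier := Q\<rparr>)" "H \<subseteq> M" "M \<noteq> Q"
    "\<And>x y. x \<in> Q \<Longrightarrow> y \<in> Q \<Longrightarrow> x \<notin> M \<Longrightarrow> y \<notin> M \<Longrightarrow> x \<otimes> y \<in> M"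
    using Q.index_two_above[of k H] k H' ne by (auto simp: order_def)
  have MG: "subgroup M G" using M(1) Q by (metis incl_subgroup)
  have MQ: "M \<subseteq> Q" using subgroup.subset[OF M(1)] by simp
  have "x \<otimes> x \<in> M" if "x \<in> Q" for x
    using that M(4)[of x x] MG by (cases "x \<in> M") (auto simp: subgroup.m_closed)
  then have "Frat Q \<subseteq> M" unfolding Frat_def using MG by (intro generate_subgroup_incl) auto
  then have "Q \<subseteq> M" using gen M(2) MG by (metis subgroup.m_closed subsetD subsetI)
  then show False using M(3) MQ by simp
qed

text \<open>\<open>Z\<close> is a maximal normal subgroup of \<open>G\<close> between
  \<open>N\<close> and \<open>Y\<close> that differs from \<open>Y\<close>. The last two conclusions
  say that the chief factor is central and of order two: a 2-group fixes a nontrivial coset of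
  \<open>Z\<close> in \<open>Y\<close>, and the union of \<open>Z\<close> and this coset is already
  normal in \<open>G\<close>.\<close>

lemma chief_step:
  assumes ord: "order G = 2 ^ n" and N: "N \<lhd> G" and Y: "Y \<lhd> G" and NY: "N \<subset> Y"
    and sq: "\<And>y. y \<in> Y \<Longrightarrow> y \<otimes> y \<in> N"
  obtains Z where "Z \<lhd> G" "N \<subseteq> Z" "Z \<subset> Y" "\<And>g y. g \<in> carrier G \<Longrightarrow> y \<in> Y \<Longrightarrow> cm g y \<in> Z"
    "\<And>x y. x \<in> Y \<Longrightarrow> y \<in> Y \<Longrightarrow> x \<notin> Z \<Longrightarrow> y \<notin> Z \<Longrightarrow> x \<otimes> y \<in> Z"
proof -
  have fin: "finite (carrier G)" using ord by (metis order_gt_0_iff_finite zero_less_numeral zero_less_power)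
  have Ys: "subgroup Y G" using Y by (rule normal_imp_subgroup)
  interpret Y: subgroup Y G by (rule Ys)
  have finY: "finite Y" using fin Y.subset by (rule rev_finite_subset)
  let ?C = "{Z. Z \<lhd> G \<and> N \<subseteq> Z \<and> Z \<subset> Y}"
  have "?C \<subseteq> Pow Y" by auto
  then have finC: "finite ?C" using finY by (simp add: finite_subset)
  have "N \<in> ?C" using assms by simp
  then have neC: "?C \<noteq> {}" by blast
  obtain Z where Z: "Z \<in> ?C" "\<forall>M'\<in>?C. card M' \<le> card Z"
    using ex_max_card[OF finC neC] by (rule bexE)
  then have Zs: "Z \<lhd> G" "N \<subseteq> Z" "Z \<subset> Y" by auto
  have Zg: "subgroup Z G" using Zs by (simp add: normal_imp_subgroup)
  interpret Z: subgroup Z G by (rule Zg)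
  have finZ: "finite Z" using finY Zs(3) by (meson finite_subset psubset_imp_subset)
  have big: "M' = Y" if "M' \<lhd> G" "Z \<subset> M'" "M' \<subseteq> Y" for M'
  proof (rule ccontr)
    assume "M' \<noteq> Y"
    then have "card M' \<le> card Z" using that Zs by (intro Z(2)[rule_format]) auto
    moreover have "finite M'" using that(3) finY by (rule finite_subset)
    ultimately show False using that(2) by (metis leD psubset_card_mono)
  qed
  have cjZ: "cj g m \<in> Z" if "g \<in> carrier G" "m \<in> Z" for g m using that Zs(1) by (simp add: normal_cj)
  have cjY: "cj g m \<in> Y" if "g \<in> carrier G" "m \<in> Y" for g m using that Y by (simp add: normal_cj)
  interpret YG: group "G\<lparr>carrier := Y\<rparr>" using Ys subgroup_imp_group by blast
  have ZY: "subgroup Z (G\<lparr>carrier := Y\<rparr>)" using Zg Ys Zs by (simp add: subgroup_incl)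
  define E where "E = (\<lambda>y. Z #> y) ` Y"
  have Eeq: "E = rcosets\<^bsub>G\<lparr>carrier := Y\<rparr>\<^esub> Z" by (auto simp: E_def RCOSETS_def)
  have lag: "card E * card Z = card Y" using YG.lagrange[OF ZY] by (simp add: Eeq order_def)
  have "card Z < card Y" using Zs(3) finY by (simp add: psubset_card_mono)
  then have "card E \<noteq> 1" using lag by auto
  moreover have "card E dvd 2 ^ n"
    using lag card_subgroup_prime_power[OF two_is_prime_nat ord Ys] lagrange[OF Ys] ord
    by (metis dvd_triv_left dvd_triv_right dvd_trans)
  ultimately have ev: "2 dvd card E"
    by (metis divides_primepow_nat dvd_power neq0_conv power_0 two_is_prime_nat)
  have act: "cj g ` (Z #> y) = Z #> cj g y" if "g \<in> carrier G" "y \<in> Y" for g y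
  proof -
    have "cj g ` (Z #> y) \<subseteq> Z #> cj g y"
      using that cjZ by (auto simp: r_coset_def cj_mult)
    moreover have "u \<otimes> cj g y \<in> cj g ` (Z #> y)" if "u \<in> Z" for u
    proof -
      have "u \<otimes> cj g y = cj g (cj (inv g) u \<otimes> y)"
        using that \<open>g \<in> carrier G\<close> \<open>y \<in> Y\<close> by (simp add: cj_mult cj_cj_inv)
      moreover have "cj (inv g) u \<in> Z" using that \<open>g \<in> carrier G\<close> cjZ by simp
      ultimately show ?thesis by (auto simp: r_coset_def)
    qed
    ultimately show ?thesis by (auto simp: r_coset_def)
  qed
  \<comment> \<open>\<open>G\<close> acts by conjugation on the cosets of \<open>Z\<close> in
    \<open>Y\<close>. Their number is even and \<open>Z\<close> is fixed, so a second coset is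
    fixed.\<close>
  have "card {W \<in> E. \<forall>g\<in>carrier G. (\<lambda>g W. cj g ` W) g W = W} mod 2 = card E mod 2"
  proof (rule fixed_points_mod_prime[where k = n])
    show "group G" by (rule is_group)
    show "order G = 2 ^ n" by (rule ord)
    show "finite E" using finY by (simp add: E_def)
    show "cj g ` W \<in> E" if "g \<in> carrier G" "W \<in> E" for g W
      using that act cjY by (auto simp: E_def)
    show "cj \<one> ` W = W" if "W \<in> E" for W
    proof -
      obtain y where "y \<in> Y" "W = Z #> y" using \<open>W \<in> E\<close> by (auto simp: E_def)
      then show ?thesis using act[of \<one> y] by simp
    qed
    show "cj (g \<otimes> h) ` W = cj g ` cj h ` W" if "g \<in> carrier G" "h \<in> carrier G" "W \<in> E" for g h W
    proof -
      obtain y where "y \<in> Y" "W = Z #> y" using \<open>W \<in> E\<close> by (auto simp: E_def)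
      then show ?thesis using act[of "g \<otimes> h" y] act[of h y] act[of g "cj h y"] cjY[of h y] that(1,2)
        by (simp add: mult_cj)
    qed
  qed simp
  then have dv: "2 dvd card {W \<in> E. \<forall>g\<in>carrier G. cj g ` W = W}" (is "2 dvd card ?F")
    using ev by (simp add: mod_eq_0_iff_dvd)
  have ZF: "Z \<in> ?F"
  proof -
    have "Z = Z #> \<one>" by (simp add: Z.subset)
    then show ?thesis using act[of _ \<one>] by (auto simp: E_def)
  qed
  have "?F \<noteq> {Z}"
  proof
    assume "?F = {Z}"
    then have "card ?F = 1" by (metis card_1_singleton_iff One_nat_def)
    then show False using dv by simp
  qed
  then obtain W where W: "W \<in> ?F" "W \<noteq> Z" using ZF by blast
  then obtain x where x: "x \<in> Y" "W = Z #> x" by (auto simp: E_def)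
  have xn: "x \<notin> Z" using W(2) x coset_join2[of x Z] Zg by auto
  have cmx: "cm g x \<in> Z" if "g \<in> carrier G" for g
  proof -
    have "Z #> cj g x = Z #> x" using W x act that by auto
    then have "cj g x \<in> Z #> x" using that x Zg rcos_self[of "cj g x" Z] by auto
    then show ?thesis using that x Z.rcos_module[OF is_group, of x "cj g x"] by (simp add: cm_cj)
  qed
  let ?Y = "Z \<union> (\<lambda>m. x \<otimes> m) ` Z"
  have xx: "x \<otimes> x \<in> Z" using sq x Zs by auto
  have cmxz: "cm g y \<in> Z" if "g \<in> carrier G" "y \<in> ?Y" for g y
  proof -
    have "cm g z \<in> Z" if "z \<in> Z" for z using that \<open>g \<in> carrier G\<close> cjZ by (simp add: cm_cj)
    then show ?thesis using that x cmx cjZ by (auto simp: cm_mult)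
  qed
  have Ysub: "subgroup ?Y G" using x xx cjZ finZ Zg by (intro subgroup_extend_index_two) auto
  have Ynorm: "?Y \<lhd> G" unfolding normal_cj
  proof (intro conjI ballI)
    fix g y assume gy: "g \<in> carrier G" "y \<in> ?Y"
    then have "cm g y \<in> ?Y" using cmxz by simp
    moreover have "cj g y = cm g y \<otimes> y" using gy Ysub by (meson cj_cm subgroup.mem_carrier)
    ultimately show "cj g y \<in> ?Y" using gy Ysub by (metis subgroup.m_closed)
  qed (rule Ysub)
  have YY: "?Y = Y"
  proof (rule big[OF Ynorm])
    have "x \<in> (\<lambda>m. x \<otimes> m) ` Z" using x(1) by (force simp: image_iff)
    then show "Z \<subset> ?Y" using xn by blast
    show "?Y \<subseteq> Y" using x Zs(3) by auto
  qed
  have "u \<otimes> v \<in> Z" if uv: "u \<in> Y" "v \<in> Y" "u \<notin> Z" "v \<notin> Z" for u v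
  proof -
    have cos: "\<exists>m\<in>Z. w = x \<otimes> m" if "w \<in> Y" "w \<notin> Z" for w
      using that unfolding YY[symmetric] by (elim UnE imageE) auto
    obtain m where m1: "m \<in> Z" "u = x \<otimes> m" using cos[OF uv(1,3)] by (rule bexE)
    obtain m' where m2: "m' \<in> Z" "v = x \<otimes> m'" using cos[OF uv(2,4)] by (rule bexE)
    note m = m1(1) m2(1) m1(2) m2(2)
    then have "u \<otimes> v = x \<otimes> x \<otimes> (cj (inv x) m \<otimes> m')" using x(1) by (simp add: word_simps)
    then show ?thesis using m x xx cjZ by simp
  qed
  then show ?thesis using that[OF Zs] cmxz YY by blast
qed

end

section \<open>Metabelian two-groups with noncyclic derived subgroup\<close>

context group
begin

text \<open>The set is the preimage of a centralizer in the quotient by \<open>Y\<close>. It reduces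
  commutator estimates modulo \<open>Y\<close> to generators and spares the passage to quotient
  groups.\<close>

lemma subgroup_cm_into:
  assumes Y: "Y \<lhd> G" and B: "B \<subseteq> carrier G"
  shows "subgroup {x \<in> carrier G. \<forall>p\<in>B. cm x p \<in> Y} G"
proof -
  interpret Y: normal Y G by (rule Y)
  have cjY: "cj g y \<in> Y" if "g \<in> carrier G" "y \<in> Y" for g y using that Y by (simp add: normal_cj)
  show ?thesis
  proof
    fix x y assume "x \<in> {x \<in> carrier G. \<forall>p\<in>B. cm x p \<in> Y}" "y \<in> {x \<in> carrier G. \<forall>p\<in>B. cm x p \<in> Y}"
    then show "x \<otimes> y \<in> {x \<in> carrier G. \<forall>p\<in>B. cm x p \<in> Y}"
      using B by (auto simp: mult_cm subset_iff intro!: cjY)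
  next
    fix x assume "x \<in> {x \<in> carrier G. \<forall>p\<in>B. cm x p \<in> Y}"
    then show "inv x \<in> {x \<in> carrier G. \<forall>p\<in>B. cm x p \<in> Y}"
      using B by (auto simp: cm_inv_left subset_iff intro!: cjY)
  qed (use B in \<open>auto simp: subset_iff\<close>)
qed

lemma cm_flip: "subgroup Y G \<Longrightarrow> g \<in> carrier G \<Longrightarrow> h \<in> carrier G \<Longrightarrow> cm g h \<in> Y \<Longrightarrow> cm h g \<in> Y"
  by (metis inv_cm subgroup.m_inv_closed)

lemma subgroup_powers: "x \<in> carrier G \<Longrightarrow> subgroup {x [^] (k::int) |k. True} G"
  using generate_pow[of x] generate_is_subgroup[of "{x}"] by simp

end

text \<open>Only an abelian normal subgroup with abelian quotient is recorded here. That
  \<open>D\<close> is generated by commutators is added where generators are constructed and where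
  the cases are put together.\<close>

locale metabelian_two_group = group +
  fixes D :: "'a set" and m :: nat
  assumes ord: "order G = 2 ^ m"
    and D: "D \<lhd> G"
    and D_comm: "x \<in> D \<Longrightarrow> y \<in> D \<Longrightarrow> x \<otimes> y = y \<otimes> x"
    and cm_D: "g \<in> carrier G \<Longrightarrow> h \<in> carrier G \<Longrightarrow> cm g h \<in> D"
begin

lemma fin: "finite (carrier G)"
  using ord by (metis order_gt_0_iff_finite zero_less_numeral zero_less_power)

lemma D_sub: "subgroup D G" using D by (rule normal_imp_subgroup)

sublocale D: subgroup D G by (rule D_sub)

lemma DcG: "x \<in> D \<Longrightarrow> x \<in> carrier G" by (rule D.mem_carrier)

lemma D_lcomm: "x \<in> D \<Longrightarrow> y \<in> D \<Longrightarrow> w \<in> carrier G \<Longrightarrow> x \<otimes> (y \<otimes> w) = y \<otimes> (x \<otimes> w)"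
  by (metis D.mem_carrier D_comm m_assoc)

lemma D_pow: "x \<in> D \<Longrightarrow> x [^] (k::int) \<in> D"
  by (rule subgroup_int_pow_closed[OF D_sub])

lemmas D_ac = m_assoc D_comm D_lcomm

lemma cj_D [simp, intro]: "g \<in> carrier G \<Longrightarrow> x \<in> D \<Longrightarrow> cj g x \<in> D"
  using D by (simp add: normal_cj)

lemma D_cj_D [simp]: "p \<in> D \<Longrightarrow> x \<in> D \<Longrightarrow> cj p x = x"
  by (simp add: cj_def D_comm[of p x] m_assoc)

lemma D_cm_D [simp]: "p \<in> D \<Longrightarrow> x \<in> D \<Longrightarrow> cm p x = \<one>"
  by (simp add: cm_cj)

lemma cm_D_mult: "g \<in> carrier G \<Longrightarrow> p \<in> D \<Longrightarrow> q \<in> D \<Longrightarrow> cm g (p \<otimes> q) = cm g p \<otimes> cm g q"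
  by (simp add: cm_mult cm_D)

lemma cm_D_inv: "g \<in> carrier G \<Longrightarrow> p \<in> D \<Longrightarrow> cm g (inv p) = inv (cm g p)"
  by (simp add: cm_inv_right cm_D)

lemma pow_mult_D: "p \<in> D \<Longrightarrow> q \<in> D \<Longrightarrow> (p \<otimes> q) [^] (k::int) = p [^] k \<otimes> q [^] k"
  by (simp add: int_pow_mult_distrib D_comm)

lemma cm_D_pow: "g \<in> carrier G \<Longrightarrow> p \<in> D \<Longrightarrow> cm g (p [^] (k::int)) = cm g p [^] k"
  by (simp add: cm_cj cj_int_pow pow_mult_D D_pow int_pow_inv)

lemma cm_D_mult_left: "g \<in> carrier G \<Longrightarrow> p \<in> D \<Longrightarrow> q \<in> D \<Longrightarrow> cm (p \<otimes> g) q = cm g q"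
  by (simp add: mult_cm cm_D)

text \<open>The action on \<open>D\<close> factors through the quotient by \<open>D\<close>, which
  is abelian, because \<open>D\<close> acts trivially on itself.\<close>

lemma cj_comm_D: "g \<in> carrier G \<Longrightarrow> h \<in> carrier G \<Longrightarrow> p \<in> D \<Longrightarrow> cj g (cj h p) = cj h (cj g p)"
proof -
  assume a: "g \<in> carrier G" "h \<in> carrier G" "p \<in> D"
  have "cj g (cj h p) = cj (cm g h \<otimes> (h \<otimes> g)) p" using a by (simp add: word_simps)
  also have "\<dots> = cj (cm g h) (cj h (cj g p))" using a by (simp add: mult_cj)
  also have "\<dots> = cj h (cj g p)" using a by (simp add: cm_D)
  finally show ?thesis .
qed

text \<open>Since \<open>D\<close> is abelian, the squares already form a subgroup, the Frattini
  subgroup of \<open>D\<close>.\<close>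

definition D2 where "D2 = {q \<otimes> q |q. q \<in> D}"

lemma D2_subgroup: "subgroup D2 G"
proof
  fix x y assume "x \<in> D2" "y \<in> D2"
  then obtain p q where "p \<in> D" "q \<in> D" "x = p \<otimes> p" "y = q \<otimes> q" by (auto simp: D2_def)
  then have "x \<otimes> y = (p \<otimes> q) \<otimes> (p \<otimes> q)" "p \<otimes> q \<in> D" by (simp_all add: D_ac)
  then show "x \<otimes> y \<in> D2" by (auto simp: D2_def)
next
  fix x assume "x \<in> D2"
  then obtain p where "p \<in> D" "x = p \<otimes> p" by (auto simp: D2_def)
  then have "inv x = inv p \<otimes> inv p" "inv p \<in> D" by (simp_all add: inv_mult_group)
  then show "inv x \<in> D2" by (auto simp: D2_def)
qed (auto simp: D2_def intro!: exI[of _ \<one>])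

lemma D2_normal: "D2 \<lhd> G"
  unfolding normal_cj
proof (intro conjI ballI D2_subgroup)
  fix g x assume "g \<in> carrier G" "x \<in> D2"
  then obtain p where "p \<in> D" "cj g x = cj g p \<otimes> cj g p" by (auto simp: D2_def cj_mult)
  then show "cj g x \<in> D2" using \<open>g \<in> carrier G\<close> by (auto simp: D2_def)
qed

lemma D2_D: "D2 \<subseteq> D" by (auto simp: D2_def)

sublocale D2: subgroup D2 G by (rule D2_subgroup)

lemma D2I: "q \<in> D \<Longrightarrow> q \<otimes> q \<in> D2" by (auto simp: D2_def)

lemma even_pow_D2: "p \<in> D \<Longrightarrow> even k \<Longrightarrow> p [^] (k::int) \<in> D2"
proof -
  assume "p \<in> D" "even k"
  then obtain j where "k = j + j" by (metis evenE mult_2)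
  then have "p [^] k = p [^] j \<otimes> p [^] j" using \<open>p \<in> D\<close> by (simp only: int_pow_mult DcG)
  then show ?thesis using \<open>p \<in> D\<close> by (simp add: D2I D_pow)
qed

lemma Frat_D: "Frat D = D2"
proof
  show "Frat D \<subseteq> D2" unfolding Frat_def by (rule generate_subgroup_incl[OF _ D2_subgroup]) (auto simp: D2_def)
  show "D2 \<subseteq> Frat D" by (auto simp: D2_def intro: square_Frat)
qed

lemma subgroup_two_powers:
  assumes "x \<in> D" "y \<in> D" shows "subgroup {x [^] (i::int) \<otimes> y [^] (j::int) |i j. True} G"
proof
  show "{x [^] (i::int) \<otimes> y [^] (j::int) |i j. True} \<subseteq> carrier G" using assms by auto
  show "\<one> \<in> {x [^] (i::int) \<otimes> y [^] (j::int) |i j. True}"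
    using assms by (auto intro!: exI[of _ "0::int"])
  fix u assume "u \<in> {x [^] (i::int) \<otimes> y [^] (j::int) |i j. True}"
  then obtain i j where u: "u = x [^] (i::int) \<otimes> y [^] (j::int)" by auto
  have "inv u = x [^] (-i) \<otimes> y [^] (-j)"
    using assms u by (simp add: inv_mult_group int_pow_neg D_comm D_pow)
  then show "inv u \<in> {x [^] (i::int) \<otimes> y [^] (j::int) |i j. True}" by blast
  fix v assume "v \<in> {x [^] (i::int) \<otimes> y [^] (j::int) |i j. True}"
  then obtain k h where v: "v = x [^] (k::int) \<otimes> y [^] (h::int)" by auto
  have "u \<otimes> v = x [^] (i + k) \<otimes> y [^] (j + h)"
    using assms u v by (simp add: int_pow_mult D_ac D_pow)
  then show "u \<otimes> v \<in> {x [^] (i::int) \<otimes> y [^] (j::int) |i j. True}" by blast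
qed

text \<open>The Burnside basis theorem for \<open>D\<close>: generators modulo squares are
  generators.\<close>

lemma D_two_powers:
  assumes xy: "x \<in> D" "y \<in> D"
    and gen: "\<And>p. p \<in> D \<Longrightarrow> \<exists>i j. \<exists>d\<in>D2. p = x [^] (i::int) \<otimes> y [^] (j::int) \<otimes> d"
  shows "p \<in> D \<Longrightarrow> \<exists>i j. p = x [^] (i::int) \<otimes> y [^] (j::int)"
proof -
  have "{x [^] (i::int) \<otimes> y [^] (j::int) |i j. True} = D"
  proof (rule subgroup_eq_if_Frat[OF ord D_sub subgroup_two_powers[OF xy]])
    show "{x [^] (i::int) \<otimes> y [^] (j::int) |i j. True} \<subseteq> D" using xy D_pow by auto
    show "\<exists>h\<in>{x [^] (i::int) \<otimes> y [^] (j::int) |i j. True}. \<exists>f\<in>Frat D. q = h \<otimes> f" if "q \<in> D" for q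
      using gen[OF that] unfolding Frat_D by blast
  qed
  then show "p \<in> D \<Longrightarrow> \<exists>i j. p = x [^] (i::int) \<otimes> y [^] (j::int)" by blast
qed

text \<open>The product of the cyclic group of \<open>x\<close> with \<open>D\<close>; being above
  \<open>D\<close>, it is normal in \<open>G\<close>.\<close>

definition cyc where "cyc x = {x [^] (k::int) \<otimes> p |k p. p \<in> D}"

lemma cyc_subgroup: assumes x: "x \<in> carrier G" shows "subgroup (cyc x) G"
proof
  show "cyc x \<subseteq> carrier G" using x by (auto simp: cyc_def)
  show "\<one> \<in> cyc x" using x by (auto simp: cyc_def intro!: exI[of _ "0::int"] exI[of _ \<one>])
  fix u assume "u \<in> cyc x"
  then obtain k p where u: "u = x [^] (k::int) \<otimes> p" "p \<in> D" by (auto simp: cyc_def)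
  have "inv u = x [^] (-k) \<otimes> cj (x [^] k) (inv p)"
    using x u by (simp add: word_simps int_pow_neg)
  then show "inv u \<in> cyc x" using x u by (auto simp: cyc_def)
  fix v assume "v \<in> cyc x"
  then obtain j q where v: "v = x [^] (j::int) \<otimes> q" "q \<in> D" by (auto simp: cyc_def)
  have "u \<otimes> v = x [^] (k + j) \<otimes> (cj (inv (x [^] j)) p \<otimes> q)"
    using x u v by (simp add: word_simps int_pow_mult)
  moreover have "cj (inv (x [^] j)) p \<otimes> q \<in> D" using x u v by simp
  ultimately show "u \<otimes> v \<in> cyc x" unfolding cyc_def by blast
qed

lemma cyc_D: "x \<in> carrier G \<Longrightarrow> D \<subseteq> cyc x"
proof
  fix p assume "x \<in> carrier G" "p \<in> D"
  then have "p = x [^] (0::int) \<otimes> p" by simp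
  then show "p \<in> cyc x" using \<open>p \<in> D\<close> unfolding cyc_def by blast
qed

lemma cyc_self: "x \<in> carrier G \<Longrightarrow> x \<in> cyc x"
  by (auto simp: cyc_def intro!: exI[of _ "1::int"] exI[of _ \<one>])

lemma cyc_least: "subgroup H G \<Longrightarrow> x \<in> H \<Longrightarrow> D \<subseteq> H \<Longrightarrow> cyc x \<subseteq> H"
  by (auto simp: cyc_def intro!: subgroup.m_closed subgroup_int_pow_closed)

lemma above_D_normal: assumes "subgroup H G" "D \<subseteq> H" shows "H \<lhd> G"
  unfolding normal_cj
proof (intro conjI ballI assms(1))
  fix g x assume gx: "g \<in> carrier G" "x \<in> H"
  then have "cj g x = cm g x \<otimes> x" using assms(1) by (simp add: cj_cm subgroup.mem_carrier)
  moreover have "cm g x \<in> H" using cm_D[OF gx(1) subgroup.mem_carrier[OF assms(1) gx(2)]] assms(2) by (rule rev_subsetD)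
  ultimately show "cj g x \<in> H" using gx assms(1) by (simp add: subgroup.m_closed)
qed

end

text \<open>The data are not symmetric in the generators: \<open>c\<close> stays fixed while
  \<open>a\<close> may be replaced by \<open>c \<otimes> a\<close>, see
  \<open>swap_noncyclic_derived\<close>. The assumption \<open>a_top\<close> is the trace that
  bicyclicity leaves; \<open>D_indep\<close> is linear independence over the field with two
  elements, written with integer exponents.\<close>

locale noncyclic_derived = metabelian_two_group +
  fixes a c :: 'a and n :: nat
  assumes aG [simp]: "a \<in> carrier G" and cG [simp]: "c \<in> carrier G"
    and gen: "g \<in> carrier G \<Longrightarrow> g \<in> cyc a \<or> (\<exists>x\<in>cyc a. g = c \<otimes> x)"
    and c_out: "c \<notin> cyc a"
    and c_sq: "c \<otimes> c \<in> D"
    and a_pow: "a [^] (k::int) \<in> D \<longleftrightarrow> 2 ^ n dvd k" and n2: "n \<ge> 2"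
    and cm_c: "p \<in> D \<Longrightarrow> cm c p \<in> D2"
    and a_top: "\<exists>d\<in>D2. a [^] ((2::int) ^ n) = cm a (cm a c) \<otimes> d"
    and D_gen: "p \<in> D \<Longrightarrow> \<exists>i j. \<exists>d\<in>D2. p = cm a c [^] (i::int) \<otimes> cm a (cm a c) [^] (j::int) \<otimes> d"
    and D_indep: "cm a c [^] (i::int) \<otimes> cm a (cm a c) [^] (j::int) \<in> D2 \<Longrightarrow> even i \<and> even j"
begin

lemma gen_subgroup:
  assumes "subgroup S G" "cyc a \<subseteq> S" "c \<in> S" "g \<in> carrier G" shows "g \<in> S"
  using gen[OF assms(4)]
proof
  assume "\<exists>x\<in>cyc a. g = c \<otimes> x"
  then obtain x where "x \<in> cyc a" "g = c \<otimes> x" by (rule bexE)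
  then show ?thesis using subgroup.m_closed[OF assms(1,3)] assms(2) by (simp add: subset_iff)
qed (use assms(2) in \<open>simp add: subset_iff\<close>)

definition z where "z = cm a c"
definition l where "l = cm a z"

lemma zD [simp]: "z \<in> D" and lD [simp]: "l \<in> D"
  by (simp_all add: z_def l_def cm_D)

lemma zG [simp]: "z \<in> carrier G" and lG [simp]: "l \<in> carrier G"
  by (simp_all add: DcG)

lemma D_zl: "p \<in> D \<Longrightarrow> \<exists>i j. p = z [^] (i::int) \<otimes> l [^] (j::int)"
  by (rule D_two_powers) (use D_gen in \<open>auto simp: z_def[symmetric] l_def[symmetric]\<close>)

lemma l_not_D2: "odd j \<Longrightarrow> l [^] (j::int) \<notin> D2"
  using D_indep[of 0 j] by (auto simp flip: z_def l_def)

text \<open>Modulo squares \<open>l\<close> may be exchanged for a power of \<open>a\<close>. The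
  gain is a generator of \<open>D\<close> that commutes with \<open>a\<close>.\<close>

lemma D_za: "p \<in> D \<Longrightarrow> \<exists>i j. p = z [^] (i::int) \<otimes> (a [^] ((2::int) ^ n)) [^] (j::int)"
proof (rule D_two_powers)
  obtain d where d: "d \<in> D2" "a [^] ((2::int) ^ n) = l \<otimes> d" using a_top by (auto simp flip: z_def l_def)
  have dD: "d \<in> D" using d D2_D by blast
  show "a [^] ((2::int) ^ n) \<in> D" using a_pow by simp
  fix p assume "p \<in> D"
  then obtain i j e where e: "e \<in> D2" "p = z [^] (i::int) \<otimes> l [^] (j::int) \<otimes> e"
    using D_gen[of p] by (auto simp flip: z_def l_def)
  have eD: "e \<in> D" using e D2_D by blast
  have "p = z [^] i \<otimes> (l \<otimes> d) [^] j \<otimes> (inv (d [^] j) \<otimes> e)"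
    using e(2) eD dD by (simp add: pow_mult_D m_assoc D_pow DcG cancel_left_inv)
  moreover have "inv (d [^] j) \<otimes> e \<in> D2" using d(1) e(1) by (simp add: subgroup_int_pow_closed[OF D2_subgroup])
  ultimately show "\<exists>i j. \<exists>d\<in>D2. p = z [^] (i::int) \<otimes> (a [^] ((2::int) ^ n)) [^] (j::int) \<otimes> d"
    unfolding d(2) by blast
qed simp

text \<open>The chain \<open>L\<close>, \<open>L2\<close>, \<open>L4\<close> is the scale on which
  commutators with \<open>D\<close>, \<open>D2\<close> and \<open>L\<close> are measured; each
  member is normal in \<open>G\<close>.\<close>

definition L where "L = {l [^] (k::int) |k. True}"
definition L2 where "L2 = {l [^] (2 * k::int) |k. True}"
definition L4 where "L4 = {l [^] (4 * k::int) |k. True}"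

lemma L_mult_subgroup: "subgroup {l [^] (t * k::int) |k. True} G"
proof -
  have "l [^] (t * k) = (l [^] t) [^] k" for k by (simp add: int_pow_pow)
  then show ?thesis using subgroup_powers[of "l [^] t"] by simp
qed

lemma L_subgroup: "subgroup L G" and L2_subgroup: "subgroup L2 G" and L4_subgroup: "subgroup L4 G"
  using L_mult_subgroup[of 1] L_mult_subgroup[of 2] L_mult_subgroup[of 4] by (simp_all add: L_def L2_def L4_def)

sublocale L: subgroup L G by (rule L_subgroup)
sublocale L2: subgroup L2 G by (rule L2_subgroup)
sublocale L4: subgroup L4 G by (rule L4_subgroup)

lemma L4_L2: "L4 \<subseteq> L2"
proof
  fix x assume "x \<in> L4"
  then obtain k where "x = l [^] (2 * (2 * k)::int)" by (auto simp: L4_def)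
  then show "x \<in> L2" unfolding L2_def by blast
qed

lemma L2_L: "L2 \<subseteq> L" by (auto simp: L2_def L_def)
lemma L_D: "L \<subseteq> D" by (auto simp: L_def D_pow)
lemma L2_D2: "L2 \<subseteq> D2" by (auto simp: L2_def even_pow_D2)
lemma lL [simp]: "l \<in> L" by (auto simp: L_def intro!: exI[of _ "1::int"])

lemma L2_sq: "x \<in> L \<Longrightarrow> x \<otimes> x \<in> L2"
  by (auto simp: L_def L2_def simp flip: int_pow_mult mult_2)

lemma L4_sq: "x \<in> L2 \<Longrightarrow> x \<otimes> x \<in> L4"
proof -
  assume "x \<in> L2"
  then obtain k where "x = l [^] (2 * k::int)" by (auto simp: L2_def)
  then have "x \<otimes> x = l [^] (4 * k)" by (simp flip: int_pow_mult)
  then show ?thesis by (auto simp: L4_def)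
qed

lemma cm_a_z: "cm a (z [^] (i::int)) = l [^] i"
  by (simp add: cm_D_pow l_def)

text \<open>In the generators of \<open>D_za\<close> the second one commutes with \<open>a\<close>,
  so the commutator is \<open>l\<close> raised to the exponent of \<open>z\<close>.\<close>

lemma cm_a_D: assumes "p \<in> D" shows "cm a p \<in> L"
proof -
  obtain i j where p: "p = z [^] (i::int) \<otimes> (a [^] ((2::int) ^ n)) [^] (j::int)" using D_za[OF assms] by blast
  have aD: "a [^] ((2::int) ^ n) \<in> D" using a_pow by simp
  have "a [^] ((2::int) ^ n) \<otimes> a = a \<otimes> a [^] ((2::int) ^ n)"
    using int_pow_mult[OF aG, of "2 ^ n" 1] int_pow_mult[OF aG, of 1 "2 ^ n"] by (simp add: add.commute)
  then have "cm a (a [^] ((2::int) ^ n)) = \<one>" by (simp add: cm_one_iff)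
  then have "cm a p = l [^] i" using aD by (simp add: p cm_D_mult D_pow cm_a_z cm_D_pow)
  then show ?thesis by (auto simp: L_def)
qed

lemma cm_a_D2: assumes "p \<in> D2" shows "cm a p \<in> L2"
proof -
  obtain q where "q \<in> D" "p = q \<otimes> q" using assms by (auto simp: D2_def)
  then show ?thesis using L2_sq cm_a_D by (simp add: cm_D_mult)
qed

text \<open>The power of \<open>a\<close> in \<open>a_top\<close> commutes with \<open>a\<close>, so
  the commutators of \<open>a\<close> with \<open>l\<close> and with the square \<open>d\<close>
  cancel, and the latter is in \<open>L2\<close>.\<close>

lemma cm_a_l: "cm a l \<in> L2"
proof -
  obtain d where d: "d \<in> D2" "a [^] ((2::int) ^ n) = l \<otimes> d" using a_top by (auto simp flip: z_def l_def)
  have dD: "d \<in> D" using d D2_D by blast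
  have "a [^] ((2::int) ^ n) \<otimes> a = a \<otimes> a [^] ((2::int) ^ n)"
    using int_pow_mult[OF aG, of "2 ^ n" 1] int_pow_mult[OF aG, of 1 "2 ^ n"] by (simp add: add.commute)
  then have "cm a (l \<otimes> d) = \<one>" using d(2) dD by (simp add: cm_one_iff)
  then have "cm a l \<otimes> cm a d = \<one>" using dD by (simp add: cm_D_mult)
  then have "cm a l = inv (cm a d)" using dD by (simp add: inv_equality DcG)
  then show ?thesis using cm_a_D2[OF d(1)] by simp
qed

text \<open>The commutator of \<open>a\<close> with the square of \<open>c\<close> is computed
  twice: by expansion it is \<open>z \<otimes> cj c z\<close>, which lies in \<open>D2\<close>; from
  \<open>c \<otimes> c = z^i l^j\<close> it is \<open>l^i\<close> up to an element of
  \<open>L2\<close>. Hence \<open>i\<close> is even. The meaning is that \<open>c\<close> inverts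
  \<open>z\<close> modulo \<open>L2\<close>.\<close>

lemma z_cj_c: "z \<otimes> cj c z \<in> L2"
proof -
  have eq: "cm a (c \<otimes> c) = z \<otimes> cj c z" by (simp add: z_def cm_mult)
  obtain i j where ij: "c \<otimes> c = z [^] (i::int) \<otimes> l [^] (j::int)" using D_zl[OF c_sq] by blast
  have e2: "cm a (c \<otimes> c) = l [^] i \<otimes> cm a l [^] j"
    by (simp add: ij cm_D_mult D_pow cm_a_z cm_D_pow)
  have lj: "cm a l [^] j \<in> L2" by (rule subgroup_int_pow_closed[OF L2_subgroup cm_a_l])
  have "z \<otimes> cj c z = cm c z \<otimes> (z \<otimes> z)" by (simp add: cj_cm[of c z] D_ac cm_D)
  also have "\<dots> \<in> D2" using cm_c[OF zD] D2I[OF zD] by simp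
  finally have "l [^] i \<otimes> cm a l [^] j \<in> D2" using eq e2 by simp
  then have "l [^] i \<otimes> cm a l [^] j \<otimes> inv (cm a l [^] j) \<in> D2" using lj L2_D2 by blast
  then have "l [^] i \<in> D2" using lj by (simp add: m_assoc cm_D DcG)
  then have "even i" using l_not_D2 by blast
  then have "l [^] i \<in> L2" by (auto simp: L2_def elim!: evenE)
  then have "l [^] i \<otimes> cm a l [^] j \<in> L2" using lj by simp
  then show ?thesis unfolding eq[symmetric] e2 .
qed

text \<open>Commutation with \<open>a\<close> is applied to \<open>z_cj_c\<close>; it turns
  \<open>z\<close> into \<open>l\<close> and, by \<open>cm_a_l\<close>, elements of
  \<open>L2\<close> into elements of \<open>L4\<close>.\<close>

lemma cj_c_l: "l \<otimes> cj c l \<in> L4"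
proof -
  have "cm a (z \<otimes> cj c z) = l \<otimes> cm a (cj c z)"
    by (simp add: cm_D_mult l_def)
  also have "cm a (cj c z) = cj c l"
    using cj_comm_D[of a c z] by (simp add: l_def cm_cj cj_mult cj_inv)
  finally have eq: "l \<otimes> cj c l = cm a (z \<otimes> cj c z)" by simp
  obtain k where k: "z \<otimes> cj c z = l [^] (2 * k::int)" using z_cj_c by (auto simp: L2_def)
  obtain j where j: "cm a l = l [^] (2 * j::int)" using cm_a_l by (auto simp: L2_def)
  have "l \<otimes> cj c l = l [^] (4 * (j * k))"
    unfolding eq k by (simp add: cm_D_pow j int_pow_pow mult_ac)
  then show ?thesis unfolding L4_def by blast
qed

lemma cj_L: assumes "g \<in> carrier G" "x \<in> L" shows "cj g x \<in> L"
proof -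
  have finL: "finite L" using fin L.subset by (rule rev_finite_subset)
  have "a \<in> nzr L"
  proof (rule nzrI[OF finL L.subset])
    fix q assume q: "q \<in> L"
    then have "cj a q = cm a q \<otimes> q" by (simp add: cj_cm)
    then show "cj a q \<in> L" using q cm_a_D L_D by auto
  qed simp
  moreover have "c \<in> nzr L"
  proof (rule nzrI[OF finL L.subset])
    fix q assume q: "q \<in> L"
    have "cj c l = inv l \<otimes> (l \<otimes> cj c l)" by (simp add: cancel_left_inv)
    then have "cj c l \<in> L" using cj_c_l L4_L2 L2_L by (metis L.m_closed L.m_inv_closed lL subsetD)
    moreover obtain k where "q = l [^] (k::int)" using q by (auto simp: L_def)
    ultimately show "cj c q \<in> L" using subgroup_int_pow_closed[OF L_subgroup] by (simp add: cj_int_pow)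
  qed simp
  moreover have "D \<subseteq> nzr L"
  proof
    fix p assume p: "p \<in> D"
    show "p \<in> nzr L" using p L_D by (intro nzrI[OF finL L.subset]) (auto simp: subset_iff)
  qed
  ultimately have "cyc a \<subseteq> nzr L" "c \<in> nzr L" using cyc_least[OF nzr_subgroup[OF L.subset]] by auto
  then have "g \<in> nzr L" using gen_subgroup[OF nzr_subgroup[OF L.subset]] assms(1) by simp
  then show ?thesis using assms(2) by (rule nzrD)
qed

lemma L_normal: "L \<lhd> G" using cj_L L_subgroup by (simp add: normal_cj)

lemma cj_L_mult: assumes "g \<in> carrier G" "x = l [^] (t * k::int)" shows "\<exists>k. cj g x = l [^] (t * k::int)"
proof -
  obtain s where "cj g l = l [^] (s::int)" using cj_L[OF assms(1) lL] by (auto simp: L_def)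
  then have "cj g x = l [^] (t * (s * k))" using assms by (simp add: cj_int_pow int_pow_pow mult_ac)
  then show ?thesis by blast
qed

lemma L2_normal: "L2 \<lhd> G" and L4_normal: "L4 \<lhd> G"
  using cj_L_mult[of _ _ 2] cj_L_mult[of _ _ 4] L2_subgroup L4_subgroup unfolding normal_cj L2_def L4_def by blast+

text \<open>\<open>M1\<close> and \<open>M\<close> are two of the three maximal subgroups containing
  \<open>D\<close>, the third being \<open>cyc (c \<otimes> a)\<close>. Any two of them meet in
  \<open>Ph\<close>, modulo which \<open>G\<close> is a four-group.\<close>

abbreviation "M1 \<equiv> cyc a"
abbreviation "Ph \<equiv> cyc (a \<otimes> a)"
definition "M = Ph \<union> (\<lambda>x. c \<otimes> x) ` Ph"

lemma M1_sub: "subgroup M1 G" and Ph_sub: "subgroup Ph G" by (simp_all add: cyc_subgroup)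

sublocale M1: subgroup "cyc a" G by (rule M1_sub)
sublocale Ph: subgroup "cyc (a \<otimes> a)" G by (rule Ph_sub)

lemma Ph_M1: "Ph \<subseteq> M1"
  using cyc_self[of a] cyc_D[of a] by (intro cyc_least M1_sub) auto

lemma D_Ph: "D \<subseteq> Ph" by (simp add: cyc_D)

lemma M_sub: "subgroup M G"
  unfolding M_def
proof (rule subgroup_extend_index_two[OF Ph_sub])
  show "cj c x \<in> Ph" if "x \<in> Ph" for x
    using above_D_normal[OF Ph_sub D_Ph] that by (simp add: normal_cj)
  show "c \<otimes> c \<in> Ph" using c_sq D_Ph by blast
  show "finite Ph" using fin Ph.subset by (rule rev_finite_subset)
qed simp

sublocale M: subgroup M G by (rule M_sub)

lemma Ph_M: "Ph \<subseteq> M" by (auto simp: M_def)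

lemma cM: "c \<in> M" unfolding M_def using Ph.one_closed by (metis UnI2 cG image_eqI r_one)

lemma c_M1: "x \<in> M1 \<Longrightarrow> c \<otimes> x \<notin> M1"
proof
  assume "x \<in> M1" "c \<otimes> x \<in> M1"
  then have "(c \<otimes> x) \<otimes> inv x \<in> M1" by blast
  then show False using \<open>x \<in> M1\<close> c_out by (simp add: m_assoc)
qed

lemma M_out: "g \<in> M - Ph \<Longrightarrow> \<exists>x\<in>Ph. g = c \<otimes> x" by (auto simp: M_def)

lemma c_Ph: "x \<in> Ph \<Longrightarrow> c \<otimes> x \<in> M - Ph"
  using c_M1[of x] Ph_M1 by (auto simp: M_def)

lemma M1_M: "M1 \<inter> M = Ph"
  using Ph_M1 c_M1 by (auto simp: M_def)

lemma a_not_M: "a \<notin> M"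
proof
  assume "a \<in> M"
  then have "a \<in> Ph" using M1_M cyc_self[of a] by auto
  then obtain k p where kp: "p \<in> D" "a = (a \<otimes> a) [^] (k::int) \<otimes> p" by (auto simp: cyc_def)
  have "a \<otimes> a = a [^] (2::int)" using int_pow_mult[of a 1 1] by simp
  then have "a = a [^] (2 * k) \<otimes> p" using kp by (simp add: int_pow_pow)
  then have "p = a [^] (1 - 2 * k)"
    using kp(1) DcG by (metis aG int_pow_1 int_pow_closed int_pow_diff int_pow_mult inv_solve_left diff_conv_add_uminus add.commute int_pow_neg)
  then have "(2::int) ^ n dvd 1 - 2 * k" using kp(1) a_pow by simp
  then have "even (1 - 2 * k)" using n2 by (meson dvd_power dvd_trans le_trans one_le_numeral zero_less_numeral less_le_trans)
  then show False by simp
qed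

lemma M_out_mult: assumes "g \<in> M - Ph" "h \<in> M - Ph" shows "g \<otimes> h \<in> Ph"
proof -
  obtain x y where xy: "x \<in> Ph" "y \<in> Ph" "g = c \<otimes> x" "h = c \<otimes> y"
    using M_out[OF assms(1)] M_out[OF assms(2)] by metis
  have "g \<otimes> h = c \<otimes> c \<otimes> (cj (inv c) x \<otimes> y)" using xy by (simp add: word_simps)
  moreover have "cj (inv c) x \<in> Ph" using above_D_normal[OF Ph_sub D_Ph] xy by (simp add: normal_cj)
  ultimately show ?thesis using xy c_sq D_Ph by auto
qed

text \<open>Only the square of \<open>a\<close> has to be checked. Its commutator with
  \<open>p\<close> is \<open>cm a (cm a p)\<close> times the square of \<open>cm a p\<close>, and
  both factors are in \<open>L2\<close>.\<close>

lemma cm_Ph_D: assumes "x \<in> Ph" "p \<in> D" shows "cm x p \<in> L2"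
proof -
  have "Ph \<subseteq> {x \<in> carrier G. \<forall>p\<in>D. cm x p \<in> L2}"
  proof (rule cyc_least[OF subgroup_cm_into[OF L2_normal D.subset]])
    have "cm (a \<otimes> a) p \<in> L2" if p: "p \<in> D" for p
    proof -
      have "cm (a \<otimes> a) p = cm a (cm a p) \<otimes> (cm a p \<otimes> cm a p)"
        using p by (simp add: mult_cm cj_cm[of a "cm a p"] m_assoc cm_D DcG)
      moreover obtain k where k: "cm a p = l [^] (k::int)" using cm_a_D[OF p] by (auto simp: L_def)
      have "cm a (cm a p) = cm a l [^] k" unfolding k by (simp add: cm_D_pow)
      then have "cm a (cm a p) \<in> L2" using subgroup_int_pow_closed[OF L2_subgroup cm_a_l] by simp
      ultimately show ?thesis using L2_sq[OF cm_a_D[OF p]] by simp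
    qed
    then show "a \<otimes> a \<in> {x \<in> carrier G. \<forall>p\<in>D. cm x p \<in> L2}" by simp
  qed auto
  then show ?thesis using assms by blast
qed

text \<open>The expansion of \<open>cm_Ph_D\<close> one level deeper: if \<open>a\<close> has
  commutator \<open>l^(2j)\<close> with \<open>l\<close>, the square of \<open>a\<close> has
  commutator \<open>l^(4jk(j+1))\<close> with \<open>l^k\<close>.\<close>

lemma cm_Ph_L: assumes "x \<in> Ph" "p \<in> L" shows "cm x p \<in> L4"
proof -
  have "Ph \<subseteq> {x \<in> carrier G. \<forall>p\<in>L. cm x p \<in> L4}"
  proof (rule cyc_least[OF subgroup_cm_into[OF L4_normal L.subset]])
    obtain j where j: "cm a l = l [^] (2 * j::int)" using cm_a_l by (auto simp: L2_def)
    have "cm (a \<otimes> a) p \<in> L4" if p: "p \<in> L" for p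
    proof -
      obtain k where k: "p = l [^] (k::int)" using p by (auto simp: L_def)
      have 1: "cm a (l [^] (i::int)) = l [^] (2 * j * i)" for i by (simp add: cm_D_pow j int_pow_pow)
      have "cm (a \<otimes> a) p = cm a (cm a p) \<otimes> (cm a p \<otimes> cm a p)"
        using p L_D by (simp add: mult_cm cj_cm[of a "cm a p"] m_assoc cm_D DcG)
      also have "\<dots> = l [^] (2 * j * (2 * j * k) + (2 * j * k + 2 * j * k))"
        by (simp only: k 1 int_pow_mult[OF lG])
      also have "2 * j * (2 * j * k) + (2 * j * k + 2 * j * k) = 4 * (j * j * k + j * k)"
        by (simp add: algebra_simps)
      finally show ?thesis unfolding L4_def by blast
    qed
    then show "a \<otimes> a \<in> {x \<in> carrier G. \<forall>p\<in>L. cm x p \<in> L4}" by simp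
    show "D \<subseteq> {x \<in> carrier G. \<forall>p\<in>L. cm x p \<in> L4}" using L_D by (auto simp: subset_iff)
  qed
  then show ?thesis using assms by blast
qed

lemma cm_Ph_D2: "x \<in> Ph \<Longrightarrow> p \<in> D2 \<Longrightarrow> cm x p \<in> L4"
  using cm_Ph_D L4_sq by (auto simp: D2_def cm_D_mult)

text \<open>The left side is \<open>cj g p \<otimes> p\<close>, so the claim is that
  \<open>g\<close> inverts \<open>p\<close> modulo \<open>L2\<close>. This holds for
  \<open>c\<close> by \<open>z_cj_c\<close> and \<open>cj_c_l\<close>, and \<open>Ph\<close> acts
  trivially on \<open>D\<close> modulo \<open>L2\<close>.\<close>

lemma cm_out_D: assumes "g \<in> M - Ph" "p \<in> D" shows "cm g p \<otimes> (p \<otimes> p) \<in> L2"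
proof -
  obtain x where x: "x \<in> Ph" "g = c \<otimes> x" using assms M_out by blast
  obtain i j where ij: "p = z [^] (i::int) \<otimes> l [^] (j::int)" using D_zl[OF assms(2)] by blast
  have "p \<otimes> cj c p = (z \<otimes> cj c z) [^] i \<otimes> (l \<otimes> cj c l) [^] j"
    unfolding ij by (simp add: cj_mult cj_int_pow pow_mult_D D_ac D_pow)
  also have "\<dots> \<in> L2" using z_cj_c cj_c_l L4_L2 subgroup_int_pow_closed[OF L2_subgroup] by auto
  finally have 1: "p \<otimes> cj c p \<in> L2" .
  have "cm g p \<otimes> (p \<otimes> p) = cj c (cm x p) \<otimes> (p \<otimes> cj c p)"
    using assms x by (simp add: mult_cm cm_cj[of c p] D_ac cm_D cancel_left_inv)
  moreover have "cj c (cm x p) \<in> L2" using cm_Ph_D[OF x(1) assms(2)] L2_normal by (simp add: normal_cj)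
  ultimately show ?thesis using 1 by simp
qed

lemma cm_out_L: assumes "g \<in> M - Ph" "p \<in> L" shows "cm g p \<otimes> (p \<otimes> p) \<in> L4"
proof -
  have pD: "p \<in> D" using assms L_D by blast
  obtain x where x: "x \<in> Ph" "g = c \<otimes> x" using assms M_out by blast
  obtain j where j: "p = l [^] (j::int)" using assms(2) by (auto simp: L_def)
  have "p \<otimes> cj c p = (l \<otimes> cj c l) [^] j"
    unfolding j by (simp add: cj_int_pow pow_mult_D D_pow)
  also have "\<dots> \<in> L4" using cj_c_l subgroup_int_pow_closed[OF L4_subgroup] by auto
  finally have 1: "p \<otimes> cj c p \<in> L4" .
  have "cm g p \<otimes> (p \<otimes> p) = cj c (cm x p) \<otimes> (p \<otimes> cj c p)"
    using pD x by (simp add: mult_cm cm_cj[of c p] D_ac cm_D cancel_left_inv)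
  moreover have "cj c (cm x p) \<in> L4" using cm_Ph_L[OF x(1) assms(2)] L4_normal by (simp add: normal_cj)
  ultimately show ?thesis using 1 by simp
qed

lemma cm_M1_D: assumes "x \<in> M1" "p \<in> D" shows "cm x p \<in> L"
proof -
  have "M1 \<subseteq> {x \<in> carrier G. \<forall>p\<in>D. cm x p \<in> L}"
    by (rule cyc_least[OF subgroup_cm_into[OF L_normal D.subset]]) (simp_all add: cm_a_D subset_iff)
  then show ?thesis using assms by blast
qed

lemma cm_L: assumes "g \<in> carrier G" "p \<in> L" shows "cm g p \<in> L2"
proof -
  let ?S = "{x \<in> carrier G. \<forall>p\<in>L. cm x p \<in> L2}"
  have S: "subgroup ?S G" by (rule subgroup_cm_into[OF L2_normal L.subset])
  have al: "cm a p \<in> L2" if "p \<in> L" for p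
  proof -
    obtain j where j: "p = l [^] (j::int)" using \<open>p \<in> L\<close> by (auto simp: L_def)
    show ?thesis using subgroup_int_pow_closed[OF L2_subgroup cm_a_l] by (simp add: j cm_D_pow)
  qed
  have "M1 \<subseteq> ?S" by (rule cyc_least[OF S]) (use al L_D in \<open>auto simp: subset_iff\<close>)
  moreover have "cm c p \<in> L2" if p: "p \<in> L" for p
  proof -
    have pD: "p \<in> D" using p L_D by blast
    have "cm c p \<otimes> (p \<otimes> p) \<in> L2" using cm_out_L[of c p] c_Ph[of \<one>] p L4_L2 by auto
    then have "cm c p \<otimes> (p \<otimes> p) \<otimes> inv (p \<otimes> p) \<in> L2" using L2_sq[OF p] by blast
    then show ?thesis using pD by (simp add: m_assoc cm_D DcG)
  qed
  then have "c \<in> ?S" by simp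
  ultimately have "g \<in> ?S" using gen_subgroup[OF S] assms(1) by simp
  then show ?thesis using assms(2) by simp
qed

text \<open>Generators can be checked only in the first entry of a commutator, so the argument runs
  twice and \<open>cm_flip\<close> exchanges the entries in between.\<close>

lemma cm_M1: assumes "x \<in> M1" "y \<in> M1" shows "cm x y \<in> L"
proof -
  have 1: "M1 \<subseteq> {x \<in> carrier G. \<forall>p\<in>{a}. cm x p \<in> L}"
    by (rule cyc_least[OF subgroup_cm_into[OF L_normal]])
      (simp_all add: subset_iff cm_flip[OF L_subgroup aG DcG cm_a_D])
  have 2: "M1 \<subseteq> {x \<in> carrier G. \<forall>p\<in>M1. cm x p \<in> L}"
  proof (rule cyc_least[OF subgroup_cm_into[OF L_normal M1.subset]])
    show "a \<in> {x \<in> carrier G. \<forall>p\<in>M1. cm x p \<in> L}"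
    proof (clarsimp)
      fix p assume "p \<in> M1"
      then show "cm a p \<in> L" using 1 by (intro cm_flip[OF L_subgroup, of p a]) (simp_all add: subset_iff)
    qed
    show "D \<subseteq> {x \<in> carrier G. \<forall>p\<in>M1. cm x p \<in> L}"
    proof (clarsimp)
      fix p q assume "p \<in> D" "q \<in> M1"
      then show "cm p q \<in> L" by (intro cm_flip[OF L_subgroup, of q p] cm_M1_D) simp_all
    qed
  qed
  show ?thesis using subsetD[OF 2 assms(1)] assms(2) by simp
qed

lemma cm_Ph: assumes "x \<in> Ph" "y \<in> Ph" shows "cm x y \<in> L2"
proof -
  have aP: "a \<otimes> a \<in> Ph" by (simp add: cyc_self)
  have 1: "Ph \<subseteq> {x \<in> carrier G. \<forall>p\<in>{a \<otimes> a}. cm x p \<in> L2}"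
    by (rule cyc_least[OF subgroup_cm_into[OF L2_normal]])
      (simp_all add: subset_iff cm_flip[OF L2_subgroup _ DcG cm_Ph_D[OF aP]])
  have 2: "Ph \<subseteq> {x \<in> carrier G. \<forall>p\<in>Ph. cm x p \<in> L2}"
  proof (rule cyc_least[OF subgroup_cm_into[OF L2_normal Ph.subset]])
    show "a \<otimes> a \<in> {x \<in> carrier G. \<forall>p\<in>Ph. cm x p \<in> L2}"
    proof (clarsimp)
      fix p assume "p \<in> Ph"
      then show "cm (a \<otimes> a) p \<in> L2" using 1 by (intro cm_flip[OF L2_subgroup, of p "a \<otimes> a"]) (simp_all add: subset_iff)
    qed
    show "D \<subseteq> {x \<in> carrier G. \<forall>p\<in>Ph. cm x p \<in> L2}"
    proof (clarsimp)
      fix p q assume "p \<in> D" "q \<in> Ph"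
      then show "cm p q \<in> L2" by (intro cm_flip[OF L2_subgroup, of q p] cm_Ph_D) simp_all
    qed
  qed
  show ?thesis using subsetD[OF 2 assms(1)] assms(2) by simp
qed

end

section \<open>Powers and counting in 2-groups\<close>

context group
begin

lemma coset_pow:
  assumes N: "N \<lhd> G" and u: "u \<in> carrier G" "v \<in> carrier G" "u \<otimes> inv v \<in> N"
  shows "u [^] (k::int) \<otimes> inv (v [^] k) \<in> N"
proof -
  interpret N: normal N G by (rule N)
  have "u \<in> N #> v" using u N.rcos_module[OF is_group, of v u] by simp
  then have "N #> u = N #> v" using u repr_independence[OF _ _ N.subgroup_axioms] by metis
  then have "N #> u [^] k = N #> v [^] k"
    using N.FactGroup_int_pow[OF u(1), of k] N.FactGroup_int_pow[OF u(2), of k] by metis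
  then have "u [^] k \<in> N #> v [^] k" using rcos_self[OF _ N.subgroup_axioms, of "u [^] k"] u by simp
  then show ?thesis using u N.rcos_module[OF is_group, of "v [^] k" "u [^] k"] by simp
qed

text \<open>In a 2-group an odd power generates the same cyclic group; Bezout's identity provides
  the inverse exponent.\<close>

lemma odd_pow_mem:
  assumes ord: "order G = 2 ^ m" and H: "subgroup H G" and x: "x \<in> carrier G"
    and k: "odd (k::int)" "x [^] k \<in> H"
  shows "x \<in> H"
proof -
  have "coprime k (2 ^ m)" using k(1) by (simp add: coprime_right_2_iff_odd)
  then obtain u v where uv: "u * k + v * 2 ^ m = 1" using bezout_int[of k "2 ^ m"] by auto
  have "x [^] (int (2 ^ m)) = \<one>" using two_group_pow[OF ord x] int_pow_int[of G x "2 ^ m"] by simp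
  then have e: "x [^] (v * 2 ^ m) = \<one>" using x int_pow_pow[of x "2 ^ m" v] by (simp add: mult.commute)
  have "x = x [^] (u * k + v * 2 ^ m)" using uv x by simp
  also have "\<dots> = x [^] (u * k)" using x e by (simp add: int_pow_mult)
  also have "\<dots> = (x [^] k) [^] u" using x by (simp add: int_pow_pow mult.commute)
  finally show ?thesis using subgroup_int_pow_closed[OF H k(2), of u] by simp
qed

text \<open>The fibres are counted directly, since \<open>f\<close> is multiplicative only on
  \<open>H\<close>. The intended maps send \<open>p\<close> in a subgroup of \<open>D\<close> to
  \<open>cm c' p\<close>.\<close>

lemma card_kernel_image:
  assumes H: "subgroup H G" "finite H" and f: "\<And>x y. x \<in> H \<Longrightarrow> y \<in> H \<Longrightarrow> f (x \<otimes> y) = f x \<otimes> f y"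
    and fc: "\<And>x. x \<in> H \<Longrightarrow> f x \<in> carrier G"
  shows "card H = card {x \<in> H. f x = \<one>} * card (f ` H)"
proof -
  interpret H: subgroup H G by (rule H)
  have one: "f \<one> = \<one>" using f[of \<one> \<one>] fc[of \<one>] by (simp add: l_cancel_one[symmetric])
  have inv: "f (inv x) = inv (f x)" if "x \<in> H" for x
    using f[of "inv x" x] that fc one inv_equality[of "f (inv x)" "f x"] by simp
  have fib: "card {x \<in> H. f x = y} = card {x \<in> H. f x = \<one>}" if y: "y \<in> f ` H" for y
  proof -
    obtain w where w: "w \<in> H" "y = f w" using y by (rule imageE)
    have "bij_betw (\<lambda>x. w \<otimes> x) {x \<in> H. f x = \<one>} {x \<in> H. f x = y}"
    proof (rule bij_betw_byWitness[where f' = "\<lambda>x. inv w \<otimes> x"])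
      show "(\<lambda>x. w \<otimes> x) ` {x \<in> H. f x = \<one>} \<subseteq> {x \<in> H. f x = y}"
        using w fc[OF w(1)] by (intro image_subsetI) (simp add: f)
      show "(\<lambda>x. inv w \<otimes> x) ` {x \<in> H. f x = y} \<subseteq> {x \<in> H. f x = \<one>}"
        using w fc[OF w(1)] by (intro image_subsetI) (simp add: f inv)
    qed (use w in \<open>simp_all add: cancel_left_inv\<close>)
    then show ?thesis by (simp add: bij_betw_same_card)
  qed
  have "card H = (\<Sum>y\<in>f ` H. card {x \<in> H. f x = y})"
    using sum.image_gen[OF H(2), of "\<lambda>_. 1::nat" f] by simp
  also have "\<dots> = card {x \<in> H. f x = \<one>} * card (f ` H)" using fib by simp
  finally show ?thesis .
qed

end

section \<open>Images of commutator maps and powers modulo the squares of \<open>D\<close>\<close>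

context noncyclic_derived
begin

lemma cm_M_D: assumes "g \<in> M" "p \<in> D" shows "cm g p \<in> D2"
proof (cases "g \<in> Ph")
  case True then show ?thesis using cm_Ph_D[OF True assms(2)] L2_D2 by (simp add: subset_iff)
next
  case False
  then have "cm g p \<otimes> (p \<otimes> p) \<in> D2" using cm_out_D[of g p] assms L2_D2 by (simp add: subset_iff)
  then have "cm g p \<otimes> (p \<otimes> p) \<otimes> inv (p \<otimes> p) \<in> D2"
    by (rule D2.m_closed[OF _ D2.m_inv_closed[OF D2I[OF assms(2)]]])
  then show ?thesis using assms by (simp add: m_assoc)
qed

text \<open>The product of \<open>L\<close> and \<open>D2\<close>, the subgroup of index two in
  \<open>D\<close> that contains all commutators of \<open>Ph\<close> with \<open>M\<close>.\<close>

definition K where "K = {l [^] (j::int) \<otimes> d |j d. d \<in> D2}"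

lemma K_D: "K \<subseteq> D" using D2_D by (auto simp: K_def D_pow subset_iff)

lemma D2_K: "D2 \<subseteq> K"
proof
  fix d assume "d \<in> D2"
  then have "d = l [^] (0::int) \<otimes> d" by simp
  then show "d \<in> K" unfolding K_def using \<open>d \<in> D2\<close> by blast
qed

lemma L_K: "L \<subseteq> K"
proof
  fix x assume "x \<in> L"
  then obtain k where "x = l [^] (k::int) \<otimes> \<one>" by (auto simp: L_def)
  then show "x \<in> K" unfolding K_def using D2.one_closed by blast
qed

lemma K_sub: "subgroup K G"
proof
  show "K \<subseteq> carrier G" using K_D by (auto simp: subset_iff)
  show "\<one> \<in> K" using D2_K by (simp add: subset_iff)
  fix u assume "u \<in> K"
  then obtain j d where u: "u = l [^] (j::int) \<otimes> d" "d \<in> D2" by (auto simp: K_def)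
  have dD: "d \<in> D" using u D2_D by (simp add: subset_iff)
  have "inv u = l [^] (-j) \<otimes> inv d" using u dD by (simp add: inv_mult_group int_pow_neg D_comm D_pow)
  then show "inv u \<in> K" unfolding K_def using u by blast
  fix v assume "v \<in> K"
  then obtain k e where v: "v = l [^] (k::int) \<otimes> e" "e \<in> D2" by (auto simp: K_def)
  have eD: "e \<in> D" using v D2_D by (simp add: subset_iff)
  have "u \<otimes> v = l [^] (j + k) \<otimes> (d \<otimes> e)" using u v dD eD by (simp add: int_pow_mult D_ac D_pow)
  moreover have "d \<otimes> e \<in> D2" using u v by simp
  ultimately show "u \<otimes> v \<in> K" unfolding K_def by blast
qed

lemma K_normal: "K \<lhd> G"
  unfolding normal_cj
proof (intro conjI ballI K_sub)
  fix g u assume g: "g \<in> carrier G" and "u \<in> K"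
  then obtain j d where u: "u = l [^] (j::int) \<otimes> d" "d \<in> D2" by (auto simp: K_def)
  have "cj g d \<in> K" using D2_normal u g D2_K by (simp add: normal_cj subset_iff)
  moreover have "cj g (l [^] j) \<in> K"
    using cj_L[OF g subgroup_int_pow_closed[OF L_subgroup lL]] L_K by (simp add: subset_iff)
  moreover have "cj g u = cj g (l [^] j) \<otimes> cj g d" using g u by (simp add: cj_mult)
  ultimately show "cj g u \<in> K" using subgroup.m_closed[OF K_sub] by simp
qed

lemma K_mult: assumes "u \<in> K" "v \<in> K" "u \<notin> D2" "v \<notin> D2" shows "inv u \<otimes> v \<in> D2"
proof -
  obtain j d where u: "u = l [^] (j::int) \<otimes> d" "d \<in> D2" using assms by (auto simp: K_def)
  obtain k e where v: "v = l [^] (k::int) \<otimes> e" "e \<in> D2" using assms by (auto simp: K_def)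
  have dD: "d \<in> D" "e \<in> D" using u v D2_D by (simp_all add: subset_iff)
  have "odd j" "odd k" using assms u v even_pow_D2[OF lD] by auto
  then have "l [^] (k - j) \<in> D2" using even_pow_D2[OF lD] by simp
  moreover have "inv u \<otimes> v = l [^] (k - j) \<otimes> (inv d \<otimes> e)"
    using u v dD by (simp add: int_pow_diff inv_mult_group D_ac D_pow)
  ultimately show ?thesis using u v by simp
qed

lemma cm_aa_c: "cm (a \<otimes> a) c = l \<otimes> (z \<otimes> z)"
  by (simp add: mult_cm cj_cm[of a z] l_def[symmetric] m_assoc flip: z_def)

lemma l_D2_out: assumes "d \<in> D2" shows "l \<otimes> d \<notin> D2"
proof
  assume "l \<otimes> d \<in> D2"
  then have "l \<otimes> d \<otimes> inv d \<in> D2" using assms by blast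
  then show False using l_not_D2[of 1] assms by (simp add: m_assoc)
qed

lemma cm_Ph_c: assumes "x \<in> Ph" shows "cm x c \<in> K"
proof -
  have "Ph \<subseteq> {x \<in> carrier G. \<forall>p\<in>{c}. cm x p \<in> K}"
  proof (rule cyc_least[OF subgroup_cm_into[OF K_normal]])
    have "l \<in> K" "z \<otimes> z \<in> K" using L_K D2_K D2I[OF zD] lL by (simp_all add: subset_iff)
    then show "a \<otimes> a \<in> {x \<in> carrier G. \<forall>p\<in>{c}. cm x p \<in> K}"
      using subgroup.m_closed[OF K_sub] by (simp add: cm_aa_c)
    show "D \<subseteq> {x \<in> carrier G. \<forall>p\<in>{c}. cm x p \<in> K}"
    proof (clarsimp)
      fix p assume "p \<in> D"
      then show "cm p c \<in> K" using cm_c[of p] D2_K by (intro cm_flip[OF K_sub cG]) (auto simp: subset_iff)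
    qed
  qed simp
  then show ?thesis using assms by (simp add: subset_iff)
qed

text \<open>An element \<open>g\<close> of \<open>M\<close> outside \<open>Ph\<close> is
  \<open>c\<close> times an element of \<open>Ph\<close>, and commutators inside \<open>Ph\<close>
  are in \<open>L2\<close>. So modulo \<open>D2\<close> any such \<open>g\<close> is as good as
  \<open>c\<close>.\<close>

lemma cm_Ph_out: assumes "x \<in> Ph" "g \<in> M - Ph"
  shows "cm x g \<in> K" "cm x g \<in> D2 \<longleftrightarrow> cm x c \<in> D2"
proof -
  obtain y where y: "y \<in> Ph" "g = c \<otimes> y" using M_out[OF assms(2)] by (rule bexE)
  have eq: "cm x g = cm x c \<otimes> cj c (cm x y)" using assms y by (simp add: cm_mult)
  have d: "cj c (cm x y) \<in> D2" using cm_Ph[OF assms(1) y(1)] L2_D2 D2_normal by (simp add: normal_cj subset_iff)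
  show "cm x g \<in> K" unfolding eq using d D2_K cm_Ph_c[OF assms(1)] subgroup.m_closed[OF K_sub] by (simp add: subset_iff)
  have "cm x c = cm x g \<otimes> inv (cj c (cm x y))" unfolding eq using assms y by (simp add: m_assoc)
  then show "cm x g \<in> D2 \<longleftrightarrow> cm x c \<in> D2" using eq d by (metis D2.m_closed D2.m_inv_closed)
qed

lemma cm_mult_D_out: assumes "h \<in> Ph" "e \<in> D" "g \<in> M - Ph" "cm h g \<notin> D2" shows "cm (h \<otimes> e) g \<notin> D2"
proof
  have gG: "g \<in> carrier G" using assms by simp
  assume "cm (h \<otimes> e) g \<in> D2"
  then have "cj h (cm e g) \<otimes> cm h g \<in> D2" using assms gG by (simp add: mult_cm)
  moreover have "cj h (cm e g) \<in> D2"
  proof -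
    have "cm e g \<in> D2" using cm_M_D[of g e] assms by (intro cm_flip[OF D2_subgroup gG]) auto
    then show ?thesis using D2_normal assms by (simp add: normal_cj)
  qed
  ultimately have "inv (cj h (cm e g)) \<otimes> (cj h (cm e g) \<otimes> cm h g) \<in> D2" by blast
  then show False using assms gG by (simp add: cancel_left_inv)
qed

lemma L2_powers: "L2 \<subseteq> H" if "subgroup H G" "l \<otimes> l \<in> H" for H
proof
  fix x assume "x \<in> L2"
  then obtain k where "x = l [^] (2 * k::int)" by (auto simp: L2_def)
  moreover have "l \<otimes> l = l [^] (2::int)" using int_pow_mult[of l 1 1] by simp
  ultimately have "x = (l \<otimes> l) [^] k" by (simp add: int_pow_pow)
  then show "x \<in> H" using subgroup_int_pow_closed[OF that] by simp
qed

text \<open>By \<open>cm_out_L\<close> the commutator is \<open>l^(4k-2)\<close>, an odd power of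
  \<open>l \<otimes> l\<close>.\<close>

lemma cm_out_gen_L2: assumes "g \<in> M - Ph" "subgroup H G" "cm g l \<in> H" shows "l \<otimes> l \<in> H"
proof -
  have e: "l \<otimes> l = l [^] (2::int)" using int_pow_mult[of l 1 1] by simp
  obtain k where k: "cm g l \<otimes> (l \<otimes> l) = l [^] (4 * k::int)" using cm_out_L[OF assms(1) lL] by (auto simp: L4_def)
  have "cm g l = l [^] (4 * k) \<otimes> inv (l \<otimes> l)" using k assms(1) by (simp add: inv_solve_right)
  also have "\<dots> = l [^] (4 * k - 2)" by (simp add: e int_pow_diff)
  also have "\<dots> = (l \<otimes> l) [^] (2 * k - 1)" by (simp add: e int_pow_pow algebra_simps)
  finally have "(l \<otimes> l) [^] (2 * k - 1) \<in> H" using assms(3) by simp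
  then show ?thesis using odd_pow_mem[OF ord assms(2), of "l \<otimes> l" "2 * k - 1"] by simp
qed

lemma D2_gen: assumes "subgroup H G" "l \<otimes> l \<in> H" "z \<otimes> z \<in> H" shows "D2 \<subseteq> H"
proof
  fix x assume "x \<in> D2"
  then obtain q where q: "q \<in> D" "x = q \<otimes> q" by (auto simp: D2_def)
  then obtain i j where ij: "q = z [^] (i::int) \<otimes> l [^] (j::int)" using D_zl by blast
  have "x = (z \<otimes> z) [^] i \<otimes> (l \<otimes> l) [^] j" unfolding q(2) ij by (simp add: pow_mult_D D_ac D_pow)
  then show "x \<in> H" using subgroup_int_pow_closed[OF assms(1)] assms subgroup.m_closed[OF assms(1)] by simp
qed

text \<open>On \<open>D\<close> the map \<open>cm g\<close> is a homomorphism. Its image contains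
  \<open>l \<otimes> l\<close>, hence \<open>L2\<close>, and then \<open>z \<otimes> z\<close>,
  because \<open>g\<close> inverts \<open>z\<close> modulo \<open>L2\<close>.\<close>

lemma cm_out_onto_D2: assumes g: "g \<in> M - Ph" and s: "s \<in> D2" shows "\<exists>p\<in>D. cm g p = s"
proof -
  have gG: "g \<in> carrier G" using g by simp
  let ?H = "{cm g p |p. p \<in> D}"
  have H: "subgroup ?H G"
  proof
    show "?H \<subseteq> carrier G" using gG by auto
    show "\<one> \<in> ?H" using gG by (auto intro!: exI[of _ \<one>])
    fix u assume "u \<in> ?H"
    then obtain p where p: "p \<in> D" "u = cm g p" by auto
    have "inv u = cm g (inv p)" using p gG by (simp add: cm_D_inv)
    then show "inv u \<in> ?H" using p by blast
    fix v assume "v \<in> ?H"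
    then obtain q where q: "q \<in> D" "v = cm g q" by auto
    have "u \<otimes> v = cm g (p \<otimes> q)" using p q gG by (simp add: cm_D_mult)
    then show "u \<otimes> v \<in> ?H" using p q by blast
  qed
  have ll: "l \<otimes> l \<in> ?H" using lD by (intro cm_out_gen_L2[OF g H]) blast
  have 1: "inv (cm g z) \<otimes> (cm g z \<otimes> (z \<otimes> z)) = z \<otimes> z" using gG by (simp add: cancel_left_inv)
  have 2: "cm g z \<otimes> (z \<otimes> z) \<in> ?H" using L2_powers[OF H ll] cm_out_D[OF g zD] by (rule subsetD)
  have "inv (cm g z) \<in> ?H" using zD by (intro subgroup.m_inv_closed[OF H]) blast
  from subgroup.m_closed[OF H this 2] have "z \<otimes> z \<in> ?H" unfolding 1 .
  then show ?thesis using D2_gen[OF H ll] s by blast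
qed

text \<open>Elements of \<open>D\<close> already produce all of \<open>D2\<close>; the square of
  \<open>a\<close>, whose commutator with \<open>g\<close> lies outside \<open>D2\<close>, reaches
  the other coset.\<close>

lemma cm_Ph_onto_K: assumes g: "g \<in> M - Ph" and s: "s \<in> K" shows "\<exists>x\<in>Ph. cm x g = s"
proof -
  have gG: "g \<in> carrier G" using g by simp
  have D2_case: "\<exists>p\<in>D. cm p g = d" if "d \<in> D2" for d
  proof -
    obtain p where "p \<in> D" "cm g p = inv d" using cm_out_onto_D2[OF g, of "inv d"] \<open>d \<in> D2\<close> by auto
    then have "cm p g = d" using inv_cm[of g p] gG \<open>d \<in> D2\<close> by simp
    then show ?thesis using \<open>p \<in> D\<close> by blast
  qed
  show ?thesis
  proof (cases "s \<in> D2")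
    case True
    obtain p where "p \<in> D" "cm p g = s" using D2_case[OF True] by (rule bexE)
    then show ?thesis using D_Ph by (intro bexI[of _ p]) (simp_all add: subset_iff)
  next
    case False
    have aP: "a \<otimes> a \<in> Ph" by (simp add: cyc_self)
    let ?u = "cm (a \<otimes> a) g"
    have u: "?u \<in> K" "?u \<notin> D2" using cm_Ph_out[OF aP g] l_D2_out[OF D2I[OF zD]] by (simp_all add: cm_aa_c)
    have uD: "?u \<in> D" "s \<in> D" using u s K_D by (simp_all add: subset_iff)
    obtain p where p: "p \<in> D" "cm p g = inv ?u \<otimes> s" using D2_case[OF K_mult[OF u(1) s u(2) False]] by (rule bexE)
    have "cm (p \<otimes> (a \<otimes> a)) g = ?u \<otimes> (inv ?u \<otimes> s)"
      using p gG uD by (simp add: mult_cm[of p "a \<otimes> a" g])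
    also have "\<dots> = s" using uD gG by (simp add: cancel_left_inv)
    finally show ?thesis using Ph.m_closed[OF _ aP, of p] p(1) D_Ph by (auto simp: subset_iff)
  qed
qed

lemma cm_a_out_K: assumes "p \<in> D" "p \<notin> K" shows "\<exists>k. odd k \<and> cm a p = l [^] (k::int)"
proof -
  obtain i j where ij: "p = z [^] (i::int) \<otimes> l [^] (j::int)" using D_zl[OF assms(1)] by blast
  have "odd i"
  proof
    assume "even i"
    then have "z [^] i \<in> K" using even_pow_D2[OF zD] D2_K by (simp add: subset_iff)
    moreover have "l [^] j \<in> K" using L_K by (auto simp: L_def)
    ultimately show False using assms(2) subgroup.m_closed[OF K_sub] ij by simp
  qed
  obtain t where t: "cm a l = l [^] (2 * t::int)" using cm_a_l by (auto simp: L2_def)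
  have "cm a p = l [^] (i + 2 * (t * j))"
    unfolding ij by (simp add: cm_D_mult D_pow cm_a_z cm_D_pow t int_pow_mult int_pow_pow mult.assoc)
  then show ?thesis using \<open>odd i\<close> by (intro exI[of _ "i + 2 * (t * j)"]) simp
qed

text \<open>The cosets of \<open>D2\<close> by the identity, \<open>l\<close> and \<open>z\<close>
  are disjoint. In \<open>case_M_noL\<close> the factor three is compared with the two cosets that
  make up the cyclic group of \<open>e\<close>.\<close>

lemma card_D: "3 * card D2 \<le> card D"
proof -
  have finD: "finite D" using fin D.subset by (rule rev_finite_subset)
  have finD2: "finite D2" using finD D2_D by (rule rev_finite_subset)
  have cc: "card ((\<lambda>d. x \<otimes> d) ` D2) = card D2" if "x \<in> carrier G" for x
    using that by (intro card_image) (auto simp: inj_on_def)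
  let ?A = "(\<lambda>d. l \<otimes> d) ` D2" and ?B = "(\<lambda>d. z \<otimes> d) ` D2"
  have dc: "d \<in> D" if "d \<in> D2" for d using that D2_D by (simp add: subset_iff)
  have "D2 \<inter> ?A = {}" using l_D2_out by auto
  moreover have "(D2 \<union> ?A) \<inter> ?B = {}"
  proof -
    have "z \<otimes> d \<notin> D2 \<union> ?A" if d: "d \<in> D2" for d
    proof
      assume "z \<otimes> d \<in> D2 \<union> ?A"
      then consider "z \<otimes> d \<in> D2" | e where "e \<in> D2" "z \<otimes> d = l \<otimes> e" by blast
      then show False
      proof cases
        case 1
        then have "z \<otimes> d \<otimes> inv d \<in> D2" using d by blast
        then show False using D_indep[of 1 0] d by (simp add: m_assoc flip: z_def l_def)
      next
        case 2
        have zz: "z = l \<otimes> e \<otimes> inv d" using 2 d dc by (metis inv_solve_right DcG zG lG m_closed)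
        have "z \<otimes> inv l = e \<otimes> inv d"
          unfolding zz using d 2(1) dc by (simp add: D_ac cancel_left_inv)
        then have "z \<otimes> inv l \<in> D2" using d 2(1) by simp
        moreover have "l [^] (-1::int) = inv l" using int_pow_neg[of l 1] by simp
        ultimately have "z [^] (1::int) \<otimes> l [^] (-1::int) \<in> D2" by simp
        then show False using D_indep[of 1 "-1"] by (simp flip: z_def l_def)
      qed
    qed
    then show ?thesis by (simp only: disjoint_iff) (metis imageE)
  qed
  ultimately have "card (D2 \<union> ?A \<union> ?B) = card D2 + card D2 + card D2"
    using finD2 by (simp add: card_Un_disjoint cc)
  moreover have "D2 \<union> ?A \<union> ?B \<subseteq> D" using dc by auto
  then have "card (D2 \<union> ?A \<union> ?B) \<le> card D" using finD by (simp add: card_mono)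
  ultimately show ?thesis by simp
qed

text \<open>With \<open>r\<close> the quotient of the two squares, the quotient of the fourth powers
  is \<open>r \<otimes> cj (y \<otimes> y) r\<close>. This is the square of \<open>r\<close> modulo
  \<open>L2\<close>, as \<open>Ph\<close> centralizes \<open>D\<close> modulo
  \<open>L2\<close>.\<close>

lemma fourth_pow:
  assumes x: "x \<in> carrier G" "y \<in> carrier G" "x \<otimes> x \<otimes> inv (y \<otimes> y) \<in> D" and y: "y \<otimes> y \<in> Ph" and k: "4 dvd k"
  shows "x [^] (k::int) \<otimes> inv (y [^] k) \<in> D2"
proof -
  define r where "r = x \<otimes> x \<otimes> inv (y \<otimes> y)"
  have r: "r \<in> D" "x \<otimes> x = r \<otimes> (y \<otimes> y)" using x by (simp_all add: r_def m_assoc)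
  have p4: "u [^] (4::int) = u \<otimes> u \<otimes> (u \<otimes> u)" if "u \<in> carrier G" for u
    using int_pow_mult[OF that, of 2 2] int_pow_mult[OF that, of 1 1] that by simp
  have "x [^] (4::int) \<otimes> inv (y [^] (4::int)) = r \<otimes> (y \<otimes> y) \<otimes> (r \<otimes> (y \<otimes> y)) \<otimes> inv (y \<otimes> y \<otimes> (y \<otimes> y))"
    using x r by (simp add: p4)
  also have "\<dots> = r \<otimes> cj (y \<otimes> y) r" using x r(1) by (simp add: word_simps)
  also have "\<dots> = cm (y \<otimes> y) r \<otimes> (r \<otimes> r)" using x r(1) by (simp add: cj_cm[of "y \<otimes> y" r] D_ac cm_D)
  also have "\<dots> \<in> D2" using cm_Ph_D[OF y r(1)] L2_D2 D2I[OF r(1)] by (simp add: subset_iff)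
  finally have "(x [^] (4::int)) [^] (k div 4) \<otimes> inv ((y [^] (4::int)) [^] (k div 4)) \<in> D2"
    using coset_pow[OF D2_normal, of "x [^] (4::int)" "y [^] (4::int)"] x by simp
  then show ?thesis using x k by (simp add: int_pow_pow)
qed

lemma four_dvd_top: "(4::int) dvd 2 ^ n"
  using n2 le_imp_power_dvd[of 2 n "2::int"] by simp

lemma aa_pow: "(a \<otimes> a) [^] (k::int) = a [^] (2 * k)"
proof -
  have "a \<otimes> a = a [^] (2::int)" using int_pow_mult[of a 1 1] by simp
  then show ?thesis by (simp add: int_pow_pow)
qed

lemma even_pow_Ph: "p \<in> D \<Longrightarrow> even k \<Longrightarrow> a [^] (k::int) \<otimes> p \<in> Ph"
  unfolding cyc_def aa_pow by (auto elim!: evenE)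

text \<open>Such an \<open>x\<close> is an odd power of \<open>a\<close> times an element of
  \<open>D\<close>. By \<open>fourth_pow\<close>, applicable because \<open>n \<ge> 2\<close>, the
  factor from \<open>D\<close> changes the power only by squares, and an odd power of
  \<open>l\<close> is \<open>l\<close> modulo squares.\<close>

lemma M1_out_pow: assumes "x \<in> M1 - Ph" shows "\<exists>d\<in>D2. x [^] ((2::int) ^ n) = l \<otimes> d"
proof -
  obtain k p where x: "x = a [^] (k::int) \<otimes> p" "p \<in> D" using assms by (auto simp: cyc_def)
  have k: "odd k" using assms x even_pow_Ph by blast
  let ?y = "a [^] k"
  have yy: "?y \<otimes> ?y = a [^] (2 * k)" by (simp flip: int_pow_mult mult_2)
  have "x \<otimes> x \<otimes> inv (?y \<otimes> ?y) = cj ?y p \<otimes> cj (?y \<otimes> ?y) p" using x by (simp add: word_simps)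
  then have "x \<otimes> x \<otimes> inv (?y \<otimes> ?y) \<in> D" using x by simp
  moreover have "?y \<otimes> ?y \<in> Ph" using even_pow_Ph[of \<one> "2 * k"] by (simp add: yy)
  ultimately have 1: "x [^] ((2::int) ^ n) \<otimes> inv (?y [^] ((2::int) ^ n)) \<in> D2"
    using x by (intro fourth_pow four_dvd_top) auto
  obtain d where d: "d \<in> D2" "a [^] ((2::int) ^ n) = l \<otimes> d" using a_top by (auto simp flip: z_def l_def)
  have dD: "d \<in> D" using d D2_D by (simp add: subset_iff)
  have "?y [^] ((2::int) ^ n) = (a [^] ((2::int) ^ n)) [^] k" by (simp add: int_pow_pow mult.commute)
  also have "\<dots> = l [^] k \<otimes> d [^] k" using d(2) dD by (simp add: pow_mult_D)
  also have "l [^] k = l \<otimes> l [^] (k - 1)" using int_pow_mult[of l 1 "k - 1"] by simp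
  finally have 2: "?y [^] ((2::int) ^ n) = l \<otimes> (l [^] (k - 1) \<otimes> d [^] k)" using dD by (simp add: m_assoc)
  let ?e = "l [^] (k - 1) \<otimes> d [^] k"
  have e: "?e \<in> D2" using even_pow_D2[OF lD, of "k - 1"] k subgroup_int_pow_closed[OF D2_subgroup d(1)] by simp
  let ?f = "x [^] ((2::int) ^ n) \<otimes> inv (?y [^] ((2::int) ^ n))"
  have fD: "?f \<in> D" using 1 D2_D by (simp add: subset_iff)
  have eD: "?e \<in> D" using e D2_D by (simp add: subset_iff)
  have xG: "x \<in> carrier G" using x by simp
  have "x [^] ((2::int) ^ n) = ?f \<otimes> ?y [^] ((2::int) ^ n)" using xG by (simp add: m_assoc)
  also have "\<dots> = ?f \<otimes> (l \<otimes> ?e)" by (simp only: 2)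
  also have "\<dots> = l \<otimes> (?f \<otimes> ?e)" using fD eD by (simp add: D_lcomm)
  finally have "x [^] ((2::int) ^ n) = l \<otimes> (?f \<otimes> ?e)" .
  then show ?thesis using 1 e by blast
qed

text \<open>If \<open>x\<close> involves \<open>a^k\<close>, then \<open>2^n\<close> divides
  \<open>2k\<close>, and \<open>n \<ge> 2\<close> makes \<open>k\<close> even.\<close>

lemma M1_sq_D: assumes "x \<in> M1" "x \<otimes> x \<in> D" shows "x \<in> Ph"
proof -
  obtain k p where x: "x = a [^] (k::int) \<otimes> p" "p \<in> D" using assms by (auto simp: cyc_def)
  let ?y = "a [^] k"
  have yy: "?y \<otimes> ?y = a [^] (2 * k)" by (simp flip: int_pow_mult mult_2)
  have "x \<otimes> x = cj ?y p \<otimes> cj (?y \<otimes> ?y) p \<otimes> (?y \<otimes> ?y)" using x by (simp add: word_simps)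
  then have "a [^] (2 * k) = inv (cj ?y p \<otimes> cj (?y \<otimes> ?y) p) \<otimes> (x \<otimes> x)"
    using x yy by (simp add: inv_solve_left)
  then have "a [^] (2 * k) \<in> D" using assms x by simp
  then have "2 ^ n dvd 2 * k" using a_pow by simp
  then have "4 dvd 2 * k" using four_dvd_top by (rule dvd_trans[rotated])
  then have "even k" by presburger
  then show ?thesis using x even_pow_Ph by simp
qed

text \<open>Replacing \<open>a\<close> by \<open>b = c \<otimes> a\<close> changes neither the
  square modulo \<open>D\<close> nor \<open>z\<close> and \<open>l\<close> modulo \<open>D2\<close>;
  by \<open>fourth_pow\<close> the relation \<open>a_top\<close> survives as well.\<close>

lemma swap_noncyclic_derived: "noncyclic_derived G D m (c \<otimes> a) c n"
proof -
  define b where "b = c \<otimes> a"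
  have bG [simp]: "b \<in> carrier G" by (simp add: b_def)
  have bb: "b \<otimes> b \<otimes> inv (a \<otimes> a) \<in> D"
  proof -
    have "b \<otimes> b \<otimes> inv (a \<otimes> a) = cj c z \<otimes> (c \<otimes> c)" by (simp add: b_def z_def word_simps)
    then show ?thesis using c_sq by simp
  qed
  have aP: "a \<otimes> a \<in> Ph" by (simp add: cyc_self)
  have bbP: "b \<otimes> b \<in> Ph"
  proof -
    have "b \<otimes> b = b \<otimes> b \<otimes> inv (a \<otimes> a) \<otimes> (a \<otimes> a)" by (simp add: m_assoc)
    then show ?thesis using bb D_Ph aP Ph.m_closed by (metis subsetD)
  qed
  have bM: "b \<notin> M"
  proof
    assume "b \<in> M"
    then have "inv c \<otimes> b \<in> M" using cM by blast
    then show False using a_not_M by (simp add: b_def cancel_left_inv)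
  qed
  have b_even: "b [^] (2 * k::int) \<in> Ph" for k
  proof -
    have "b \<otimes> b = b [^] (2::int)" using int_pow_mult[of b 1 1] by simp
    then have "b [^] (2 * k) = (b \<otimes> b) [^] k" by (simp add: int_pow_pow)
    then show ?thesis using subgroup_int_pow_closed[OF Ph_sub bbP] by simp
  qed
  have b_odd: "b [^] (k::int) \<notin> M" if "odd k" for k
  proof
    assume k: "b [^] k \<in> M"
    obtain j where "k = 2 * j + 1" using \<open>odd k\<close> by (rule oddE)
    then have "b = inv (b [^] (2 * j)) \<otimes> b [^] k" by (simp add: int_pow_mult cancel_left_inv)
    moreover have "inv (b [^] (2 * j)) \<in> M" using b_even Ph_M by blast
    ultimately show False using k bM M.m_closed by metis
  qed
  have b_pow: "b [^] (2 * k::int) \<otimes> inv (a [^] (2 * k)) \<in> D" for k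
  proof -
    have "b \<otimes> b = b [^] (2::int)" using int_pow_mult[of b 1 1] by simp
    then have "b [^] (2 * k) = (b \<otimes> b) [^] k" by (simp add: int_pow_pow)
    then show ?thesis using coset_pow[OF D _ _ bb, of k] by (simp add: aa_pow)
  qed
  \<comment> \<open>The new \<open>z\<close> and \<open>l\<close>. They differ from the old ones by
    elements of \<open>D2\<close>, because \<open>c\<close> centralizes \<open>D\<close> modulo
    squares.\<close>
  define zb where "zb = cm b c"
  define lb where "lb = cm b zb"
  have zb: "zb = cm c z \<otimes> z" by (simp add: zb_def b_def mult_cm cj_cm[of c z] flip: z_def)
  have dz: "cm c z \<in> D2" by (simp add: cm_c)
  have zbD: "zb \<in> D" "lb \<in> D" by (simp_all add: zb_def lb_def cm_D)
  have lb: "\<exists>d\<in>D2. lb = d \<otimes> l"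
  proof -
    have dzD: "cm c z \<in> D" by (simp add: cm_D)
    let ?w = "cm a zb"
    have w: "?w = cm a (cm c z) \<otimes> l" using dzD by (simp add: zb cm_D_mult flip: l_def)
    have wD: "?w \<in> D" "cm a (cm c z) \<in> D" using zbD by (simp_all add: cm_D DcG)
    have "lb = cj c ?w \<otimes> cm c zb" using zbD by (simp add: lb_def b_def mult_cm)
    also have "cj c ?w = cm c ?w \<otimes> (cm a (cm c z) \<otimes> l)" using wD by (simp add: cj_cm[of c ?w] flip: w)
    also have "\<dots> \<otimes> cm c zb = (cm c ?w \<otimes> cm a (cm c z) \<otimes> cm c zb) \<otimes> l"
      using wD zbD by (simp add: D_ac cm_D)
    finally have "lb = (cm c ?w \<otimes> cm a (cm c z) \<otimes> cm c zb) \<otimes> l" .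
    moreover have "cm c ?w \<in> D2" "cm c zb \<in> D2" using wD zbD by (simp_all add: cm_c)
    moreover have "cm a (cm c z) \<in> D2" using cm_a_D2[OF dz] L2_D2 by (simp add: subset_iff)
    ultimately show ?thesis by (metis D2.m_closed)
  qed
  then obtain d where d: "d \<in> D2" "lb = d \<otimes> l" by blast
  have dD: "d \<in> D" "cm c z \<in> D" using d dz D2_D by (simp_all add: subset_iff)
  have pw: "zb [^] i \<otimes> lb [^] j = (cm c z [^] i \<otimes> d [^] j) \<otimes> (z [^] i \<otimes> l [^] j)" for i j :: int
    unfolding zb d(2) using dD by (simp add: pow_mult_D D_ac D_pow)
  have pd: "cm c z [^] i \<otimes> d [^] j \<in> D2" for i j :: int
    using dz d(1) subgroup_int_pow_closed[OF D2_subgroup] by simp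
  show ?thesis unfolding b_def[symmetric]
  proof (unfold_locales, goal_cases)
    case 1 show ?case by simp
  next
    case 2 show ?case by simp
  next
    case (3 g)
    let ?S = "cyc b \<union> (\<lambda>x. c \<otimes> x) ` cyc b"
    have S: "subgroup ?S G"
    proof (rule subgroup_extend_index_two[OF cyc_subgroup])
      show "cj c x \<in> cyc b" if "x \<in> cyc b" for x
        using above_D_normal[OF cyc_subgroup[OF bG] cyc_D[OF bG]] that by (simp add: normal_cj)
      show "c \<otimes> c \<in> cyc b" using c_sq cyc_D[OF bG] by (simp add: subset_iff)
      show "finite (cyc b)" using fin subgroup.subset[OF cyc_subgroup[OF bG]] by (rule rev_finite_subset)
    qed simp_all
    have "c \<otimes> \<one> \<in> ?S" using subgroup.one_closed[OF cyc_subgroup[OF bG]] by blast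
    then have cS: "c \<in> ?S" by simp
    moreover have "b \<in> ?S" using cyc_self[OF bG] by blast
    ultimately have "inv c \<otimes> b \<in> ?S" using S subgroup.m_closed subgroup.m_inv_closed by metis
    then have "a \<in> ?S" by (simp add: b_def cancel_left_inv)
    moreover have "D \<subseteq> ?S" using cyc_D[OF bG] by blast
    ultimately have "cyc a \<subseteq> ?S" by (rule cyc_least[OF S])
    then have "g \<in> ?S" using cS 3 by (rule gen_subgroup[OF S])
    then show ?case by blast
  next
    case 4
    show ?case
    proof
      assume "c \<in> cyc b"
      then obtain k p where kp: "c = b [^] (k::int) \<otimes> p" "p \<in> D" by (auto simp: cyc_def)
      show False
      proof (cases "even k")
        case True
        then have "b [^] k \<in> Ph" using b_even by (auto elim!: evenE)
        then have "c \<in> Ph" using kp D_Ph Ph.m_closed by (metis subsetD)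
        then show False using c_out Ph_M1 by blast
      next
        case False
        have "b [^] k = c \<otimes> inv p" using kp by (simp add: m_assoc)
        then have "b [^] k \<in> M" using cM kp(2) D_Ph Ph_M by auto
        then show False using b_odd False by blast
      qed
    qed
  next
    case 5 show ?case by (rule c_sq)
  next
    \<comment> \<open>For even exponents the powers of \<open>a\<close> and \<open>b\<close> agree
      modulo \<open>D\<close>. For odd exponents neither side holds: the power of \<open>b\<close>
      is outside \<open>M\<close>, and \<open>2^n\<close> is even.\<close>
    case (6 k)
    show ?case
    proof (cases "even k")
      case True
      then obtain j where j: "k = 2 * j" by (rule evenE)
      have 1: "b [^] k = b [^] k \<otimes> inv (a [^] k) \<otimes> a [^] k" by (simp add: m_assoc)
      have 2: "a [^] k = inv (b [^] k \<otimes> inv (a [^] k)) \<otimes> b [^] k" by (simp add: inv_mult_group m_assoc)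
      have 3: "b [^] k \<otimes> inv (a [^] k) \<in> D" using b_pow[of j] by (simp add: j)
      have "b [^] k \<in> D \<longleftrightarrow> a [^] k \<in> D"
        using 1 2 3 D.m_closed D.m_inv_closed by metis
      then show ?thesis using a_pow by simp
    next
      case False
      have "b [^] k \<notin> D" using b_odd[OF False] D_Ph Ph_M by blast
      moreover have "\<not> 2 ^ n dvd k" using False four_dvd_top by (meson dvd_trans even_numeral dvd_trans[OF _ four_dvd_top])
      ultimately show ?thesis by simp
    qed
  next
    case 7 show ?case by (rule n2)
  next
    case (8 p) then show ?case by (rule cm_c)
  next
    case 9
    have 1: "b [^] ((2::int) ^ n) \<otimes> inv (a [^] ((2::int) ^ n)) \<in> D2" (is "?f \<in> _")
      by (rule fourth_pow[OF _ _ bb aP four_dvd_top]) simp_all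
    obtain e where e: "e \<in> D2" "a [^] ((2::int) ^ n) = l \<otimes> e" using a_top by (auto simp flip: z_def l_def)
    have eD: "e \<in> D" "?f \<in> D" using e 1 D2_D by (simp_all add: subset_iff)
    have "b [^] ((2::int) ^ n) = ?f \<otimes> a [^] ((2::int) ^ n)" by (simp add: m_assoc)
    also have "\<dots> = ?f \<otimes> (l \<otimes> e)" by (simp only: e(2))
    also have "l = inv d \<otimes> lb" using d dD by (simp add: cancel_left_inv)
    also have "?f \<otimes> (inv d \<otimes> lb \<otimes> e) = lb \<otimes> (?f \<otimes> (inv d \<otimes> e))" using eD dD zbD by (simp add: D_ac)
    finally have "b [^] ((2::int) ^ n) = lb \<otimes> (?f \<otimes> (inv d \<otimes> e))" .
    moreover have "?f \<otimes> (inv d \<otimes> e) \<in> D2" using 1 e(1) d(1) by simp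
    ultimately show ?case unfolding zb_def[symmetric] lb_def[symmetric] by blast
  next
    case (10 p)
    obtain i j e where e: "e \<in> D2" "p = z [^] (i::int) \<otimes> l [^] (j::int) \<otimes> e"
      using D_gen[OF 10] by (auto simp flip: z_def l_def)
    let ?g = "cm c z [^] i \<otimes> d [^] j"
    have gD: "?g \<in> D" "e \<in> D" using pd[of i j] e(1) D2_D by (simp_all add: subset_iff)
    have "p = zb [^] i \<otimes> lb [^] j \<otimes> (inv ?g \<otimes> e)"
    proof -
      have "zb [^] i \<otimes> lb [^] j \<otimes> (inv ?g \<otimes> e) = (?g \<otimes> (z [^] i \<otimes> l [^] j)) \<otimes> (inv ?g \<otimes> e)" by (simp only: pw)
      also have "\<dots> = z [^] i \<otimes> l [^] j \<otimes> e"
        using gD D_pow[OF zD, of i] D_pow[OF lD, of j]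
        by (simp add: D_ac cancel_left_inv del: D_pow)
      finally show ?thesis using e(2) by simp
    qed
    moreover have "inv ?g \<otimes> e \<in> D2" using pd[of i j] e(1) by simp
    ultimately show ?case unfolding zb_def[symmetric] lb_def[symmetric] by blast
  next
    case (11 i j)
    then have "zb [^] i \<otimes> lb [^] j \<in> D2" by (simp add: zb_def lb_def)
    then have "inv (cm c z [^] i \<otimes> d [^] j) \<otimes> (zb [^] i \<otimes> lb [^] j) \<in> D2" using pd[of i j] by simp
    moreover have "inv (cm c z [^] i \<otimes> d [^] j) \<otimes> (zb [^] i \<otimes> lb [^] j) = z [^] i \<otimes> l [^] j"
      unfolding pw using pd[of i j] by (simp add: cancel_left_inv)
    ultimately show ?case using D_indep[of i j] by (simp flip: z_def l_def)
  qed
qed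

end

section \<open>Automizers\<close>

text \<open>What the local analysis keeps of a saturated fusion system. \<open>A\<close> stands for
  the automorphisms of \<open>Q\<close> in the system, \<open>A_index\<close> is the Sylow
  condition, and \<open>A_extend\<close> is the extension axiom merged with the induction
  hypothesis: an automorphism carrying the action of some \<open>g\<close> outside \<open>Q\<close>
  to that of \<open>h\<close> extends to a larger subgroup, where all morphisms are inner.\<close>

locale automizer = group +
  fixes m :: nat and Q :: "'a set" and A :: "('a \<Rightarrow> 'a) set" and r :: nat
  assumes ord: "order G = 2 ^ m" and Q_sub: "subgroup Q G"
    and A_Bij: "A \<subseteq> Bij Q"
    and A_mult: "\<alpha> \<in> A \<Longrightarrow> x \<in> Q \<Longrightarrow> y \<in> Q \<Longrightarrow> \<alpha> (x \<otimes> y) = \<alpha> x \<otimes> \<alpha> y"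
    and A_compose: "\<alpha> \<in> A \<Longrightarrow> \<beta> \<in> A \<Longrightarrow> compose Q \<alpha> \<beta> \<in> A"
    and A_inverse: "\<alpha> \<in> A \<Longrightarrow> restrict (inv_into Q \<alpha>) Q \<in> A"
    and A_cj: "g \<in> nzr Q \<Longrightarrow> restrict (cj g) Q \<in> A"
    and A_index: "card A = card ((\<lambda>g. restrict (cj g) Q) ` nzr Q) * r" "odd r"
    and A_extend: "\<alpha> \<in> A \<Longrightarrow> g \<in> nzr Q \<Longrightarrow> g \<notin> Q \<Longrightarrow> h \<in> nzr Q \<Longrightarrow> (\<And>x. x \<in> Q \<Longrightarrow> \<alpha> (cj g x) = cj h (\<alpha> x))
      \<Longrightarrow> \<alpha> \<in> (\<lambda>g. restrict (cj g) Q) ` nzr Q"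
begin

abbreviation "cjQ g \<equiv> restrict (cj g) Q"
text \<open>The automorphisms induced by the normalizer of \<open>Q\<close> in the 2-group. Calling
  an automorphism inner or outer refers to \<open>S\<close>, not to conjugation by elements of
  \<open>Q\<close>.\<close>

definition "S = cjQ ` nzr Q"

lemma A_extend_S: "\<alpha> \<in> A \<Longrightarrow> g \<in> nzr Q \<Longrightarrow> g \<notin> Q \<Longrightarrow> h \<in> nzr Q \<Longrightarrow> (\<And>x. x \<in> Q \<Longrightarrow> \<alpha> (cj g x) = cj h (\<alpha> x))
      \<Longrightarrow> \<alpha> \<in> S"
  unfolding S_def by (rule A_extend)

lemma finG: "finite (carrier G)"
  using ord by (metis order_gt_0_iff_finite zero_less_numeral zero_less_power)

sublocale Q: subgroup Q G by (rule Q_sub)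

lemma finQ: "finite Q" using finG Q.subset by (rule rev_finite_subset)

lemma nzQ: "subgroup (nzr Q) G" by (rule nzr_subgroup[OF Q.subset])

sublocale nz: subgroup "nzr Q" G by (rule nzQ)

lemma Q_nz: "Q \<subseteq> nzr Q" by (rule subgroup_nzr[OF Q_sub finQ])

lemma S_A: "S \<subseteq> A" using A_cj by (auto simp: S_def)

lemma S_iff: "\<alpha> \<in> A \<Longrightarrow> \<alpha> \<in> S \<longleftrightarrow> (\<exists>h\<in>nzr Q. \<forall>x\<in>Q. \<alpha> x = cj h x)"
proof
  assume "\<alpha> \<in> A" "\<exists>h\<in>nzr Q. \<forall>x\<in>Q. \<alpha> x = cj h x"
  then obtain h where h: "h \<in> nzr Q" "\<forall>x\<in>Q. \<alpha> x = cj h x" by blast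
  have "\<alpha> = cjQ h"
  proof (rule extensionalityI[of _ Q])
    show "\<alpha> \<in> extensional Q" using \<open>\<alpha> \<in> A\<close> A_Bij Bij_imp_extensional by (metis subsetD)
  qed (use h in auto)
  then show "\<alpha> \<in> S" using h by (auto simp: S_def)
qed (auto simp: S_def)

lemma S_D: assumes "\<alpha> \<in> S" obtains h where "h \<in> nzr Q" "\<forall>x\<in>Q. \<alpha> x = cj h x"
  using assms by (auto simp: S_def)

lemma A_closed [simp, intro]: "\<alpha> \<in> A \<Longrightarrow> x \<in> Q \<Longrightarrow> \<alpha> x \<in> Q"
  using A_Bij Bij_imp_funcset by (metis PiE subsetD)

lemma A_inj: "\<alpha> \<in> A \<Longrightarrow> x \<in> Q \<Longrightarrow> y \<in> Q \<Longrightarrow> \<alpha> x = \<alpha> y \<Longrightarrow> x = y"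
proof -
  assume "\<alpha> \<in> A" "x \<in> Q" "y \<in> Q" "\<alpha> x = \<alpha> y"
  moreover have "inj_on \<alpha> Q" using A_Bij \<open>\<alpha> \<in> A\<close> by (auto simp: Bij_def bij_betw_def subset_iff)
  ultimately show "x = y" by (simp add: inj_on_def)
qed

lemma A_image: "\<alpha> \<in> A \<Longrightarrow> \<alpha> ` Q = Q"
  using A_Bij by (auto simp: Bij_def bij_betw_def subset_iff)

definition "iv \<alpha> = restrict (inv_into Q \<alpha>) Q"

lemma iv_A [simp]: "\<alpha> \<in> A \<Longrightarrow> iv \<alpha> \<in> A" by (simp add: iv_def A_inverse)

lemma iv_left [simp]: assumes "\<alpha> \<in> A" "x \<in> Q" shows "iv \<alpha> (\<alpha> x) = x"
proof -
  have "inj_on \<alpha> Q" using A_Bij assms(1) by (auto simp: Bij_def bij_betw_def subset_iff)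
  then show ?thesis using assms by (simp add: iv_def inv_into_f_f)
qed

lemma iv_right [simp]: assumes "\<alpha> \<in> A" "x \<in> Q" shows "\<alpha> (iv \<alpha> x) = x"
  using assms A_image[OF assms(1)] by (simp add: iv_def f_inv_into_f)

lemma A_one: "\<alpha> \<in> A \<Longrightarrow> \<alpha> \<one> = \<one>"
proof -
  assume a: "\<alpha> \<in> A"
  have "\<alpha> \<one> \<otimes> \<alpha> \<one> = \<alpha> \<one>" using A_mult[OF a, of \<one> \<one>] by simp
  moreover have "\<alpha> \<one> \<in> carrier G" using a A_closed[OF a Q.one_closed] by simp
  ultimately show ?thesis by simp
qed

lemma A_inv: "\<alpha> \<in> A \<Longrightarrow> x \<in> Q \<Longrightarrow> \<alpha> (inv x) = inv (\<alpha> x)"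
proof -
  assume a: "\<alpha> \<in> A" "x \<in> Q"
  have "\<alpha> (inv x) \<otimes> \<alpha> x = \<one>" using A_mult[OF a(1), of "inv x" x] a A_one[OF a(1)] by simp
  moreover have "\<alpha> (inv x) \<in> carrier G" "\<alpha> x \<in> carrier G" using a A_closed[OF a(1)] by simp_all
  ultimately show ?thesis by (simp add: inv_equality)
qed

lemma A_cm: "\<alpha> \<in> A \<Longrightarrow> x \<in> Q \<Longrightarrow> y \<in> Q \<Longrightarrow> \<alpha> (cm x y) = cm (\<alpha> x) (\<alpha> y)"
  by (simp add: cm_def A_mult A_inv)

lemma A_nat_pow: "\<alpha> \<in> A \<Longrightarrow> x \<in> Q \<Longrightarrow> \<alpha> (x [^] (k::nat)) = \<alpha> x [^] k"
proof (induction k)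
  case (Suc k)
  moreover have "x [^] k \<in> Q" using Suc.prems by (metis Q_sub subgroup_int_pow_closed int_pow_int)
  ultimately show ?case by (simp add: A_mult)
qed (simp add: A_one)

lemma A_int_pow: "\<alpha> \<in> A \<Longrightarrow> x \<in> Q \<Longrightarrow> \<alpha> (x [^] (k::int)) = \<alpha> x [^] k"
proof (cases k rule: int_cases2)
  case (nonneg j) then show "\<alpha> \<in> A \<Longrightarrow> x \<in> Q \<Longrightarrow> ?thesis" by (simp add: int_pow_int A_nat_pow)
next
  case (nonpos j)
  assume a: "\<alpha> \<in> A" "x \<in> Q"
  have "x [^] j \<in> Q" using a by (metis Q_sub subgroup_int_pow_closed int_pow_int)
  then show ?thesis using a nonpos A_closed[OF a] by (simp add: int_pow_neg_int A_nat_pow A_inv)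
qed

lemma A_generate:
  assumes a: "\<alpha> \<in> A" and R: "R \<subseteq> Q" "\<And>x. x \<in> R \<Longrightarrow> \<alpha> x \<in> generate G R" and x: "x \<in> generate G R"
  shows "\<alpha> x \<in> generate G R"
proof -
  have RG: "R \<subseteq> carrier G" using R(1) Q.subset by (rule order_trans)
  have gQ: "generate G R \<subseteq> Q" by (rule generate_subgroup_incl[OF R(1) Q_sub])
  show ?thesis using x
  proof (induction rule: generate.induct)
    case one then show ?case using a by (simp add: A_one generate.one)
  next
    case (incl h) then show ?case by (rule R(2))
  next
    case (inv h)
    then show ?case using R(1) R(2)[OF inv] a generate_m_inv_closed[OF RG] by (simp add: A_inv subset_iff)
  next
    case (eng h1 h2)
    then show ?case using a gQ by (simp add: A_mult subset_iff generate.eng)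
  qed
qed

section \<open>The Frattini quotient of \<open>Q\<close>\<close>

definition "Fr = Frat Q"

lemma Fr_sub: "subgroup Fr G" unfolding Fr_def by (rule Frat_subgroup[OF Q.subset])

sublocale Fr: subgroup Fr G by (rule Fr_sub)

lemma Fr_Q: "Fr \<subseteq> Q" unfolding Fr_def by (rule Frat_subset[OF Q_sub])

lemma sq_Fr: "x \<in> Q \<Longrightarrow> x \<otimes> x \<in> Fr" unfolding Fr_def by (rule square_Frat)

lemma cm_Fr: "x \<in> Q \<Longrightarrow> y \<in> Q \<Longrightarrow> cm x y \<in> Fr" unfolding Fr_def by (rule cm_Frat[OF Q_sub])

lemma cj_Fr: "g \<in> nzr Q \<Longrightarrow> x \<in> Fr \<Longrightarrow> cj g x \<in> Fr" unfolding Fr_def by (rule Frat_normal[OF Q_sub])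

lemma A_Fr: assumes "\<alpha> \<in> A" "x \<in> Fr" shows "\<alpha> x \<in> Fr"
  unfolding Fr_def Frat_def
proof (rule A_generate[OF assms(1) _ _ assms(2)[unfolded Fr_def Frat_def]])
  fix x assume "x \<in> {x \<otimes> x |x. x \<in> Q}"
  then obtain y where y: "y \<in> Q" "x = y \<otimes> y" by auto
  then have "\<alpha> x = \<alpha> y \<otimes> \<alpha> y" by (simp add: A_mult[OF assms(1)])
  moreover have "\<alpha> y \<in> Q" using y assms(1) by simp
  ultimately show "\<alpha> x \<in> generate G {x \<otimes> x |x. x \<in> Q}" by (intro generate.incl) auto
qed auto

lemma derived_sub: "subgroup (derived G Q) G" by (rule derived_is_subgroup[OF Q.subset])

lemma cm_derived: "x \<in> Q \<Longrightarrow> y \<in> Q \<Longrightarrow> cm x y \<in> derived G Q"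
  unfolding derived_def by (rule generate.incl) (auto simp: cm_def)

lemma A_derived: assumes a: "\<alpha> \<in> A" and x: "x \<in> derived G Q" shows "\<alpha> x \<in> derived G Q"
  unfolding derived_def
proof (rule A_generate[OF a _ _ x[unfolded derived_def]])
  fix x assume "x \<in> derived_set G Q"
  then obtain y w where yw: "y \<in> Q" "w \<in> Q" "x = cm y w" by (auto simp: cm_def)
  then have "\<alpha> x = cm (\<alpha> y) (\<alpha> w)" using a by (simp add: A_cm)
  then show "\<alpha> x \<in> generate G (derived_set G Q)" using cm_derived[of "\<alpha> y" "\<alpha> w"] yw A_closed[OF a] by (simp add: derived_def)
next
  show "derived_set G Q \<subseteq> Q" by (rule derived_set_incl[OF subset_refl Q_sub])
qed

text \<open>Equality in the Frattini quotient, with membership in \<open>Q\<close> built in. By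
  \<open>eqv_comm\<close> and \<open>eqv_sq\<close> the quotient behaves as a vector space over the
  field with two elements.\<close>

definition eqv where "eqv x y \<longleftrightarrow> x \<in> Q \<and> y \<in> Q \<and> x \<otimes> inv y \<in> Fr"

lemma eqv_refl: "x \<in> Q \<Longrightarrow> eqv x x" by (simp add: eqv_def)

lemma eqv_sym: "eqv x y \<Longrightarrow> eqv y x"
proof -
  assume e: "eqv x y"
  then have "inv (x \<otimes> inv y) \<in> Fr" by (simp add: eqv_def)
  then show ?thesis using e by (simp add: eqv_def inv_mult_group)
qed

lemma eqv_trans [trans]: "eqv x y \<Longrightarrow> eqv y w \<Longrightarrow> eqv x w"
proof -
  assume e: "eqv x y" "eqv y w"
  then have "(x \<otimes> inv y) \<otimes> (y \<otimes> inv w) \<in> Fr" by (simp add: eqv_def)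
  moreover have "(x \<otimes> inv y) \<otimes> (y \<otimes> inv w) = x \<otimes> inv w" using e by (simp add: eqv_def word_simps)
  ultimately show ?thesis using e by (simp add: eqv_def)
qed

lemma eqv_mult: "eqv x y \<Longrightarrow> eqv x' y' \<Longrightarrow> eqv (x \<otimes> x') (y \<otimes> y')"
proof -
  assume e: "eqv x y" "eqv x' y'"
  have "cj x (x' \<otimes> inv y') \<in> Fr" using e Q_nz by (intro cj_Fr) (auto simp: eqv_def)
  then have "cj x (x' \<otimes> inv y') \<otimes> (x \<otimes> inv y) \<in> Fr" using e by (simp add: eqv_def)
  moreover have "cj x (x' \<otimes> inv y') \<otimes> (x \<otimes> inv y) = x \<otimes> x' \<otimes> inv (y \<otimes> y')" using e by (simp add: eqv_def word_simps)
  ultimately show ?thesis using e by (simp add: eqv_def)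
qed

lemma eqv_comm: "x \<in> Q \<Longrightarrow> y \<in> Q \<Longrightarrow> eqv (x \<otimes> y) (y \<otimes> x)"
proof -
  assume a: "x \<in> Q" "y \<in> Q"
  have "x \<otimes> y \<otimes> inv (y \<otimes> x) = cm x y" using a by (simp add: word_simps)
  then show ?thesis using a cm_Fr by (simp add: eqv_def)
qed

lemma eqv_A: "\<alpha> \<in> A \<Longrightarrow> eqv x y \<Longrightarrow> eqv (\<alpha> x) (\<alpha> y)"
  using A_Fr[of \<alpha> "x \<otimes> inv y"] by (simp add: eqv_def A_mult A_inv)

lemma eqv_Fr: "x \<in> Fr \<Longrightarrow> y \<in> Q \<Longrightarrow> eqv (x \<otimes> y) y"
  using Fr_Q by (simp add: eqv_def m_assoc subset_iff)

lemma eqv_sq: "x \<in> Q \<Longrightarrow> y \<in> Q \<Longrightarrow> eqv (x \<otimes> (x \<otimes> y)) y"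
  using eqv_Fr[OF sq_Fr[of x], of y] by (simp add: m_assoc)

text \<open>Automorphisms that act trivially on the Frattini quotient form a normal 2-subgroup, which lies in
  every Sylow 2-subgroup.\<close>

lemma odd_order_trivial:
  assumes k: "k \<in> A" "\<And>q. q \<in> Q \<Longrightarrow> eqv (k q) q" and p: "Factorial_Ring.prime (p::nat)" "odd p"
    and kp: "k [^]\<^bsub>BijGroup Q\<^esub> p = \<one>\<^bsub>BijGroup Q\<^esub>" and q: "q \<in> Q"
  shows "k q = q"
proof (cases "k = \<one>\<^bsub>BijGroup Q\<^esub>")
  case True then show ?thesis using q by (simp add: BijGroup_def)
next
  case k1: False
  interpret B: group "BijGroup Q" by (rule group_BijGroup)
  have kB: "k \<in> carrier (BijGroup Q)" using k(1) A_Bij by (auto simp: BijGroup_def)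
  have "B.ord k dvd p" using kp kB B.pow_eq_id by simp
  moreover have "B.ord k \<noteq> 1" using kB k1 B.ord_eq_1 by simp
  ultimately have ordk: "B.ord k = p" using p by (metis prime_nat_iff)
  let ?K = "generate (BijGroup Q) {k}"
  have K: "subgroup ?K (BijGroup Q)" using kB by (simp add: B.generate_is_subgroup)
  have cK: "card ?K = p" using B.generate_pow_card[OF kB] ordk by simp
  have KN: "g \<in> A \<and> (\<forall>x\<in>Q. eqv (g x) x)" if "g \<in> ?K" for g
  proof -
    have "\<exists>i::nat. g = k [^]\<^bsub>BijGroup Q\<^esub> i"
      using that B.generate_pow_nat[OF kB] ordk p by (auto simp: prime_gt_0_nat)
    then obtain i :: nat where i: "g = k [^]\<^bsub>BijGroup Q\<^esub> i" by blast
    have idA: "(\<lambda>x\<in>Q. x) \<in> A"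
    proof -
      have "compose Q (iv k) k = (\<lambda>x\<in>Q. x)" using k(1) by (auto simp: compose_def)
      then show ?thesis using A_compose[OF iv_A[OF k(1)] k(1)] by simp
    qed
    have "k [^]\<^bsub>BijGroup Q\<^esub> i \<in> A \<and> (\<forall>x\<in>Q. eqv ((k [^]\<^bsub>BijGroup Q\<^esub> i) x) x)" for i :: nat
    proof (induction i)
      case 0
      have e0: "k [^]\<^bsub>BijGroup Q\<^esub> (0::nat) = (\<lambda>x\<in>Q. x)" by (simp add: BijGroup_def nat_pow_def)
      show ?case unfolding e0 by (intro conjI ballI idA) (simp add: eqv_refl)
    next
      case (Suc i)
      let ?g = "k [^]\<^bsub>BijGroup Q\<^esub> i"
      have g: "?g \<in> A" "\<And>x. x \<in> Q \<Longrightarrow> eqv (?g x) x" using Suc by auto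
      have e: "k [^]\<^bsub>BijGroup Q\<^esub> Suc i = compose Q ?g k"
      proof -
        have "k [^]\<^bsub>BijGroup Q\<^esub> Suc i = ?g \<otimes>\<^bsub>BijGroup Q\<^esub> k" by simp
        also have "\<dots> = compose Q ?g k" using k(1) g(1) A_Bij by (auto simp: BijGroup_def subset_iff)
        finally show ?thesis .
      qed
      have "eqv (?g (k x)) x" if "x \<in> Q" for x
        using g(2)[of "k x"] k(2)[of x] k(1) that eqv_trans by blast
      then show ?case unfolding e using A_compose[OF g(1) k(1)] by (simp add: compose_eq)
    qed
    then show ?thesis unfolding i by blast
  qed
  \<comment> \<open>\<open>C\<close> is the subgroup fixed by \<open>k\<close>. Each coset of the
    Frattini subgroup has 2-power size and is stable under the group of odd prime order generated by
    \<open>k\<close>, so it contains a fixed point. Hence \<open>C\<close> generates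
    \<open>Q\<close> modulo the Frattini subgroup.\<close>
  define C where "C = {x \<in> Q. k x = x}"
  have C: "subgroup C G"
  proof
    show "C \<subseteq> carrier G" by (auto simp: C_def)
    show "\<one> \<in> C" using k(1) by (simp add: C_def A_one)
    show "x \<otimes> y \<in> C" if "x \<in> C" "y \<in> C" for x y using that k(1) by (simp add: C_def A_mult)
    show "inv x \<in> C" if "x \<in> C" for x using that k(1) by (simp add: C_def A_inv)
  qed
  have "C = Q"
  proof (rule subgroup_eq_if_Frat[OF ord Q_sub C])
    show "C \<subseteq> Q" by (auto simp: C_def)
    fix y assume y: "y \<in> Q"
    let ?E = "Fr #> y"
    have E: "x \<in> ?E \<longleftrightarrow> eqv x y" for x
      using y Fr_Q Fr.rcos_module[OF is_group, of y x] Q.m_closed[of "x \<otimes> inv y" y]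
      by (auto simp: eqv_def r_coset_def)
    have cE: "card ?E = card Fr"
    proof -
      have "?E = (\<lambda>x. x \<otimes> y) ` Fr" by (auto simp: r_coset_def)
      moreover have "inj_on (\<lambda>x. x \<otimes> y) Fr" using y by (auto simp: inj_on_def)
      ultimately show ?thesis by (simp add: card_image)
    qed
    obtain j where j: "card Fr = 2 ^ j" using card_subgroup_prime_power[OF two_is_prime_nat ord Fr_sub] by blast
    have "card {x \<in> ?E. \<forall>g\<in>carrier (BijGroup Q\<lparr>carrier := ?K\<rparr>). (\<lambda>g x. g x) g x = x} mod p = card ?E mod p"
    proof (rule fixed_points_mod_prime[where k = 1])
      show "group (BijGroup Q\<lparr>carrier := ?K\<rparr>)" using K by (rule B.subgroup_imp_group)
      show "order (BijGroup Q\<lparr>carrier := ?K\<rparr>) = p ^ 1" using cK by (simp add: order_def)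
      have "?E \<subseteq> carrier G" using y by (intro r_coset_subset_G) auto
      then show "finite ?E" using finG by (rule finite_subset)
      show "g x \<in> ?E" if "g \<in> carrier (BijGroup Q\<lparr>carrier := ?K\<rparr>)" "x \<in> ?E" for g x
      proof -
        have "eqv x y" using that E by simp
        moreover have "eqv (g x) x" using KN[of g] that(1) \<open>eqv x y\<close> by (simp add: eqv_def)
        ultimately show ?thesis using E eqv_trans by blast
      qed
      show "\<one>\<^bsub>BijGroup Q\<lparr>carrier := ?K\<rparr>\<^esub> x = x" if "x \<in> ?E" for x
        using that E by (simp add: BijGroup_def eqv_def)
      show "(g \<otimes>\<^bsub>BijGroup Q\<lparr>carrier := ?K\<rparr>\<^esub> h) x = g (h x)"
        if "g \<in> carrier (BijGroup Q\<lparr>carrier := ?K\<rparr>)" "h \<in> carrier (BijGroup Q\<lparr>carrier := ?K\<rparr>)" "x \<in> ?E" for g h x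
      proof -
        have "g \<in> Bij Q" "h \<in> Bij Q" using KN that A_Bij by (auto simp: subset_iff)
        then show ?thesis using that(3) E by (simp add: BijGroup_def compose_def eqv_def)
      qed
    qed (rule p(1))
    moreover have "\<not> p dvd card ?E" using p cE j by (metis prime_dvd_power_nat primes_dvd_imp_eq two_is_prime_nat even_numeral)
    ultimately have "card {x \<in> ?E. \<forall>g\<in>carrier (BijGroup Q\<lparr>carrier := ?K\<rparr>). g x = x} \<noteq> 0"
      by (metis dvd_eq_mod_eq_0 mod_0)
    then have "{x \<in> ?E. \<forall>g\<in>carrier (BijGroup Q\<lparr>carrier := ?K\<rparr>). g x = x} \<noteq> {}" by (metis card.empty)
    then obtain x where x: "x \<in> ?E" "\<forall>g\<in>?K. g x = x" by auto
    have "k \<in> ?K" by (rule generate.incl) simp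
    then have xC: "x \<in> C" using x E by (simp add: C_def eqv_def)
    have xy: "x \<otimes> inv y \<in> Fr" "x \<in> Q" using x(1) E by (simp_all add: eqv_def)
    have "y = x \<otimes> cj (inv x) (inv (x \<otimes> inv y))" using xy y by (simp add: word_simps)
    moreover have "cj (inv x) (inv (x \<otimes> inv y)) \<in> Fr"
      using xy Q_nz by (intro cj_Fr Fr.m_inv_closed) (auto simp: subset_iff)
    ultimately show "\<exists>h\<in>C. \<exists>f\<in>Frat Q. y = h \<otimes> f" using xC unfolding Fr_def by blast
  qed
  then show ?thesis using q by (auto simp: C_def)
qed

section \<open>The group of automorphisms and its inner part\<close>

lemma id_A: "(\<lambda>x\<in>Q. x) \<in> A"
proof -
  have "cjQ \<one> = (\<lambda>x\<in>Q. x)" by (auto simp: restrict_def)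
  then show ?thesis using A_cj[OF nz.one_closed] by simp
qed

lemma A_subgroup: "subgroup A (BijGroup Q)"
proof -
  interpret B: group "BijGroup Q" by (rule group_BijGroup)
  have m: "\<alpha> \<otimes>\<^bsub>BijGroup Q\<^esub> \<beta> = compose Q \<alpha> \<beta>" if "\<alpha> \<in> A" "\<beta> \<in> A" for \<alpha> \<beta>
    using that A_Bij by (auto simp: BijGroup_def subset_iff)
  have o: "\<one>\<^bsub>BijGroup Q\<^esub> = (\<lambda>x\<in>Q. x)" by (simp add: BijGroup_def)
  show ?thesis
  proof
    show "A \<subseteq> carrier (BijGroup Q)" using A_Bij by (simp add: BijGroup_def)
    show "\<alpha> \<otimes>\<^bsub>BijGroup Q\<^esub> \<beta> \<in> A" if "\<alpha> \<in> A" "\<beta> \<in> A" for \<alpha> \<beta> using that by (simp add: m A_compose)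
    show "\<one>\<^bsub>BijGroup Q\<^esub> \<in> A" by (simp add: o id_A)
    show "inv\<^bsub>BijGroup Q\<^esub> \<alpha> \<in> A" if a: "\<alpha> \<in> A" for \<alpha>
    proof -
      have "iv \<alpha> \<otimes>\<^bsub>BijGroup Q\<^esub> \<alpha> = \<one>\<^bsub>BijGroup Q\<^esub>"
        unfolding m[OF iv_A[OF a] a] o using a by (auto simp: compose_def)
      then have "inv\<^bsub>BijGroup Q\<^esub> \<alpha> = iv \<alpha>"
        using a A_Bij iv_A[OF a] by (intro B.inv_equality) (auto simp: BijGroup_def subset_iff)
      then show ?thesis using a by simp
    qed
  qed
qed

abbreviation "AG \<equiv> BijGroup Q\<lparr>carrier := A\<rparr>"

lemma AG_group: "group AG"
  by (rule group.subgroup_imp_group[OF group_BijGroup A_subgroup])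

lemma AG_mult: "\<alpha> \<in> A \<Longrightarrow> \<beta> \<in> A \<Longrightarrow> \<alpha> \<otimes>\<^bsub>AG\<^esub> \<beta> = compose Q \<alpha> \<beta>"
  using A_Bij by (auto simp: BijGroup_def subset_iff)

lemma AG_one: "\<one>\<^bsub>AG\<^esub> = (\<lambda>x\<in>Q. x)" by (simp add: BijGroup_def)

lemma AG_inv: assumes a: "\<alpha> \<in> A" shows "inv\<^bsub>AG\<^esub> \<alpha> = iv \<alpha>"
proof (rule group.inv_equality[OF AG_group])
  show "iv \<alpha> \<otimes>\<^bsub>AG\<^esub> \<alpha> = \<one>\<^bsub>AG\<^esub>" unfolding AG_mult[OF iv_A[OF a] a] AG_one using a by (auto simp: compose_def)
qed (use a in simp_all)

lemma A_finite: "finite A"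
proof -
  have "Bij Q \<subseteq> Q \<rightarrow>\<^sub>E Q" by (auto simp: Bij_def PiE_def bij_betw_def)
  then have "A \<subseteq> Q \<rightarrow>\<^sub>E Q" using A_Bij by (rule order_trans[rotated])
  then show ?thesis using finQ by (meson finite_PiE finite_subset)
qed

lemma S_subgroup: "subgroup S AG"
proof -
  interpret AG: group AG by (rule AG_group)
  show ?thesis
  proof (rule AG.subgroupI)
    show "S \<subseteq> carrier AG" using S_A by simp
    show "S \<noteq> {}" using nz.one_closed unfolding S_def by blast
    fix \<alpha> assume "\<alpha> \<in> S"
    then obtain g where g: "g \<in> nzr Q" "\<alpha> = cjQ g" by (auto simp: S_def)
    have aA: "\<alpha> \<in> A" using S_A \<open>\<alpha> \<in> S\<close> by blast
    have "iv \<alpha> x = cj (inv g) x" if x: "x \<in> Q" for x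
    proof -
      have "cj (inv g) x \<in> Q" using nzrD(1)[OF nz.m_inv_closed[OF g(1)] x] .
      moreover have "\<alpha> (cj (inv g) x) = x" using calculation g x by (simp add: cj_cj_inv)
      ultimately show ?thesis using iv_left[OF aA] by metis
    qed
    then have "iv \<alpha> \<in> S" using S_iff[OF iv_A[OF aA]] nz.m_inv_closed[OF g(1)] by blast
    then show "inv\<^bsub>AG\<^esub> \<alpha> \<in> S" by (simp add: AG_inv[OF aA])
    fix \<beta> assume "\<beta> \<in> S"
    then obtain h where h: "h \<in> nzr Q" "\<beta> = cjQ h" by (auto simp: S_def)
    have bA: "\<beta> \<in> A" using S_A \<open>\<beta> \<in> S\<close> by blast
    have "compose Q \<alpha> \<beta> x = cj (g \<otimes> h) x" if "x \<in> Q" for x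
      using that g h nzrD(1)[OF h(1) that] by (simp add: compose_def mult_cj)
    then have "compose Q \<alpha> \<beta> \<in> S" using S_iff[OF A_compose[OF aA bA]] nz.m_closed[OF g(1) h(1)] by blast
    then show "\<alpha> \<otimes>\<^bsub>AG\<^esub> \<beta> \<in> S" by (simp only: AG_mult[OF aA bA])
  qed
qed

lemma AG_pow_BijGroup: "\<alpha> \<in> A \<Longrightarrow> \<alpha> [^]\<^bsub>AG\<^esub> (j::nat) = \<alpha> [^]\<^bsub>BijGroup Q\<^esub> j"
  by (induction j) (auto simp: nat_pow_def BijGroup_def)

text \<open>The kernel \<open>N\<close> of the action on the Frattini quotient is a 2-group by
  \<open>odd_order_trivial\<close>. It acts on the cosets of \<open>S\<close>, whose number is odd;
  a fixed coset conjugates \<open>N\<close> into \<open>S\<close>, and \<open>N\<close> is normal in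
  \<open>A\<close>.\<close>

lemma kernel_in_S:
  assumes k: "k \<in> A" "\<And>q. q \<in> Q \<Longrightarrow> eqv (k q) q"
  shows "k \<in> S"
proof -
  interpret AG: group AG by (rule AG_group)
  define N where "N = {k \<in> A. \<forall>q\<in>Q. eqv (k q) q}"
  have NA: "N \<subseteq> A" by (auto simp: N_def)
  have N: "subgroup N AG"
  proof (rule AG.subgroupI)
    show "N \<subseteq> carrier AG" using NA by simp
    have "(\<lambda>x\<in>Q. x) \<in> N" using id_A eqv_refl by (simp add: N_def)
    then show "N \<noteq> {}" by blast
    fix \<alpha> assume a: "\<alpha> \<in> N"
    then have aA: "\<alpha> \<in> A" using NA by blast
    have "eqv (iv \<alpha> q) q" if "q \<in> Q" for q
    proof -
      have "eqv (\<alpha> (iv \<alpha> q)) (iv \<alpha> q)" using a A_closed[OF iv_A[OF aA] that] unfolding N_def by blast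
      then show ?thesis using aA that eqv_sym by simp
    qed
    then show "inv\<^bsub>AG\<^esub> \<alpha> \<in> N" using aA by (simp add: AG_inv N_def)
    fix \<beta> assume b: "\<beta> \<in> N"
    then have bA: "\<beta> \<in> A" using NA by blast
    have "eqv (\<alpha> (\<beta> q)) q" if "q \<in> Q" for q
      using a b that A_closed[OF bA that] eqv_trans[of "\<alpha> (\<beta> q)" "\<beta> q" q] by (simp add: N_def)
    then have "compose Q \<alpha> \<beta> \<in> N" using A_compose[OF aA bA] by (simp add: N_def compose_eq)
    then show "\<alpha> \<otimes>\<^bsub>AG\<^esub> \<beta> \<in> N" by (simp only: AG_mult[OF aA bA])
  qed
  have "\<exists>i. order (AG\<lparr>carrier := N\<rparr>) = 2 ^ i"
  proof (rule power_of_two_card)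
    show "group (AG\<lparr>carrier := N\<rparr>)" using N by (rule AG.subgroup_imp_group)
    show "finite (carrier (AG\<lparr>carrier := N\<rparr>))" using NA A_finite by (simp add: finite_subset)
    fix \<alpha> assume "\<alpha> \<in> carrier (AG\<lparr>carrier := N\<rparr>)"
    then have a: "\<alpha> \<in> N" by simp
    then have aA: "\<alpha> \<in> A" using NA by blast
    have pos: "AG.ord \<alpha> > 0" using AG.ord_ge_1[of \<alpha>] A_finite aA by simp
    obtain s where s: "AG.ord \<alpha> = 2 ^ multiplicity 2 (AG.ord \<alpha>) * s" "\<not> 2 dvd s"
      using multiplicity_decompose'[of "AG.ord \<alpha>" 2] pos by (metis not_is_unit_0 not_gr0 odd_one)
    \<comment> \<open>\<open>s\<close> is the odd part of the order of \<alpha>. For a prime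
      \<open>p\<close> dividing it, a power of \<alpha> would have order \<open>p\<close> and lie in
      \<open>N\<close>.\<close>
    have "s = 1"
    proof (rule ccontr)
      assume "s \<noteq> 1"
      then obtain p where p: "Factorial_Ring.prime p" "p dvd s" by (metis prime_factor_nat)
      then have podd: "odd p" using s(2) by (metis dvd_trans)
      have pd: "p dvd AG.ord \<alpha>" using p s(1) by (metis dvd_mult)
      define j where "j = AG.ord \<alpha> div p"
      have jp: "j * p = AG.ord \<alpha>" using pd by (simp add: j_def)
      define k where "k = \<alpha> [^]\<^bsub>AG\<^esub> j"
      have kN: "k \<in> N" using a N by (metis AG.subgroup_int_pow_closed int_pow_int k_def)
      have kA: "k \<in> A" using kN NA by blast
      have "k [^]\<^bsub>AG\<^esub> p = \<one>\<^bsub>AG\<^esub>" using aA AG.nat_pow_pow[of \<alpha> j p] by (simp add: k_def jp)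
      then have kp: "k [^]\<^bsub>BijGroup Q\<^esub> p = \<one>\<^bsub>BijGroup Q\<^esub>" using AG_pow_BijGroup[OF kA, of p] by simp
      have "k q = q" if "q \<in> Q" for q
        using odd_order_trivial[OF kA _ p(1) podd kp that] kN by (simp add: N_def)
      then have "k = \<one>\<^bsub>AG\<^esub>"
        unfolding AG_one using kA A_Bij Bij_imp_extensional by (intro extensionalityI[of _ Q]) auto
      then have "AG.ord \<alpha> dvd j" using aA AG.pow_eq_id[of \<alpha> j] by (simp add: k_def)
      then have "j * p \<le> j" using jp pos by (metis dvd_imp_le mult_0 not_gr0)
      moreover have "j > 0" using jp pos by (metis mult_0 not_gr0)
      ultimately show False using prime_gt_1_nat[OF p(1)] by simp
    qed
    then have "\<alpha> [^]\<^bsub>AG\<^esub> ((2::nat) ^ multiplicity 2 (AG.ord \<alpha>)) = \<one>\<^bsub>AG\<^esub>"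
      using s(1) aA AG.pow_eq_id[of \<alpha>] by simp
    then show "\<exists>k. \<alpha> [^]\<^bsub>AG\<lparr>carrier := N\<rparr>\<^esub> ((2::nat) ^ k) = \<one>\<^bsub>AG\<lparr>carrier := N\<rparr>\<^esub>"
      using AG.nat_pow_consistent[of \<alpha> _ N] by auto
  qed
  then obtain i where i: "card N = 2 ^ i" by (auto simp: order_def)
  have "card (rcosets\<^bsub>AG\<^esub> S) * card S = card A" using AG.lagrange[OF S_subgroup] by (simp add: order_def)
  moreover have "card A = r * card S" using A_index(1) by (simp add: S_def mult.commute)
  moreover have "S \<noteq> {}" using nz.one_closed unfolding S_def by blast
  then have "card S > 0" using finite_subset[OF S_A A_finite] by (simp add: card_gt_0_iff)
  ultimately have "card (rcosets\<^bsub>AG\<^esub> S) = r" by simp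
  then have "odd (card {W \<in> rcosets\<^bsub>AG\<^esub> S. \<forall>g\<in>N. W #>\<^bsub>AG\<^esub> inv\<^bsub>AG\<^esub> g = W})"
    using AG.coset_fixed_points[OF _ N S_subgroup two_is_prime_nat i] A_finite A_index(2) by (simp add: odd_iff_mod_2_eq_one)
  then have "{W \<in> rcosets\<^bsub>AG\<^esub> S. \<forall>g\<in>N. W #>\<^bsub>AG\<^esub> inv\<^bsub>AG\<^esub> g = W} \<noteq> {}" by (metis card.empty even_zero)
  then obtain W where W: "W \<in> rcosets\<^bsub>AG\<^esub> S" "\<forall>g\<in>N. W #>\<^bsub>AG\<^esub> inv\<^bsub>AG\<^esub> g = W" by blast
  then obtain x where x: "x \<in> A" "W = S #>\<^bsub>AG\<^esub> x" by (auto simp: RCOSETS_def)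
  have fixd: "AG.cj x g \<in> S" if "g \<in> N" for g
    using W(2) that x NA AG.rcoset_fixed_iff[OF S_subgroup, of x g] by auto
  \<comment> \<open>Every element of \<open>N\<close> is conjugated into \<open>S\<close> by
    \<open>x\<close>. As \<open>N\<close> is normal, the conjugate \<open>k'\<close> of
    \<open>k\<close> is again in \<open>N\<close>, and conjugating back by \<open>x\<close> returns
    \<open>k\<close>.\<close>
  define k' where "k' = compose Q (iv x) (compose Q k x)"
  have k'A: "k' \<in> A" unfolding k'_def using k(1) x(1) by (simp add: A_compose)
  have "eqv (k' q) q" if q: "q \<in> Q" for q
  proof -
    have "eqv (iv x (k (x q))) (iv x (x q))" by (rule eqv_A[OF iv_A[OF x(1)] k(2)[OF A_closed[OF x(1) q]]])
    then show ?thesis using q x(1) k(1) by (simp add: k'_def compose_def)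
  qed
  then have "k' \<in> N" using k'A by (simp add: N_def)
  then have "AG.cj x k' \<in> S" by (rule fixd)
  moreover have "AG.cj x k' = k"
  proof -
    have e: "AG.cj x k' = compose Q (compose Q x k') (iv x)"
      unfolding AG.cj_def AG_inv[OF x(1)] AG_mult[OF x(1) k'A] by (rule AG_mult[OF A_compose[OF x(1) k'A] iv_A[OF x(1)]])
    show ?thesis unfolding e
    proof (rule extensionalityI[of _ Q])
      show "k \<in> extensional Q" using k(1) A_Bij Bij_imp_extensional by (metis subsetD)
      fix y assume "y \<in> Q"
      then show "compose Q (compose Q x k') (iv x) y = k y" using x(1) k(1) by (simp add: compose_def k'_def)
    qed simp
  qed
  ultimately show ?thesis by simp
qed

end

locale nontrivial_automizer = automizer +
  assumes A_ne: "A \<noteq> S"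
begin

lemma ex_out: obtains \<alpha> where "\<alpha> \<in> A" "\<alpha> \<notin> S"
  using A_ne S_A by blast

lemma cjQ_A: "g \<in> nzr Q \<Longrightarrow> cjQ g \<in> A" by (rule A_cj)

lemma eqv_cj: assumes "g \<in> nzr Q" "eqv x y" shows "eqv (cj g x) (cj g y)"
  using eqv_A[OF cjQ_A[OF assms(1)] assms(2)] assms(2) by (simp add: eqv_def)

lemma eqv_cj_iff: "g \<in> nzr Q \<Longrightarrow> q \<in> Q \<Longrightarrow> eqv (cj g q) q \<longleftrightarrow> cm g q \<in> Fr"
  using nzrD[of g Q] by (simp add: eqv_def cm_cj)

text \<open>If \<open>u\<close> were outside \<open>Q\<close>, then for every \<alpha> the
  \<alpha>-conjugate of its action would also be trivial on the Frattini quotient, hence induced by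
  some \<open>h\<close>. Then \<alpha> carries the action of \<open>u\<close> to that of
  \<open>h\<close> and would be inner.\<close>

lemma trivial_action_mem:
  assumes u: "u \<in> nzr Q" and t: "\<And>q. q \<in> Q \<Longrightarrow> cm u q \<in> Fr"
  shows "u \<in> Q"
proof (rule ccontr)
  assume uQ: "u \<notin> Q"
  have "\<alpha> \<in> S" if a: "\<alpha> \<in> A" for \<alpha>
  proof -
    let ?k = "compose Q \<alpha> (compose Q (cjQ u) (iv \<alpha>))"
    have kA: "?k \<in> A" using a u by (simp add: A_compose A_cj)
    have kx: "?k x = \<alpha> (cj u (iv \<alpha> x))" if "x \<in> Q" for x using that a by (simp add: compose_def)
    have "eqv (?k x) x" if x: "x \<in> Q" for x
    proof -
      have "eqv (cj u (iv \<alpha> x)) (iv \<alpha> x)" using eqv_cj_iff[OF u] t x a by simp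
      then have "eqv (\<alpha> (cj u (iv \<alpha> x))) (\<alpha> (iv \<alpha> x))" by (rule eqv_A[OF a])
      then show ?thesis using x a kx by simp
    qed
    then have "?k \<in> S" by (rule kernel_in_S[OF kA])
    then obtain h where h: "h \<in> nzr Q" "\<forall>x\<in>Q. ?k x = cj h x" by (rule S_D)
    have "\<alpha> (cj u x) = cj h (\<alpha> x)" if x: "x \<in> Q" for x
      using h(2)[rule_format, of "\<alpha> x"] kx[of "\<alpha> x"] x a by simp
    then show ?thesis by (rule A_extend_S[OF a u uQ h(1)])
  qed
  then show False using A_ne S_A by blast
qed

text \<open>The action of \<open>u\<close> on the Frattini quotient is a transvection with centre
  \<open>e\<close>. That it is not the identity follows from \<open>trivial_action_mem\<close>, as
  \<open>u\<close> is outside \<open>Q\<close>.\<close>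

definition transv where
  "transv u e \<longleftrightarrow> u \<in> nzr Q \<and> u \<notin> Q \<and> e \<in> Q \<and> cm u e \<in> Fr \<and> (\<forall>q\<in>Q. cm u q \<in> Fr \<or> eqv (cm u q) e)"

section \<open>Transvections on the Frattini quotient\<close>

context
  fixes u e
  assumes tr: "transv u e"
begin

text \<open>The linear form of the transvection as a predicate; addition in the field with two
  elements becomes inequality of truth values in \<open>f_mult\<close>.\<close>

definition "f q \<longleftrightarrow> cm u q \<notin> Fr"

lemma u: "u \<in> nzr Q" "u \<notin> Q" "e \<in> Q" using tr by (simp_all add: transv_def)

lemma fe: "\<not> f e" using tr by (simp add: transv_def f_def)

lemma f_eqv: "eqv x y \<Longrightarrow> f x \<longleftrightarrow> f y"
proof -
  have "cm u y \<in> Fr" if xy: "eqv x y" and "cm u x \<in> Fr" for x y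
  proof -
    have "x \<in> Q" using xy by (simp add: eqv_def)
    then have "eqv (cj u x) x" using that(2) eqv_cj_iff[OF u(1)] by blast
    then have "eqv (cj u y) y" using xy eqv_cj[OF u(1) eqv_sym[OF xy]] eqv_trans by blast
    moreover have "y \<in> Q" using xy by (simp add: eqv_def)
    ultimately show ?thesis using eqv_cj_iff[OF u(1)] by blast
  qed
  then show "eqv x y \<Longrightarrow> f x \<longleftrightarrow> f y" using eqv_sym unfolding f_def by blast
qed

lemma f_form: assumes "q \<in> Q" shows "eqv (cj u q) ((if f q then e else \<one>) \<otimes> q)"
proof (cases "f q")
  case False
  then show ?thesis using assms u eqv_cj_iff by (simp add: f_def)
next
  case True
  then have "eqv (cm u q) e" using tr assms by (auto simp: transv_def f_def)
  then have "eqv (cm u q \<otimes> q) (e \<otimes> q)" by (rule eqv_mult[OF _ eqv_refl[OF assms]])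
  then show ?thesis using True assms u nzrD(2)[OF u(1)] by (simp add: cj_cm)
qed

lemma f_mult: assumes "x \<in> Q" "y \<in> Q" shows "f (x \<otimes> y) \<longleftrightarrow> f x \<noteq> f y"
proof -
  have uG: "u \<in> carrier G" using u nzrD by blast
  have cc: "cm u q \<in> Q" if "q \<in> Q" for q using nzrD(1)[OF u(1) that] that uG by (simp add: cm_cj)
  have ex: "cm u (x \<otimes> y) = cm u x \<otimes> cj x (cm u y)" using assms uG by (simp add: cm_mult)
  have xnz: "x \<in> nzr Q" using assms Q_nz by blast
  have e2: "eqv (cj x (cm u y)) (cm u y)" using eqv_cj_iff[OF xnz cc[OF assms(2)]] cm_Fr[OF assms(1) cc[OF assms(2)]] by simp
  have E: "eqv (cm u (x \<otimes> y)) (cm u x \<otimes> cm u y)" unfolding ex by (rule eqv_mult[OF eqv_refl[OF cc[OF assms(1)]] e2])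
  have Fr1: "w \<in> Fr \<longleftrightarrow> eqv w \<one>" if "w \<in> Q" for w using that by (simp add: eqv_def)
  have neg: "\<not> f w \<longleftrightarrow> eqv (cm u w) \<one>" if "w \<in> Q" for w using Fr1[OF cc[OF that]] by (simp add: f_def)
  have pos: "eqv (cm u w) e" if "w \<in> Q" "f w" for w using tr that by (auto simp: transv_def f_def)
  have one: "eqv (\<one> \<otimes> \<one>) \<one>" by (simp add: eqv_refl)
  show ?thesis
  proof (cases "f x"; cases "f y")
    assume "\<not> f x" "\<not> f y"
    then have "eqv (cm u x \<otimes> cm u y) (\<one> \<otimes> \<one>)" using neg assms by (intro eqv_mult) auto
    then show ?thesis using E neg[of "x \<otimes> y"] assms \<open>\<not> f x\<close> \<open>\<not> f y\<close> eqv_trans one by (metis Q.m_closed)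
  next
    assume xy: "f x" "f y"
    then have "eqv (cm u x \<otimes> cm u y) (e \<otimes> e)" using pos assms by (intro eqv_mult) auto
    moreover have "eqv (e \<otimes> e) \<one>" using eqv_Fr[OF sq_Fr[OF u(3)], of \<one>] u(3) by simp
    ultimately have "eqv (cm u (x \<otimes> y)) \<one>" using E eqv_trans by blast
    then show ?thesis using neg[of "x \<otimes> y"] assms xy by simp
  next
    assume xy: "f x" "\<not> f y"
    have "f (x \<otimes> y)"
    proof (rule ccontr)
      assume "\<not> f (x \<otimes> y)"
      then have "eqv (cm u x \<otimes> cm u y) \<one>" using neg[of "x \<otimes> y"] assms E eqv_trans eqv_sym by (metis Q.m_closed)
      moreover have "eqv (cm u x \<otimes> cm u y) (cm u x \<otimes> \<one>)" using neg[of y] xy assms eqv_refl[OF cc[OF assms(1)]] by (intro eqv_mult) auto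
      ultimately have "eqv (cm u x) \<one>" using eqv_trans eqv_sym cc[OF assms(1)] by (metis Q.mem_carrier r_one)
      then show False using neg[of x] xy assms by simp
    qed
    then show ?thesis using xy by simp
  next
    assume xy: "\<not> f x" "f y"
    have "f (x \<otimes> y)"
    proof (rule ccontr)
      assume "\<not> f (x \<otimes> y)"
      then have "eqv (cm u x \<otimes> cm u y) \<one>" using neg[of "x \<otimes> y"] assms E eqv_trans eqv_sym by (metis Q.m_closed)
      moreover have "eqv (cm u x \<otimes> cm u y) (\<one> \<otimes> cm u y)" using neg[of x] xy assms eqv_refl[OF cc[OF assms(2)]] by (intro eqv_mult) auto
      ultimately have "eqv (cm u y) \<one>" using eqv_trans eqv_sym cc[OF assms(2)] by (metis Q.mem_carrier l_one)
      then show False using neg[of y] xy assms by simp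
    qed
    then show ?thesis using xy by simp
  qed
qed

lemma f_one: "\<not> f \<one>" using nzrD(2)[OF u(1)] by (simp add: f_def)

text \<open>\<open>g\<close> adds \<open>w\<close> along the linear form of \<open>u\<close>. With
  the same linear form and centres in its kernel, two such maps commute modulo the Frattini
  subgroup, see \<open>form_commute\<close>.\<close>

definition "form g w \<longleftrightarrow> w \<in> Q \<and> (\<forall>q\<in>Q. eqv (g q) ((if f q then w else \<one>) \<otimes> q))"

lemma form_f: assumes "form g w" "\<not> f w" "q \<in> Q" shows "f (g q) \<longleftrightarrow> f q"
proof -
  have "f (g q) \<longleftrightarrow> f ((if f q then w else \<one>) \<otimes> q)" using assms f_eqv by (simp add: form_def)
  also have "\<dots> \<longleftrightarrow> f q" using assms f_mult[of "if f q then w else \<one>" q] f_one by (simp add: form_def)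
  finally show ?thesis .
qed

lemma form_commute:
  assumes g: "form g w" "\<not> f w" and g': "form g' w'" "\<not> f w'" and q: "q \<in> Q"
  shows "eqv (g (g' q)) (g' (g q))"
proof -
  let ?w = "if f q then w else \<one>" and ?w' = "if f q then w' else \<one>"
  have W: "?w \<in> Q" "?w' \<in> Q" using g g' by (simp_all add: form_def)
  have Q': "g q \<in> Q" "g' q \<in> Q" "eqv (g q) (?w \<otimes> q)" "eqv (g' q) (?w' \<otimes> q)"
    using g g' q by (simp_all add: form_def eqv_def)
  have "eqv (g (g' q)) ((if f (g' q) then w else \<one>) \<otimes> g' q)" using g Q' by (simp add: form_def)
  then have "eqv (g (g' q)) (?w \<otimes> g' q)" using form_f[OF g' q] by simp
  also have "eqv (?w \<otimes> g' q) (?w \<otimes> (?w' \<otimes> q))" by (rule eqv_mult[OF eqv_refl[OF W(1)] Q'(4)])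
  also have "?w \<otimes> (?w' \<otimes> q) = (?w \<otimes> ?w') \<otimes> q" using W q by (simp add: m_assoc)
  also have "eqv ((?w \<otimes> ?w') \<otimes> q) ((?w' \<otimes> ?w) \<otimes> q)" by (rule eqv_mult[OF eqv_comm[OF W] eqv_refl[OF q]])
  also have "(?w' \<otimes> ?w) \<otimes> q = ?w' \<otimes> (?w \<otimes> q)" using W q by (simp add: m_assoc)
  also have "eqv (?w' \<otimes> (?w \<otimes> q)) (?w' \<otimes> g q)" by (rule eqv_mult[OF eqv_refl[OF W(2)] eqv_sym[OF Q'(3)]])
  also have "eqv (?w' \<otimes> g q) (g' (g q))"
  proof (rule eqv_sym)
    have "eqv (g' (g q)) ((if f (g q) then w' else \<one>) \<otimes> g q)" using g' Q' by (simp add: form_def)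
    then show "eqv (g' (g q)) (?w' \<otimes> g q)" using form_f[OF g q] by simp
  qed
  finally show ?thesis .
qed

text \<open>Over the field with two elements a transvection is its own inverse.\<close>

lemma cj_inv_form: assumes q: "q \<in> Q" shows "eqv (cj (inv u) q) ((if f q then e else \<one>) \<otimes> q)"
proof -
  let ?w = "if f q then e else \<one>"
  have uG: "u \<in> carrier G" using u nzrD by blast
  have W: "?w \<in> Q" using u by simp
  have fw: "\<not> f ?w" using fe f_one by simp
  have "eqv (cj u (?w \<otimes> q)) ((if f (?w \<otimes> q) then e else \<one>) \<otimes> (?w \<otimes> q))" using f_form W q by simp
  also have "(if f (?w \<otimes> q) then e else \<one>) = ?w" using f_mult[OF W q] fw by simp
  also have "eqv (?w \<otimes> (?w \<otimes> q)) q" by (rule eqv_sq[OF W q])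
  finally have "eqv (cj (inv u) (cj u (?w \<otimes> q))) (cj (inv u) q)" by (rule eqv_cj[OF nz.m_inv_closed[OF u(1)]])
  then have "eqv (?w \<otimes> q) (cj (inv u) q)" using uG W q by (simp add: cj_inv_cj)
  then show ?thesis by (rule eqv_sym)
qed

text \<open>Suppose \<open>u\<close> fixes the image of its centre under \<alpha>. Then the
  \<alpha>-conjugate \<open>t'\<close> of \<open>u\<close> preserves the linear form
  \<open>f\<close>, so conjugating \<open>u\<close> by \<open>t'\<close> gives a map
  \<open>t1\<close> with the same linear form, and \<open>t1\<close> commutes with \<open>u\<close>
  on the Frattini quotient. The extension axiom makes \<open>t1\<close>, then \<open>t'\<close>,
  then \<alpha> inner.\<close>

lemma moves_center:
  assumes a: "\<alpha> \<in> A" "\<alpha> \<notin> S" shows "f (\<alpha> e)"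
proof (rule ccontr)
  assume fn: "\<not> f (\<alpha> e)"
  have uG: "u \<in> carrier G" using u nzrD by blast
  have iu: "inv u \<in> nzr Q" using u by simp
  let ?e' = "\<alpha> e"
  have e'Q: "?e' \<in> Q" using a u by simp
  \<comment> \<open>\<open>t'\<close> is the \<alpha>-conjugate of the action of \<open>u\<close>,
    and \<open>t''\<close> is its inverse.\<close>
  define t' where "t' = compose Q \<alpha> (compose Q (cjQ u) (iv \<alpha>))"
  define t'' where "t'' = compose Q \<alpha> (compose Q (cjQ (inv u)) (iv \<alpha>))"
  have t'A: "t' \<in> A" and t''A: "t'' \<in> A" using a u iu by (simp_all add: t'_def t''_def A_compose A_cj)
  have t'x: "t' x = \<alpha> (cj u (iv \<alpha> x))" and t''x: "t'' x = \<alpha> (cj (inv u) (iv \<alpha> x))" if "x \<in> Q" for x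
    using that a by (simp_all add: t'_def t''_def compose_def)
  have t't'': "t' (t'' x) = x" if x: "x \<in> Q" for x
  proof -
    have c: "cj (inv u) (iv \<alpha> x) \<in> Q" using x a nzrD(1)[OF iu] by simp
    have "t' (t'' x) = \<alpha> (cj u (iv \<alpha> (\<alpha> (cj (inv u) (iv \<alpha> x)))))" using x t'x[OF A_closed[OF t''A x]] t''x[of x] by simp
    also have "\<dots> = \<alpha> (cj u (cj (inv u) (iv \<alpha> x)))" using c a by simp
    also have "\<dots> = x" using uG x a A_closed[OF iv_A[OF a(1)] x] by (simp add: cj_cj_inv)
    finally show ?thesis .
  qed
  have al: "eqv (\<alpha> ((if b then e else \<one>) \<otimes> iv \<alpha> x)) ((if b then ?e' else \<one>) \<otimes> x)" if "x \<in> Q" for b x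
    using that a u by (auto simp: A_mult A_one intro: eqv_refl)
  have t'f: "eqv (t' x) ((if f (iv \<alpha> x) then ?e' else \<one>) \<otimes> x)" if x: "x \<in> Q" for x
    unfolding t'x[OF x] using eqv_trans[OF eqv_A[OF a(1) f_form[OF A_closed[OF iv_A[OF a(1)] x]]] al[OF x]] .
  have t''f: "eqv (t'' x) ((if f (iv \<alpha> x) then ?e' else \<one>) \<otimes> x)" if x: "x \<in> Q" for x
    unfolding t''x[OF x] using eqv_trans[OF eqv_A[OF a(1) cj_inv_form[OF A_closed[OF iv_A[OF a(1)] x]]] al[OF x]] .
  have ft'': "f (t'' x) \<longleftrightarrow> f x" if x: "x \<in> Q" for x
  proof -
    have "f (t'' x) \<longleftrightarrow> f ((if f (iv \<alpha> x) then ?e' else \<one>) \<otimes> x)" by (rule f_eqv[OF t''f[OF x]])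
    also have "\<dots> \<longleftrightarrow> f x" using f_mult[of "if f (iv \<alpha> x) then ?e' else \<one>" x] x e'Q fn f_one by simp
    finally show ?thesis .
  qed
  have ft'e: "\<not> f (t' e)"
  proof -
    have "f (t' e) \<longleftrightarrow> f ((if f (iv \<alpha> e) then ?e' else \<one>) \<otimes> e)" by (rule f_eqv[OF t'f[OF u(3)]])
    also have "\<dots> \<longleftrightarrow> False" using f_mult[of "if f (iv \<alpha> e) then ?e' else \<one>" e] u(3) e'Q fn f_one fe by simp
    finally show ?thesis by simp
  qed
  \<comment> \<open>The conjugate of \<open>u\<close> by \<open>t'\<close>. Its linear form is that
    of \<open>u\<close> because \<open>t''\<close> preserves \<open>f\<close>; its centre is
    \<open>t' e\<close>.\<close>
  define t1 where "t1 = compose Q t' (compose Q (cjQ u) t'')"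
  have t1A: "t1 \<in> A" unfolding t1_def using t'A t''A u by (simp add: A_compose A_cj)
  have t1x: "t1 x = t' (cj u (t'' x))" if "x \<in> Q" for x using that t''A by (simp add: t1_def compose_def)
  have f1: "form t1 (t' e)"
    unfolding form_def
  proof (intro conjI ballI)
    show "t' e \<in> Q" using t'A u by simp
    fix q assume q: "q \<in> Q"
    have q'': "t'' q \<in> Q" using q t''A by simp
    let ?w = "if f q then e else \<one>"
    have "eqv (cj u (t'' q)) (?w \<otimes> t'' q)" using f_form[OF q''] ft''[OF q] by simp
    then have "eqv (t' (cj u (t'' q))) (t' (?w \<otimes> t'' q))" by (rule eqv_A[OF t'A])
    moreover have "t' (?w \<otimes> t'' q) = (if f q then t' e else \<one>) \<otimes> q"
      using t'A q'' u t't''[OF q] A_one[OF t'A] by (simp add: A_mult)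
    ultimately show "eqv (t1 q) ((if f q then t' e else \<one>) \<otimes> q)" using t1x[OF q] by simp
  qed
  have f0: "form (cj u) e" unfolding form_def using f_form u by blast
  have t1S: "t1 \<in> S"
  proof -
    \<comment> \<open>The commutator of \<open>t1\<close> and \<open>u\<close>. It acts trivially on
      the Frattini quotient and so is induced by some \<open>h\<close>; thus \<open>t1\<close>
      carries the action of \<open>u\<close> to that of \<open>h \<otimes> u\<close>.\<close>
    define k where "k = compose Q (compose Q t1 (cjQ u)) (compose Q (iv t1) (cjQ (inv u)))"
    have kA: "k \<in> A" unfolding k_def using t1A u iu by (simp add: A_compose A_cj)
    have kx: "k x = t1 (cj u (iv t1 (cj (inv u) x)))" if x: "x \<in> Q" for x
    proof -
      have "cj (inv u) x \<in> Q" using nzrD(1)[OF iu x] .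
      then have "iv t1 (cj (inv u) x) \<in> Q" using t1A by simp
      then show ?thesis using x by (simp add: k_def compose_def)
    qed
    have kt: "k (cj u (t1 y)) = t1 (cj u y)" if y: "y \<in> Q" for y
    proof -
      have ty: "t1 y \<in> Q" using y t1A by simp
      have "cj u (t1 y) \<in> Q" using nzrD(1)[OF u(1) ty] .
      then have "k (cj u (t1 y)) = t1 (cj u (iv t1 (cj (inv u) (cj u (t1 y)))))" by (rule kx)
      also have "\<dots> = t1 (cj u y)" using ty uG y t1A by (simp add: cj_inv_cj)
      finally show ?thesis .
    qed
    have "eqv (k x) x" if x: "x \<in> Q" for x
    proof -
      define y where "y = iv t1 (cj (inv u) x)"
      have "cj (inv u) x \<in> Q" using nzrD(1)[OF iu x] .
      then have y: "y \<in> Q" "cj u (t1 y) = x" using t1A x uG by (simp_all add: y_def cj_cj_inv)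
      have "eqv (t1 (cj u y)) (cj u (t1 y))" by (rule form_commute[OF f1 ft'e f0 fe y(1)])
      then show ?thesis using kt[OF y(1)] y(2) by simp
    qed
    then have "k \<in> S" by (rule kernel_in_S[OF kA])
    then obtain h where h: "h \<in> nzr Q" "\<forall>x\<in>Q. k x = cj h x" by (rule S_D)
    show ?thesis
    proof (rule A_extend_S[OF t1A u(1,2) nz.m_closed[OF h(1) u(1)]])
      fix x assume x: "x \<in> Q"
      have tx: "t1 x \<in> Q" using x t1A by simp
      have "t1 (cj u x) = cj h (cj u (t1 x))" using kt[OF x] h(2) nzrD(1)[OF u(1) tx] by simp
      then show "t1 (cj u x) = cj (h \<otimes> u) (t1 x)" using h(1) uG tx nzrD(2)[OF h(1)] by (simp add: mult_cj)
    qed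
  qed
  then obtain h1 where h1: "h1 \<in> nzr Q" "\<forall>x\<in>Q. t1 x = cj h1 x" by (rule S_D)
  have t''t': "t'' (t' x) = x" if "x \<in> Q" for x
    using t't''[of "t' x"] that A_inj[OF t'A, of "t'' (t' x)" x] t'A t''A by simp
  have "t' \<in> S"
  proof (rule A_extend_S[OF t'A u(1,2) h1(1)])
    fix x assume x: "x \<in> Q"
    have "t1 (t' x) = t' (cj u x)" using t1x[of "t' x"] t''t'[OF x] t'A x by simp
    then show "t' (cj u x) = cj h1 (t' x)" using h1(2) t'A x by simp
  qed
  then obtain h2 where h2: "h2 \<in> nzr Q" "\<forall>x\<in>Q. t' x = cj h2 x" by (rule S_D)
  have "\<alpha> \<in> S"
  proof (rule A_extend_S[OF a(1) u(1,2) h2(1)])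
    fix x assume x: "x \<in> Q"
    then show "\<alpha> (cj u x) = cj h2 (\<alpha> x)" using t'x[of "\<alpha> x"] h2(2) a by simp
  qed
  then show False using a by simp
qed

lemma iv_out: assumes "\<alpha> \<in> A" "\<alpha> \<notin> S" shows "iv \<alpha> \<notin> S"
proof
  assume "iv \<alpha> \<in> S"
  then obtain h where h: "h \<in> nzr Q" "\<forall>x\<in>Q. iv \<alpha> x = cj h x" by (rule S_D)
  have "\<alpha> x = cj (inv h) x" if x: "x \<in> Q" for x
  proof -
    have "x = cj h (\<alpha> x)" using h(2)[rule_format, OF A_closed[OF assms(1) x]] iv_left[OF assms(1) x] by simp
    then show ?thesis using x assms nzrD(2)[OF h(1)] A_closed[OF assms(1) x] by (metis Q.mem_carrier cj_inv_cj)
  qed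
  then have "\<alpha> \<in> S" using S_iff[OF assms(1)] nz.m_inv_closed[OF h(1)] by blast
  then show False using assms by simp
qed

text \<open>With \<open>y = cj s (\<alpha> e)\<close>, \<open>moves_center\<close> is applied to
  \<open>iv \<alpha>\<close> and to the conjugates by \<alpha> of the actions of \<open>s\<close>
  and of \<open>inv u \<otimes> s\<close>: the form \<open>f\<close> holds at the images under
  \<open>iv \<alpha>\<close> of \<open>e\<close>, of \<open>y\<close> and of
  \<open>cj (inv u) y\<close>. But the last argument is \<open>e \<otimes> y\<close> up to the
  Frattini subgroup, and \<open>f\<close> is additive.\<close>

lemma normalizer_index_two:
  assumes s: "s \<in> nzr Q" shows "s \<in> Q \<or> inv u \<otimes> s \<in> Q"
proof (rule ccontr)
  assume "\<not> (s \<in> Q \<or> inv u \<otimes> s \<in> Q)"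
  then have sQ: "s \<notin> Q" "inv u \<otimes> s \<notin> Q" by auto
  have uG: "u \<in> carrier G" "s \<in> carrier G" using u s nzrD by blast+
  have iu: "inv u \<in> nzr Q" using u by simp
  obtain \<alpha> where a: "\<alpha> \<in> A" "\<alpha> \<notin> S" by (rule ex_out)
  have b: "iv \<alpha> \<in> A" "iv \<alpha> \<notin> S" using a iv_out by simp_all
  define \<beta> where "\<beta> g = compose Q (iv \<alpha>) (compose Q (cjQ g) \<alpha>)" for g
  have \<beta>A: "\<beta> g \<in> A" if "g \<in> nzr Q" for g unfolding \<beta>_def using that a by (simp add: A_compose A_cj)
  have \<beta>x: "\<beta> g x = iv \<alpha> (cj g (\<alpha> x))" if "x \<in> Q" for g x using that a by (simp add: \<beta>_def compose_def)
  \<comment> \<open>If the conjugated action of \<open>g\<close> were inner, the extension axiom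
    would make \<open>iv \<alpha>\<close> inner.\<close>
  have \<beta>S: "\<beta> g \<notin> S" if g: "g \<in> nzr Q" "g \<notin> Q" for g
  proof
    assume "\<beta> g \<in> S"
    then obtain h where h: "h \<in> nzr Q" "\<forall>x\<in>Q. \<beta> g x = cj h x" by (rule S_D)
    have "iv \<alpha> \<in> S"
    proof (rule A_extend_S[OF b(1) g h(1)])
      fix y assume y: "y \<in> Q"
      then show "iv \<alpha> (cj g y) = cj h (iv \<alpha> y)" using \<beta>x[of "iv \<alpha> y" g] h(2) a by simp
    qed
    then show False using b by simp
  qed
  define y where "y = cj s (\<alpha> e)"
  have ae: "\<alpha> e \<in> Q" using a u by simp
  have yQ: "y \<in> Q" unfolding y_def by (rule nzrD(1)[OF s ae])
  have fy: "f y"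
  proof -
    let ?g = "compose Q (cjQ s) \<alpha>"
    have gA: "?g \<in> A" using a s by (simp add: A_compose A_cj)
    have "?g \<notin> S"
    proof
      assume "?g \<in> S"
      then obtain h where h: "h \<in> nzr Q" "\<forall>x\<in>Q. ?g x = cj h x" by (rule S_D)
      have "\<alpha> x = cj (inv s \<otimes> h) x" if x: "x \<in> Q" for x
      proof -
        have "cj s (\<alpha> x) = cj h x" using h(2) x a by (auto simp: compose_def)
        then have "cj (inv s) (cj s (\<alpha> x)) = cj (inv s) (cj h x)" by simp
        then show ?thesis using x a uG nzrD(2)[OF h(1)] A_closed[OF a(1) x] by (simp add: cj_inv_cj mult_cj)
      qed
      then have "\<alpha> \<in> S" using S_iff[OF a(1)] nz.m_closed[OF nz.m_inv_closed[OF s] h(1)] by blast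
      then show False using a by simp
    qed
    then have "f (?g e)" by (rule moves_center[OF gA])
    then show ?thesis using u ae by (simp add: compose_def y_def)
  qed
  have f1: "f (iv \<alpha> e)" by (rule moves_center[OF b])
  have f2: "f (iv \<alpha> y)" using moves_center[OF \<beta>A[OF s] \<beta>S[OF s sQ(1)]] \<beta>x[OF u(3)] by (simp add: y_def)
  have us: "inv u \<otimes> s \<in> nzr Q" using iu s by simp
  have f3: "f (iv \<alpha> (cj (inv u) y))"
    using moves_center[OF \<beta>A[OF us] \<beta>S[OF us sQ(2)]] \<beta>x[OF u(3)] uG ae by (simp add: y_def mult_cj)
  have "eqv (cj (inv u) y) (e \<otimes> y)" using cj_inv_form[OF yQ] fy by simp
  then have "eqv (iv \<alpha> (cj (inv u) y)) (iv \<alpha> (e \<otimes> y))" by (rule eqv_A[OF b(1)])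
  then have "f (iv \<alpha> (e \<otimes> y))" using f3 f_eqv by blast
  then have "f (iv \<alpha> e \<otimes> iv \<alpha> y)" using b(1) u yQ by (simp add: A_mult)
  then show False using f_mult[of "iv \<alpha> e" "iv \<alpha> y"] b(1) u(3) yQ f1 f2 by simp
qed

end

end

section \<open>Critical subgroups\<close>

context group
begin

lemma normalizer_grows_in:
  assumes ord: "order G = 2 ^ n" and T: "subgroup T G" and Q: "subgroup Q G" "Q \<subseteq> T" "Q \<noteq> T"
  shows "\<exists>x \<in> T. x \<in> nzr Q \<and> x \<notin> Q"
proof -
  interpret T: group "G\<lparr>carrier := T\<rparr>" using T subgroup_imp_group by blast
  obtain k where k: "card T = 2 ^ k" using card_subgroup_prime_power[OF two_is_prime_nat ord T] by blast
  have "subgroup Q (G\<lparr>carrier := T\<rparr>)" using Q T by (simp add: subgroup_incl)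
  then obtain x where x: "x \<in> T.nzr Q" "x \<notin> Q"
    using T.normalizer_grows[of 2 k Q] Q(3) k by (auto simp: order_def)
  have xT: "x \<in> T" using T.nzrD(2)[OF x(1)] by simp
  have "T.cj x q = cj x q" for q
    using T xT by (simp add: T.cj_def cj_def m_inv_consistent)
  then have "cj x ` Q = Q" using x(1) by (simp add: T.nzr_def)
  then have "x \<in> nzr Q" using subgroup.mem_carrier[OF T xT] by (simp add: nzr_def)
  then show ?thesis using x(2) xT by blast
qed

lemma pow_mult_mod:
  assumes N: "N \<lhd> G" and x: "x \<in> carrier G" "y \<in> carrier G" "cm x y \<in> N"
  shows "(x \<otimes> y) [^] (k::int) \<otimes> inv (x [^] k \<otimes> y [^] k) \<in> N"
proof -
  interpret N: normal N G by (rule N)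
  interpret H: group "G Mod N" by (rule N.factorgroup_is_group)
  let ?p = "\<lambda>x. N #> x"
  have mult: "?p (u \<otimes> v) = ?p u \<otimes>\<^bsub>G Mod N\<^esub> ?p v" if "u \<in> carrier G" "v \<in> carrier G" for u v
    using that by (simp add: N.rcos_sum)
  have mem: "?p u \<in> carrier (G Mod N)" if "u \<in> carrier G" for u using that by (auto simp: carrier_FactGroup)
  have eqI: "?p u = ?p v" if "u \<in> carrier G" "v \<in> carrier G" "u \<otimes> inv v \<in> N" for u v
  proof -
    have "u \<in> N #> v" using that N.rcos_module[OF is_group, of v u] by simp
    then show ?thesis using that repr_independence[OF _ _ N.subgroup_axioms] by metis
  qed
  have "x \<otimes> y \<otimes> inv (y \<otimes> x) = cm x y" using x by (simp add: word_simps)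
  then have "?p (x \<otimes> y) = ?p (y \<otimes> x)" using x by (intro eqI) simp_all
  then have comm: "?p x \<otimes>\<^bsub>G Mod N\<^esub> ?p y = ?p y \<otimes>\<^bsub>G Mod N\<^esub> ?p x" using mult[OF x(1,2)] mult[OF x(2,1)] by (simp only:)
  have "?p ((x \<otimes> y) [^] k) = (?p (x \<otimes> y)) [^]\<^bsub>G Mod N\<^esub> k" using N.FactGroup_int_pow[of "x \<otimes> y" k] x by simp
  also have "\<dots> = (?p x \<otimes>\<^bsub>G Mod N\<^esub> ?p y) [^]\<^bsub>G Mod N\<^esub> k" by (simp only: mult[OF x(1,2)])
  also have "\<dots> = ?p x [^]\<^bsub>G Mod N\<^esub> k \<otimes>\<^bsub>G Mod N\<^esub> ?p y [^]\<^bsub>G Mod N\<^esub> k"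
    by (rule H.int_pow_mult_distrib[OF comm mem[OF x(1)] mem[OF x(2)]])
  also have "\<dots> = ?p (x [^] k \<otimes> y [^] k)" using N.FactGroup_int_pow[of x k] N.FactGroup_int_pow[of y k] x mult[of "x [^] k" "y [^] k"] by simp
  finally have "(x \<otimes> y) [^] k \<in> N #> (x [^] k \<otimes> y [^] k)"
    using rcos_self[OF _ N.subgroup_axioms, of "(x \<otimes> y) [^] k"] x by simp
  then show ?thesis using x N.rcos_module[OF is_group, of "x [^] k \<otimes> y [^] k" "(x \<otimes> y) [^] k"] by simp
qed

lemma int_pow_double: "x \<in> carrier G \<Longrightarrow> x [^] (2 * k::int) = x [^] k \<otimes> x [^] k"
  unfolding mult_2 by (rule int_pow_mult)

lemma square_int_pow: assumes "x \<in> carrier G" shows "(x \<otimes> x) [^] (k::int) = x [^] (2 * k)"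
proof -
  have "x \<otimes> x = x [^] (2::int)" using int_pow_double[OF assms, of 1] assms by simp
  then show ?thesis using assms by (simp add: int_pow_pow)
qed

lemma last_int_power_outside:
  assumes "order G = 2 ^ n" "subgroup M G" "y \<in> carrier G" "y \<notin> M"
  obtains i where "y [^] ((2::int) ^ i) \<notin> M" "y [^] ((2::int) ^ Suc i) \<in> M"
proof -
  have "y [^] ((2::nat) ^ i) = y [^] ((2::int) ^ i)" for i using int_pow_int[of G y "2 ^ i"] by simp
  then show ?thesis using last_power_outside[OF assms] that by metis
qed

end

lemma odd_int_decompose:
  assumes "(s::int) \<noteq> 0" obtains j t where "s = 2 ^ j * t" "odd t"
  using multiplicity_decompose'[of s 2] assms by (metis not_is_unit_0 odd_one)

locale critical = noncyclic_derived G D m a c n + nontrivial_automizer G m Q A r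
  for G (structure) and D m a c n Q A r
begin

section \<open>Frattini arguments for \<open>Q\<close> and subgroups contained in
  \<open>M1\<close>\<close>

lemma derived_D: "derived G Q \<subseteq> D"
  unfolding derived_def
proof (rule generate_subgroup_incl[OF _ D_sub])
  show "derived_set G Q \<subseteq> D" using cm_D by (auto simp: cm_def)
qed

lemma moves: "transv u e \<Longrightarrow> \<alpha> \<in> A \<Longrightarrow> \<alpha> \<notin> S \<Longrightarrow> cm u (\<alpha> e) \<notin> Fr"
  using moves_center[of u e \<alpha>] by (simp add: f_def)

lemma even_pow_Fr: assumes "x \<in> Q" "even k" shows "x [^] (k::int) \<in> Fr"
proof -
  obtain j where "k = j + j" using assms(2) by (metis evenE mult_2)
  then have "x [^] k = x [^] j \<otimes> x [^] j" using assms by (simp only: int_pow_mult Q.mem_carrier)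
  then show ?thesis using sq_Fr[OF subgroup_int_pow_closed[OF Q_sub assms(1), of j]] by simp
qed

lemma odd_pow_eqv: assumes "x \<in> Q" "odd k" shows "eqv (x [^] (k::int)) x"
proof -
  have "x [^] k \<otimes> inv x = x [^] (k - 1)" using assms(1) by (simp add: int_pow_diff)
  then show ?thesis using assms even_pow_Fr[OF assms(1), of "k - 1"] subgroup_int_pow_closed[OF Q_sub assms(1), of k]
    by (simp add: eqv_def)
qed

lemma nz_if_cm: assumes "g \<in> carrier G" "\<And>q. q \<in> Q \<Longrightarrow> cm g q \<in> Q" shows "g \<in> nzr Q"
proof (rule nzrI[OF finQ Q.subset assms(1)])
  fix q assume "q \<in> Q"
  then show "cj g q \<in> Q" using assms by (simp add: cj_cm)
qed

lemma above_D_nz: assumes "D \<subseteq> Q" "g \<in> carrier G" shows "g \<in> nzr Q"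
proof (rule nz_if_cm[OF assms(2)])
  fix q assume "q \<in> Q"
  then show "cm g q \<in> Q" using cm_D[of g q] assms by (simp add: subset_iff)
qed

lemma D2_Fr: assumes "D \<subseteq> Q" shows "D2 \<subseteq> Fr"
  using assms sq_Fr by (auto simp: D2_def subset_iff)

lemma L2_Fr: assumes "L \<subseteq> Q" shows "L2 \<subseteq> Fr"
proof
  fix x assume "x \<in> L2"
  then obtain k where "x = l [^] (2 * k::int)" by (auto simp: L2_def)
  moreover have "l \<in> Q" using assms lL by (simp add: subset_iff)
  ultimately show "x \<in> Fr" using even_pow_Fr[of l "2 * k"] by simp
qed

text \<open>The square of the centre of the transvection is a commutator, so its image under an outer
  automorphism squares into D, hence lies in Ph and cannot be moved.\<close>

lemma M1_no_transvection:
  assumes QM: "Q \<subseteq> M1" and u: "u \<in> D" "u \<in> nzr Q" "u \<notin> Q" "u \<otimes> u \<in> Q" and e: "e \<in> Q" "e \<in> D"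
    and cu: "\<And>q. q \<in> Q \<Longrightarrow> \<exists>k. cm u q = e [^] (k::int)" and cPh: "\<And>q. q \<in> Q \<Longrightarrow> q \<in> Ph \<Longrightarrow> cm u q \<in> Fr"
  shows False
proof -
  have alt: "cm u q \<in> Fr \<or> eqv (cm u q) e" if "q \<in> Q" for q
  proof -
    obtain k where "cm u q = e [^] (k::int)" using cu \<open>q \<in> Q\<close> by blast
    then show ?thesis using even_pow_Fr[OF e(1), of k] odd_pow_eqv[OF e(1), of k] by (cases "even k") auto
  qed
  have tr: "transv u e" using u e alt by (simp add: transv_def)
  obtain \<alpha> where a: "\<alpha> \<in> A" "\<alpha> \<notin> S" by (rule ex_out)
  obtain q0 where q0: "q0 \<in> Q" "cm u q0 \<notin> Fr" using trivial_action_mem[OF u(2)] u(3) by metis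
  obtain k where k: "cm u q0 = e [^] (k::int)" using cu q0 by blast
  \<comment> \<open>An even exponent would put the commutator into the Frattini subgroup. Oddness is
    what later places the square of \<open>e\<close> itself, not just a power of it, in the derived
    subgroup of \<open>Q\<close>.\<close>
  have ko: "odd k" using k q0(2) even_pow_Fr[OF e(1), of k] by auto
  have uG: "u \<in> carrier G" "e \<in> carrier G" "q0 \<in> carrier G" using u e q0 by simp_all
  have "cm (u \<otimes> u) q0 = cj u (cm u q0) \<otimes> cm u q0" using uG by (simp add: mult_cm)
  also have "\<dots> = e [^] k \<otimes> e [^] k" using k u(1) e(2) by (simp add: D_pow)
  also have "\<dots> = (e \<otimes> e) [^] k" using e by (simp add: pow_mult_D)
  finally have "cm (u \<otimes> u) q0 = (e \<otimes> e) [^] k" .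
  with cm_derived[OF u(4) q0(1)] have "(e \<otimes> e) [^] k \<in> derived G Q" by (rule subst[rotated])
  then have "e \<otimes> e \<in> derived G Q" by (rule odd_pow_mem[OF ord derived_sub m_closed[OF uG(2) uG(2)] ko])
  then have "\<alpha> (e \<otimes> e) \<in> D" using A_derived[OF a(1)] derived_D by (simp add: subset_iff)
  then have "\<alpha> e \<otimes> \<alpha> e \<in> D" using a e by (simp add: A_mult)
  moreover have "\<alpha> e \<in> M1" using QM a e by (simp add: subset_iff)
  ultimately have "\<alpha> e \<in> Ph" by (intro M1_sq_D)
  then have "cm u (\<alpha> e) \<in> Fr" using cPh a e by simp
  then show False using moves[OF tr a] by simp
qed

lemma D_sub_Q: assumes "L \<subseteq> Q" "z \<in> Q" shows "D \<subseteq> Q"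
proof
  fix p assume "p \<in> D"
  then obtain i j where "p = z [^] (i::int) \<otimes> l [^] (j::int)" using D_zl by blast
  moreover have "l \<in> Q" using assms(1) lL by (simp add: subset_iff)
  ultimately show "p \<in> Q" using subgroup_int_pow_closed[OF Q_sub] assms(2) by simp
qed

text \<open>The transvection is given by \<open>z\<close>, with centre \<open>l\<close>. The square
  of \<open>z\<close> lies in \<open>Q\<close> because its commutators with \<open>Q\<close> are
  squares of elements of \<open>L\<close>, so that it acts trivially on the Frattini
  quotient.\<close>

lemma case_M1_L: assumes QM: "Q \<subseteq> M1" and LQ: "L \<subseteq> Q" and DQ: "\<not> D \<subseteq> Q" shows False
proof -
  have zQ: "z \<notin> Q" using D_sub_Q LQ DQ by blast
  have lQ: "l \<in> Q" using LQ lL by (simp add: subset_iff)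
  have cz: "cm z q \<in> L" if "q \<in> Q" for q
    using cm_flip[OF L_subgroup, of q z] cm_M1_D[of q z] that QM by (simp add: subset_iff)
  have znz: "z \<in> nzr Q" using cz LQ by (intro nz_if_cm) (simp_all add: subset_iff)
  have zz: "z \<otimes> z \<in> Q"
  proof (rule trivial_action_mem)
    show "z \<otimes> z \<in> nzr Q" using znz by simp
    fix q assume q: "q \<in> Q"
    have "cm z q \<in> D" using q by (simp add: cm_D)
    then have "cm (z \<otimes> z) q = cm z q \<otimes> cm z q" using q by (simp add: mult_cm)
    then show "cm (z \<otimes> z) q \<in> Fr" using sq_Fr[of "cm z q"] cz[OF q] LQ by (simp add: subset_iff)
  qed
  show False
  proof (rule M1_no_transvection[OF QM zD znz zQ zz lQ lD])
    show "\<exists>k. cm z q = l [^] (k::int)" if "q \<in> Q" for q using cz[OF that] by (auto simp: L_def)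
    show "cm z q \<in> Fr" if "q \<in> Q" "q \<in> Ph" for q
      using cm_flip[OF L2_subgroup, of q z] cm_Ph_D[of q z] that L2_Fr[OF LQ] by (simp add: subset_iff)
  qed
qed

context
  fixes N :: int and u e
  assumes ue: "u = l [^] N" "e = u \<otimes> u"
begin

lemma ueD: "u \<in> L" "u \<in> D" "e \<in> L" "e \<in> D"
proof -
  show "u \<in> L" using ue by (auto simp: L_def)
  then show "u \<in> D" using L_D by (simp add: subset_iff)
  show "e \<in> L" using \<open>u \<in> L\<close> ue by simp
  then show "e \<in> D" using L_D by (simp add: subset_iff)
qed

lemma e_pow: "e [^] (t::int) = l [^] (2 * t * N)"
proof -
  have "e = l [^] (2 * N)" using ue by (simp add: int_pow_double)
  then show ?thesis by (simp add: int_pow_pow mult_ac)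
qed

text \<open>Commutators of \<open>l\<close> are even powers of \<open>l\<close>, so those of its
  power \<open>u\<close> are powers of the square \<open>e\<close>. The exponent \<open>N\<close> is
  chosen in \<open>L_outside\<close> such that \<open>u\<close> is the last 2-power of
  \<open>l\<close> outside \<open>Q\<close>.\<close>

lemma cm_u: assumes "g \<in> carrier G" shows "\<exists>t. cm u g = e [^] (t::int)"
proof -
  obtain t where "cm g l = l [^] (2 * t::int)" using cm_L[OF assms lL] by (auto simp: L2_def)
  then have "cm g u = e [^] t" unfolding e_pow using assms by (simp add: ue(1) cm_D_pow int_pow_pow)
  then have "cm u g = e [^] (-t)" using inv_cm[of g u] assms ueD by (simp add: int_pow_neg)
  then show ?thesis by blast
qed

lemma cm_u_Ph: assumes "g \<in> Ph" shows "\<exists>t. cm u g = (e \<otimes> e) [^] (t::int)"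
proof -
  obtain t where "cm g l = l [^] (4 * t::int)" using cm_Ph_L[OF assms lL] by (auto simp: L4_def)
  then have "cm g u = e [^] (2 * t)" unfolding e_pow using assms by (simp add: ue(1) cm_D_pow int_pow_pow)
  also have "\<dots> = (e \<otimes> e) [^] t" using ueD by (simp add: square_int_pow DcG)
  finally have "cm u g = (e \<otimes> e) [^] (-t)" using inv_cm[of g u] assms ueD by (simp add: int_pow_neg)
  then show ?thesis by blast
qed

text \<open>Elements of \<open>M\<close> outside \<open>Ph\<close> invert \<open>l\<close> modulo
  \<open>L4\<close>; hence the exponent of \<open>e\<close> in the commutator is odd, in contrast to
  \<open>cm_u_Ph\<close>.\<close>

lemma cm_u_out: assumes "g \<in> M - Ph" shows "\<exists>t. cm u g = e \<otimes> (e \<otimes> e) [^] (t::int)"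
proof -
  have gG: "g \<in> carrier G" using assms by simp
  obtain t where t: "cm g l \<otimes> (l \<otimes> l) = l [^] (4 * t::int)" using cm_out_L[OF assms lL] by (auto simp: L4_def)
  have ll: "l \<otimes> l = l [^] (2::int)" using int_pow_mult[of l 1 1] by simp
  have "cm g l = l [^] (4 * t) \<otimes> inv (l \<otimes> l)" using t gG by (simp add: inv_solve_right)
  also have "\<dots> = l [^] (4 * t - 2)" by (simp add: ll int_pow_diff)
  finally have "cm g u = l [^] ((4 * t - 2) * N)" using gG ue by (simp add: cm_D_pow int_pow_pow)
  also have "(4 * t - 2) * N = 2 * (2 * t - 1) * N" by (simp add: algebra_simps)
  finally have "cm g u = e [^] (2 * t - 1)" using e_pow by simp
  then have "cm u g = e [^] (1 + 2 * (-t))" using inv_cm[of g u] gG ueD by (simp flip: int_pow_neg)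
  also have "\<dots> = e \<otimes> (e \<otimes> e) [^] (-t)" using ueD int_pow_mult[of e 1 "2 * (-t)"] by (simp add: square_int_pow DcG)
  finally show ?thesis by blast
qed

end

lemma L_outside: assumes "\<not> L \<subseteq> Q"
  obtains N :: int and u e where "u = l [^] N" "e = u \<otimes> u" "u \<notin> Q" "e \<in> Q" "u \<in> nzr Q"
    "\<forall>x\<in>L \<inter> Q. \<exists>k. x = e [^] (k::int)"
proof -
  have "l \<notin> Q"
  proof
    assume "l \<in> Q"
    then have "L \<subseteq> Q" using subgroup_int_pow_closed[OF Q_sub] by (auto simp: L_def)
    then show False using assms by simp
  qed
  then obtain i where i: "l [^] ((2::int) ^ i) \<notin> Q" "l [^] ((2::int) ^ Suc i) \<in> Q"
    using last_int_power_outside[OF ord Q_sub lG] by blast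
  define u where "u = l [^] ((2::int) ^ i)"
  have e: "u \<otimes> u \<in> Q" using i(2) by (simp add: u_def int_pow_double)
  have "u \<in> nzr Q"
  proof (rule nz_if_cm)
    fix q assume "q \<in> Q"
    then obtain t where "cm u q = (u \<otimes> u) [^] (t::int)" using cm_u[OF u_def refl, of q] by auto
    then show "cm u q \<in> Q" using subgroup_int_pow_closed[OF Q_sub e] by simp
  qed (simp add: u_def)
  moreover have "\<exists>k. x = (u \<otimes> u) [^] (k::int)" if x: "x \<in> L" "x \<in> Q" for x
  proof -
    obtain s where s: "x = l [^] (s::int)" using x by (auto simp: L_def)
    show ?thesis
    proof (cases "s = 0")
      case True then show ?thesis using s by (intro exI[of _ "0::int"]) simp
    next
      case False
      then obtain j t where j: "s = 2 ^ j * t" "odd t" by (rule odd_int_decompose)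
      have "(l [^] ((2::int) ^ j)) [^] t \<in> Q" using x(2) s j(1) by (simp add: int_pow_pow)
      then have lj: "l [^] ((2::int) ^ j) \<in> Q" by (rule odd_pow_mem[OF ord Q_sub int_pow_closed[OF lG] j(2)])
      \<comment> \<open>Otherwise \<open>u\<close> would be a power of an element of
        \<open>Q\<close>.\<close>
      have "Suc i \<le> j"
      proof (rule ccontr)
        assume "\<not> Suc i \<le> j"
        then have "(2::int) ^ i = 2 ^ j * 2 ^ (i - j)" by (simp flip: power_add)
        then have "l [^] ((2::int) ^ i) = (l [^] ((2::int) ^ j)) [^] ((2::int) ^ (i - j))" by (simp only: int_pow_pow[OF lG])
        then show False using subgroup_int_pow_closed[OF Q_sub lj] i(1) by simp
      qed
      then have "(2::int) ^ j = 2 ^ Suc i * 2 ^ (j - Suc i)" by (simp only: le_add_diff_inverse power_add[symmetric])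
      then have "s = 2 * 2 ^ i * (2 ^ (j - Suc i) * t)" using j(1) by simp
      then have "x = (u \<otimes> u) [^] (2 ^ (j - Suc i) * t)" using s by (simp add: u_def square_int_pow int_pow_pow mult_ac)
      then show ?thesis by blast
    qed
  qed
  ultimately show ?thesis using that[OF u_def refl, unfolded u_def[symmetric]] i(1) e by (auto simp: u_def)
qed

lemma case_M1_noL: assumes QM: "Q \<subseteq> M1" and LQ: "\<not> L \<subseteq> Q" shows False
proof -
  obtain N :: int and u e where ue: "u = l [^] N" "e = u \<otimes> u" "u \<notin> Q" "e \<in> Q" "u \<in> nzr Q"
    by (rule L_outside[OF LQ])
  note d = ueD[OF ue(1,2)]
  show False
  proof (rule M1_no_transvection[OF QM d(2) ue(5) ue(3) _ ue(4) d(4)])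
    show "u \<otimes> u \<in> Q" using ue by simp
    show "\<exists>k. cm u q = e [^] (k::int)" if "q \<in> Q" for q using cm_u[OF ue(1,2)] that by simp
    show "cm u q \<in> Fr" if q: "q \<in> Q" "q \<in> Ph" for q
    proof -
      obtain t where "cm u q = (e \<otimes> e) [^] (t::int)" using cm_u_Ph[OF ue(1,2) q(2)] by blast
      then show ?thesis using subgroup_int_pow_closed[OF Fr_sub sq_Fr[OF ue(4)]] by simp
    qed
  qed
qed

lemma M1_split: assumes "x \<in> M1 - Ph" shows "\<exists>y\<in>Ph. x = a \<otimes> y"
proof -
  obtain k p where x: "x = a [^] (k::int) \<otimes> p" "p \<in> D" using assms by (auto simp: cyc_def)
  have k: "odd k" using assms x even_pow_Ph by blast
  have "x = a \<otimes> (a [^] (k - 1) \<otimes> p)"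
    using x int_pow_mult[of a 1 "k - 1"] by (simp add: m_assoc)
  then show ?thesis using even_pow_Ph[OF x(2), of "k - 1"] k by (intro bexI[of _ "a [^] (k - 1) \<otimes> p"]) simp_all
qed

text \<open>Since \<open>Q\<close> contains \<open>D\<close>, it is normal in \<open>G\<close>.
  Commutators of \<open>c\<close> with \<open>Ph\<close> lie in \<open>K\<close>, so
  \<open>c\<close> acts as a transvection with centre \<open>l\<close> and \<open>Q\<close> would
  have index two in \<open>G\<close>; but neither \<open>a\<close> nor
  \<open>inv c \<otimes> a\<close> lies in \<open>M\<close>.\<close>

lemma case_M1_D_Ph: assumes QP: "Q \<subseteq> Ph" and DQ: "D \<subseteq> Q" shows False
proof -
  have QM: "Q \<subseteq> M" using QP Ph_M by (rule order_trans)
  have cnz: "c \<in> nzr Q" by (rule above_D_nz[OF DQ cG])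
  have cQ: "c \<notin> Q" using QP c_out Ph_M1 by blast
  have lQ: "l \<in> Q" using DQ lD by (simp add: subset_iff)
  have alt: "cm c q \<in> Fr \<or> eqv (cm c q) l" if q: "q \<in> Q" for q
  proof -
    have "cm c q \<in> K" using cm_flip[OF K_sub, of q c] cm_Ph_c[of q] q QP by (simp add: subset_iff)
    then obtain j d where jd: "cm c q = l [^] (j::int) \<otimes> d" "d \<in> D2" by (auto simp: K_def)
    have dF: "d \<in> Fr" using jd D2_Fr[OF DQ] by (simp add: subset_iff)
    have dQ: "d \<in> Q" using dF Fr_Q by (simp add: subset_iff)
    have ljQ: "l [^] j \<in> Q" by (rule subgroup_int_pow_closed[OF Q_sub lQ])
    show ?thesis
    proof (cases "even j")
      case True
      then show ?thesis using jd(1) dF even_pow_Fr[OF lQ True] by simp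
    next
      case False
      have "eqv (l [^] j \<otimes> d) (l [^] j \<otimes> \<one>)" using dF dQ ljQ by (intro eqv_mult eqv_refl) (simp_all add: eqv_def)
      then have "eqv (l [^] j \<otimes> d) (l [^] j)" by simp
      then show ?thesis using jd(1) odd_pow_eqv[OF lQ False] eqv_trans by metis
    qed
  qed
  have tr: "transv c l" using cnz cQ lQ alt cm_c[OF lD] D2_Fr[OF DQ] by (simp add: transv_def subset_iff)
  have "a \<in> Q \<or> inv c \<otimes> a \<in> Q" by (rule normalizer_index_two[OF tr above_D_nz[OF DQ aG]])
  then show False
  proof
    assume "a \<in> Q" then show False using QM a_not_M by blast
  next
    assume "inv c \<otimes> a \<in> Q"
    then have "c \<otimes> (inv c \<otimes> a) \<in> M" using QM M.m_closed[OF cM] by (simp add: subset_iff)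
    then show False using a_not_M by (simp add: cancel_left_inv)
  qed
qed

text \<open>\<open>D\<close> modulo \<open>L\<close> is cyclic, generated by \<open>z\<close>, and
  therefore has only one element of order two. The proof compares the 2-parts of exponents.\<close>

lemma D_mod_L_involution:
  assumes w: "w \<in> D" "w \<notin> L" "w \<otimes> w \<in> L" and i: "z [^] ((2::int) ^ i) \<notin> L" "z [^] ((2::int) ^ Suc i) \<in> L"
  shows "w \<otimes> inv (z [^] ((2::int) ^ i)) \<in> L"
proof -
  obtain s t where st: "w = z [^] (s::int) \<otimes> l [^] (t::int)" using D_zl[OF w(1)] by blast
  have lt: "l [^] t \<in> L" by (auto simp: L_def)
  have zs: "z [^] s \<notin> L" using st lt w(2) L.m_closed by metis
  have "s \<noteq> 0" using zs by (intro notI) simp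
  then obtain j o' where j: "s = 2 ^ j * o'" "odd o'" by (rule odd_int_decompose)
  have "z [^] (s + s) = w \<otimes> w \<otimes> inv (l [^] t \<otimes> l [^] t)"
  proof -
    have "w \<otimes> w = z [^] s \<otimes> z [^] s \<otimes> (l [^] t \<otimes> l [^] t)" unfolding st by (simp add: D_ac D_pow)
    then show ?thesis unfolding int_pow_mult[OF zG] by (simp add: m_assoc)
  qed
  then have "z [^] (s + s) \<in> L" using w(3) lt by simp
  moreover have "s + s = 2 ^ Suc j * o'" using j(1) by simp
  then have "z [^] (s + s) = (z [^] ((2::int) ^ Suc j)) [^] o'" by (simp only: int_pow_pow[OF zG])
  ultimately have "(z [^] ((2::int) ^ Suc j)) [^] o' \<in> L" by simp
  then have 1: "z [^] ((2::int) ^ Suc j) \<in> L" by (rule odd_pow_mem[OF ord L_subgroup int_pow_closed[OF zG] j(2)])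
  have up: "z [^] ((2::int) ^ q) \<in> L" if "z [^] ((2::int) ^ p) \<in> L" "p \<le> q" for p q
  proof -
    have "(2::int) ^ q = 2 ^ p * 2 ^ (q - p)" using that(2) by (simp flip: power_add)
    then show ?thesis using subgroup_int_pow_closed[OF L_subgroup that(1), of "2 ^ (q - p)"] by (simp add: int_pow_pow)
  qed
  have "j \<ge> i" using up[OF 1, of i] i(1) by (meson not_less_eq_eq)
  moreover have "j \<le> i"
  proof (rule ccontr)
    assume "\<not> j \<le> i"
    then have "z [^] ((2::int) ^ j) \<in> L" using up[OF i(2), of j] by simp
    then have "(z [^] ((2::int) ^ j)) [^] o' \<in> L" by (rule subgroup_int_pow_closed[OF L_subgroup])
    then show False using zs j(1) by (simp add: int_pow_pow)
  qed
  ultimately have "j = i" by simp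
  obtain o2 where o2: "o' = 2 * o2 + 1" using j(2) by (rule oddE)
  have se: "s - 2 ^ i = 2 ^ Suc i * o2" using j(1) \<open>j = i\<close> o2 by (simp add: algebra_simps)
  have "w \<otimes> inv (z [^] ((2::int) ^ i)) = z [^] (s - 2 ^ i) \<otimes> l [^] t"
    unfolding st by (simp add: int_pow_diff D_ac D_pow)
  also have "z [^] (s - 2 ^ i) = (z [^] ((2::int) ^ Suc i)) [^] o2" unfolding se by (simp add: int_pow_pow)
  also have "\<dots> \<otimes> l [^] t \<in> L" using subgroup_int_pow_closed[OF L_subgroup i(2)] lt by simp
  finally show ?thesis .
qed

text \<open>Here \<open>Q\<close> is \<open>M1\<close>, and \<open>c\<close> acts as a transvection
  with centre \<open>z\<close>, so that an outer \<alpha> moves \<open>z\<close> outside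
  \<open>Ph\<close>. As \<alpha> preserves the derived subgroup \<open>L\<close> of
  \<open>Q\<close>, the elements \<open>z\<close> and \<open>\<alpha> z\<close> have the same order
  modulo \<open>L\<close>. Comparing it with the order \<open>2^n\<close> of
  \<open>\<alpha> z\<close> modulo \<open>D\<close> leaves two cases, both impossible.\<close>

lemma case_M1_D: assumes QM: "Q \<subseteq> M1" and DQ: "D \<subseteq> Q" shows False
proof -
  have "\<not> Q \<subseteq> Ph" using case_M1_D_Ph DQ by blast
  then obtain x where x: "x \<in> Q" "x \<notin> Ph" by blast
  obtain k p where kp: "x = a [^] (k::int) \<otimes> p" "p \<in> D" using x QM by (auto simp: cyc_def)
  have k: "odd k" using x kp even_pow_Ph by blast
  have "x \<otimes> inv p = a [^] k" using kp by (simp add: m_assoc)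
  moreover have "x \<otimes> inv p \<in> Q" using x kp(2) DQ by (simp add: subset_iff)
  ultimately have "a [^] k \<in> Q" by (rule subst)
  then have aQ: "a \<in> Q" by (rule odd_pow_mem[OF ord Q_sub aG k])
  have QeqM1: "Q = M1" using QM cyc_least[OF Q_sub aQ DQ] by (rule subset_antisym)
  have zQ: "z \<in> Q" and lQ: "l \<in> Q" using DQ by (simp_all add: subset_iff)
  have LD: "L \<subseteq> Q" using L_D DQ by (rule order_trans)
  obtain d where d: "d \<in> D2" "a [^] ((2::int) ^ n) = l \<otimes> d" using a_top by (auto simp flip: z_def l_def)
  have ev: "even ((2::int) ^ n)" using n2 by simp
  have dF: "d \<in> Fr" using d D2_Fr[OF DQ] by (simp add: subset_iff)
  \<comment> \<open>As \<open>a\<close> is in \<open>Q\<close>, its even power equal to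
    \<open>l \<otimes> d\<close> is in the Frattini subgroup, and with it \<open>l\<close> and all
    of \<open>K\<close>.\<close>
  have "l \<otimes> d \<in> Fr" using even_pow_Fr[OF aQ ev] d(2) by simp
  then have "l \<otimes> d \<otimes> inv d \<in> Fr" using dF by blast
  then have lF: "l \<in> Fr" using dF by (simp add: m_assoc)
  have KF: "K \<subseteq> Fr" using D2_Fr[OF DQ] subgroup_int_pow_closed[OF Fr_sub lF] by (auto simp: K_def subset_iff)
  have cnz: "c \<in> nzr Q" by (rule above_D_nz[OF DQ cG])
  have cQ: "c \<notin> Q" using QM c_out by blast
  have cPh: "cm c q \<in> K" if "q \<in> Ph" for q using cm_flip[OF K_sub, of q c] cm_Ph_c[of q] that by simp
  have cout: "\<exists>\<kappa>\<in>K. cm c q = inv z \<otimes> \<kappa>" if q: "q \<in> M1 - Ph" for q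
  proof -
    obtain y where y: "y \<in> Ph" "q = a \<otimes> y" using M1_split[OF q] by blast
    have "cm c q = cm c a \<otimes> cj a (cm c y)" using y by (simp add: cm_mult)
    also have "cm c a = inv z" using inv_cm[of a c] by (simp add: z_def)
    finally have "cm c q = inv z \<otimes> cj a (cm c y)" .
    moreover have "cj a (cm c y) \<in> K" using cPh[OF y(1)] K_normal by (simp add: normal_cj)
    ultimately show ?thesis by blast
  qed
  have alt: "cm c q \<in> Fr \<or> eqv (cm c q) z" if q: "q \<in> Q" for q
  proof (cases "q \<in> Ph")
    case True
    then show ?thesis using cPh[OF True] KF by (simp add: subset_iff)
  next
    case False
    then obtain \<kappa> where \<kappa>: "\<kappa> \<in> K" "cm c q = inv z \<otimes> \<kappa>" using cout q QM by blast
    have \<kappa>D: "\<kappa> \<in> D" "\<kappa> \<in> Fr" using \<kappa> K_D KF by (simp_all add: subset_iff)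
    have "inv z \<otimes> \<kappa> \<otimes> inv z = \<kappa> \<otimes> inv (z \<otimes> z)" using \<kappa>D by (simp add: D_ac inv_mult_group)
    also have "\<dots> \<in> Fr" using \<kappa>D sq_Fr[OF zQ] by simp
    finally have "eqv (cm c q) z" using \<kappa> \<kappa>D(1) zQ DQ by (simp add: eqv_def subset_iff)
    then show ?thesis by simp
  qed
  have tr: "transv c z" using cnz cQ zQ alt cm_c[OF zD] D2_Fr[OF DQ] by (simp add: transv_def subset_iff)
  obtain \<alpha> where al: "\<alpha> \<in> A" "\<alpha> \<notin> S" by (rule ex_out)
  define a' where "a' = \<alpha> z"
  have a'Q: "a' \<in> Q" using al zQ by (simp add: a'_def)
  have "cm c a' \<notin> Fr" unfolding a'_def by (rule moves[OF tr al])
  then have a'P: "a' \<in> M1 - Ph" using a'Q QM cPh KF by (auto simp: subset_iff)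
  have dL: "derived G Q = L"
  proof
    show "derived G Q \<subseteq> L" unfolding derived_def
    proof (rule generate_subgroup_incl[OF _ L_subgroup])
      show "derived_set G Q \<subseteq> L" using cm_M1 QM by (auto simp: cm_def subset_iff)
    qed
    show "L \<subseteq> derived G Q"
    proof
      fix y assume "y \<in> L"
      then obtain i where "y = l [^] (i::int)" by (auto simp: L_def)
      then have "y = cm a (z [^] i)" by (simp add: cm_a_z)
      then show "y \<in> derived G Q" using cm_derived[OF aQ] subgroup_int_pow_closed[OF Q_sub zQ] by simp
    qed
  qed
  have alL: "\<alpha> y \<in> L" if "y \<in> L" for y using A_derived[OF al(1)] dL that by simp
  have ivL: "iv \<alpha> y \<in> L" if "y \<in> L" for y using A_derived[OF iv_A[OF al(1)]] dL that by simp
  have iva': "iv \<alpha> a' = z" using al zQ by (simp add: a'_def)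
  have zL: "z \<notin> L"
  proof
    assume "z \<in> L"
    then have "a' \<in> Ph" using alL L_D D_Ph by (auto simp: a'_def subset_iff)
    then show False using a'P by simp
  qed
  \<comment> \<open>The order of \<open>z\<close> modulo \<open>L\<close>, and hence that of
    \<open>a'\<close>, is \<open>2^(i+1)\<close>. The order of \<open>a'\<close> modulo
    \<open>D\<close> is \<open>2^n\<close>, so \<open>n \<le> i + 1\<close>.\<close>
  obtain i where i: "z [^] ((2::int) ^ i) \<notin> L" "z [^] ((2::int) ^ Suc i) \<in> L"
    by (rule last_int_power_outside[OF ord L_subgroup zG zL])
  have a'i: "a' [^] ((2::int) ^ i) \<notin> L"
  proof
    assume "a' [^] ((2::int) ^ i) \<in> L"
    from ivL[OF this] show False using i(1) iva' A_int_pow[OF iv_A[OF al(1)] a'Q] by simp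
  qed
  have a'Si: "a' [^] ((2::int) ^ Suc i) \<in> L"
    using alL[OF i(2)] A_int_pow[OF al(1) zQ, of "2 ^ Suc i"] by (simp only: a'_def)
  obtain k' p' where kp': "a' = a [^] (k'::int) \<otimes> p'" "p' \<in> D" using a'P by (auto simp: cyc_def)
  have k': "odd k'" using a'P kp' even_pow_Ph by blast
  have a'G: "a' \<in> carrier G" using a'Q by simp
  have a'D: "a' [^] (t::int) \<in> D \<longleftrightarrow> 2 ^ n dvd t" for t
  proof -
    have "a' \<otimes> inv (a [^] k') = cj (a [^] k') p'" using kp' by (simp add: cj_def)
    then have "a' \<otimes> inv (a [^] k') \<in> D" using kp' by simp
    then have r: "a' [^] t \<otimes> inv ((a [^] k') [^] t) \<in> D" (is "?r \<in> D") using a'G by (intro coset_pow[OF D]) simp_all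
    have 1: "a' [^] t = ?r \<otimes> (a [^] k') [^] t" using a'G by (simp add: m_assoc)
    have 2: "(a [^] k') [^] t = inv ?r \<otimes> a' [^] t" using a'G by (simp add: inv_mult_group m_assoc)
    have "a' [^] t \<in> D \<longleftrightarrow> (a [^] k') [^] t \<in> D" using 1 2 r D.m_closed D.m_inv_closed by metis
    also have "\<dots> \<longleftrightarrow> 2 ^ n dvd k' * t" using a_pow by (simp add: int_pow_pow)
    also have "\<dots> \<longleftrightarrow> 2 ^ n dvd t" using k' by (simp add: coprime_dvd_mult_right_iff)
    finally show ?thesis .
  qed
  have "a' [^] ((2::int) ^ Suc i) \<in> D" using a'Si L_D by (simp add: subset_iff)
  then have "(2::int) ^ n dvd 2 ^ Suc i" using a'D by blast
  then have ni: "n \<le> Suc i" 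
    using power_dvd_imp_le[of 2 n "Suc i"] of_nat_dvd_iff[of "2 ^ n" "2 ^ Suc i", where ?'a = int] by simp
  show False
  proof (cases "n \<le> i")
    case True
    define w1 where "w1 = a' [^] ((2::int) ^ i)"
    define z1 where "z1 = z [^] ((2::int) ^ i)"
    have w1D: "w1 \<in> D" using a'D[of "2 ^ i"] True le_imp_power_dvd[of n i "2::int"] by (simp add: w1_def)
    have "w1 \<otimes> w1 = a' [^] ((2::int) ^ Suc i)" using a'G by (simp add: w1_def int_pow_double)
    then have w1s: "w1 \<otimes> w1 \<in> L" using a'Si by simp
    \<comment> \<open>Both \<open>w1\<close> and \<open>z1\<close> have order two modulo
      \<open>L\<close> and lie in \<open>D\<close>, so they agree modulo \<open>L\<close>.\<close>
    have wz: "w1 \<otimes> inv z1 \<in> L" unfolding z1_def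
      by (rule D_mod_L_involution[OF w1D _ w1s i]) (use a'i in \<open>simp add: w1_def\<close>)
    have z1D: "z1 \<in> D" by (simp add: z1_def D_pow)
    obtain \<kappa> where \<kappa>: "\<kappa> \<in> K" "cm c a' = inv z \<otimes> \<kappa>" using cout[OF a'P] by blast
    have \<kappa>D: "\<kappa> \<in> D" using \<kappa> K_D by (simp add: subset_iff)
    have \<kappa>L: "\<kappa> [^] ((2::int) ^ i) \<in> L"
    proof -
      obtain j e where je: "\<kappa> = l [^] (j::int) \<otimes> e" "e \<in> D2" using \<kappa>(1) by (auto simp: K_def)
      then obtain q where q: "q \<in> D" "e = q \<otimes> q" by (auto simp: D2_def)
      obtain s t where st: "q = z [^] (s::int) \<otimes> l [^] (t::int)" using D_zl[OF q(1)] by blast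
      have "e [^] ((2::int) ^ i) = q [^] ((2::int) ^ Suc i)" using q by (simp add: square_int_pow)
      also have "\<dots> = (z [^] ((2::int) ^ Suc i)) [^] s \<otimes> (l [^] t) [^] ((2::int) ^ Suc i)"
        unfolding st by (simp add: pow_mult_D D_pow int_pow_pow mult.commute)
      also have "\<dots> \<in> L" using subgroup_int_pow_closed[OF L_subgroup i(2), of s] by (auto simp: L_def int_pow_pow intro!: L.m_closed[unfolded L_def, simplified])
      finally have eL: "e [^] ((2::int) ^ i) \<in> L" .
      have "\<kappa> [^] ((2::int) ^ i) = (l [^] j) [^] ((2::int) ^ i) \<otimes> e [^] ((2::int) ^ i)"
        unfolding je(1) using je(2) D2_D by (simp add: pow_mult_D D_pow subset_iff)
      moreover have "(l [^] j) [^] ((2::int) ^ i) \<in> L" by (auto simp: L_def int_pow_pow)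
      ultimately show ?thesis using eL by simp
    qed
    \<comment> \<open>Conjugation by \<open>c\<close> multiplies \<open>a'\<close> by
      \<open>d'\<close>, which is the inverse of \<open>z\<close> up to a factor in
      \<open>K\<close>. Since \<open>M1\<close> is abelian modulo \<open>L\<close>, the power with
      exponent \<open>2^i\<close> is taken factorwise: the contribution of \<open>d'\<close> cancels
      \<open>w1\<close>, so the conjugate of \<open>w1\<close>, and then \<open>w1\<close>, would be
      in \<open>L\<close>.\<close>
    define d' where "d' = cm c a'"
    have d'D: "d' \<in> D" using a'G by (simp add: d'_def cm_D)
    have "d' \<otimes> a' = cj c a'" using a'G by (simp add: cj_cm d'_def)
    then have "cj c w1 = (d' \<otimes> a') [^] ((2::int) ^ i)" using a'G by (simp add: w1_def cj_int_pow)
    moreover have "(d' \<otimes> a') [^] ((2::int) ^ i) \<otimes> inv (d' [^] ((2::int) ^ i) \<otimes> a' [^] ((2::int) ^ i)) \<in> L"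
    proof (rule pow_mult_mod[OF L_normal])
      have "d' \<in> M1" using d'D D_Ph Ph_M1 by (simp add: subset_iff)
      then show "cm d' a' \<in> L" using a'P by (intro cm_M1) simp_all
    qed (use d'D a'G in simp_all)
    ultimately have c1: "cj c w1 \<otimes> inv (d' [^] ((2::int) ^ i) \<otimes> w1) \<in> L" by (simp add: w1_def)
    have d'w: "d' [^] ((2::int) ^ i) \<otimes> w1 \<in> L"
    proof -
      have "d' [^] ((2::int) ^ i) = inv z1 \<otimes> \<kappa> [^] ((2::int) ^ i)"
        unfolding d'_def \<kappa>(2) using \<kappa>D by (simp add: pow_mult_D int_pow_inv z1_def)
      then have "d' [^] ((2::int) ^ i) \<otimes> w1 = \<kappa> [^] ((2::int) ^ i) \<otimes> (w1 \<otimes> inv z1)"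
        using \<kappa>D z1D w1D by (simp add: D_ac D_pow)
      then show ?thesis using \<kappa>L wz by simp
    qed
    have "cj c w1 = cj c w1 \<otimes> inv (d' [^] ((2::int) ^ i) \<otimes> w1) \<otimes> (d' [^] ((2::int) ^ i) \<otimes> w1)"
      using d'D w1D by (simp add: m_assoc)
    then have "cj c w1 \<in> L" using c1 d'w L.m_closed by metis
    then have "cj (inv c) (cj c w1) \<in> L" by (rule cj_L[rotated]) simp
    then have "w1 \<in> L" using w1D by (simp add: cj_inv_cj)
    then show False using a'i by (simp add: w1_def)
  next
    case False
    then have nS: "n = Suc i" using ni by simp
    have wL: "a' [^] ((2::int) ^ n) \<in> L" using a'Si nS by simp
    then obtain s where s: "a' [^] ((2::int) ^ n) = l [^] (s::int)" by (auto simp: L_def)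
    obtain e where e: "e \<in> D2" "a' [^] ((2::int) ^ n) = l \<otimes> e" using M1_out_pow[OF a'P] by blast
    have so: "odd s"
    proof
      assume "even s"
      then have "l \<otimes> e \<in> D2" using even_pow_D2[OF lD] s e by simp
      then show False using l_D2_out[OF e(1)] by simp
    qed
    \<comment> \<open>The odd power \<open>l^s\<close> generates \<open>L\<close>, and
      \<open>\<alpha> l\<close> lies in \<open>L\<close>. Applying \<open>iv \<alpha>\<close> makes
      \<open>l\<close> a power of \<open>z^(2^n)\<close>, a square in \<open>D\<close>, against the
      independence of \<open>l\<close>.\<close>
    have iz: "iv \<alpha> (l [^] s) = z [^] ((2::int) ^ n)"
      using A_int_pow[OF iv_A[OF al(1)] a'Q, of "2 ^ n"] s iva' by simp
    have lH: "l \<in> {(l [^] s) [^] (k::int) |k. True}"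
    proof (rule odd_pow_mem[OF ord subgroup_powers lG so])
      show "l [^] s \<in> {(l [^] s) [^] (k::int) |k. True}" by (auto intro!: exI[of _ "1::int"])
    qed simp
    then obtain v where v: "l = (l [^] s) [^] (v::int)" by blast
    obtain t where t: "\<alpha> l = l [^] (t::int)" using alL[OF lL] by (auto simp: L_def)
    have "l = iv \<alpha> (\<alpha> l)" using al lQ by simp
    also have "\<alpha> l = ((l [^] s) [^] v) [^] t" using t v by simp
    also have "\<dots> = (l [^] s) [^] (v * t)" by (simp add: int_pow_pow mult.assoc)
    also have "iv \<alpha> \<dots> = (z [^] ((2::int) ^ n)) [^] (v * t)"
      using A_int_pow[OF iv_A[OF al(1)] subgroup_int_pow_closed[OF Q_sub lQ, of s]] iz by simp
    also have "\<dots> \<in> D2" using subgroup_int_pow_closed[OF D2_subgroup even_pow_D2[OF zD ev]] by simp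
    finally show False using l_not_D2[of 1] by simp
  qed
qed

lemma case_M1: "Q \<subseteq> M1 \<Longrightarrow> False"
  using case_M1_D case_M1_L case_M1_noL by blast

end

section \<open>Subgroups contained in \<open>M\<close>\<close>

context critical
begin

text \<open>The subgroup generated by the square of the centre of the transvection is normal in the whole
  group; modulo it, Q is the centralizer of the image of that centre.\<close>

lemma case_M_noL:
  assumes QM: "Q \<subseteq> M" and LQ: "\<not> L \<subseteq> Q"
  shows False
proof -
  obtain N :: int and u e where ue: "u = l [^] N" "e = u \<otimes> u" "u \<notin> Q" "e \<in> Q" "u \<in> nzr Q"
    and LQe: "\<forall>x\<in>L \<inter> Q. \<exists>k. x = e [^] (k::int)"
    by (rule L_outside[OF LQ])
  note d = ueD[OF ue(1,2)]
  have uG: "u \<in> carrier G" and eG: "e \<in> carrier G" using d by simp_all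
  have e2F: "(e \<otimes> e) [^] (t::int) \<in> Fr" for t by (rule subgroup_int_pow_closed[OF Fr_sub sq_Fr[OF ue(4)]])
  have cPh: "cm u q \<in> Fr" if "q \<in> Ph" for q using cm_u_Ph[OF ue(1,2) that] e2F by auto
  have cout: "eqv (cm u q) e" if q: "q \<in> M - Ph" for q
  proof -
    obtain t where t: "cm u q = e \<otimes> (e \<otimes> e) [^] (t::int)" using cm_u_out[OF ue(1,2) q] by blast
    have "(e \<otimes> e) [^] t \<in> Q" using e2F Fr_Q by (simp add: subset_iff)
    moreover have "e \<otimes> (e \<otimes> e) [^] t \<otimes> inv e = (e \<otimes> e) [^] t" using d by (simp add: D_ac D_pow cancel_left_inv)
    ultimately show ?thesis using t ue(4) e2F by (simp add: eqv_def)
  qed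
  have tr: "transv u e"
    unfolding transv_def using ue d cPh cout QM by (auto simp: subset_iff)
  \<comment> \<open>Otherwise all commutators of \<open>u\<close> with \<open>Q\<close> would be in
    the Frattini subgroup, and \<open>u\<close> would belong to \<open>Q\<close>.\<close>
  have eF: "e \<notin> Fr"
  proof
    assume eF: "e \<in> Fr"
    have "cm u q \<in> Fr" if q: "q \<in> Q" for q
    proof (cases "q \<in> Ph")
      case False
      then have "eqv (cm u q) e" using cout q QM by blast
      moreover have "eqv e \<one>" using eF ue(4) by (simp add: eqv_def)
      ultimately have "eqv (cm u q) \<one>" by (rule eqv_trans)
      then show ?thesis using q uG by (simp add: eqv_def)
    qed (rule cPh)
    then have "u \<in> Q" by (rule trivial_action_mem[OF ue(5)])
    then show False using ue(3) by simp
  qed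
  obtain \<alpha> where al: "\<alpha> \<in> A" "\<alpha> \<notin> S" by (rule ex_out)
  define c' where "c' = \<alpha> e"
  have c'Q: "c' \<in> Q" using al ue(4) by (simp add: c'_def)
  have c'G: "c' \<in> carrier G" using c'Q by simp
  have "cm u c' \<notin> Fr" unfolding c'_def by (rule moves[OF tr al])
  then have c'out: "c' \<in> M - Ph" using cPh c'Q QM by blast
  define Z0 where "Z0 = {(e \<otimes> e) [^] (k::int) |k. True}"
  have Z0s: "subgroup Z0 G" unfolding Z0_def using eG by (intro subgroup_powers) simp
  interpret Z0: subgroup Z0 G by (rule Z0s)
  have eeZ: "(e \<otimes> e) [^] (k::int) \<in> Z0" for k by (auto simp: Z0_def)
  have eeZ0: "e \<otimes> e \<in> Z0" using eeZ[of 1] eG by simp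
  have Z0Q: "Z0 \<subseteq> Q" using subgroup_int_pow_closed[OF Q_sub, of "e \<otimes> e"] ue(4) by (auto simp: Z0_def)
  have Z0F: "Z0 \<subseteq> Fr" using e2F by (auto simp: Z0_def)
  have Z0D: "Z0 \<subseteq> D" using d by (auto simp: Z0_def D_pow)
  have eZ0: "e \<notin> Z0" using eF Z0F by blast
  have Z0n: "Z0 \<lhd> G"
    unfolding normal_cj
  proof (intro conjI ballI Z0s)
    fix g x assume g: "g \<in> carrier G" and "x \<in> Z0"
    then obtain k where x: "x = (e \<otimes> e) [^] (k::int)" by (auto simp: Z0_def)
    obtain s where s: "cj g l = l [^] (s::int)" using cj_L[OF g lL] by (auto simp: L_def)
    have "cj g u = u [^] s" using g s by (simp add: ue(1) cj_int_pow int_pow_pow mult.commute)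
    then have "cj g e = e [^] s" using g d ue(2) by (simp add: cj_mult pow_mult_D)
    then have "cj g (e \<otimes> e) = (e \<otimes> e) [^] s" using g d by (simp add: cj_mult pow_mult_D)
    then have "cj g x = (e \<otimes> e) [^] (s * k)" using g x eG by (simp add: cj_int_pow int_pow_pow)
    then show "cj g x \<in> Z0" by (simp add: eeZ)
  qed
  have cjZ0: "cj g x \<in> Z0" if "g \<in> carrier G" "x \<in> Z0" for g x using that Z0n by (simp add: normal_cj)
  have cm_e: "cm e q \<in> Z0" if q: "q \<in> Q" for q
  proof -
    obtain t where t: "cm u q = e [^] (t::int)" using cm_u[OF ue(1,2), of q] q by auto
    have "cm e q = cj u (cm u q) \<otimes> cm u q" unfolding ue(2) using uG q by (simp add: mult_cm)
    also have "\<dots> = e [^] t \<otimes> e [^] t" using d t by (simp add: D_pow)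
    also have "\<dots> = (e \<otimes> e) [^] t" using d by (simp add: pow_mult_D)
    finally show ?thesis by (simp add: eeZ)
  qed
  have cm_e_out: "\<exists>t. cm e c' = (e \<otimes> e) [^] (1 + 2 * t::int)"
  proof -
    obtain t where t: "cm u c' = e \<otimes> (e \<otimes> e) [^] (t::int)" using cm_u_out[OF ue(1,2) c'out] by blast
    have t': "cm u c' = e [^] (1 + 2 * t)" using t eG by (simp add: int_pow_mult square_int_pow)
    have "cm e c' = cj u (cm u c') \<otimes> cm u c'" unfolding ue(2) using uG c'G by (simp add: mult_cm)
    also have "\<dots> = e [^] (1 + 2 * t) \<otimes> e [^] (1 + 2 * t)" using d t' by (simp add: D_pow)
    also have "\<dots> = (e \<otimes> e) [^] (1 + 2 * t)" using d by (simp add: pow_mult_D)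
    finally show ?thesis by blast
  qed
  \<comment> \<open>The commutator of \<open>c'\<close> and \<open>e\<close> generates
    \<open>Z0\<close>, its exponent being odd. It is the image under \<alpha> of a commutator of
    \<open>e\<close> with an element of \<open>Q\<close>, hence in the image of \<open>Z0\<close>.
    So \<open>Z0\<close> is contained in its image, and the orders agree.\<close>
  have alZ0: "\<alpha> ` Z0 = Z0"
  proof -
    have aZs: "subgroup (\<alpha> ` Z0) G"
    proof
      show "\<alpha> ` Z0 \<subseteq> carrier G" using Z0Q al by (auto simp: subset_iff)
      show "\<one> \<in> \<alpha> ` Z0" using A_one[OF al(1)] Z0.one_closed by (metis imageI)
      show "x \<otimes> y \<in> \<alpha> ` Z0" if xy: "x \<in> \<alpha> ` Z0" "y \<in> \<alpha> ` Z0" for x y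
      proof -
        obtain x' where x': "x' \<in> Z0" "x = \<alpha> x'" using xy(1) by blast
        obtain y' where y': "y' \<in> Z0" "y = \<alpha> y'" using xy(2) by blast
        have "x \<otimes> y = \<alpha> (x' \<otimes> y')" using x' y' Z0Q A_mult[OF al(1)] by (simp add: subset_iff)
        then show ?thesis using Z0.m_closed[OF x'(1) y'(1)] by simp
      qed
      show "inv x \<in> \<alpha> ` Z0" if x: "x \<in> \<alpha> ` Z0" for x
      proof -
        obtain x' where x': "x' \<in> Z0" "x = \<alpha> x'" using x by blast
        have "inv x = \<alpha> (inv x')" using x' Z0Q A_inv[OF al(1)] by (simp add: subset_iff)
        then show ?thesis using Z0.m_inv_closed[OF x'(1)] by simp
      qed
    qed
    obtain t where t: "cm e c' = (e \<otimes> e) [^] (1 + 2 * t::int)" using cm_e_out by blast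
    have "cm c' e = \<alpha> (cm e (iv \<alpha> e))" using al ue(4) by (simp add: A_cm c'_def)
    moreover have "cm e (iv \<alpha> e) \<in> Z0" using al ue(4) by (intro cm_e) simp
    ultimately have "cm c' e \<in> \<alpha> ` Z0" by simp
    then have "cm e c' \<in> \<alpha> ` Z0" by (rule cm_flip[OF aZs c'G eG])
    then have "(e \<otimes> e) [^] (1 + 2 * t) \<in> \<alpha> ` Z0" by (simp only: t)
    from odd_pow_mem[OF ord aZs m_closed[OF eG eG] _ this] have "e \<otimes> e \<in> \<alpha> ` Z0" by simp
    then have ek: "(e \<otimes> e) [^] (k::int) \<in> \<alpha> ` Z0" for k by (rule subgroup_int_pow_closed[OF aZs])
    have sub: "Z0 \<subseteq> \<alpha> ` Z0"
    proof
      fix w assume "w \<in> Z0"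
      then obtain k where "w = (e \<otimes> e) [^] (k::int)" by (auto simp: Z0_def)
      then show "w \<in> \<alpha> ` Z0" using ek by simp
    qed
    have finZ: "finite Z0" using finQ Z0Q by (rule rev_finite_subset)
    have "card (\<alpha> ` Z0) \<le> card Z0" using finZ by (rule card_image_le)
    then show ?thesis using card_subset_eq[of "\<alpha> ` Z0" Z0] sub finZ card_mono[OF _ sub] by (metis finite_imageI le_antisym)
  qed
  \<comment> \<open>\<open>e\<close> is central in \<open>Q\<close> modulo \<open>Z0\<close>;
    applying \<alpha> gives the same for \<open>c'\<close>.\<close>
  have cm_c': "cm c' q \<in> Z0" if q: "q \<in> Q" for q
  proof -
    have "cm c' q = \<alpha> (cm e (iv \<alpha> q))" using al ue(4) q by (simp add: A_cm c'_def)
    moreover have "cm e (iv \<alpha> q) \<in> Z0" using al q by (intro cm_e) simp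
    ultimately show ?thesis using alZ0 by blast
  qed
  have cm_c'2: "cm q c' \<in> Z0" if "q \<in> Q" for q using cm_flip[OF Z0s c'G _ cm_c'[OF that]] that by simp
  \<comment> \<open>Such a commutator is a power of \<open>e\<close>, because it lies in
    \<open>L\<close> and \<open>Q\<close>. It also lies in the Frattini subgroup, which does not
    contain \<open>e\<close>, so the exponent is even.\<close>
  have cm_PhQ: "cm g g' \<in> Z0" if g: "g \<in> Q" "g \<in> Ph" "g' \<in> Q" "g' \<in> Ph" for g g'
  proof -
    have "cm g g' \<in> L" using cm_Ph[OF g(2,4)] L2_L by (simp add: subset_iff)
    moreover have F: "cm g g' \<in> Fr" by (rule cm_Fr[OF g(1,3)])
    moreover have "cm g g' \<in> Q" using F Fr_Q by (simp add: subset_iff)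
    ultimately obtain k where k: "cm g g' = e [^] (k::int)" using LQe by blast
    have "even k"
    proof (rule ccontr)
      assume "odd k"
      then have "eqv e (e [^] k)" using odd_pow_eqv[OF ue(4)] eqv_sym by blast
      moreover have "eqv (e [^] k) \<one>" using F k subgroup_int_pow_closed[OF Q_sub ue(4)] by (simp add: eqv_def eG)
      ultimately have "eqv e \<one>" by (rule eqv_trans)
      then show False using eF eG by (simp add: eqv_def)
    qed
    then obtain j where "k = 2 * j" by (rule evenE)
    then have "cm g g' = (e \<otimes> e) [^] j" using k eG by (simp add: square_int_pow)
    then show ?thesis by (simp add: eeZ)
  qed
  have cuc: "\<exists>w\<in>Z0. cm u c' = e \<otimes> w" using cm_u_out[OF ue(1,2) c'out] eeZ by blast
  have nz2: "x \<in> Q \<or> (\<exists>q\<in>Q. x = u \<otimes> q)" if x: "x \<in> nzr Q" for x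
    using normalizer_index_two[OF tr x]
  proof
    assume "inv u \<otimes> x \<in> Q"
    moreover have "x = u \<otimes> (inv u \<otimes> x)" using uG nzrD(2)[OF x] by (simp add: cancel_left_inv)
    ultimately show ?thesis by blast
  qed simp
  have cm_uq: "\<exists>w\<in>Z0. cm (u \<otimes> q) c' = e \<otimes> w" if q: "q \<in> Q" for q
  proof -
    obtain w where w: "w \<in> Z0" "cm u c' = e \<otimes> w" using cuc by blast
    let ?v = "cj u (cm q c')"
    have v: "?v \<in> Z0" by (rule cjZ0[OF uG cm_c'2[OF q]])
    have vD: "?v \<in> D" "w \<in> D" using v w Z0D by (simp_all add: subset_iff)
    have "cm (u \<otimes> q) c' = ?v \<otimes> (e \<otimes> w)" using uG q c'G w(2) by (simp add: mult_cm)
    also have "\<dots> = e \<otimes> (?v \<otimes> w)" using vD d by (simp add: D_lcomm)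
    finally show ?thesis using Z0.m_closed[OF v w(1)] by blast
  qed
  \<comment> \<open>\<open>?T\<close> is the preimage of the centralizer of \<open>c'\<close> modulo
    \<open>Z0\<close>. Were it larger than \<open>Q\<close>, it would contain an element
    \<open>u \<otimes> q\<close> of the normalizer, whose commutator with \<open>c'\<close> is
    \<open>e\<close> modulo \<open>Z0\<close>.\<close>
  have TQ: "x \<in> Q" if x: "x \<in> carrier G" "cm x c' \<in> Z0" for x
  proof -
    let ?T = "{x \<in> carrier G. \<forall>p\<in>{c'}. cm x p \<in> Z0}"
    have T: "subgroup ?T G" using c'G by (intro subgroup_cm_into[OF Z0n]) simp
    have QT: "Q \<subseteq> ?T" using cm_c'2 by auto
    have "Q = ?T"
    proof (rule ccontr)
      assume "Q \<noteq> ?T"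
      then obtain y where y: "y \<in> ?T" "y \<in> nzr Q" "y \<notin> Q" using normalizer_grows_in[OF ord T Q_sub QT] by blast
      then obtain q where q: "q \<in> Q" "y = u \<otimes> q" using nz2[OF y(2)] by blast
      obtain w where w: "w \<in> Z0" "cm y c' = e \<otimes> w" using cm_uq[OF q(1)] q(2) by blast
      then have "e \<otimes> w \<in> Z0" using y(1) by simp
      then have "e \<otimes> w \<otimes> inv w \<in> Z0" using w(1) by blast
      then show False using eZ0 w(1) eG by (simp add: m_assoc)
    qed
    then show ?thesis using x by blast
  qed
  \<comment> \<open>Each \<open>s\<close> in \<open>K\<close> is the commutator of some
    \<open>x\<close> in \<open>Ph\<close> with \<open>c'\<close>. If \<open>s\<close> is in
    \<open>Q\<close>, this \<open>x\<close> normalizes \<open>Q\<close>; so it lies in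
    \<open>Q\<close> or in the coset of \<open>u\<close>, which places \<open>s\<close> in
    \<open>Z0\<close> or in its coset by \<open>e\<close>.\<close>
  have UK: "\<exists>k. s = e [^] (k::int)" if s: "s \<in> Q" "s \<in> K" for s
  proof -
    obtain x where x: "x \<in> Ph" "cm x c' = s" using cm_Ph_onto_K[OF c'out s(2)] by blast
    have xG: "x \<in> carrier G" using x by simp
    have sD: "s \<in> D" using s K_D by (simp add: subset_iff)
    have sP: "s \<in> Ph" using sD D_Ph by (simp add: subset_iff)
    have cc: "cj x c' = s \<otimes> c'" using x c'G by (simp add: cj_cm)
    \<comment> \<open>Conjugation by \<open>x\<close> sends \<open>c'\<close> to
      \<open>s \<otimes> c'\<close>. So the commutator of \<open>cj x g\<close> with
      \<open>c'\<close> differs from a conjugate of \<open>cm g c'\<close> only by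
      \<open>cm g s\<close>, and both are in \<open>Z0\<close>.\<close>
    have gP: "cj x g \<in> Q" if g: "g \<in> Q" "g \<in> Ph" for g
    proof (rule TQ)
      let ?g = "cj x g"
      show gG: "?g \<in> carrier G" using g xG by simp
      have "cj x (cm g c') = cm ?g (s \<otimes> c')" using cj_cm_distrib[of g x c'] xG g c'G cc by simp
      moreover have "cm ?g (s \<otimes> c') = cm ?g s \<otimes> cj s (cm ?g c')" using gG sD c'G by (intro cm_mult) simp_all
      moreover have "cj s (cm ?g c') = cm ?g c'" using sD gG c'G by (simp add: cm_D)
      moreover have "cm ?g s = cm g s"
      proof -
        have "?g = cm x g \<otimes> g" using xG g by (simp add: cj_cm)
        moreover have "cm x g \<in> D" using xG g by (simp add: cm_D)
        ultimately show ?thesis using g sD by (simp add: cm_D_mult_left)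
      qed
      ultimately have eq: "cj x (cm g c') = cm g s \<otimes> cm ?g c'" by simp
      have gs: "cm g s \<in> Z0" by (rule cm_PhQ[OF g s(1) sP])
      have "cm ?g c' = inv (cm g s) \<otimes> cj x (cm g c')" unfolding eq using g sD gG c'G by (simp add: cancel_left_inv)
      then show "cm ?g c' \<in> Z0" using gs cjZ0[OF xG cm_c'2[OF g(1)]] by simp
    qed
    have "x \<in> nzr Q"
    proof (rule nzrI[OF finQ Q.subset xG])
      fix q assume q: "q \<in> Q"
      show "cj x q \<in> Q"
      proof (cases "q \<in> Ph")
        case True then show ?thesis using gP q by simp
      next
        case False
        then have qo: "q \<in> M - Ph" using q QM by blast
        have ic: "inv c' \<in> M - Ph"
        proof
          show "inv c' \<in> M" using c'out by blast
          show "inv c' \<notin> Ph" using c'out Ph.m_inv_closed[of "inv c'"] by auto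
        qed
        have "inv c' \<otimes> q \<in> Ph" by (rule M_out_mult[OF ic qo])
        then have "cj x (inv c' \<otimes> q) \<in> Q" using c'Q q by (intro gP) simp_all
        moreover have "cj x q = (s \<otimes> c') \<otimes> cj x (inv c' \<otimes> q)"
          using xG c'G q by (simp add: cj_mult[symmetric] cancel_left_inv flip: cc)
        ultimately show ?thesis using s(1) c'Q by simp
      qed
    qed
    then consider "x \<in> Q" | q where "q \<in> Q" "x = u \<otimes> q" using nz2 by blast
    then show ?thesis
    proof cases
      case 1
      then have "s \<in> Z0" using cm_c'2 x(2) by blast
      then obtain k where "s = (e \<otimes> e) [^] (k::int)" by (auto simp: Z0_def)
      then show ?thesis using eG by (auto simp: square_int_pow)
    next
      case 2
      then obtain w where w: "w \<in> Z0" "s = e \<otimes> w" using cm_uq[OF 2(1)] x(2) by metis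
      then obtain k where "w = (e \<otimes> e) [^] (k::int)" by (auto simp: Z0_def)
      then have "s = e [^] (1 + 2 * k)" using w(2) eG by (simp add: square_int_pow int_pow_mult)
      then show ?thesis by blast
    qed
  qed
  have finD: "finite D" using fin D.subset by (rule rev_finite_subset)
  \<comment> \<open>\<open>U\<close> is the full preimage of \<open>Z0\<close> under the
    homomorphism \<open>cm c'\<close> on \<open>D\<close>, whose image is \<open>D2\<close>. The
    kernel is the same on both groups, so \<open>U\<close> is at least three times as large as
    \<open>Z0\<close>, whereas the cyclic group of \<open>e\<close> is at most twice as
    large.\<close>
  define U where "U = Q \<inter> D"
  have Us: "subgroup U G" unfolding U_def using Q_sub D_sub by (rule subgroups_Inter_pair)
  have finU: "finite U" using finD by (simp add: U_def)
  have Uiff: "p \<in> U \<longleftrightarrow> cm c' p \<in> Z0" if p: "p \<in> D" for p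
  proof
    assume "p \<in> U" then show "cm c' p \<in> Z0" using cm_c' by (simp add: U_def)
  next
    assume "cm c' p \<in> Z0"
    then have "cm p c' \<in> Z0" using p by (intro cm_flip[OF Z0s c'G]) simp_all
    then show "p \<in> U" using TQ[of p] p by (simp add: U_def)
  qed
  have Z0D2: "Z0 \<subseteq> D2"
    using d by (auto simp: Z0_def intro!: subgroup_int_pow_closed[OF D2_subgroup] D2I)
  have imD: "cm c' ` D = D2"
  proof
    show "cm c' ` D \<subseteq> D2" using cm_M_D c'out by auto
    show "D2 \<subseteq> cm c' ` D" using cm_out_onto_D2[OF c'out] by (metis imageI subsetI)
  qed
  have imU: "cm c' ` U = Z0"
  proof
    show "cm c' ` U \<subseteq> Z0" using cm_c' by (auto simp: U_def)
    show "Z0 \<subseteq> cm c' ` U"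
    proof
      fix w assume w: "w \<in> Z0"
      then obtain p where "p \<in> D" "cm c' p = w" using cm_out_onto_D2[OF c'out, of w] Z0D2 by blast
      then show "w \<in> cm c' ` U" using Uiff[of p] w by (metis imageI)
    qed
  qed
  have ker: "{x \<in> U. cm c' x = \<one>} = {x \<in> D. cm c' x = \<one>}"
    using Uiff by (auto simp: U_def)
  have cD: "card D = card {x \<in> D. cm c' x = \<one>} * card D2"
    using card_kernel_image[OF D_sub finD, of "cm c'"] imD c'G by (simp add: cm_D_mult)
  have cU: "card U = card {x \<in> D. cm c' x = \<one>} * card Z0"
    using card_kernel_image[OF Us finU, of "cm c'"] imU ker c'G by (simp add: cm_D_mult U_def)
  have finZ: "finite Z0" using finD Z0D by (rule rev_finite_subset)
  have "Z0 \<noteq> {}" using Z0.one_closed by blast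
  then have posZ: "card Z0 > 0" using finZ by (simp add: card_gt_0_iff)
  have "D2 \<noteq> {}" using D2.one_closed by blast
  then have posD: "card D2 > 0" using finite_subset[OF D2_D finD] by (simp add: card_gt_0_iff)
  have "3 * card D2 \<le> card {x \<in> D. cm c' x = \<one>} * card D2" using card_D cD by simp
  then have "3 \<le> card {x \<in> D. cm c' x = \<one>}" using posD by simp
  then have cU3: "3 * card Z0 \<le> card U" using cU by simp
  have "\<not> U \<subseteq> {e [^] (k::int) |k. True}"
  proof
    assume sub: "U \<subseteq> {e [^] (k::int) |k. True}"
    have "{e [^] (k::int) |k. True} \<subseteq> Z0 \<union> (\<lambda>w. e \<otimes> w) ` Z0"
    proof
      fix y assume "y \<in> {e [^] (k::int) |k. True}"
      then obtain k where y: "y = e [^] (k::int)" by blast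
      show "y \<in> Z0 \<union> (\<lambda>w. e \<otimes> w) ` Z0"
      proof (cases "even k")
        case True
        then obtain j where "k = 2 * j" by (rule evenE)
        then show ?thesis using y eeZ[of j] eG by (simp add: square_int_pow)
      next
        case False
        then obtain j where "k = 2 * j + 1" by (rule oddE)
        then have "y = e [^] (1 + 2 * j)" using y by (simp add: add.commute)
        then have "y = e \<otimes> (e \<otimes> e) [^] j" using eG by (simp add: square_int_pow int_pow_mult)
        then show ?thesis using eeZ[of j] by blast
      qed
    qed
    then have "card U \<le> card (Z0 \<union> (\<lambda>w. e \<otimes> w) ` Z0)" using sub finZ by (intro card_mono) auto
    also have "\<dots> \<le> card Z0 + card ((\<lambda>w. e \<otimes> w) ` Z0)" by (rule card_Un_le)
    also have "\<dots> \<le> card Z0 + card Z0" using card_image_le[OF finZ] by simp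
    finally show False using cU3 posZ by simp
  qed
  \<comment> \<open>Such an \<open>s\<close> is outside \<open>K\<close>, while its square lies in
    \<open>K\<close> and \<open>Q\<close> and is a power of \<open>e\<close>. Hence the commutator
    of \<open>a\<close> with this square is in \<open>Z0\<close>; being an odd power of
    \<open>l \<otimes> l\<close>, it brings \<open>l \<otimes> l\<close> and then \<open>e\<close>
    into \<open>Z0\<close>.\<close>
  then obtain s where s: "s \<in> Q" "s \<in> D" "\<nexists>k. s = e [^] (k::int)" by (auto simp: U_def)
  have sK: "s \<notin> K" using UK[OF s(1)] s(3) by blast
  have "s \<otimes> s \<in> K" using D2I[OF s(2)] D2_K by (simp add: subset_iff)
  then obtain k where k: "s \<otimes> s = e [^] (k::int)" using UK[of "s \<otimes> s"] s(1) by auto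
  have "cm a e \<in> Z0"
  proof -
    obtain t where t: "cm u a = e [^] (t::int)" using cm_u[OF ue(1,2), of a] by auto
    have "cm e a = cj u (cm u a) \<otimes> cm u a" unfolding ue(2) using uG by (simp add: mult_cm)
    also have "\<dots> = e [^] t \<otimes> e [^] t" using d t by (simp add: D_pow)
    also have "\<dots> = (e \<otimes> e) [^] t" using d by (simp add: pow_mult_D)
    finally have "cm e a \<in> Z0" by (simp add: eeZ)
    then show ?thesis by (rule cm_flip[OF Z0s eG aG])
  qed
  then have 1: "cm a (s \<otimes> s) \<in> Z0" unfolding k using d by (simp add: cm_D_pow subgroup_int_pow_closed[OF Z0s])
  obtain k1 where k1: "odd k1" "cm a s = l [^] (k1::int)" using cm_a_out_K[OF s(2) sK] by blast
  have "cm a (s \<otimes> s) = (l \<otimes> l) [^] k1" using s(2) k1(2) by (simp add: cm_D_mult pow_mult_D)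
  then have "(l \<otimes> l) [^] k1 \<in> Z0" using 1 by simp
  then have "l \<otimes> l \<in> Z0" by (rule odd_pow_mem[OF ord Z0s m_closed[OF lG lG] k1(1)])
  then have "(l \<otimes> l) [^] N \<in> Z0" by (rule subgroup_int_pow_closed[OF Z0s])
  moreover have "(l \<otimes> l) [^] N = e" using ue by (simp add: pow_mult_D)
  ultimately show False using eZ0 by simp
qed

text \<open>For an outer \<alpha> the images of \<open>e\<close> under \<alpha> and
  \<open>iv \<alpha>\<close> are in \<open>M\<close> outside \<open>Ph\<close>. Multiplying
  \<open>h\<close> by \<open>e\<close> if necessary gives an \<open>h1\<close> whose preimage is in
  \<open>Ph\<close>. Then the commutator of \<open>\<alpha> e\<close> with \<open>h1\<close> is in
  \<open>D2\<close> by the assumption on images, although by \<open>cm_Ph_out\<close> it behaves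
  like the commutator with \<open>c\<close>.\<close>

lemma no_transvection_with_h:
  assumes QM: "Q \<subseteq> M" and tr: "transv u e" and e: "e \<in> D"
    and Ph: "\<And>q. q \<in> Q \<Longrightarrow> q \<in> Ph \<Longrightarrow> cm u q \<in> Fr"
    and h: "h \<in> Q" "h \<in> Ph" "cm h c \<notin> D2"
    and im: "\<And>\<alpha> x. \<alpha> \<in> A \<Longrightarrow> x \<in> Q \<Longrightarrow> x \<in> Ph \<Longrightarrow> \<alpha> (cm e x) \<in> D2"
  shows False
proof -
  have eQ: "e \<in> Q" using tr by (simp add: transv_def)
  obtain \<alpha> where al: "\<alpha> \<in> A" "\<alpha> \<notin> S" by (rule ex_out)
  have iv: "iv \<alpha> \<in> A" "iv \<alpha> \<notin> S" using al iv_out[OF tr al] by simp_all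
  have out: "\<beta> e \<in> M - Ph" if b: "\<beta> \<in> A" "\<beta> \<notin> S" for \<beta>
  proof -
    have "\<beta> e \<in> Q" using b eQ by simp
    moreover have "\<beta> e \<notin> Ph" using moves[OF tr b] Ph[of "\<beta> e"] \<open>\<beta> e \<in> Q\<close> by blast
    ultimately show ?thesis using QM by blast
  qed
  have ePh: "e \<in> Ph" using e D_Ph by (simp add: subset_iff)
  have co: "c \<in> M - Ph" using c_Ph[of \<one>] by simp
  have "\<exists>h1. h1 \<in> Q \<and> h1 \<in> Ph \<and> cm h1 c \<notin> D2 \<and> iv \<alpha> h1 \<in> Ph"
  proof (cases "iv \<alpha> h \<in> Ph")
    case True then show ?thesis using h by blast
  next
    case False
    then have "iv \<alpha> h \<in> M - Ph" using QM h(1) iv(1) by (auto simp: subset_iff)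
    then have "iv \<alpha> h \<otimes> iv \<alpha> e \<in> Ph" by (rule M_out_mult[OF _ out[OF iv]])
    then have "iv \<alpha> (h \<otimes> e) \<in> Ph" using iv(1) h(1) eQ by (simp add: A_mult)
    moreover have "cm (h \<otimes> e) c \<notin> D2" by (rule cm_mult_D_out[OF h(2) e co h(3)])
    ultimately show ?thesis using h eQ ePh by (intro exI[of _ "h \<otimes> e"]) simp
  qed
  then obtain h1 where h1: "h1 \<in> Q" "h1 \<in> Ph" "cm h1 c \<notin> D2" "iv \<alpha> h1 \<in> Ph" by blast
  have "cm (\<alpha> e) h1 = \<alpha> (cm e (iv \<alpha> h1))" using al eQ h1(1) by (simp add: A_cm)
  moreover have "\<alpha> (cm e (iv \<alpha> h1)) \<in> D2" using im[OF al(1) _ h1(4)] iv(1) h1(1) by simp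
  ultimately have "cm (\<alpha> e) h1 \<in> D2" by simp
  then have "cm h1 (\<alpha> e) \<in> D2" using al eQ h1(1) by (intro cm_flip[OF D2_subgroup, of "\<alpha> e" h1]) simp_all
  then show False using cm_Ph_out(2)[OF h1(2) out[OF al]] h1(3) by simp
qed

text \<open>An element \<open>h\<close> as in \<open>no_transvection_with_h\<close> is constructed
  in every case. The transvection is given by the last 2-power of \<open>z\<close> outside
  \<open>Q\<close> if \<open>D\<close> is not contained in \<open>Q\<close>, and by \<open>a\<close>
  with centre \<open>z\<close> otherwise.\<close>

lemma case_M_L:
  assumes QM: "Q \<subseteq> M" and QP: "\<not> Q \<subseteq> Ph" and LQ: "L \<subseteq> Q"
  shows False
proof -
  obtain g0 where g0: "g0 \<in> Q" "g0 \<in> M - Ph" using QM QP by blast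
  have g0G: "g0 \<in> carrier G" using g0 by simp
  have lQ: "l \<in> Q" using LQ lL by (simp add: subset_iff)
  have L2F: "L2 \<subseteq> Fr" by (rule L2_Fr[OF LQ])
  have L2Q: "L2 \<subseteq> Q" using L2_L LQ by (rule order_trans)
  have L2d: "L2 \<subseteq> derived G Q"
    by (rule L2_powers[OF derived_sub cm_out_gen_L2[OF g0(2) derived_sub cm_derived[OF g0(1) lQ]]])
  obtain y where y: "y \<in> Ph" "cm y g0 = l" using cm_Ph_onto_K[OF g0(2), of l] L_K lL by (auto simp: subset_iff)
  have yG: "y \<in> carrier G" using y by simp
  have split: "\<exists>x. x \<in> Q \<and> x \<in> Ph \<and> q = g0 \<otimes> x" if q: "q \<in> Q" "q \<notin> Ph" for q
  proof -
    have ig: "inv g0 \<in> M - Ph"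
    proof
      show "inv g0 \<in> M" using g0 by blast
      show "inv g0 \<notin> Ph" using g0 Ph.m_inv_closed[of "inv g0"] by auto
    qed
    have "inv g0 \<otimes> q \<in> Ph" using M_out_mult[OF ig] q QM by blast
    then show ?thesis using g0 q by (intro exI[of _ "inv g0 \<otimes> q"]) (simp add: cancel_left_inv)
  qed
  have cyP: "cm y q \<in> L2" if "q \<in> Ph" for q by (rule cm_Ph[OF y(1) that])
  have cyo: "\<exists>w\<in>L2. cm y q = l \<otimes> w" if q: "q \<in> Q" "q \<notin> Ph" for q
  proof -
    obtain x where x: "x \<in> Q" "x \<in> Ph" "q = g0 \<otimes> x" using split[OF q] by blast
    have "cm y q = l \<otimes> cj g0 (cm y x)" using x yG g0G y(2) by (simp add: cm_mult)
    moreover have "cj g0 (cm y x) \<in> L2" using cyP[OF x(2)] L2_normal g0G by (simp add: normal_cj)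
    ultimately show ?thesis by blast
  qed
  have ynz: "y \<in> nzr Q"
  proof (rule nz_if_cm[OF yG])
    fix q assume q: "q \<in> Q"
    show "cm y q \<in> Q"
    proof (cases "q \<in> Ph")
      case True then show ?thesis using cyP L2Q by (simp add: subset_iff)
    next
      case False
      then obtain w where "w \<in> L2" "cm y q = l \<otimes> w" using cyo[OF q] by blast
      then show ?thesis using lQ L2Q by (simp add: subset_iff)
    qed
  qed
  have yl: "cm y c \<notin> D2"
  proof -
    have "cm y g0 \<notin> D2" using y(2) l_not_D2[of 1] by simp
    then show ?thesis using cm_Ph_out(2)[OF y(1) g0(2)] by simp
  qed
  have uz: "u \<in> nzr Q" if u: "u \<in> D" "u \<otimes> u \<in> Q" for u
  proof (rule nz_if_cm)
    show uG: "u \<in> carrier G" using u by simp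
    fix q assume q: "q \<in> Q"
    have qG: "q \<in> carrier G" using q by simp
    show "cm u q \<in> Q"
    proof (cases "q \<in> Ph")
      case True
      then show ?thesis using cm_Ph_D[OF True u(1)] L2Q by (intro cm_flip[OF Q_sub qG uG]) (simp add: subset_iff)
    next
      case False
      then have "cm q u \<otimes> (u \<otimes> u) \<in> Q" using cm_out_D[of q u] u(1) q QM L2Q by blast
      then have "cm q u \<otimes> (u \<otimes> u) \<otimes> inv (u \<otimes> u) \<in> Q" using u(2) by blast
      then show ?thesis using u q by (intro cm_flip[OF Q_sub qG uG]) (simp add: m_assoc)
    qed
  qed
  have zlast: "\<exists>i. z [^] ((2::int) ^ i) \<notin> Q \<and> z [^] ((2::int) ^ i) \<otimes> z [^] ((2::int) ^ i) \<in> Q" if DQ: "\<not> D \<subseteq> Q"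
  proof -
    have zQ: "z \<notin> Q" using D_sub_Q LQ DQ by blast
    obtain i where i: "z [^] ((2::int) ^ i) \<notin> Q" "z [^] ((2::int) ^ Suc i) \<in> Q"
      by (rule last_int_power_outside[OF ord Q_sub zG zQ])
    then show ?thesis by (intro exI[of _ i]) (simp add: int_pow_double)
  qed
  \<comment> \<open>If \<open>y\<close> is not in \<open>Q\<close>, it acts as a transvection with
    centre \<open>l\<close>, so \<open>Q\<close> has index two in its normalizer. This rules out
    \<open>D \<subseteq> Q\<close> because of \<open>a\<close>; otherwise it puts the last outside
    2-power \<open>u\<close> of \<open>z\<close> into the coset of \<open>y\<close>, and
    \<open>y\<close> can be corrected by a conjugate of \<open>inv u\<close> to an element of
    \<open>Q\<close>.\<close>
  have "\<exists>h. h \<in> Q \<and> h \<in> Ph \<and> cm h c \<notin> D2"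
  proof (cases "y \<in> Q")
    case True then show ?thesis using y yl by blast
  next
    case False
    have alt: "cm y q \<in> Fr \<or> eqv (cm y q) l" if q: "q \<in> Q" for q
    proof (cases "q \<in> Ph")
      case True then show ?thesis using cyP L2F by (simp add: subset_iff)
    next
      case False
      then obtain w where w: "w \<in> L2" "cm y q = l \<otimes> w" using cyo[OF q] by blast
      have wF: "w \<in> Fr" "w \<in> Q" using w L2F L2Q by (simp_all add: subset_iff)
      have "eqv (l \<otimes> w) (l \<otimes> \<one>)" using wF lQ by (intro eqv_mult eqv_refl) (simp_all add: eqv_def)
      then show ?thesis using w(2) by simp
    qed
    have "cm y l \<in> Fr" using cm_L[OF yG lL] L2F by (simp add: subset_iff)
    then have tr: "transv y l" using ynz False lQ alt by (simp add: transv_def)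
    have "\<not> D \<subseteq> Q"
    proof
      assume DQ: "D \<subseteq> Q"
      have "a \<in> Q \<or> inv y \<otimes> a \<in> Q" by (rule normalizer_index_two[OF tr above_D_nz[OF DQ aG]])
      then show False
      proof
        assume "a \<in> Q" then show False using QM a_not_M by blast
      next
        assume "inv y \<otimes> a \<in> Q"
        moreover have "y \<in> M" using y Ph_M by blast
        ultimately have "y \<otimes> (inv y \<otimes> a) \<in> M" using QM M.m_closed by blast
        then show False using a_not_M yG by (simp add: cancel_left_inv)
      qed
    qed
    then obtain i where i: "z [^] ((2::int) ^ i) \<notin> Q" "z [^] ((2::int) ^ i) \<otimes> z [^] ((2::int) ^ i) \<in> Q"
      using zlast by blast
    define u where "u = z [^] ((2::int) ^ i)"
    have u: "u \<in> D" "u \<notin> Q" "u \<otimes> u \<in> Q" using i by (simp_all add: u_def D_pow)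
    have uG: "u \<in> carrier G" using u by simp
    have "inv y \<otimes> u \<in> Q" using normalizer_index_two[OF tr uz[OF u(1,3)]] u(2) by blast
    then have "inv (inv y \<otimes> u) \<in> Q" by blast
    moreover define k where "k = cj (inv y) (inv u)"
    have kD: "k \<in> D" using yG u(1) by (simp add: k_def)
    have "inv (inv y \<otimes> u) = y \<otimes> k" using yG uG by (simp add: word_simps k_def)
    moreover have "y \<otimes> k \<in> Ph" using y kD D_Ph by (simp add: subset_iff)
    moreover have "cm (y \<otimes> k) c \<notin> D2" using c_Ph[of \<one>] by (intro cm_mult_D_out[OF y(1) kD _ yl]) simp
    ultimately show ?thesis by metis
  qed
  then obtain h where h: "h \<in> Q" "h \<in> Ph" "cm h c \<notin> D2" by blast
  \<comment> \<open>It is not known that \<alpha> preserves \<open>D2\<close>. It does preserve the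
    derived subgroup of \<open>Q\<close>, which is inside \<open>D\<close>, so squares of elements
    of that subgroup go to squares in \<open>D\<close>.\<close>
  have sqD2: "\<alpha> (w \<otimes> w) \<in> D2" if "\<alpha> \<in> A" "w \<in> derived G Q" for \<alpha> w
  proof -
    have wQ: "w \<in> Q" using that derived_incl[OF subset_refl Q_sub] by blast
    have "\<alpha> w \<in> D" using A_derived[OF that] derived_D by blast
    then show ?thesis using that(1) wQ D2I by (simp add: A_mult)
  qed
  show False
  proof (cases "D \<subseteq> Q")
    case False
    then obtain i where i: "z [^] ((2::int) ^ i) \<notin> Q" "z [^] ((2::int) ^ i) \<otimes> z [^] ((2::int) ^ i) \<in> Q"
      using zlast by blast
    define u where "u = z [^] ((2::int) ^ i)"
    have u: "u \<in> D" "u \<notin> Q" "u \<otimes> u \<in> Q" using i by (simp_all add: u_def D_pow)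
    have uG: "u \<in> carrier G" using u by simp
    have uPh: "cm u q \<in> Fr" if q: "q \<in> Q" "q \<in> Ph" for q
      using cm_Ph_D[OF q(2) u(1)] L2F q by (intro cm_flip[OF Fr_sub _ uG, of q]) (simp_all add: subset_iff)
    have alt: "cm u q \<in> Fr \<or> eqv (cm u q) (u \<otimes> u)" if q: "q \<in> Q" for q
    proof (cases "q \<in> Ph")
      case True then show ?thesis using uPh q by simp
    next
      case False
      have qG: "q \<in> carrier G" using q by simp
      define w where "w = cm q u \<otimes> (u \<otimes> u)"
      have w: "w \<in> L2" unfolding w_def using False q QM u(1) by (intro cm_out_D) blast+
      have wF: "w \<in> Fr" "w \<in> Q" "w \<in> D" using w L2F L2Q L2_L L_D by (simp_all add: subset_iff)
      have "cm q u = w \<otimes> inv (u \<otimes> u)" using qG uG by (simp add: w_def m_assoc)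
      then have "cm u q = inv (w \<otimes> inv (u \<otimes> u))" using inv_cm[OF qG uG] by simp
      also have "\<dots> = u \<otimes> u \<otimes> inv w" using uG wF(2) by (simp add: inv_mult_group m_assoc)
      finally have "cm u q = u \<otimes> u \<otimes> inv w" .
      moreover have "eqv (u \<otimes> u \<otimes> inv w) (u \<otimes> u \<otimes> \<one>)" using wF u(3) by (intro eqv_mult eqv_refl) (simp_all add: eqv_def)
      ultimately show ?thesis using uG by simp
    qed
    have tr: "transv u (u \<otimes> u)" using uz[OF u(1,3)] u alt by (simp add: transv_def)
    show False
    proof (rule no_transvection_with_h[OF QM tr _ uPh h])
      show "u \<otimes> u \<in> D" using u by simp
      fix \<alpha> x assume a: "\<alpha> \<in> A" and x: "x \<in> Q" "x \<in> Ph"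
      have "cm x (u \<otimes> u) \<in> L4" by (rule cm_Ph_D2[OF x(2) D2I[OF u(1)]])
      then have "cm (u \<otimes> u) x \<in> L4" using x uG by (intro cm_flip[OF L4_subgroup, of x]) simp_all
      then obtain k where "cm (u \<otimes> u) x = l [^] (2 * (2 * k)::int)" by (auto simp: L4_def)
      then have "cm (u \<otimes> u) x = l [^] (2 * k) \<otimes> l [^] (2 * k)" by (simp only: int_pow_double[OF lG, of "2 * k"])
      moreover have "l [^] (2 * k) \<in> derived G Q" using L2d by (auto simp: L2_def)
      ultimately show "\<alpha> (cm (u \<otimes> u) x) \<in> D2" using sqD2[OF a] by simp
    qed
  next
    case True
    have zQ: "z \<in> Q" using True zD by (simp add: subset_iff)
    have lld: "l \<otimes> l \<in> derived G Q" using L2d L2_sq[OF lL] by (simp add: subset_iff)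
    have zzd: "z \<otimes> z \<in> derived G Q"
    proof -
      have 1: "cm g0 z \<in> derived G Q" by (rule cm_derived[OF g0(1) zQ])
      have "cm g0 z \<otimes> (z \<otimes> z) \<in> derived G Q" using cm_out_D[OF g0(2) zD] L2d by (simp add: subset_iff)
      then have "inv (cm g0 z) \<otimes> (cm g0 z \<otimes> (z \<otimes> z)) \<in> derived G Q"
        using subgroup.m_closed[OF derived_sub subgroup.m_inv_closed[OF derived_sub 1]] by simp
      then show ?thesis using g0G by (simp add: cancel_left_inv)
    qed
    have D2d: "D2 \<subseteq> derived G Q" by (rule D2_gen[OF derived_sub lld zzd])
    \<comment> \<open>The commutator of \<open>h\<close> with \<open>g0\<close> is an odd power of
      \<open>l\<close> times a square, and all squares of \<open>D\<close> are already in the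
      derived subgroup of \<open>Q\<close>.\<close>
    have ld: "l \<in> derived G Q"
    proof -
      have "cm h g0 \<in> K" "cm h g0 \<notin> D2" using cm_Ph_out[OF h(2) g0(2)] h(3) by simp_all
      then obtain j w where jw: "cm h g0 = l [^] (j::int) \<otimes> w" "w \<in> D2" by (auto simp: K_def)
      have jo: "odd j" using even_pow_D2[OF lD, of j] jw \<open>cm h g0 \<notin> D2\<close> by auto
      have "l [^] j = cm h g0 \<otimes> inv w" using jw by (simp add: m_assoc)
      moreover have "cm h g0 \<otimes> inv w \<in> derived G Q"
        using subgroup.m_closed[OF derived_sub cm_derived[OF h(1) g0(1)] subgroup.m_inv_closed[OF derived_sub]] jw(2) D2d
        by (simp add: subset_iff)
      ultimately have "l [^] j \<in> derived G Q" by simp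
      then show ?thesis by (rule odd_pow_mem[OF ord derived_sub lG jo])
    qed
    have Ld: "L \<subseteq> derived G Q" using subgroup_int_pow_closed[OF derived_sub ld] by (auto simp: L_def)
    have dF: "derived G Q \<subseteq> Fr" unfolding derived_def
    proof (rule generate_subgroup_incl[OF _ Fr_sub])
      show "derived_set G Q \<subseteq> Fr" using cm_Fr by (auto simp: cm_def)
    qed
    have LF: "L \<subseteq> Fr" using Ld dF by (rule order_trans)
    have aPh: "cm a q \<in> Fr" if "q \<in> Q" "q \<in> Ph" for q
      using cm_M1[of a q] that Ph_M1 cyc_self[of a] LF by (simp add: subset_iff)
    have alt: "cm a q \<in> Fr \<or> eqv (cm a q) z" if q: "q \<in> Q" for q
    proof (cases "q \<in> Ph")
      case True then show ?thesis using aPh q by simp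
    next
      case False
      then obtain x where x: "x \<in> Ph" "q = c \<otimes> x" using M_out[of q] q QM by blast
      have "cm a q = z \<otimes> cj c (cm a x)" using x by (simp add: cm_mult z_def)
      moreover have "cm a x \<in> L" using cm_M1[of a x] x Ph_M1 cyc_self[of a] by (simp add: subset_iff)
      then have w: "cj c (cm a x) \<in> Fr" using cj_L[OF cG] LF by (simp add: subset_iff)
      moreover have "eqv (z \<otimes> cj c (cm a x)) (z \<otimes> \<one>)"
        using w Fr_Q zQ by (intro eqv_mult eqv_refl) (simp_all add: eqv_def subset_iff)
      ultimately show ?thesis by simp
    qed
    have aQ: "a \<notin> Q" using QM a_not_M by blast
    have "cm a z \<in> Fr" using LF lL by (simp add: l_def[symmetric] subset_iff)
    then have tr: "transv a z" using above_D_nz[OF True aG] aQ zQ alt by (simp add: transv_def)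
    show False
    proof (rule no_transvection_with_h[OF QM tr zD aPh h])
      fix \<alpha> x assume a: "\<alpha> \<in> A" and x: "x \<in> Q" "x \<in> Ph"
      have "cm x z \<in> L2" by (rule cm_Ph_D[OF x(2) zD])
      then have "cm z x \<in> L2" using x by (intro cm_flip[OF L2_subgroup, of x]) simp_all
      then obtain k where "cm z x = l [^] (2 * k::int)" by (auto simp: L2_def)
      then have "cm z x = l [^] k \<otimes> l [^] k" by (simp only: int_pow_double[OF lG])
      moreover have "l [^] k \<in> derived G Q" using Ld by (auto simp: L_def)
      ultimately show "\<alpha> (cm z x) \<in> D2" using sqD2[OF a] by simp
    qed
  qed
qed

lemma case_M: "Q \<subseteq> M \<Longrightarrow> False"
  using case_M_noL case_M_L case_M1 Ph_M1 by blast

section \<open>The whole group, and the distinction of cases\<close>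

lemma out_M: assumes "x \<in> carrier G" "x \<notin> M" shows "\<exists>y\<in>M. x = y \<otimes> a"
proof -
  have M1c: "\<exists>y\<in>Ph. x = y \<otimes> a" if x: "x \<in> M1" "x \<notin> Ph" for x
  proof -
    obtain y where y: "y \<in> Ph" "x = a \<otimes> y" using M1_split[of x] x by blast
    have "cj a y \<in> Ph" using above_D_normal[OF Ph_sub D_Ph] y(1) by (simp add: normal_cj)
    moreover have "x = cj a y \<otimes> a" using y by (simp add: word_simps)
    ultimately show ?thesis by blast
  qed
  show ?thesis using gen[OF assms(1)]
  proof
    assume "x \<in> M1"
    then show ?thesis using M1c[of x] assms(2) Ph_M by blast
  next
    assume "\<exists>w\<in>M1. x = c \<otimes> w"
    then obtain w where w: "w \<in> M1" "x = c \<otimes> w" by blast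
    have "w \<notin> Ph" using assms(2) w(2) c_Ph by blast
    then obtain y where y: "y \<in> Ph" "w = y \<otimes> a" using M1c w(1) by blast
    have "c \<otimes> y \<in> M" using c_Ph[OF y(1)] by blast
    moreover have "x = c \<otimes> y \<otimes> a" using y w by (simp add: m_assoc)
    ultimately show ?thesis by blast
  qed
qed

text \<open>Modulo \<open>D\<close> the group is generated by commuting elements \<open>a\<close> of
  order \<open>2^n\<close> and \<open>c\<close> of order two. As \<open>n \<ge> 2\<close>, the
  exponent \<open>2^(n-1)\<close> kills \<open>c\<close> and the square of \<open>a\<close> but not
  \<open>a\<close>. This describes \<open>M\<close> through powers and \<open>D\<close> alone, so it
  is preserved by automorphisms that preserve \<open>D\<close>.\<close>

lemma M_char: assumes x: "x \<in> carrier G" shows "x \<in> M \<longleftrightarrow> x [^] ((2::int) ^ (n - 1)) \<in> D"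
proof -
  define N where "N = (2::int) ^ (n - 1)"
  have N2: "N * 2 = 2 ^ n" using n2 by (cases n) (simp_all add: N_def)
  have "even ((2::int) ^ (n - 1))" using n2 by simp
  then have Ne: "even N" by (simp add: N_def)
  have ab: "(x \<otimes> y) [^] N \<in> D \<longleftrightarrow> x [^] N \<otimes> y [^] N \<in> D" if "x \<in> carrier G" "y \<in> carrier G" for x y
  proof -
    let ?r = "(x \<otimes> y) [^] N \<otimes> inv (x [^] N \<otimes> y [^] N)"
    have r: "?r \<in> D" using that by (intro pow_mult_mod[OF D] cm_D)
    have 1: "(x \<otimes> y) [^] N = ?r \<otimes> (x [^] N \<otimes> y [^] N)" using that by (simp add: m_assoc)
    have 2: "x [^] N \<otimes> y [^] N = inv ?r \<otimes> (x \<otimes> y) [^] N" using that by (simp add: inv_mult_group m_assoc)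
    show ?thesis using 1 2 r D.m_closed D.m_inv_closed by metis
  qed
  have cN: "c [^] N \<in> D"
  proof -
    obtain j where "N = 2 * j" using Ne by (rule evenE)
    then have "c [^] N = (c \<otimes> c) [^] j" by (simp add: square_int_pow)
    then show ?thesis using D_pow[OF c_sq] by simp
  qed
  have PhN: "y [^] N \<in> D" if y: "y \<in> Ph" for y
  proof -
    obtain k p where kp: "y = (a \<otimes> a) [^] (k::int) \<otimes> p" "p \<in> D" using y by (auto simp: cyc_def)
    have "((a \<otimes> a) [^] k) [^] N = a [^] (2 ^ n * k)" by (simp add: aa_pow int_pow_pow N2[symmetric] mult_ac)
    then have "((a \<otimes> a) [^] k) [^] N \<in> D" using a_pow by simp
    then show ?thesis unfolding kp(1) using ab[of "(a \<otimes> a) [^] k" p] kp(2) D_pow by simp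
  qed
  have MN: "y [^] N \<in> D" if y: "y \<in> M" for y
  proof (cases "y \<in> Ph")
    case False
    then obtain w where "w \<in> Ph" "y = c \<otimes> w" using M_out[of y] y by blast
    then show ?thesis using ab[of c w] cN PhN[of w] by simp
  qed (rule PhN)
  have aN: "a [^] N \<notin> D"
  proof
    assume "a [^] N \<in> D"
    then have "2 ^ n dvd N" using a_pow by simp
    then have "N * 2 dvd N * 1" by (simp add: N2)
    moreover have "N \<noteq> 0" by (simp add: N_def)
    ultimately have "(2::int) dvd 1" using dvd_mult_cancel_left by blast
    then show False by simp
  qed
  show ?thesis unfolding N_def[symmetric]
  proof
    assume "x [^] N \<in> D"
    show "x \<in> M"
    proof (rule ccontr)
      assume "x \<notin> M"
      then obtain y where y: "y \<in> M" "x = y \<otimes> a" using out_M[OF x] by blast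
      have "y [^] N \<otimes> a [^] N \<in> D" using \<open>x [^] N \<in> D\<close> ab[of y a] y by simp
      then have "inv (y [^] N) \<otimes> (y [^] N \<otimes> a [^] N) \<in> D" using MN[OF y(1)] by blast
      then show False using aN y(1) by (simp add: cancel_left_inv)
    qed
  qed (rule MN)
qed

lemma sq_Ph: assumes "x \<in> carrier G" shows "x \<otimes> x \<in> Ph"
proof (cases "x \<in> M")
  case True
  then show ?thesis using M_out_mult[of x x] by (cases "x \<in> Ph") auto
next
  case False
  then obtain y where y: "y \<in> M" "x = y \<otimes> a" using out_M[OF assms] by blast
  have "x \<otimes> x = y \<otimes> y \<otimes> (cj (inv y) (cm a y) \<otimes> (a \<otimes> a))" using y by (simp add: word_simps)
  moreover have "y \<otimes> y \<in> Ph" using y(1) M_out_mult[of y y] by (cases "y \<in> Ph") auto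
  moreover have "cj (inv y) (cm a y) \<in> Ph" using y(1) D_Ph cm_D[of a y] by (simp add: subset_iff)
  moreover have "a \<otimes> a \<in> Ph" by (simp add: cyc_self)
  ultimately show ?thesis by simp
qed

text \<open>Every \<alpha> preserves \<open>M\<close> by \<open>M_char\<close> and therefore fixes a
  nonzero vector of the Frattini quotient, a four-group. So \<alpha> applied twice acts trivially
  there and is inner; \<open>A\<close> is then a 2-group in which \<open>S\<close> has odd
  index.\<close>

lemma case_full: assumes QG: "Q = carrier G" and Dd: "D = derived G (carrier G)" shows False
proof -
  have nz: "nzr Q = carrier G" using QG Q_nz nz.subset by blast
  have FrPh: "Fr = Ph"
  proof
    show "Fr \<subseteq> Ph" unfolding Fr_def Frat_def using sq_Ph QG by (intro generate_subgroup_incl[OF _ Ph_sub]) auto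
    show "Ph \<subseteq> Fr"
    proof (rule cyc_least[OF Fr_sub])
      show "a \<otimes> a \<in> Fr" using sq_Fr QG by simp
      show "D \<subseteq> Fr" unfolding Dd derived_def
      proof (rule generate_subgroup_incl[OF _ Fr_sub])
        show "derived_set G (carrier G) \<subseteq> Fr" using cm_Fr QG by (auto simp: cm_def)
      qed
    qed
  qed
  have AM: "\<alpha> x \<in> M" if a: "\<alpha> \<in> A" and x: "x \<in> M" for \<alpha> x
  proof -
    have xQ: "x \<in> Q" using x QG by simp
    have "derived G Q = D" unfolding QG by (rule Dd[symmetric])
    moreover have "x [^] ((2::int) ^ (n - 1)) \<in> D" using M_char[of x] x by simp
    ultimately have "x [^] ((2::int) ^ (n - 1)) \<in> derived G Q" by (simp only:)
    then have "\<alpha> (x [^] ((2::int) ^ (n - 1))) \<in> D" using A_derived[OF a] derived_D by blast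
    then have "\<alpha> x [^] ((2::int) ^ (n - 1)) \<in> D" using A_int_pow[OF a xQ] by simp
    then show ?thesis using M_char[of "\<alpha> x"] A_closed[OF a xQ] by simp
  qed
  have AMe: "eqv (\<alpha> x) x" if a: "\<alpha> \<in> A" and x: "x \<in> M" for \<alpha> x
  proof -
    have xQ: "x \<in> Q" using x QG by simp
    have "\<alpha> x \<otimes> inv x \<in> Ph"
    proof (cases "x \<in> Ph")
      case True
      then have "\<alpha> x \<in> Ph" using A_Fr[OF a] FrPh by simp
      then show ?thesis using True by simp
    next
      case False
      have "\<alpha> x \<notin> Ph"
      proof
        assume "\<alpha> x \<in> Ph"
        then have "iv \<alpha> (\<alpha> x) \<in> Ph" using A_Fr[OF iv_A[OF a]] FrPh by simp
        then show False using False a xQ by simp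
      qed
      moreover have "inv x \<notin> Ph" using False x Ph.m_inv_closed[of "inv x"] by auto
      ultimately show ?thesis using AM[OF a x] x by (intro M_out_mult) auto
    qed
    then show ?thesis using FrPh a xQ by (simp add: eqv_def)
  qed
  have sq: "compose Q \<alpha> \<alpha> \<in> S" if a: "\<alpha> \<in> A" for \<alpha>
  proof (rule kernel_in_S[OF A_compose[OF a a]])
    fix x assume x: "x \<in> Q"
    have "eqv (\<alpha> (\<alpha> x)) x"
    proof (cases "x \<in> M")
      case True
      show ?thesis using AMe[OF a AM[OF a True]] AMe[OF a True] by (rule eqv_trans)
    next
      case False
      have ax: "\<alpha> x \<in> Q" using a x by simp
      have "\<alpha> x \<notin> M"
      proof
        assume "\<alpha> x \<in> M"
        then have "iv \<alpha> (\<alpha> x) \<in> M" by (rule AM[OF iv_A[OF a]])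
        then show False using False a x by simp
      qed
      then obtain y where y: "y \<in> M" "\<alpha> x = y \<otimes> a" using out_M ax QG by blast
      obtain y' where y': "y' \<in> M" "x = y' \<otimes> a" using out_M False x QG by blast
      \<comment> \<open>\<alpha> multiplies \<open>x\<close> by \<open>w\<close>, and fixes
        \<open>w\<close> modulo the Frattini subgroup because \<open>w\<close> is in
        \<open>M\<close>. Two applications multiply \<open>x\<close> by \<open>w\<close> twice,
        which is trivial in the quotient.\<close>
      define w where "w = \<alpha> x \<otimes> inv x"
      have "w = y \<otimes> inv y'" using y y' by (simp add: w_def word_simps)
      then have wM: "w \<in> M" using y y' by simp
      then have wQ: "w \<in> Q" using QG by simp
      have axw: "\<alpha> x = w \<otimes> x" using ax x by (simp add: w_def m_assoc)
      then have "\<alpha> (\<alpha> x) = \<alpha> w \<otimes> \<alpha> x" using A_mult[OF a wQ x] by simp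
      moreover have "eqv (\<alpha> w \<otimes> \<alpha> x) (w \<otimes> \<alpha> x)" by (rule eqv_mult[OF AMe[OF a wM] eqv_refl[OF ax]])
      moreover have "eqv (w \<otimes> \<alpha> x) x" using eqv_sq[OF wQ x] axw by simp
      ultimately show ?thesis using eqv_trans by metis
    qed
    then show "eqv (compose Q \<alpha> \<alpha> x) x" using x by (simp add: compose_eq)
  qed
  interpret AG: group AG by (rule AG_group)
  have Spow: "\<beta> [^]\<^bsub>AG\<^esub> ((2::nat) ^ m) = \<one>\<^bsub>AG\<^esub>" if b: "\<beta> \<in> S" for \<beta>
  proof -
    obtain g where g: "g \<in> nzr Q" "\<beta> = cjQ g" using b by (auto simp: S_def)
    have gG: "g \<in> carrier G" using g nzrD by blast
    have bA: "\<beta> \<in> A" using b S_A by blast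
    have "\<beta> [^]\<^bsub>AG\<^esub> k = cjQ (g [^] k)" for k :: nat
    proof (induction k)
      case 0
      have "cjQ \<one> = (\<lambda>x\<in>Q. x)" by (auto simp: restrict_def)
      then show ?case using AG_one by simp
    next
      case (Suc k)
      have gk: "g [^] k \<in> nzr Q" using nz gG by simp
      have "\<beta> [^]\<^bsub>AG\<^esub> Suc k = cjQ (g [^] k) \<otimes>\<^bsub>AG\<^esub> \<beta>" using Suc by (simp only: AG.nat_pow_Suc)
      also have "\<dots> = compose Q (cjQ (g [^] k)) \<beta>" by (rule AG_mult[OF A_cj[OF gk] bA])
      also have "\<dots> = cjQ (g [^] Suc k)"
      proof (rule extensionalityI[of _ Q])
        fix x assume x: "x \<in> Q"
        then show "compose Q (cjQ (g [^] k)) \<beta> x = cjQ (g [^] Suc k) x"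
          using g gG nzrD(1)[OF g(1) x] by (simp add: compose_eq mult_cj)
      qed auto
      finally show ?case .
    qed
    moreover have "cjQ \<one> = (\<lambda>x\<in>Q. x)" by (auto simp: restrict_def)
    ultimately show ?thesis using two_group_pow[OF ord gG] AG_one by simp
  qed
  have "\<exists>k. order AG = 2 ^ k"
  proof (rule power_of_two_card[OF AG_group])
    show "finite (carrier AG)" using A_finite by simp
    fix \<alpha> assume "\<alpha> \<in> carrier AG"
    then have a: "\<alpha> \<in> A" by simp
    have "\<alpha> [^]\<^bsub>AG\<^esub> (2::nat) = \<alpha> \<otimes>\<^bsub>AG\<^esub> \<alpha>" 
    proof -
      have "\<alpha> [^]\<^bsub>AG\<^esub> (Suc (Suc 0)) = \<alpha> \<otimes>\<^bsub>AG\<^esub> \<alpha>"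
        unfolding AG.nat_pow_Suc AG.nat_pow_0 using a AG.l_one[of \<alpha>] by simp
      then show ?thesis by (simp only: numeral_2_eq_2)
    qed
    then have "\<alpha> [^]\<^bsub>AG\<^esub> (2::nat) = compose Q \<alpha> \<alpha>" by (simp only: AG_mult[OF a a])
    then have "(\<alpha> [^]\<^bsub>AG\<^esub> (2::nat)) [^]\<^bsub>AG\<^esub> ((2::nat) ^ m) = \<one>\<^bsub>AG\<^esub>" using Spow[OF sq[OF a]] by simp
    then have "\<alpha> [^]\<^bsub>AG\<^esub> ((2::nat) ^ Suc m) = \<one>\<^bsub>AG\<^esub>" using a AG.nat_pow_pow[of \<alpha> 2 "2 ^ m"] by simp
    then show "\<exists>k. \<alpha> [^]\<^bsub>AG\<^esub> ((2::nat) ^ k) = \<one>\<^bsub>AG\<^esub>" by blast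
  qed
  then obtain k where k: "card A = 2 ^ k" by (auto simp: order_def)
  then have "r dvd 2 ^ k" using A_index(1) by (metis dvd_triv_right)
  then have "r = 1" using A_index(2) by (metis divides_primepow_nat two_is_prime_nat even_power neq0_conv power_0 dvd_refl)
  then have "card A = card S" using A_index(1) by (simp add: S_def)
  then show False using A_ne card_subset_eq[OF A_finite S_A] by simp
qed

text \<open>A proper \<open>Q\<close> lies in a subgroup \<open>M0\<close> of index two, which
  contains \<open>D\<close>. It contains exactly one of \<open>a\<close>, \<open>c\<close> and
  \<open>c \<otimes> a\<close>, which decides between \<open>M1\<close>, \<open>M\<close> and the
  third maximal subgroup.\<close>

lemma critical_false: assumes Dd: "D = derived G (carrier G)" shows False
proof (cases "Q = carrier G")
  case True then show False using case_full Dd by blast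
next
  case False
  obtain M0 where M0: "subgroup M0 G" "Q \<subseteq> M0" "M0 \<noteq> carrier G"
    and ix: "\<And>x y. x \<in> carrier G \<Longrightarrow> y \<in> carrier G \<Longrightarrow> x \<notin> M0 \<Longrightarrow> y \<notin> M0 \<Longrightarrow> x \<otimes> y \<in> M0"
    using index_two_above[OF ord Q_sub False] by metis
  interpret M0: subgroup M0 G by (rule M0(1))
  have out: "x \<otimes> y \<notin> M0" "y \<otimes> x \<notin> M0" if "x \<in> M0" "y \<in> carrier G" "y \<notin> M0" for x y
  proof -
    have "inv x \<otimes> (x \<otimes> y) = y" "y \<otimes> x \<otimes> inv x = y" using that by (simp_all add: cancel_left_inv m_assoc)
    then show "x \<otimes> y \<notin> M0" "y \<otimes> x \<notin> M0"
      using that M0.m_closed[OF M0.m_inv_closed[OF that(1)], of "x \<otimes> y"] M0.m_closed[OF _ M0.m_inv_closed[OF that(1)], of "y \<otimes> x"] by auto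
  qed
  have DM: "D \<subseteq> M0" unfolding Dd derived_def
  proof (rule generate_subgroup_incl[OF _ M0(1)])
    have "cm x y \<in> M0" if xy: "x \<in> carrier G" "y \<in> carrier G" for x y
    proof -
      have "cm x y = (x \<otimes> y) \<otimes> inv (y \<otimes> x)" using xy by (simp add: word_simps)
      moreover have "(x \<otimes> y) \<otimes> inv (y \<otimes> x) \<in> M0"
      proof (cases "x \<otimes> y \<in> M0")
        case True
        then have "y \<otimes> x \<in> M0" using ix[of y x] xy out[of y x] out[of x y] M0.m_closed[of y x] by blast
        then show ?thesis using True by blast
      next
        case False
        then have 1: "y \<otimes> x \<notin> M0" using ix[of x y] xy out[of y x] out[of x y] M0.m_closed[of x y] by blast
        then have "inv (y \<otimes> x) \<notin> M0" using M0.m_inv_closed[of "inv (y \<otimes> x)"] xy by auto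
        then show ?thesis using False xy by (intro ix) simp_all
      qed
      ultimately show ?thesis by simp
    qed
    then show "derived_set G (carrier G) \<subseteq> M0" by (auto simp: cm_def)
  qed
  have full: False if "a \<in> M0" "c \<in> M0"
    using gen_subgroup[OF M0(1) cyc_least[OF M0(1) that(1) DM] that(2)] M0(3) M0.subset by blast
  have QM1: "Q \<subseteq> M1" if aM: "a \<in> M0"
  proof
    fix x assume x: "x \<in> Q"
    have xM0: "x \<in> M0" using x M0(2) by blast
    have M1M0: "M1 \<subseteq> M0" by (rule cyc_least[OF M0(1) aM DM])
    show "x \<in> M1" using gen[OF Q.mem_carrier[OF x]]
    proof (elim disjE)
      assume "\<exists>y\<in>M1. x = c \<otimes> y"
      then obtain y where y: "y \<in> M1" "x = c \<otimes> y" by blast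
      have "x \<otimes> inv y \<in> M0" using xM0 y(1) M1M0 by blast
      then have "c \<in> M0" using y by (simp add: m_assoc)
      then show ?thesis using full aM by blast
    qed auto
  qed
  show False
  proof (cases "a \<in> M0")
    case True
    then show False using QM1 case_M1 by blast
  next
    case aM: False
    show False
    proof (cases "c \<in> M0")
      case cM0: True
      have "Q \<subseteq> M"
      proof
        fix x assume x: "x \<in> Q"
        then have xM0: "x \<in> M0" using M0(2) by blast
        have M1c: "y \<in> Ph" if y: "y \<in> M1" "y \<in> M0" for y
        proof -
          obtain k p where kp: "y = a [^] (k::int) \<otimes> p" "p \<in> D" using y by (auto simp: cyc_def)
          have "y \<otimes> inv p \<in> M0" using y(2) kp(2) DM by blast
          then have "a [^] k \<in> M0" using kp by (simp add: m_assoc)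
          then have "even k" using odd_pow_mem[OF ord M0(1) aG, of k] aM by blast
          then show ?thesis using kp even_pow_Ph by simp
        qed
        show "x \<in> M" using gen[OF Q.mem_carrier[OF x]]
        proof (elim disjE)
          assume "x \<in> M1" then show ?thesis using M1c xM0 Ph_M by blast
        next
          assume "\<exists>y\<in>M1. x = c \<otimes> y"
          then obtain y where y: "y \<in> M1" "x = c \<otimes> y" by blast
          have "inv c \<otimes> x \<in> M0" using xM0 cM0 by blast
          then have "y \<in> M0" using y by (simp add: cancel_left_inv)
          then show ?thesis using c_Ph[OF M1c[OF y(1)]] y(2) by blast
        qed
      qed
      then show False by (rule case_M)
    next
      case False
      have b: "c \<otimes> a \<in> M0" using ix[of c a] False aM by simp
      interpret sw: noncyclic_derived G D m "c \<otimes> a" c n by (rule swap_noncyclic_derived)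
      \<comment> \<open>With \<open>c \<otimes> a\<close> in the role of \<open>a\<close>, the third
        maximal subgroup becomes the first one.\<close>
      interpret swc: critical G D m "c \<otimes> a" c n Q A r by unfold_locales
      have bM0: "cyc (c \<otimes> a) \<subseteq> M0" by (rule cyc_least[OF M0(1) b DM])
      have "Q \<subseteq> cyc (c \<otimes> a)"
      proof
        fix x assume x: "x \<in> Q"
        then have xM0: "x \<in> M0" using M0(2) by blast
        show "x \<in> cyc (c \<otimes> a)" using sw.gen[OF Q.mem_carrier[OF x]]
        proof (elim disjE)
          assume "\<exists>y\<in>cyc (c \<otimes> a). x = c \<otimes> y"
          then obtain y where y: "y \<in> cyc (c \<otimes> a)" "x = c \<otimes> y" by blast
          have yM: "y \<in> M0" using y bM0 by blast
          have "x \<otimes> inv y \<in> M0" using xM0 yM by blast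
          then have "c \<in> M0" using y yM by (simp add: m_assoc)
          then show ?thesis using False by blast
        qed auto
      qed
      then show False by (rule swc.case_M1)
    qed
  qed
qed

end

section \<open>Products of two cyclic groups\<close>

context group
begin

lemma pow_commute: "g \<in> carrier G \<Longrightarrow> cm g (g [^] (i::int)) = \<one>"
  using int_pow_mult[of g 1 i] int_pow_mult[of g i 1] by (simp add: cm_one_iff add.commute)

lemma generate_commute:
  assumes W: "W \<subseteq> carrier G" "\<And>u v. u \<in> W \<Longrightarrow> v \<in> W \<Longrightarrow> u \<otimes> v = v \<otimes> u"
    and u: "u \<in> generate G W" and v: "v \<in> generate G W"
  shows "u \<otimes> v = v \<otimes> u"
proof -
  have C: "subgroup {g \<in> carrier G. \<forall>p\<in>B. cm g p \<in> {\<one>}} G" if "B \<subseteq> carrier G" for B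
    by (rule subgroup_cm_into[OF one_is_normal that])
  have gW: "generate G W \<subseteq> carrier G" by (rule generate_incl[OF W(1)])
  have "generate G W \<subseteq> {g \<in> carrier G. \<forall>p\<in>W. cm g p \<in> {\<one>}}"
    using W by (intro generate_subgroup_incl[OF _ C[OF W(1)]]) (auto simp: cm_one_iff subset_iff)
  then have 1: "cm g p = \<one>" if "g \<in> generate G W" "p \<in> W" for g p using that by blast
  have "generate G W \<subseteq> {g \<in> carrier G. \<forall>p\<in>generate G W. cm g p \<in> {\<one>}}"
  proof (rule generate_subgroup_incl[OF _ C[OF gW]])
    show "W \<subseteq> {g \<in> carrier G. \<forall>p\<in>generate G W. cm g p \<in> {\<one>}}"
    proof clarsimp
      fix w assume w: "w \<in> W"
      have "cm w p = \<one>" if p: "p \<in> generate G W" for p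
        using 1[OF p w] w p W(1) gW inv_cm[of p w] by (auto simp: subset_iff)
      then show "w \<in> carrier G \<and> (\<forall>p\<in>generate G W. cm w p = \<one>)" using w W(1) by blast
    qed
  qed
  then have "cm u v = \<one>" using u v by blast
  then show ?thesis using u v gW by (simp add: cm_one_iff subset_iff)
qed

text \<open>Ito's theorem. Conjugation by \<open>A\<close> changes only the entry from \<open>B\<close> in a commutator \<open>[a,b]\<close>, conjugation by
  \<open>B\<close> only the entry from \<open>A\<close>; hence the two actions on such commutators commute.\<close>

lemma ito:
  assumes A: "subgroup A G" "\<And>u v. u \<in> A \<Longrightarrow> v \<in> A \<Longrightarrow> u \<otimes> v = v \<otimes> u"
    and B: "subgroup B G" "\<And>u v. u \<in> B \<Longrightarrow> v \<in> B \<Longrightarrow> u \<otimes> v = v \<otimes> u"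
    and AB: "\<And>g. g \<in> carrier G \<Longrightarrow> \<exists>a\<in>A. \<exists>b\<in>B. g = a \<otimes> b"
    and pq: "p \<in> derived G (carrier G)" "q \<in> derived G (carrier G)"
  shows "p \<otimes> q = q \<otimes> p"
proof -
  interpret A: subgroup A G by (rule A(1))
  interpret B: subgroup B G by (rule B(1))
  define W where "W = {cm a b |a b. a \<in> A \<and> b \<in> B}"
  have WI: "cm a b \<in> W" if "a \<in> A" "b \<in> B" for a b using that by (auto simp: W_def)
  have WG: "W \<subseteq> carrier G" by (auto simp: W_def)
  have BA: "\<exists>b\<in>B. \<exists>a\<in>A. g = b \<otimes> a" if g: "g \<in> carrier G" for g
  proof -
    obtain a b where ab: "a \<in> A" "b \<in> B" "inv g = a \<otimes> b" using AB[of "inv g"] g by auto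
    have "g = inv (a \<otimes> b)" using ab(3) g by (metis inv_inv)
    also have "\<dots> = inv b \<otimes> inv a" using ab by (simp add: inv_mult_group)
    finally show ?thesis using ab by blast
  qed
  have cA: "cm u v = \<one>" if "u \<in> A" "v \<in> A" for u v using that A(2)[OF that] by (simp add: cm_one_iff)
  have cB: "cm u v = \<one>" if "u \<in> B" "v \<in> B" for u v using that B(2)[OF that] by (simp add: cm_one_iff)
  have jA: "cj u v = v" if "u \<in> A" "v \<in> A" for u v using cA[OF that] that by (simp add: cj_cm)
  have jB: "cj u v = v" if "u \<in> B" "v \<in> B" for u v using cB[OF that] that by (simp add: cj_cm)
  have conj1: "\<exists>b3\<in>B. \<forall>a\<in>A. cj a1 (cm a b) = cm a b3" if a1: "a1 \<in> A" and b: "b \<in> B" for a1 b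
  proof -
    obtain b3 a3 where ba: "b3 \<in> B" "a3 \<in> A" "cj a1 b = b3 \<otimes> a3" using BA[of "cj a1 b"] a1 b by auto
    have "cj a1 (cm a b) = cm a b3" if a: "a \<in> A" for a
    proof -
      have "cj a1 (cm a b) = cm (cj a1 a) (cj a1 b)" using a a1 b by (intro cj_cm_distrib) auto
      also have "\<dots> = cm a (b3 \<otimes> a3)" using jA[OF a1 a] ba(3) by simp
      also have "\<dots> = cm a b3" using a ba cA[OF a ba(2)] by (simp add: cm_mult)
      finally show ?thesis .
    qed
    then show ?thesis using ba(1) by blast
  qed
  have conj2: "\<exists>a2\<in>A. \<forall>b\<in>B. cj b1 (cm a b) = cm a2 b" if b1: "b1 \<in> B" and a: "a \<in> A" for b1 a
  proof -
    obtain a2 b2 where ab: "a2 \<in> A" "b2 \<in> B" "cj b1 a = a2 \<otimes> b2" using AB[of "cj b1 a"] a b1 by auto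
    have "cj b1 (cm a b) = cm a2 b" if b: "b \<in> B" for b
    proof -
      have "cj b1 (cm a b) = cm (cj b1 a) (cj b1 b)" using a b1 b by (intro cj_cm_distrib) auto
      also have "\<dots> = cm (a2 \<otimes> b2) b" using jB[OF b1 b] ab(3) by simp
      also have "\<dots> = cm a2 b" using b ab cB[OF ab(2) b] by (simp add: mult_cm)
      finally show ?thesis .
    qed
    then show ?thesis using ab(1) by blast
  qed
  have WA: "cj a1 w \<in> W" if "a1 \<in> A" "w \<in> W" for a1 w
  proof -
    obtain a b where "a \<in> A" "b \<in> B" "w = cm a b" using \<open>w \<in> W\<close> by (auto simp: W_def)
    then show ?thesis using conj1[OF \<open>a1 \<in> A\<close>, of b] WI by metis
  qed
  have WB: "cj b1 w \<in> W" if "b1 \<in> B" "w \<in> W" for b1 w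
  proof -
    obtain a b where "a \<in> A" "b \<in> B" "w = cm a b" using \<open>w \<in> W\<close> by (auto simp: W_def)
    then show ?thesis using conj2[OF \<open>b1 \<in> B\<close>, of a] WI by metis
  qed
  have swap: "cj a1 (cj b1 w) = cj b1 (cj a1 w)" if a1: "a1 \<in> A" and b1: "b1 \<in> B" and w: "w \<in> W" for a1 b1 w
  proof -
    obtain a b where ab: "a \<in> A" "b \<in> B" "w = cm a b" using w by (auto simp: W_def)
    obtain b3 where b3: "b3 \<in> B" "\<forall>a\<in>A. cj a1 (cm a b) = cm a b3" using conj1[OF a1 ab(2)] by blast
    obtain a2 where a2: "a2 \<in> A" "\<forall>b\<in>B. cj b1 (cm a b) = cm a2 b" using conj2[OF b1 ab(1)] by blast
    show ?thesis using ab a2 b3 by simp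
  qed
  have comm: "u \<otimes> v = v \<otimes> u" if u: "u \<in> W" and v: "v \<in> W" for u v
  proof -
    obtain a1 b1 where ab: "a1 \<in> A" "b1 \<in> B" "u = cm a1 b1" using u by (auto simp: W_def)
    have vG: "v \<in> carrier G" using v WG by blast
    \<comment> \<open>\<open>w\<close> is chosen such that \<open>v\<close> arises from it by
      conjugation with \<open>b1 \<otimes> a1\<close>. Since \<open>u\<close> times
      \<open>b1 \<otimes> a1\<close> is \<open>a1 \<otimes> b1\<close>, conjugating \<open>v\<close>
      by \<open>u\<close> only exchanges the two actions, which commute on \<open>W\<close>.\<close>
    define w where "w = cj (inv a1) (cj (inv b1) v)"
    have w: "w \<in> W" unfolding w_def using ab v by (intro WA WB) auto
    have v1: "v = cj b1 (cj a1 w)" using ab vG by (simp add: w_def cj_cj_inv)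
    have wG: "w \<in> carrier G" using w WG by blast
    have "cj u v = cj (u \<otimes> (b1 \<otimes> a1)) w" using ab wG v1 by (simp add: mult_cj)
    also have "u \<otimes> (b1 \<otimes> a1) = a1 \<otimes> b1" using ab by (simp add: word_simps)
    also have "cj (a1 \<otimes> b1) w = v" using swap[OF ab(1,2) w] v1 ab wG by (simp add: mult_cj)
    finally have "cm u v = \<one>" using vG u WG by (simp add: cm_cj subset_iff)
    then show ?thesis using vG u WG by (simp add: cm_one_iff subset_iff)
  qed
  have WN: "generate G W \<lhd> G"
  proof (rule normal_generateI[OF WG])
    fix h g assume h: "h \<in> W" and g: "g \<in> carrier G"
    obtain a b where ab: "a \<in> A" "b \<in> B" "g = a \<otimes> b" using AB[OF g] by blast
    have "cj g h = cj a (cj b h)" using ab h WG by (simp add: mult_cj subset_iff)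
    then have "cj g h \<in> W" using WA[OF ab(1) WB[OF ab(2) h]] by simp
    then show "g \<otimes> h \<otimes> inv g \<in> W" by (simp add: cj_def)
  qed
  have Wg: "subgroup (generate G W) G" by (rule generate_is_subgroup[OF WG])
  have cjW: "cj g h \<in> generate G W" if "g \<in> carrier G" "h \<in> generate G W" for g h using that WN by (simp add: normal_cj)
  have cmAg: "cm a g \<in> generate G W" if a: "a \<in> A" and g: "g \<in> carrier G" for a g
  proof -
    obtain a' b' where ab: "a' \<in> A" "b' \<in> B" "g = a' \<otimes> b'" using AB[OF g] by blast
    have "cm a g = cj a' (cm a b')" using ab a cA[OF a ab(1)] by (simp add: cm_mult)
    then show ?thesis using ab a cjW[OF _ generate.incl[OF WI[OF a ab(2)]], of a'] by simp
  qed
  have cmBg: "cm b g \<in> generate G W" if b: "b \<in> B" and g: "g \<in> carrier G" for b g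
  proof -
    obtain a' b' where ab: "a' \<in> A" "b' \<in> B" "g = a' \<otimes> b'" using AB[OF g] by blast
    have "cm b g = cm b a'" using ab b cB[OF b ab(2)] by (simp add: cm_mult)
    moreover have "cm b a' \<in> generate G W" using ab b by (intro cm_flip[OF Wg, of a' b] generate.incl[OF WI]) auto
    ultimately show ?thesis by simp
  qed
  have "derived G (carrier G) \<subseteq> generate G W"
    unfolding derived_def
  proof (rule generate_subgroup_incl[OF _ Wg])
    have "cm g h \<in> generate G W" if g: "g \<in> carrier G" and h: "h \<in> carrier G" for g h
    proof -
      obtain a b where ab: "a \<in> A" "b \<in> B" "g = a \<otimes> b" using AB[OF g] by blast
      have "cm g h = cj a (cm b h) \<otimes> cm a h" using ab h by (simp add: mult_cm)
      then show ?thesis using subgroup.m_closed[OF Wg cjW[OF _ cmBg[OF ab(2) h]] cmAg[OF ab(1) h]] ab(1) by simp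
    qed
    then show "derived_set G (carrier G) \<subseteq> generate G W" by (auto simp: cm_def)
  qed
  then show ?thesis using pq by (intro generate_commute[OF WG comm]) auto
qed

definition gen2 where "gen2 x y \<longleftrightarrow> x \<in> carrier G \<and> y \<in> carrier G \<and> (\<forall>S. subgroup S G \<longrightarrow> x \<in> S \<longrightarrow> y \<in> S \<longrightarrow> carrier G \<subseteq> S)"

lemma gen2_sym: "gen2 x y \<Longrightarrow> gen2 y x" by (auto simp: gen2_def)

lemma gen2_cm:
  assumes g: "gen2 x y" and N: "N \<lhd> G" and xy: "cm x y \<in> N" and uv: "u \<in> carrier G" "v \<in> carrier G"
  shows "cm u v \<in> N"
proof -
  have G: "x \<in> carrier G" "y \<in> carrier G" using g by (simp_all add: gen2_def)
  have Ns: "subgroup N G" using N by (rule normal_imp_subgroup)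
  have all: "carrier G \<subseteq> S" if "subgroup S G" "x \<in> S" "y \<in> S" for S using g that by (simp add: gen2_def)
  have yx: "cm y x \<in> N" by (rule cm_flip[OF Ns G xy])
  have one: "\<one> \<in> N" by (rule subgroup.one_closed[OF Ns])
  have "carrier G \<subseteq> {g \<in> carrier G. \<forall>p\<in>{x, y}. cm g p \<in> N}"
    by (rule all[OF subgroup_cm_into[OF N]]) (use G xy yx one in auto)
  then have 1: "cm g x \<in> N" "cm g y \<in> N" if "g \<in> carrier G" for g using that by auto
  have "carrier G \<subseteq> {g \<in> carrier G. \<forall>p\<in>carrier G. cm g p \<in> N}"
  proof (rule all[OF subgroup_cm_into[OF N subset_refl]])
    show "x \<in> {g \<in> carrier G. \<forall>p\<in>carrier G. cm g p \<in> N}" using 1 G cm_flip[OF Ns _ G(1)] by blast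
    show "y \<in> {g \<in> carrier G. \<forall>p\<in>carrier G. cm g p \<in> N}" using 1 G cm_flip[OF Ns _ G(2)] by blast
  qed
  then show ?thesis using uv by blast
qed

lemma gen2_odd: assumes ord: "order G = 2 ^ m" and gh: "gen2 g h" and j: "odd j" shows "gen2 g (h [^] (j::int) \<otimes> g [^] (k::int))"
  unfolding gen2_def
proof (intro conjI allI impI)
  have G: "g \<in> carrier G" "h \<in> carrier G" using gh by (simp_all add: gen2_def)
  then show "g \<in> carrier G" "h [^] j \<otimes> g [^] k \<in> carrier G" by simp_all
  fix S assume S: "subgroup S G" "g \<in> S" "h [^] j \<otimes> g [^] k \<in> S"
  have "h [^] j \<otimes> g [^] k \<otimes> inv (g [^] k) \<in> S"
    using S subgroup_int_pow_closed[OF S(1,2)] by (simp add: subgroup.m_closed subgroup.m_inv_closed)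
  then have "h [^] j \<in> S" using G by (simp add: m_assoc)
  then have "h \<in> S" by (rule odd_pow_mem[OF ord S(1) G(2) j])
  then show "carrier G \<subseteq> S" using gh S by (simp add: gen2_def)
qed

end

text \<open>This describes the quotient by \<open>J\<close> in \<open>lift_generators\<close>:
  \<open>E\<close> is the image of \<open>D\<close>, a four-group, and \<open>k0\<close> is the
  nontrivial element in the image of \<open>K\<close>.\<close>

locale bicyclic_four_derived = group +
  fixes m :: nat and x y :: 'a and E :: "'a set" and k0 :: 'a
  assumes ord: "order G = 2 ^ m" and xG [simp]: "x \<in> carrier G" and yG [simp]: "y \<in> carrier G"
    and fact: "g \<in> carrier G \<Longrightarrow> \<exists>i j. g = x [^] (i::int) \<otimes> y [^] (j::int)"
    and E_sub: "subgroup E G" and cm_E: "g \<in> carrier G \<Longrightarrow> h \<in> carrier G \<Longrightarrow> cm g h \<in> E"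
    and E_sq: "p \<in> E \<Longrightarrow> p \<otimes> p = \<one>"
    and E_comm: "p \<in> E \<Longrightarrow> q \<in> E \<Longrightarrow> p \<otimes> q = q \<otimes> p"
    and k0: "k0 \<in> E" "k0 \<noteq> \<one>" and cm_k0: "g \<in> carrier G \<Longrightarrow> cm g k0 = \<one>"
    and cm_cm: "g \<in> carrier G \<Longrightarrow> p \<in> E \<Longrightarrow> cm g p \<in> {\<one>, k0}"
    and E_min: "N \<lhd> G \<Longrightarrow> (\<And>g h. g \<in> carrier G \<Longrightarrow> h \<in> carrier G \<Longrightarrow> cm g h \<in> N) \<Longrightarrow> E \<subseteq> N"
    and E_big: "\<not> E \<subseteq> {\<one>, k0}"
    and E_four: "p \<in> E \<Longrightarrow> q \<in> E \<Longrightarrow> p \<notin> {\<one>, k0} \<Longrightarrow> q \<notin> {\<one>, k0} \<Longrightarrow> p \<otimes> q \<in> {\<one>, k0}"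
begin

abbreviation "Kk \<equiv> {\<one>, k0}"

sublocale E: subgroup E G by (rule E_sub)

lemma two_set_normal:
  assumes "p \<in> E" "\<And>g. g \<in> carrier G \<Longrightarrow> cm g p = \<one>" shows "{\<one>, p} \<lhd> G"
proof -
  have pG: "p \<in> carrier G" using assms(1) by simp
  have ip: "inv p = p" using E_sq[OF assms(1)] pG by (simp add: inv_equality)
  have "subgroup {\<one>, p} G" using pG ip E_sq[OF assms(1)] by (intro subgroup.intro) auto
  moreover have "cj g u \<in> {\<one>, p}" if "g \<in> carrier G" "u \<in> {\<one>, p}" for g u
    using that assms(2)[OF that(1)] pG cj_cm[of g p] by auto
  ultimately show ?thesis by (simp add: normal_cj)
qed

lemma Kk_normal: "Kk \<lhd> G" by (rule two_set_normal[OF k0(1) cm_k0])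

lemma Kk_sub: "subgroup Kk G" using Kk_normal by (rule normal_imp_subgroup)

sublocale Kk: subgroup Kk G by (rule Kk_sub)

lemma Kk_E: "Kk \<subseteq> E" using k0 by simp

lemma E_coset: "p \<in> E \<Longrightarrow> q \<in> E \<Longrightarrow> p \<notin> Kk \<Longrightarrow> q \<notin> Kk \<Longrightarrow> \<exists>k\<in>Kk. p = q \<otimes> k"
proof -
  assume a: "p \<in> E" "q \<in> E" "p \<notin> Kk" "q \<notin> Kk"
  have "q \<otimes> (q \<otimes> p) = p" using a E_sq[of q] by (simp flip: m_assoc)
  moreover have "q \<otimes> p \<in> Kk" by (rule E_four[OF a(2,1,4,3)])
  ultimately show ?thesis by metis
qed

lemma cm_coset: assumes "g \<in> carrier G" "p \<in> E" "q \<in> E" "p \<notin> Kk" "q \<notin> Kk" shows "cm g p = cm g q"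
proof -
  obtain k where k: "k \<in> Kk" "p = q \<otimes> k" using E_coset assms by blast
  have "cm g k = \<one>" using k(1) assms(1) cm_k0 by auto
  moreover have "k \<in> carrier G" using k(1) k0 by auto
  ultimately show ?thesis using k(2) assms by (simp add: cm_mult)
qed

lemma gen2_xy: "gen2 x y"
  unfolding gen2_def
proof (intro conjI allI impI subsetI)
  fix S g assume S: "subgroup S G" "x \<in> S" "y \<in> S" and g: "g \<in> carrier G"
  obtain i j where "g = x [^] (i::int) \<otimes> y [^] (j::int)" using fact[OF g] by blast
  then show "g \<in> S" using S subgroup_int_pow_closed[OF S(1)] subgroup.m_closed[OF S(1)] by simp
qed simp_all

text \<open>A normal subgroup containing the commutator of two generators contains \<open>E\<close>.
  \<open>Kk\<close> is too small for this; so is the group of order two generated by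
  \<open>cm g h\<close>, which would be normal if \<open>cm g h\<close> were central.\<close>

lemma gen2_noncentral:
  assumes "gen2 g h" shows "cm g h \<notin> Kk" "\<not> (cm g (cm g h) = \<one> \<and> cm h (cm g h) = \<one>)"
proof -
  have G: "g \<in> carrier G" "h \<in> carrier G" using assms by (simp_all add: gen2_def)
  show 1: "cm g h \<notin> Kk"
  proof
    assume "cm g h \<in> Kk"
    then have "E \<subseteq> Kk" using gen2_cm[OF assms Kk_normal] by (intro E_min[OF Kk_normal]) blast
    then show False using E_big by simp
  qed
  show "\<not> (cm g (cm g h) = \<one> \<and> cm h (cm g h) = \<one>)"
  proof
    assume a: "cm g (cm g h) = \<one> \<and> cm h (cm g h) = \<one>"
    let ?z = "cm g h"
    have zE: "?z \<in> E" using G by (rule cm_E)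
    have zG: "?z \<in> carrier G" using zE by simp
    have "carrier G \<subseteq> {u \<in> carrier G. \<forall>p\<in>{?z}. cm u p \<in> {\<one>}}"
      using assms a G zG subgroup_cm_into[OF one_is_normal, of "{?z}"] by (simp add: gen2_def)
    then have "cm u ?z = \<one>" if "u \<in> carrier G" for u using that by blast
    then have N: "{\<one>, ?z} \<lhd> G" using zE by (intro two_set_normal)
    have "E \<subseteq> {\<one>, ?z}" using gen2_cm[OF assms N] by (intro E_min[OF N]) blast
    then have "k0 = ?z" using k0 by blast
    then show False using 1 by simp
  qed
qed

text \<open>Since \<open>E\<close> has exponent two, \<open>cm (g \<otimes> g) h\<close> reduces to
  \<open>cm g (cm g h)\<close>, which is in \<open>Kk\<close>. An odd power behaving likewise would
  force \<open>g\<close> to do so.\<close>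

lemma power_parity: assumes gh: "gen2 g h" shows "cm (g [^] (i::int)) h \<in> Kk \<longleftrightarrow> even i"
proof -
  have G: "g \<in> carrier G" "h \<in> carrier G" using gh by (simp_all add: gen2_def)
  let ?B = "{u \<in> carrier G. \<forall>p\<in>{h}. cm u p \<in> Kk}"
  have B: "subgroup ?B G" using G by (intro subgroup_cm_into[OF Kk_normal]) simp
  have zE: "cm g h \<in> E" using G by (rule cm_E)
  have "cm (g \<otimes> g) h = cm g (cm g h)" using G zE E_sq[OF zE] by (simp add: mult_cm cj_cm[of g "cm g h"] m_assoc)
  then have gg: "g \<otimes> g \<in> ?B" using cm_cm[OF G(1) zE] G by simp
  show ?thesis
  proof
    assume "even i"
    then obtain j where "i = 2 * j" by (rule evenE)
    then have "g [^] i = (g \<otimes> g) [^] j" using G by (simp add: square_int_pow)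
    then have "g [^] i \<in> ?B" using subgroup_int_pow_closed[OF B gg] by simp
    then show "cm (g [^] i) h \<in> Kk" by blast
  next
    assume "cm (g [^] i) h \<in> Kk"
    then have "g [^] i \<in> ?B" using G by simp
    show "even i"
    proof (rule ccontr)
      assume "odd i"
      then have "g \<in> ?B" by (rule odd_pow_mem[OF ord B G(1) _ \<open>g [^] i \<in> ?B\<close>])
      then show False using gen2_noncentral(1)[OF gh] by blast
    qed
  qed
qed

text \<open>Commutators with elements of \<open>E\<close> outside \<open>Kk\<close> do not depend on
  the chosen element. If a power \<open>?p\<close> of \<open>g\<close> were such an element,
  \<open>g\<close> would commute with \<open>?z\<close> and \<open>h\<close> would not; but then the
  square of \<open>g\<close>, and with it the even power \<open>?p\<close>, commutes with
  \<open>h\<close>.\<close>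

lemma no_power_in_E: assumes gh: "gen2 g h" and i: "g [^] (i::int) \<in> E" shows "g [^] i \<in> Kk"
proof (rule ccontr)
  assume n: "g [^] i \<notin> Kk"
  have G: "g \<in> carrier G" "h \<in> carrier G" using gh by (simp_all add: gen2_def)
  let ?p = "g [^] i" and ?z = "cm g h"
  have zE: "?z \<in> E" using G by (rule cm_E)
  have z: "?z \<notin> Kk" by (rule gen2_noncentral(1)[OF gh])
  have "cm g ?z = cm g ?p" by (rule cm_coset[OF G(1) zE i z n])
  also have "\<dots> = \<one>" using G by (simp add: pow_commute)
  finally have gz: "cm g ?z = \<one>" .
  then have hz: "cm h ?z \<noteq> \<one>" using gen2_noncentral(2)[OF gh] by simp
  have hp: "cm h ?p = cm h ?z" by (rule cm_coset[OF G(2) i zE n z])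
  have "cm h ?p \<in> Kk" by (rule cm_cm[OF G(2) i])
  from cm_flip[OF Kk_sub _ _ this] have "cm ?p h \<in> Kk" using G by simp
  then have "even i" using power_parity[OF gh] by simp
  then obtain j where j: "i = 2 * j" by (rule evenE)
  have "cm (g \<otimes> g) h = \<one>" using G zE gz E_sq[OF zE] by (simp add: mult_cm cj_cm[of g ?z] m_assoc)
  then have "g \<otimes> g \<in> {u \<in> carrier G. \<forall>p\<in>{h}. cm u p \<in> {\<one>}}" using G by simp
  then have "(g \<otimes> g) [^] j \<in> {u \<in> carrier G. \<forall>p\<in>{h}. cm u p \<in> {\<one>}}"
    using G by (intro subgroup_int_pow_closed[OF subgroup_cm_into[OF one_is_normal]]) simp_all
  then have "cm ?p h = \<one>" using G j by (simp add: square_int_pow)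
  then have "cm h ?p = \<one>" using inv_cm[of ?p h] G by simp
  then show False using hp hz by simp
qed

text \<open>With \<open>u = h^j\<close> and \<open>v = g^\<mu>\<close>, the power of
  \<open>u \<otimes> v\<close> to \<open>2^r\<close> must not agree modulo \<open>Kk\<close> with
  the product of the powers, or a power of the generator \<open>u \<otimes> v\<close> would lie in
  \<open>E\<close> outside \<open>Kk\<close>. An even \<mu> makes \<open>u\<close> and
  \<open>v\<close> commute modulo \<open>Kk\<close>, and \<open>r \<ge> 2\<close> kills the
  correction \<kappa>; so \<mu> is odd and \<open>r = 1\<close>.\<close>

lemma pair_exponents:
  assumes gh: "gen2 g h" and E: "\<exists>k\<in>Kk. h [^] (2 ^ r * j) \<otimes> g [^] (2 ^ r * \<mu>) = p \<otimes> k" "p \<in> E" "p \<notin> Kk"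
    and j: "odd (j::int)" and r: "r \<ge> 1"
  shows "r = 1 \<and> odd (\<mu>::int) \<and> (h [^] j \<otimes> g [^] \<mu>) \<otimes> (h [^] j \<otimes> g [^] \<mu>) \<in> Kk"
proof -
  have G: "g \<in> carrier G" "h \<in> carrier G" using gh by (simp_all add: gen2_def)
  define u where "u = h [^] j"
  define v where "v = g [^] \<mu>"
  have uv [simp]: "u \<in> carrier G" "v \<in> carrier G" using G by (simp_all add: u_def v_def)
  have gen: "gen2 g (u \<otimes> v)" unfolding u_def v_def by (rule gen2_odd[OF ord gh j])
  have gu: "gen2 g u" using gen2_odd[OF ord gh j, of 0] by (simp add: u_def G)
  have uvp: "\<exists>k\<in>Kk. u [^] ((2::int) ^ r) \<otimes> v [^] ((2::int) ^ r) = p \<otimes> k"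
    using E(1) G by (simp add: u_def v_def int_pow_pow mult.commute)
  have pG: "p \<in> carrier G" using E by simp
  have no: False if a: "(u \<otimes> v) [^] ((2::int) ^ r) \<otimes> inv (u [^] ((2::int) ^ r) \<otimes> v [^] ((2::int) ^ r)) \<in> Kk"
  proof -
    obtain k where k: "k \<in> Kk" "u [^] ((2::int) ^ r) \<otimes> v [^] ((2::int) ^ r) = p \<otimes> k" using uvp by blast
    have kG: "k \<in> E" using k(1) Kk_E by blast
    define w where "w = (u \<otimes> v) [^] ((2::int) ^ r) \<otimes> inv (p \<otimes> k)"
    have w: "w \<in> Kk" using a k(2) by (simp add: w_def)
    have wE: "w \<in> E" using w Kk_E by blast
    have e: "(u \<otimes> v) [^] ((2::int) ^ r) = w \<otimes> (p \<otimes> k)" using pG kG by (simp add: w_def m_assoc)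
    then have "(u \<otimes> v) [^] ((2::int) ^ r) \<in> E" using wE kG E(2) by simp
    then have "w \<otimes> (p \<otimes> k) \<in> Kk" unfolding e[symmetric] by (rule no_power_in_E[OF gen2_sym[OF gen]])
    then have "inv w \<otimes> (w \<otimes> (p \<otimes> k)) \<otimes> inv k \<in> Kk" by (rule Kk.m_closed[OF Kk.m_closed[OF Kk.m_inv_closed[OF w]] Kk.m_inv_closed[OF k(1)]])
    then have "p \<in> Kk" using wE pG kG by (simp add: cancel_left_inv m_assoc)
    then show False using E(3) by simp
  qed
  have muodd: "odd \<mu>"
  proof (rule ccontr)
    assume "\<not> odd \<mu>"
    then have "cm v u \<in> Kk" using power_parity[OF gu, of \<mu>] by (simp add: v_def)
    from cm_flip[OF Kk_sub _ _ this] have "cm u v \<in> Kk" by simp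
    then show False by (intro no pow_mult_mod[OF Kk_normal]) simp_all
  qed
  define \<kappa> where "\<kappa> = cj u (cm v u)"
  have cvu: "cm v u \<in> E" "cm v u \<notin> Kk" using muodd power_parity[OF gu, of \<mu>] cm_E[OF uv(2,1)] by (simp_all add: v_def)
  have \<kappa>E: "\<kappa> \<in> E" using cm_E[of u "cm v u"] cvu by (simp add: \<kappa>_def cj_cm)
  have sq: "(u \<otimes> v) \<otimes> (u \<otimes> v) = \<kappa> \<otimes> ((u \<otimes> u) \<otimes> (v \<otimes> v))" by (simp add: \<kappa>_def word_simps)
  have sqv: "cm (u \<otimes> u) (v \<otimes> v) \<in> Kk"
  proof -
    have 1: "v \<otimes> v = g [^] (2 * \<mu>)" using G by (simp add: v_def int_pow_double)
    have "cm (v \<otimes> v) u \<in> Kk" unfolding 1 using power_parity[OF gu, of "2 * \<mu>"] by simp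
    from cm_flip[OF Kk_sub _ _ this] have 2: "cm u (v \<otimes> v) \<in> Kk" by simp
    have "cm (u \<otimes> u) (v \<otimes> v) = cj u (cm u (v \<otimes> v)) \<otimes> cm u (v \<otimes> v)" by (simp add: mult_cm)
    moreover have "cj u (cm u (v \<otimes> v)) \<in> Kk" using 2 Kk_normal uv(1) unfolding normal_cj by blast
    ultimately show ?thesis using 2 Kk.m_closed by metis
  qed
  have r1: "r = 1"
  proof (rule ccontr)
    assume "r \<noteq> 1"
    then have r2: "r - 1 \<ge> 1" using r by simp
    define N where "N = (2::int) ^ (r - 1)"
    have N: "(2::int) ^ r = 2 * N" using r by (cases r) (simp_all add: N_def)
    have "even ((2::int) ^ (r - 1))" using r2 by simp
    then obtain N' where N': "N = 2 * N'" unfolding N_def by (rule evenE)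
    let ?q = "(u \<otimes> u) \<otimes> (v \<otimes> v)"
    have kN: "\<kappa> [^] N = \<one>" using \<kappa>E E_sq[OF \<kappa>E] square_int_pow[of \<kappa> N'] N' by simp
    have "cm ?q \<kappa> \<in> Kk" using \<kappa>E by (intro cm_cm) simp_all
    then have "cm \<kappa> ?q \<in> Kk" using \<kappa>E by (intro cm_flip[OF Kk_sub, of ?q \<kappa>]) simp_all
    then have "(\<kappa> \<otimes> ?q) [^] N \<otimes> inv (\<kappa> [^] N \<otimes> ?q [^] N) \<in> Kk" using \<kappa>E by (intro pow_mult_mod[OF Kk_normal]) simp_all
    then have a: "(\<kappa> \<otimes> ?q) [^] N \<otimes> inv (?q [^] N) \<in> Kk" using kN by simp
    have b: "?q [^] N \<otimes> inv ((u \<otimes> u) [^] N \<otimes> (v \<otimes> v) [^] N) \<in> Kk" by (intro pow_mult_mod[OF Kk_normal] sqv) simp_all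
    have "(\<kappa> \<otimes> ?q) [^] N \<otimes> inv (?q [^] N) \<otimes> (?q [^] N \<otimes> inv ((u \<otimes> u) [^] N \<otimes> (v \<otimes> v) [^] N)) \<in> Kk"
      by (rule Kk.m_closed[OF a b])
    moreover have "(\<kappa> \<otimes> ?q) [^] N \<otimes> inv (?q [^] N) \<otimes> (?q [^] N \<otimes> inv ((u \<otimes> u) [^] N \<otimes> (v \<otimes> v) [^] N))
        = (\<kappa> \<otimes> ?q) [^] N \<otimes> inv ((u \<otimes> u) [^] N \<otimes> (v \<otimes> v) [^] N)"
      using \<kappa>E by (simp add: m_assoc cancel_left_inv)
    moreover have "(\<kappa> \<otimes> ?q) [^] N = (u \<otimes> v) [^] ((2::int) ^ r)"
      unfolding sq[symmetric] N by (simp add: square_int_pow)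
    moreover have "(u \<otimes> u) [^] N = u [^] ((2::int) ^ r)" "(v \<otimes> v) [^] N = v [^] ((2::int) ^ r)" unfolding N by (simp_all add: square_int_pow)
    ultimately show False by (intro no) simp
  qed
  have "\<kappa> \<notin> Kk"
  proof
    assume "\<kappa> \<in> Kk"
    then have "cj (inv u) \<kappa> \<in> Kk" using Kk_normal inv_closed[OF uv(1)] unfolding normal_cj by blast
    then show False using cvu by (simp add: \<kappa>_def cj_inv_cj)
  qed
  \<comment> \<open>The correction \<kappa> and \<open>p\<close> are both in \<open>E\<close>
    outside \<open>Kk\<close>, so their product is in \<open>Kk\<close>; this brings the square of
    \<open>u \<otimes> v\<close> into \<open>Kk\<close>.\<close>
  then obtain k where k: "k \<in> Kk" "u \<otimes> u \<otimes> (v \<otimes> v) = p \<otimes> k" "\<kappa> \<otimes> p \<in> Kk"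
    using uvp r1 E_four[OF \<kappa>E E(2) _ E(3)] int_pow_double[of u 1] int_pow_double[of v 1] by auto
  have "(u \<otimes> v) \<otimes> (u \<otimes> v) = \<kappa> \<otimes> p \<otimes> k" unfolding sq k(2) using \<kappa>E pG k(1) k0 by (auto simp: m_assoc)
  also have "\<dots> \<in> Kk" by (rule Kk.m_closed[OF k(3) k(1)])
  finally show ?thesis using r1 muodd by (simp add: u_def v_def)
qed

text \<open>The element \<open>c\<close> is read off from the factorization of the commutator of
  \<open>x\<close> and \<open>y\<close> into powers of \<open>x\<close> and \<open>y\<close>, by
  removing the common 2-part of the exponents. \<open>pair_exponents\<close> shows that this 2-part
  is exactly two and that \<open>c\<close> squares into \<open>Kk\<close>.\<close>

lemma generator_structure:
  "\<exists>c j \<mu>. odd (j::int) \<and> c = y [^] j \<otimes> x [^] (\<mu>::int) \<and> c \<otimes> c \<in> Kk \<and> cm x c \<notin> Kk \<and> cm c (cm x c) = \<one>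
    \<and> cm x (cm x c) = k0 \<and> x \<otimes> x \<notin> E \<and> (\<forall>i::int. x [^] i \<in> E \<longrightarrow> x [^] i \<in> Kk) \<and> (\<exists>i::int. x [^] i = k0)"
proof -
  define z0 where "z0 = cm x y"
  have z0: "z0 \<in> E" "z0 \<notin> Kk" using gen2_noncentral(1)[OF gen2_xy] by (simp_all add: z0_def cm_E)
  have z0G: "z0 \<in> carrier G" using z0 by simp
  obtain i j where ij: "z0 = x [^] (i::int) \<otimes> y [^] (j::int)" using fact[OF z0G] by blast
  \<comment> \<open>The power of \<open>x\<close> differs from \<open>z0\<close> by a power of
    \<open>y\<close>, so it commutes with \<open>y\<close> modulo \<open>Kk\<close>;
    \<open>power_parity\<close> turns this into evenness.\<close>
  have ei: "even i"
  proof -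
    have "x [^] i = z0 \<otimes> inv (y [^] j)" using ij by (simp add: m_assoc)
    then have "cm (x [^] i) y = cj z0 (cm (inv (y [^] j)) y) \<otimes> cm z0 y" using z0G by (simp add: mult_cm)
    moreover have "cm (inv (y [^] j)) y = \<one>" using inv_cm[of y "y [^] (-j)"] pow_commute[of y "-j"] by (simp add: int_pow_neg)
    moreover have "cm z0 y \<in> Kk" using cm_cm[OF yG z0(1)] z0G by (intro cm_flip[OF Kk_sub, of y]) simp_all
    ultimately have "cm (x [^] i) y \<in> Kk" using z0G by simp
    then show ?thesis using power_parity[OF gen2_xy] by simp
  qed
  have ej: "even j"
  proof -
    have "y [^] j = inv (x [^] i) \<otimes> z0" using ij by (simp add: cancel_left_inv)
    then have "cm (y [^] j) x = cj (inv (x [^] i)) (cm z0 x) \<otimes> cm (inv (x [^] i)) x" using z0G by (simp add: mult_cm)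
    moreover have "cm (inv (x [^] i)) x = \<one>" using inv_cm[of x "x [^] (-i)"] pow_commute[of x "-i"] by (simp add: int_pow_neg)
    moreover have "cm z0 x \<in> Kk" using cm_cm[OF xG z0(1)] z0G by (intro cm_flip[OF Kk_sub, of x]) simp_all
    then have "cj (inv (x [^] i)) (cm z0 x) \<in> Kk" using Kk_normal inv_closed[OF int_pow_closed[OF xG]] unfolding normal_cj by blast
    ultimately have "cm (y [^] j) x \<in> Kk" using z0G by simp
    then show ?thesis using power_parity[OF gen2_sym[OF gen2_xy]] by simp
  qed
  have i0: "i \<noteq> 0"
  proof
    assume "i = 0"
    then have "z0 = y [^] j" using ij by simp
    then show False using no_power_in_E[OF gen2_sym[OF gen2_xy], of j] z0 by simp
  qed
  have j0: "j \<noteq> 0"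
  proof
    assume "j = 0"
    then have "z0 = x [^] i" using ij by simp
    then show False using no_power_in_E[OF gen2_xy, of i] z0 by simp
  qed
  obtain s i' where s: "i = 2 ^ s * i'" "odd i'" by (rule odd_int_decompose[OF i0])
  obtain r j' where r: "j = 2 ^ r * j'" "odd j'" by (rule odd_int_decompose[OF j0])
  have s1: "s \<ge> 1" using ei s by (cases s) auto
  have r1: "r \<ge> 1" using ej r by (cases r) auto
  \<comment> \<open>\<open>pair_exponents\<close> expects the power of \<open>y\<close> in front;
    the even power of \<open>x\<close> commutes with \<open>y\<close> modulo
    \<open>Kk\<close>.\<close>
  have flip: "\<exists>k\<in>Kk. y [^] j \<otimes> x [^] i = z0 \<otimes> k"
  proof -
    let ?w = "cm (y [^] j) (x [^] i)"
    have "cm (x [^] i) y \<in> Kk" using power_parity[OF gen2_xy] ei by simp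
    from cm_flip[OF Kk_sub _ _ this] have "cm y (x [^] i) \<in> Kk" by simp
    then have "y \<in> {u \<in> carrier G. \<forall>p\<in>{x [^] i}. cm u p \<in> Kk}" by simp
    then have "y [^] j \<in> {u \<in> carrier G. \<forall>p\<in>{x [^] i}. cm u p \<in> Kk}"
      by (intro subgroup_int_pow_closed[OF subgroup_cm_into[OF Kk_normal]]) simp_all
    then have w: "?w \<in> Kk" by blast
    have "y [^] j \<otimes> x [^] i = ?w \<otimes> z0" unfolding ij by (simp add: word_simps)
    also have "\<dots> = z0 \<otimes> ?w" using w z0 Kk_E by (intro E_comm) auto
    finally show ?thesis using w by blast
  qed
  \<comment> \<open>If the 2-part of \<open>i\<close> were the smaller one,
    \<open>pair_exponents\<close> with \<open>x\<close> and \<open>y\<close> exchanged would make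
    \<open>2 ^ (r - s) * j'\<close> odd.\<close>
  have rs: "r \<le> s"
  proof (rule ccontr)
    assume "\<not> r \<le> s"
    then have "j = 2 ^ s * (2 ^ (r - s) * j')" using r(1) by (simp flip: power_add mult.assoc)
    moreover have "\<exists>k\<in>Kk. x [^] i \<otimes> y [^] j = z0 \<otimes> k" using ij z0G by (intro bexI[of _ \<one>]) simp_all
    ultimately have "odd (2 ^ (r - s) * j')"
      using pair_exponents[OF gen2_sym[OF gen2_xy], of s i' "2 ^ (r - s) * j'" z0] s z0 s1 by simp
    then show False using \<open>\<not> r \<le> s\<close> by simp
  qed
  define \<mu> where "\<mu> = 2 ^ (s - r) * i'"
  have i\<mu>: "i = 2 ^ r * \<mu>" using s(1) rs by (simp add: \<mu>_def flip: power_add mult.assoc)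
  define c where "c = y [^] j' \<otimes> x [^] \<mu>"
  have pe: "r = 1 \<and> odd \<mu> \<and> c \<otimes> c \<in> Kk"
    unfolding c_def using pair_exponents[OF gen2_xy, of r j' \<mu> z0] flip r i\<mu> z0 r1 by simp
  have cG [simp]: "c \<in> carrier G" by (simp add: c_def)
  have gxc: "gen2 x c" unfolding c_def by (rule gen2_odd[OF ord gen2_xy r(2)])
  define z where "z = cm x c"
  have z: "z \<in> E" "z \<notin> Kk" using gen2_noncentral(1)[OF gxc] by (simp_all add: z_def cm_E)
  have zG [simp]: "z \<in> carrier G" using z by simp
  \<comment> \<open>The commutator of \<open>x\<close> with the square of \<open>c\<close> is
    trivial and expands to \<open>z \<otimes> cj c z\<close>; the square of \<open>z\<close> is
    trivial as well.\<close>
  have cz: "cm c z = \<one>"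
  proof -
    have "cm x (c \<otimes> c) = \<one>" using pe cm_k0[OF xG] by auto
    then have "z \<otimes> cj c z = \<one>" by (simp add: z_def cm_mult)
    moreover have "cj c z = cm c z \<otimes> z" by (simp add: cj_cm)
    moreover have "cm c z \<in> E" by (simp add: cm_E)
    ultimately have "cm c z \<otimes> (z \<otimes> z) = \<one>" using E_comm[OF z(1), of "cm c z"] by (simp flip: m_assoc)
    then show ?thesis using E_sq[OF z(1)] by simp
  qed
  have xz: "cm x z = k0"
  proof -
    have "cm x z \<noteq> \<one>" using gen2_noncentral(2)[OF gxc] cz by (simp add: z_def)
    then show ?thesis using cm_cm[OF xG z(1)] by simp
  qed
  have xK: "x [^] i \<in> Kk" if "x [^] i \<in> E" for i :: int by (rule no_power_in_E[OF gxc that])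
  have xx: "x \<otimes> x \<notin> E"
  proof
    assume "x \<otimes> x \<in> E"
    moreover have "x \<otimes> x = x [^] (2::int)" using int_pow_double[of x 1] by simp
    ultimately have "x \<otimes> x \<in> Kk" using xK[of 2] by simp
    then have "(x \<otimes> x) [^] \<mu> \<in> Kk" by (rule subgroup_int_pow_closed[OF Kk_sub])
    then have xi: "x [^] i \<in> Kk" using i\<mu> pe by (simp add: square_int_pow)
    then have xiE: "x [^] i \<in> E" using Kk_E by blast
    have yj: "y [^] j = inv (x [^] i) \<otimes> z0" using ij by (simp add: cancel_left_inv)
    then have "y [^] j \<in> E" using xiE z0 by simp
    then have "y [^] j \<in> Kk" by (rule no_power_in_E[OF gen2_sym[OF gen2_xy]])
    then have "x [^] i \<otimes> y [^] j \<in> Kk" by (rule Kk.m_closed[OF xi])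
    then show False using ij z0 by simp
  qed
  \<comment> \<open>\<open>y'\<close> generates the same cyclic group as \<open>y\<close>. Its
    square is a power of \<open>x\<close> up to a factor in \<open>E\<close> outside
    \<open>Kk\<close>, and its fourth power is a power of \<open>x\<close>.\<close>
  define y' where "y' = y [^] j'"
  have y'G [simp]: "y' \<in> carrier G" by (simp add: y'_def)
  have gxy': "gen2 x y'" using gen2_odd[OF ord gen2_xy r(2), of 0] by (simp add: y'_def)
  have y'c: "y' = c \<otimes> x [^] (-\<mu>)" by (simp add: c_def y'_def m_assoc int_pow_neg)
  define \<kappa> where "\<kappa> = cm (x [^] (-\<mu>)) c"
  have \<kappa>: "\<kappa> \<in> E" "\<kappa> \<notin> Kk" using power_parity[OF gxc, of "-\<mu>"] pe by (simp_all add: \<kappa>_def cm_E)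
  have \<kappa>c: "cj c \<kappa> = \<kappa>"
  proof -
    have "cm c \<kappa> = \<one>" using cm_coset[OF cG \<kappa>(1) z(1) \<kappa>(2) z(2)] cz by simp
    then show ?thesis using \<kappa>(1) by (simp add: cj_cm)
  qed
  define \<kappa>1 where "\<kappa>1 = \<kappa> \<otimes> (c \<otimes> c)"
  have ccE: "c \<otimes> c \<in> E" using pe Kk_E by blast
  have \<kappa>1: "\<kappa>1 \<in> E" "\<kappa>1 \<notin> Kk"
  proof -
    show "\<kappa>1 \<in> E" using \<kappa>(1) ccE by (simp add: \<kappa>1_def)
    show "\<kappa>1 \<notin> Kk"
    proof
      assume "\<kappa>1 \<in> Kk"
      then have "\<kappa>1 \<otimes> inv (c \<otimes> c) \<in> Kk" by (rule Kk.m_closed[OF _ Kk.m_inv_closed[OF conjunct2[OF conjunct2[OF pe]]]])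
      moreover have "\<kappa>1 \<otimes> inv (c \<otimes> c) = \<kappa>" using \<kappa>(1) ccE by (simp add: \<kappa>1_def m_assoc)
      ultimately show False using \<kappa>(2) by simp
    qed
  qed
  have y'2: "y' \<otimes> y' = \<kappa>1 \<otimes> x [^] (-2 * \<mu>)"
  proof -
    let ?v = "x [^] (-\<mu>)"
    have "y' \<otimes> y' = cj c \<kappa> \<otimes> (c \<otimes> c) \<otimes> (?v \<otimes> ?v)" unfolding y'c \<kappa>_def by (simp add: word_simps)
    also have "?v \<otimes> ?v = x [^] (-2 * \<mu>)" using int_pow_double[of x "-\<mu>"] by simp
    finally show ?thesis using \<kappa>c by (simp add: \<kappa>1_def)
  qed
  have xxE: "cj (x [^] (2 * t::int)) p = p" if p: "p \<in> E" for t p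
  proof -
    have "cm (x \<otimes> x) p = \<one>"
    proof -
      have pG: "p \<in> carrier G" using p by simp
      have c1: "cm x p \<in> Kk" by (rule cm_cm[OF xG p])
      then have c1E: "cm x p \<in> E" using Kk_E by blast
      have "cm x (cm x p) = \<one>" using c1 cm_k0[OF xG] by auto
      then have "cj x (cm x p) = cm x p" using c1E by (simp add: cj_cm)
      then have "cm (x \<otimes> x) p = cm x p \<otimes> cm x p" using pG by (simp add: mult_cm)
      then show ?thesis using E_sq[OF c1E] by simp
    qed
    then have "x \<otimes> x \<in> {u \<in> carrier G. \<forall>q\<in>{p}. cm u q \<in> {\<one>}}" by simp
    then have "(x \<otimes> x) [^] t \<in> {u \<in> carrier G. \<forall>q\<in>{p}. cm u q \<in> {\<one>}}"
      using p by (intro subgroup_int_pow_closed[OF subgroup_cm_into[OF one_is_normal]]) auto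
    then have "cm (x [^] (2 * t)) p = \<one>" by (simp add: square_int_pow)
    then show ?thesis using p by (simp add: cj_cm)
  qed
  have y'4: "(y' \<otimes> y') \<otimes> (y' \<otimes> y') = x [^] (-4 * \<mu>)"
  proof -
    let ?v = "x [^] (-2 * \<mu>)"
    have "(y' \<otimes> y') \<otimes> (y' \<otimes> y') = \<kappa>1 \<otimes> cj ?v \<kappa>1 \<otimes> (?v \<otimes> ?v)" unfolding y'2 using \<kappa>1(1) by (simp add: word_simps)
    also have "cj ?v \<kappa>1 = \<kappa>1" using xxE[OF \<kappa>1(1), of "-\<mu>"] by simp
    also have "\<kappa>1 \<otimes> \<kappa>1 = \<one>" by (rule E_sq[OF \<kappa>1(1)])
    also have "?v \<otimes> ?v = x [^] (-4 * \<mu>)" using int_pow_double[of x "-2 * \<mu>"] by simp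
    finally show ?thesis by simp
  qed
  have k0G: "k0 \<in> carrier G" using k0 by simp
  have "\<exists>p q. k0 = x [^] (p::int) \<otimes> y' [^] (q::int)"
  proof -
    have "y \<in> {y' [^] (k::int) |k. True}"
    proof (rule odd_pow_mem[OF ord subgroup_powers[OF y'G] yG r(2)])
      show "y [^] j' \<in> {y' [^] (k::int) |k. True}" by (auto simp: y'_def[symmetric] intro!: exI[of _ "1::int"])
    qed
    then obtain v where v: "y = y' [^] (v::int)" by blast
    obtain p q where "k0 = x [^] (p::int) \<otimes> y [^] (q::int)" using fact[OF k0G] by blast
    then have "k0 = x [^] p \<otimes> y' [^] (v * q)" by (subst (asm) v) (simp add: int_pow_pow)
    then show ?thesis by blast
  qed
  then obtain p q where pq: "k0 = x [^] (p::int) \<otimes> y' [^] (q::int)" by blast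
  have eq: "even q"
  proof -
    have "inv (x [^] p) \<otimes> (x [^] p \<otimes> y' [^] q) = y' [^] q" by (simp add: cancel_left_inv)
    then have "y' [^] q = inv (x [^] p) \<otimes> k0" unfolding pq[symmetric] by (rule sym)
    then have "cm (y' [^] q) x = cj (inv (x [^] p)) (cm k0 x) \<otimes> cm (inv (x [^] p)) x" using k0G by (simp add: mult_cm)
    moreover have "cm (inv (x [^] p)) x = \<one>" using inv_cm[of x "x [^] (-p)"] pow_commute[of x "-p"] by (simp add: int_pow_neg)
    moreover have "cm k0 x = \<one>" using inv_cm[of x k0] cm_k0[OF xG] k0G by simp
    ultimately have "cm (y' [^] q) x \<in> Kk" by simp
    then show ?thesis using power_parity[OF gen2_sym[OF gxy']] by simp
  qed
  then obtain q1 where q1: "q = 2 * q1" by (rule evenE)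
  have y4: "y' [^] (2 * (2 * t)) = x [^] (-4 * \<mu> * t)" for t :: int
  proof -
    have "y' [^] (2 * (2 * t)) = ((y' \<otimes> y') \<otimes> (y' \<otimes> y')) [^] t" by (simp add: square_int_pow)
    also have "\<dots> = x [^] (-4 * \<mu> * t)" unfolding y'4 by (simp add: int_pow_pow)
    finally show ?thesis .
  qed
  \<comment> \<open>If four divides \<open>q\<close>, the power of \<open>y'\<close> in
    \<open>k0\<close> is a power of \<open>x\<close>. Otherwise \<open>k0\<close> is a conjugate of
    \<kappa>1 times a power of \<open>x\<close>; that power would be in \<open>E\<close>, hence in
    \<open>Kk\<close>, and so would \<kappa>1.\<close>
  have "\<exists>w::int. x [^] w = k0"
  proof (cases "even q1")
    case True
    then obtain t where "q1 = 2 * t" by (rule evenE)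
    then have "k0 = x [^] (p + (-4 * \<mu> * t))" unfolding int_pow_mult[OF xG] using pq q1 y4[of t] by simp
    then show ?thesis by metis
  next
    case False
    then obtain t where t: "q1 = 2 * t + 1" by (rule oddE)
    have "y' [^] q = (y' \<otimes> y') \<otimes> y' [^] (2 * (2 * t))"
      unfolding q1 t using int_pow_mult[of y' 2 "2 * (2 * t)"] int_pow_double[of y' 1] by (simp add: algebra_simps)
    then have "k0 = x [^] p \<otimes> (\<kappa>1 \<otimes> x [^] (-2 * \<mu>) \<otimes> x [^] (-4 * \<mu> * t))" using pq y4[of t] y'2 by simp
    also have "\<dots> = cj (x [^] p) \<kappa>1 \<otimes> (x [^] p \<otimes> (x [^] (-2 * \<mu>) \<otimes> x [^] (-4 * \<mu> * t)))"
      using \<kappa>1(1) by (simp add: word_simps)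
    also have "x [^] p \<otimes> (x [^] (-2 * \<mu>) \<otimes> x [^] (-4 * \<mu> * t)) = x [^] (p + (-2 * \<mu> + -4 * \<mu> * t))" by (simp only: int_pow_mult[OF xG])
    finally have k0e: "k0 = cj (x [^] p) \<kappa>1 \<otimes> x [^] (p + (-2 * \<mu> + -4 * \<mu> * t))" (is "_ = ?c \<otimes> x [^] ?w") .
    have cE: "?c \<in> E" using cm_E[of "x [^] p" \<kappa>1] \<kappa>1(1) by (simp add: cj_cm)
    have xw: "x [^] ?w = inv ?c \<otimes> k0" unfolding k0e using cE by (simp add: cancel_left_inv)
    then have "x [^] ?w \<in> E" using cE k0 by simp
    then have "x [^] ?w \<in> Kk" by (rule xK)
    then have "k0 \<otimes> inv (x [^] ?w) \<in> Kk" by (intro Kk.m_closed Kk.m_inv_closed) simp_all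
    moreover have "k0 \<otimes> inv (x [^] ?w) = ?c" using k0e cE by (simp add: m_assoc)
    ultimately have "?c \<in> Kk" by (rule back_subst)
    then have "cj (inv (x [^] p)) ?c \<in> Kk" using Kk_normal inv_closed[OF int_pow_closed[OF xG]] unfolding normal_cj by blast
    then show ?thesis using \<kappa>1 by (simp add: cj_inv_cj)
  qed
  then show ?thesis using r(2) pe z(2) cz xz xx xK unfolding z_def c_def by blast
qed

end

section \<open>Generators lifted from the quotient\<close>

lemma (in group_hom) hom_cm: "x \<in> carrier G \<Longrightarrow> y \<in> carrier G \<Longrightarrow> h (G.cm x y) = H.cm (h x) (h y)"
  by (simp add: G.cm_def H.cm_def)

locale bicyclic_metabelian = metabelian_two_group +
  fixes x y :: 'a
  assumes xG [simp]: "x \<in> carrier G" and yG [simp]: "y \<in> carrier G"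
    and fact: "g \<in> carrier G \<Longrightarrow> \<exists>i j. g = x [^] (i::int) \<otimes> y [^] (j::int)"
    and D_min: "N \<lhd> G \<Longrightarrow> (\<And>g h. g \<in> carrier G \<Longrightarrow> h \<in> carrier G \<Longrightarrow> cm g h \<in> N) \<Longrightarrow> D \<subseteq> N"
    and D_noncyclic: "d \<in> D \<Longrightarrow> \<exists>p\<in>D. \<forall>k::int. p \<noteq> d [^] k"
begin

lemma gen2_xy: "gen2 x y"
  unfolding gen2_def
proof (intro conjI allI impI subsetI)
  fix S g assume S: "subgroup S G" "x \<in> S" "y \<in> S" and g: "g \<in> carrier G"
  obtain i j where "g = x [^] (i::int) \<otimes> y [^] (j::int)" using fact[OF g] by blast
  then show "g \<in> S" using S subgroup_int_pow_closed[OF S(1)] subgroup.m_closed[OF S(1)] by simp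
qed simp_all

text \<open>Modulo \<open>J\<close> the group \<open>D\<close> has order four and exponent two, so
  \<open>generator_structure\<close> applies to the quotient. In the pulled back statement
  \<open>J\<close> replaces the trivial subgroup, and lying in \<open>K\<close> but not in
  \<open>J\<close> replaces being equal to \<open>k0\<close>.\<close>

lemma lift_generators:
  assumes K: "K \<lhd> G" "K \<subset> D" "\<And>g p. g \<in> carrier G \<Longrightarrow> p \<in> D \<Longrightarrow> cm g p \<in> K"
      "\<And>p q. p \<in> D \<Longrightarrow> q \<in> D \<Longrightarrow> p \<notin> K \<Longrightarrow> q \<notin> K \<Longrightarrow> p \<otimes> q \<in> K"
    and J: "J \<lhd> G" "D2 \<subseteq> J" "J \<subset> K" "\<And>g p. g \<in> carrier G \<Longrightarrow> p \<in> K \<Longrightarrow> cm g p \<in> J"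
      "\<And>p q. p \<in> K \<Longrightarrow> q \<in> K \<Longrightarrow> p \<notin> J \<Longrightarrow> q \<notin> J \<Longrightarrow> p \<otimes> q \<in> J"
  shows "\<exists>c j \<mu>. odd (j::int) \<and> c = y [^] j \<otimes> x [^] (\<mu>::int) \<and> c \<otimes> c \<in> K \<and> cm x c \<notin> K \<and> cm c (cm x c) \<in> J
    \<and> cm x (cm x c) \<in> K \<and> cm x (cm x c) \<notin> J \<and> x \<otimes> x \<notin> D \<and> (\<forall>i::int. x [^] i \<in> D \<longrightarrow> x [^] i \<in> K)
    \<and> (\<exists>i::int. x [^] i \<in> K \<and> x [^] i \<notin> J)"
proof -
  interpret J: normal J G by (rule J(1))
  interpret K: normal K G by (rule K(1))
  interpret H: group "G Mod J" by (rule J.factorgroup_is_group)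
  define f where "f g = J #> g" for g
  interpret f: group_hom G "G Mod J" f
    unfolding f_def by (intro group_hom.intro is_group H.is_group group_hom_axioms.intro J.r_coset_hom_Mod)
  have KD: "p \<in> D" if "p \<in> K" for p using that K(2) by blast
  have f_one: "f g = \<one>\<^bsub>G Mod J\<^esub> \<longleftrightarrow> g \<in> J" if "g \<in> carrier G" for g
    using coset_join1[of J g] coset_join2[of g J] that J.subgroup_axioms by (auto simp: f_def FactGroup_def)
  have f_eq: "f g = f h \<longleftrightarrow> g \<otimes> inv h \<in> J" if "g \<in> carrier G" "h \<in> carrier G" for g h
  proof -
    have "f g = f h \<longleftrightarrow> f g \<otimes>\<^bsub>G Mod J\<^esub> inv\<^bsub>G Mod J\<^esub> (f h) = \<one>\<^bsub>G Mod J\<^esub>"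
      using that by (metis H.inv_equality H.r_inv H.inv_inv f.hom_closed H.inv_closed)
    also have "\<dots> \<longleftrightarrow> f (g \<otimes> inv h) = \<one>\<^bsub>G Mod J\<^esub>" using that by simp
    finally show ?thesis using f_one[of "g \<otimes> inv h"] that by simp
  qed
  have surj: "\<exists>g\<in>carrier G. u = f g" if "u \<in> carrier (G Mod J)" for u
    using that by (auto simp: FactGroup_def RCOSETS_def f_def)
  obtain k where k: "k \<in> K" "k \<notin> J" using J(3) by blast
  have kG [simp]: "k \<in> carrier G" using k(1) by (rule K.mem_carrier)
  have ik: "inv k \<in> K" "inv k \<notin> J"
    using k J.m_inv_closed[of "inv k"] by (auto simp: K.m_inv_closed)
  have f_K: "f g \<in> {\<one>\<^bsub>G Mod J\<^esub>, f k} \<longleftrightarrow> g \<in> K" if g: "g \<in> carrier G" for g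
  proof
    assume "f g \<in> {\<one>\<^bsub>G Mod J\<^esub>, f k}"
    then have "g \<in> J \<or> g \<otimes> inv k \<in> J" using f_one[OF g] f_eq[OF g kG] by simp
    then show "g \<in> K"
    proof
      assume "g \<otimes> inv k \<in> J"
      then have "g \<otimes> inv k \<otimes> k \<in> K" by (rule K.m_closed[OF subsetD[OF psubset_imp_subset[OF J(3)]] k(1)])
      then show ?thesis using g by (simp add: m_assoc)
    qed (use J(3) in blast)
  next
    assume "g \<in> K"
    then have "g \<in> J \<or> g \<otimes> inv k \<in> J" using J(5)[OF \<open>g \<in> K\<close> ik(1) _ ik(2)] by (cases "g \<in> J") simp_all
    then show "f g \<in> {\<one>\<^bsub>G Mod J\<^esub>, f k}" using f_one[OF g] f_eq[OF g kG] by simp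
  qed
  have f_D: "f g \<in> f ` D \<longleftrightarrow> g \<in> D" if g: "g \<in> carrier G" for g
  proof
    assume "f g \<in> f ` D"
    then obtain p where p: "p \<in> D" "f g = f p" by (rule imageE) simp
    then have "g \<otimes> inv p \<in> J" using f_eq[OF g, of p] by simp
    then have "g \<otimes> inv p \<in> D" using J(3) KD by blast
    then have "g \<otimes> inv p \<otimes> p \<in> D" using p(1) by (rule D.m_closed)
    then show "g \<in> D" using g p(1) by (simp add: m_assoc)
  qed (rule imageI)
  have "order (G Mod J) * card J = 2 ^ m"
    using lagrange[OF J.subgroup_axioms] ord by (simp add: order_def FactGroup_def)
  then obtain m' where m': "order (G Mod J) = 2 ^ m'"
    using divides_primepow_nat[OF two_is_prime_nat, of "order (G Mod J)" m] by (metis dvd_triv_left)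
  interpret q: bicyclic_four_derived "G Mod J" m' "f x" "f y" "f ` D" "f k"
  proof (rule bicyclic_four_derived.intro[OF H.is_group], rule bicyclic_four_derived_axioms.intro)
    show "order (G Mod J) = 2 ^ m'" by (rule m')
    show "f x \<in> carrier (G Mod J)" "f y \<in> carrier (G Mod J)" by simp_all
    show "\<exists>i j. u = f x [^]\<^bsub>G Mod J\<^esub> (i::int) \<otimes>\<^bsub>G Mod J\<^esub> f y [^]\<^bsub>G Mod J\<^esub> (j::int)" if u: "u \<in> carrier (G Mod J)" for u
    proof -
      obtain g where g: "g \<in> carrier G" "u = f g" using surj[OF u] by (rule bexE)
      obtain i j where "g = x [^] (i::int) \<otimes> y [^] (j::int)" using fact[OF g(1)] by (elim exE)
      then have "u = f x [^]\<^bsub>G Mod J\<^esub> i \<otimes>\<^bsub>G Mod J\<^esub> f y [^]\<^bsub>G Mod J\<^esub> j" using g by (simp add: f.hom_int_pow)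
      then show ?thesis by (intro exI)
    qed
    show "subgroup (f ` D) (G Mod J)" by (rule f.subgroup_img_is_subgroup[OF D_sub])
    show "H.cm u v \<in> f ` D" if u: "u \<in> carrier (G Mod J)" and v: "v \<in> carrier (G Mod J)" for u v
    proof -
      obtain g where g: "g \<in> carrier G" "u = f g" using surj[OF u] by (rule bexE)
      obtain h where h: "h \<in> carrier G" "v = f h" using surj[OF v] by (rule bexE)
      have "H.cm u v = f (cm g h)" using g h by (simp add: f.hom_cm)
      then show ?thesis using cm_D[OF g(1) h(1)] by simp
    qed
    show "p \<otimes>\<^bsub>G Mod J\<^esub> p = \<one>\<^bsub>G Mod J\<^esub>" if p: "p \<in> f ` D" for p
    proof -
      obtain d where d: "d \<in> D" "p = f d" using p by (rule imageE) simp
      have "d \<otimes> d \<in> J" using D2I[OF d(1)] J(2) by blast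
      then have "f (d \<otimes> d) = \<one>\<^bsub>G Mod J\<^esub>" using d f_one[of "d \<otimes> d"] by simp
      then show ?thesis using d by simp
    qed
    show "p \<otimes>\<^bsub>G Mod J\<^esub> q = q \<otimes>\<^bsub>G Mod J\<^esub> p" if pq: "p \<in> f ` D" "q \<in> f ` D" for p q
    proof -
      obtain d where d: "d \<in> D" "p = f d" using pq(1) by (rule imageE) simp
      obtain e where e: "e \<in> D" "q = f e" using pq(2) by (rule imageE) simp
      have "f (d \<otimes> e) = f (e \<otimes> d)" using D_comm[OF d(1) e(1)] by simp
      then show ?thesis using d e by simp
    qed
    show "f k \<in> f ` D" using k KD by simp
    show "f k \<noteq> \<one>\<^bsub>G Mod J\<^esub>" using f_one[OF kG] k by simp
    show "H.cm u (f k) = \<one>\<^bsub>G Mod J\<^esub>" if u: "u \<in> carrier (G Mod J)" for u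
    proof -
      obtain g where g: "g \<in> carrier G" "u = f g" using surj[OF u] by (rule bexE)
      have "f (cm g k) = \<one>\<^bsub>G Mod J\<^esub>" using J(4)[OF g(1) k(1)] f_one[of "cm g k"] g by simp
      then show ?thesis using g by (simp add: f.hom_cm)
    qed
    show "H.cm u p \<in> {\<one>\<^bsub>G Mod J\<^esub>, f k}" if u: "u \<in> carrier (G Mod J)" and p: "p \<in> f ` D" for u p
    proof -
      obtain g where g: "g \<in> carrier G" "u = f g" using surj[OF u] by (rule bexE)
      obtain d where d: "d \<in> D" "p = f d" using p by (rule imageE) simp
      have "f (cm g d) \<in> {\<one>\<^bsub>G Mod J\<^esub>, f k}" using K(3)[OF g(1) d(1)] f_K[of "cm g d"] g d by simp
      then show ?thesis using g d by (simp add: f.hom_cm)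
    qed
    show "f ` D \<subseteq> N" if N: "N \<lhd> G Mod J" "\<And>u v. u \<in> carrier (G Mod J) \<Longrightarrow> v \<in> carrier (G Mod J) \<Longrightarrow> H.cm u v \<in> N" for N
    proof -
      let ?P = "{g \<in> carrier G. f g \<in> N}"
      interpret N: normal N "G Mod J" by (rule N(1))
      have "subgroup ?P G" using N.m_closed N.one_closed by (intro subgroup.intro) auto
      moreover have "cj g p \<in> ?P" if gp: "g \<in> carrier G" "p \<in> ?P" for g p
      proof -
        have "f g \<otimes>\<^bsub>G Mod J\<^esub> f p \<otimes>\<^bsub>G Mod J\<^esub> inv\<^bsub>G Mod J\<^esub> f g \<in> N" using gp by (intro N.inv_op_closed2) auto
        then show ?thesis using gp by (simp add: cj_def)
      qed
      ultimately have P: "?P \<lhd> G" by (simp add: normal_cj)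
      have "D \<subseteq> ?P"
      proof (rule D_min[OF P])
        fix g h assume g: "g \<in> carrier G" "h \<in> carrier G"
        then show "cm g h \<in> ?P" using N(2)[of "f g" "f h"] by (simp add: f.hom_cm)
      qed
      then show ?thesis by (intro image_subsetI) (simp add: subset_iff)
    qed
    show "\<not> f ` D \<subseteq> {\<one>\<^bsub>G Mod J\<^esub>, f k}"
    proof
      assume a: "f ` D \<subseteq> {\<one>\<^bsub>G Mod J\<^esub>, f k}"
      obtain d where d: "d \<in> D" "d \<notin> K" using K(2) by (metis psubsetE subsetI)
      have "f d \<in> {\<one>\<^bsub>G Mod J\<^esub>, f k}" using a d(1) by (rule subsetD[OF _ imageI])
      then show False using f_K[of d] d by simp
    qed
    show "p \<otimes>\<^bsub>G Mod J\<^esub> q \<in> {\<one>\<^bsub>G Mod J\<^esub>, f k}"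
      if pq: "p \<in> f ` D" "q \<in> f ` D" "p \<notin> {\<one>\<^bsub>G Mod J\<^esub>, f k}" "q \<notin> {\<one>\<^bsub>G Mod J\<^esub>, f k}" for p q
    proof -
      obtain d where d: "d \<in> D" "p = f d" using pq(1) by (rule imageE) simp
      obtain e where e: "e \<in> D" "q = f e" using pq(2) by (rule imageE) simp
      have "d \<notin> K" "e \<notin> K" using pq(3,4) f_K[of d] f_K[of e] d e by simp_all
      then have "d \<otimes> e \<in> K" by (rule K(4)[OF d(1) e(1)])
      then have "f (d \<otimes> e) \<in> {\<one>\<^bsub>G Mod J\<^esub>, f k}" using f_K[of "d \<otimes> e"] d e by simp
      then show ?thesis using d e by simp
    qed
  qed
  obtain c' j \<mu> w where j: "odd (j::int)" and c': "c' = f y [^]\<^bsub>G Mod J\<^esub> j \<otimes>\<^bsub>G Mod J\<^esub> f x [^]\<^bsub>G Mod J\<^esub> (\<mu>::int)"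
    and r: "c' \<otimes>\<^bsub>G Mod J\<^esub> c' \<in> {\<one>\<^bsub>G Mod J\<^esub>, f k}" "H.cm (f x) c' \<notin> {\<one>\<^bsub>G Mod J\<^esub>, f k}"
      "H.cm c' (H.cm (f x) c') = \<one>\<^bsub>G Mod J\<^esub>" "H.cm (f x) (H.cm (f x) c') = f k" "f x \<otimes>\<^bsub>G Mod J\<^esub> f x \<notin> f ` D"
      "\<forall>i::int. f x [^]\<^bsub>G Mod J\<^esub> i \<in> f ` D \<longrightarrow> f x [^]\<^bsub>G Mod J\<^esub> i \<in> {\<one>\<^bsub>G Mod J\<^esub>, f k}"
      "f x [^]\<^bsub>G Mod J\<^esub> (w::int) = f k"
    using q.generator_structure by (elim exE conjE)
  define c where "c = y [^] j \<otimes> x [^] \<mu>"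
  have cG [simp]: "c \<in> carrier G" by (simp add: c_def)
  have fc: "c' = f c" by (simp add: c' c_def f.hom_int_pow)
  have "f (c \<otimes> c) \<in> {\<one>\<^bsub>G Mod J\<^esub>, f k}" using r(1) by (simp add: fc)
  then have 1: "c \<otimes> c \<in> K" using f_K[of "c \<otimes> c"] by simp
  have "f (cm x c) \<notin> {\<one>\<^bsub>G Mod J\<^esub>, f k}" using r(2) by (simp add: fc f.hom_cm)
  then have 2: "cm x c \<notin> K" using f_K[of "cm x c"] by simp
  have "f (cm c (cm x c)) = \<one>\<^bsub>G Mod J\<^esub>" using r(3) by (simp add: fc f.hom_cm)
  then have 3: "cm c (cm x c) \<in> J" using f_one[of "cm c (cm x c)"] by simp
  have fl: "f (cm x (cm x c)) = f k" using r(4) by (simp add: fc f.hom_cm)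
  then have 4: "cm x (cm x c) \<in> K" using f_K[of "cm x (cm x c)"] by simp
  have 5: "cm x (cm x c) \<notin> J" using fl f_one[of "cm x (cm x c)"] f_one[OF kG] k by simp
  have "f (x \<otimes> x) \<notin> f ` D" using r(5) by simp
  then have 6: "x \<otimes> x \<notin> D" using f_D[of "x \<otimes> x"] by simp
  have 7: "x [^] i \<in> K" if i: "x [^] i \<in> D" for i :: int
  proof -
    have "f x [^]\<^bsub>G Mod J\<^esub> i \<in> f ` D" using imageI[OF i, of f] by (simp add: f.hom_int_pow)
    then have "f x [^]\<^bsub>G Mod J\<^esub> i \<in> {\<one>\<^bsub>G Mod J\<^esub>, f k}" using r(6) by (elim allE impE)
    then have "f (x [^] i) \<in> {\<one>\<^bsub>G Mod J\<^esub>, f k}" by (simp add: f.hom_int_pow)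
    then show ?thesis using f_K[of "x [^] i"] by simp
  qed
  have fw: "f (x [^] w) = f k" using r(7) by (simp add: f.hom_int_pow)
  then have 8: "x [^] w \<in> K" using f_K[of "x [^] w"] by simp
  have 9: "x [^] w \<notin> J" using fw f_one[of "x [^] w"] f_one[OF kG] k by simp
  show ?thesis
    by (intro exI[of _ c] exI[of _ j] exI[of _ \<mu>] conjI j c_def 1 2 3 4 5 6 exI[of _ w] 8 9 allI impI 7)
qed

lemma cm_cm_swap: "g \<in> carrier G \<Longrightarrow> h \<in> carrier G \<Longrightarrow> p \<in> D \<Longrightarrow> cm g (cm h p) = cm h (cm g p)"
  by (simp add: cm_cj cj_mult cj_inv cj_comm_D[of g h p] inv_mult_group D_ac)

lemma odd_pow_out:
  assumes "subgroup H G" "p \<in> carrier G" "p \<notin> H" "p [^] (i::int) \<in> H" shows "even i"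
  using odd_pow_mem[OF ord assms(1,2) _ assms(4)] assms(3) by (cases "even i") simp_all

lemma a_power_D:
  obtains n where "\<And>k::int. x [^] k \<in> D \<longleftrightarrow> 2 ^ n dvd k"
proof -
  define n where "n = (LEAST n. x [^] ((2::int) ^ n) \<in> D)"
  have "x [^] ((2::int) ^ m) = x [^] ((2::nat) ^ m)" by (simp flip: int_pow_int)
  then have "x [^] ((2::int) ^ m) \<in> D" using two_group_pow[OF ord xG] by simp
  then have n: "x [^] ((2::int) ^ n) \<in> D" unfolding n_def by (rule LeastI)
  have "2 ^ n dvd k" if k: "x [^] k \<in> D" for k :: int
  proof (cases "k = 0")
    case False
    then obtain s t where st: "k = 2 ^ s * t" "odd t" by (rule odd_int_decompose)
    have "(x [^] ((2::int) ^ s)) [^] t \<in> D" using k st by (simp add: int_pow_pow)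
    then have "x [^] ((2::int) ^ s) \<in> D" by (rule odd_pow_mem[OF ord D_sub int_pow_closed[OF xG] st(2)])
    then have "n \<le> s" unfolding n_def by (rule Least_le)
    then show ?thesis using st by (simp add: le_imp_power_dvd)
  qed simp
  moreover have "x [^] k \<in> D" if k: "2 ^ n dvd k" for k :: int
  proof -
    obtain t where "k = 2 ^ n * t" using k by (rule dvdE)
    then have "x [^] k = (x [^] ((2::int) ^ n)) [^] t" by (simp add: int_pow_pow)
    then show ?thesis using D_pow[OF n] by simp
  qed
  ultimately show ?thesis using that[of n] by blast
qed

lemma index_two_split:
  assumes "subgroup N G" "p \<notin> N" "p \<in> carrier G" "q \<in> carrier G" "q \<in> N \<or> q \<otimes> inv p \<in> N"
  shows "\<exists>i. \<exists>r\<in>N. q = r \<otimes> p [^] (i::int)"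
proof (cases "q \<in> N")
  case True
  then show ?thesis using assms by (intro exI[of _ 0] bexI[of _ q]) simp_all
next
  case False
  then show ?thesis using assms by (intro exI[of _ 1] bexI[of _ "q \<otimes> inv p"]) (simp_all add: m_assoc)
qed

text \<open>Two chief steps from \<open>D\<close> give \<open>K\<close> and \<open>J\<close> with
  factors of order two, the second being possible because \<open>D\<close> is not cyclic. The
  calculation modulo \<open>J\<close> supplies \<open>c\<close>; that \<open>J\<close> is already
  \<open>D2\<close>, so that \<open>D\<close> has rank two, is shown by taking one more chief
  step.\<close>

lemma noncyclic_derived_exists: "\<exists>a c n. noncyclic_derived G D m a c n"
proof -
  have "\<exists>p\<in>D. p \<notin> D2"
  proof (rule ccontr)
    assume "\<not> ?thesis"
    then have a: "p \<in> D2" if "p \<in> D" for p using that by simp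
    have "{\<one>} = D"
    proof (rule subgroup_eq_if_Frat[OF ord D_sub normal_imp_subgroup[OF one_is_normal]])
      show "\<exists>h\<in>{\<one>}. \<exists>f\<in>Frat D. q = h \<otimes> f" if "q \<in> D" for q
        using a[OF that] DcG[OF that] unfolding Frat_D by (intro bexI[of _ \<one>] bexI[of _ q]) simp_all
    qed simp
    then show False using D_noncyclic[of \<one>] by auto
  qed
  then have "D2 \<subset> D" using D2_D by blast
  then obtain K where K: "K \<lhd> G" "D2 \<subseteq> K" "K \<subset> D" "\<And>g p. g \<in> carrier G \<Longrightarrow> p \<in> D \<Longrightarrow> cm g p \<in> K"
      "\<And>p q. p \<in> D \<Longrightarrow> q \<in> D \<Longrightarrow> p \<notin> K \<Longrightarrow> q \<notin> K \<Longrightarrow> p \<otimes> q \<in> K"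
    using chief_step[OF ord D2_normal D _ D2I] by metis
  interpret K: normal K G by (rule K(1))
  note Ks = K.subgroup_axioms
  have KD: "p \<in> D" if "p \<in> K" for p using that K(3) by (simp add: psubset_eq subset_iff)
  have splitK: "q \<in> K \<or> q \<otimes> inv p \<in> K" if "p \<in> D" "q \<in> D" "p \<notin> K" for p q
  proof -
    have "inv p \<notin> K" using K.m_inv_closed[of "inv p"] that by auto
    then show ?thesis using that K(5)[of q "inv p"] by (cases "q \<in> K") simp_all
  qed
  \<comment> \<open>Otherwise one element would generate \<open>D\<close> modulo its Frattini
    subgroup.\<close>
  have "D2 \<noteq> K"
  proof
    assume e: "D2 = K"
    obtain d where d: "d \<in> D" "d \<notin> K" using K(3) by (metis psubsetE subsetI)
    have dG: "d \<in> carrier G" using d(1) by (rule DcG)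
    have "{d [^] (k::int) |k. True} = D"
    proof (rule subgroup_eq_if_Frat[OF ord D_sub subgroup_powers[OF dG]])
      show "{d [^] (k::int) |k. True} \<subseteq> D" using D_pow[OF d(1)] by auto
      show "\<exists>h\<in>{d [^] (k::int) |k. True}. \<exists>f\<in>Frat D. q = h \<otimes> f" if q: "q \<in> D" for q
      proof -
        obtain i r where r: "r \<in> K" "q = r \<otimes> d [^] (i::int)"
          using index_two_split[OF Ks d(2) dG DcG[OF q] splitK[OF d(1) q d(2)]] by (elim exE bexE)
        have "q = d [^] i \<otimes> r" using r D_comm[OF KD[OF r(1)] D_pow[OF d(1)]] by simp
        then show ?thesis using r(1) unfolding Frat_D e by (intro bexI[of _ "d [^] i"] bexI[of _ r]) auto
      qed
    qed
    then show False using D_noncyclic[OF d(1)] by blast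
  qed
  then have "D2 \<subset> K" using K(2) by simp
  then obtain J where J: "J \<lhd> G" "D2 \<subseteq> J" "J \<subset> K" "\<And>g p. g \<in> carrier G \<Longrightarrow> p \<in> K \<Longrightarrow> cm g p \<in> J"
      "\<And>p q. p \<in> K \<Longrightarrow> q \<in> K \<Longrightarrow> p \<notin> J \<Longrightarrow> q \<notin> J \<Longrightarrow> p \<otimes> q \<in> J"
    using chief_step[OF ord D2_normal K(1) _ D2I[OF KD]] by metis
  interpret J: normal J G by (rule J(1))
  note Js = J.subgroup_axioms
  have JK: "p \<in> K" if "p \<in> J" for p using that J(3) by (simp add: psubset_eq subset_iff)
  have JD: "p \<in> D" if "p \<in> J" for p using KD[OF JK[OF that]] .
  have splitJ: "q \<in> J \<or> q \<otimes> inv p \<in> J" if "p \<in> K" "q \<in> K" "p \<notin> J" for p q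
  proof -
    have "inv p \<notin> J" using J.m_inv_closed[of "inv p"] that by auto
    then show ?thesis using that J(5)[of q "inv p"] by (cases "q \<in> J") simp_all
  qed
  have "\<exists>c j \<mu>. odd (j::int) \<and> c = y [^] j \<otimes> x [^] (\<mu>::int) \<and> c \<otimes> c \<in> K \<and> cm x c \<notin> K \<and> cm c (cm x c) \<in> J
    \<and> cm x (cm x c) \<in> K \<and> cm x (cm x c) \<notin> J \<and> x \<otimes> x \<notin> D \<and> (\<forall>i::int. x [^] i \<in> D \<longrightarrow> x [^] i \<in> K)
    \<and> (\<exists>i::int. x [^] i \<in> K \<and> x [^] i \<notin> J)"
    by (rule lift_generators) (fact K(1,3-5) J)+
  then obtain c j \<mu> w where j: "odd (j::int)" and c: "c = y [^] j \<otimes> x [^] (\<mu>::int)" and cc: "c \<otimes> c \<in> K"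
    and zK: "cm x c \<notin> K" and cz: "cm c (cm x c) \<in> J" and lK: "cm x (cm x c) \<in> K" "cm x (cm x c) \<notin> J"
    and xx: "x \<otimes> x \<notin> D" and xK: "\<forall>i::int. x [^] i \<in> D \<longrightarrow> x [^] i \<in> K"
    and w: "x [^] (w::int) \<in> K" "x [^] w \<notin> J"
    by (elim exE conjE)
  have cG [simp]: "c \<in> carrier G" by (simp add: c)
  have gxc: "gen2 x c" unfolding c by (rule gen2_odd[OF ord gen2_xy j])
  have all: "g \<in> S" if "subgroup S G" "x \<in> S" "c \<in> S" "g \<in> carrier G" for S g
    using gxc that by (simp add: gen2_def subset_iff)
  define z where "z = cm x c"
  define l where "l = cm x z"
  have zD [simp]: "z \<in> D" by (simp add: z_def cm_D)
  have zG [simp]: "z \<in> carrier G" by (simp add: z_def)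
  have lG [simp]: "l \<in> carrier G" by (simp add: l_def)
  have lD [simp]: "l \<in> D" by (simp add: l_def cm_D)
  have zK: "z \<notin> K" using zK by (simp add: z_def)
  have lK: "l \<in> K" "l \<notin> J" using lK by (simp_all add: l_def z_def)
  have indep: "even i \<and> even k" if h: "z [^] (i::int) \<otimes> l [^] (k::int) \<in> J" for i k
  proof -
    have lk: "l [^] k \<in> K" by (rule subgroup_int_pow_closed[OF Ks lK(1)])
    have "z [^] i \<otimes> l [^] k \<otimes> inv (l [^] k) \<in> K" by (rule K.m_closed[OF JK[OF h] K.m_inv_closed[OF lk]])
    then have "z [^] i \<in> K" by (simp add: m_assoc)
    then have ei: "even i" by (rule odd_pow_out[OF Ks zG zK])
    then have "z [^] i \<in> J" using even_pow_D2[OF zD] J(2) by (simp add: subset_iff)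
    then have "inv (z [^] i) \<otimes> (z [^] i \<otimes> l [^] k) \<in> J" by (rule J.m_closed[OF J.m_inv_closed h])
    then have "l [^] k \<in> J" by (simp add: cancel_left_inv)
    then have "even k" by (rule odd_pow_out[OF Js lG lK(2)])
    then show ?thesis using ei by simp
  qed
  have J_D2: "J = D2"
  proof (rule ccontr)
    \<comment> \<open>A further step \<open>J1\<close> leads to a contradiction: \<open>J1\<close>,
      \<open>z\<close> and \<open>l\<close> generate a normal subgroup \<open>Y\<close> that
      contains \<open>D\<close>, while independence of \<open>z\<close> and \<open>l\<close> modulo
      \<open>J\<close> lets \<open>Y\<close> meet \<open>J\<close> only in
      \<open>J1\<close>.\<close>
    assume "J \<noteq> D2"
    then have "D2 \<subset> J" using J(2) by simp
    then obtain J1 where J1: "J1 \<lhd> G" "D2 \<subseteq> J1" "J1 \<subset> J" "\<And>g p. g \<in> carrier G \<Longrightarrow> p \<in> J \<Longrightarrow> cm g p \<in> J1"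
      using chief_step[OF ord D2_normal J(1) _ D2I[OF JD]] by metis
    interpret J1: normal J1 G by (rule J1(1))
    have J1D: "p \<in> D" if "p \<in> J1" for p
    proof -
      have "p \<in> J" using that J1(3) by (simp add: psubset_eq subset_iff)
      then show ?thesis by (rule JD)
    qed
    \<comment> \<open>\<open>l\<close> and \<open>x^w\<close> represent the same nontrivial coset of
      \<open>J\<close> in \<open>K\<close>. As \<open>x\<close> commutes with its power, the
      commutator with \<open>l\<close> equals that with an element of \<open>J\<close>.\<close>
    have xl: "cm x l \<in> J1"
    proof -
      have "l \<otimes> x [^] w \<in> J" by (rule J(5)[OF lK(1) w(1) lK(2) w(2)])
      then have "cm x (l \<otimes> x [^] w) \<in> J1" by (rule J1(4)[OF xG])
      then show ?thesis by (simp add: cm_mult pow_commute)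
    qed
    have xKJ: "cm x q \<in> J1" if q: "q \<in> K" for q
    proof -
      obtain i r where r: "r \<in> J" "q = r \<otimes> l [^] (i::int)"
        using index_two_split[OF Js lK(2) lG K.mem_carrier[OF q] splitJ[OF lK(1) q lK(2)]] by (elim exE bexE)
      have "cm x q = cm x r \<otimes> cm x l [^] i" using r JD[OF r(1)] by (simp add: cm_D_mult cm_D_pow D_pow)
      then show ?thesis using J1.m_closed[OF J1(4)[OF xG r(1)] subgroup_int_pow_closed[OF J1.subgroup_axioms xl]] by simp
    qed
    \<comment> \<open>\<open>c \<otimes> c\<close> is in \<open>K\<close>, so this commutator is in
      \<open>J1\<close>; splitting off the square of \<open>z\<close> leaves
      \<open>cm c z\<close>.\<close>
    have "cm x (c \<otimes> c) = z \<otimes> cj c z" by (simp add: cm_mult z_def)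
    also have "cj c z = cm c z \<otimes> z" by (simp add: cj_cm)
    also have "z \<otimes> (cm c z \<otimes> z) = cm c z \<otimes> (z \<otimes> z)" by (simp add: D_lcomm cm_D)
    finally have e1: "cm c z \<otimes> (z \<otimes> z) \<in> J1" using xKJ[OF cc] by simp
    have zz: "z \<otimes> z \<in> J1" using J1(2) D2I[OF zD] by (rule subsetD)
    have "cm c z \<otimes> (z \<otimes> z) \<otimes> inv (z \<otimes> z) \<in> J1" by (rule J1.m_closed[OF e1 J1.m_inv_closed[OF zz]])
    moreover have "cm c z \<otimes> (z \<otimes> z) \<otimes> inv (z \<otimes> z) = cm c z" by (subst m_assoc) simp_all
    ultimately have czJ: "cm c z \<in> J1" by simp
    have cj1: "cm g p \<in> J1" if "g \<in> carrier G" "p \<in> J1" for g p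
    proof -
      have "cj g p \<in> J1" using that J1(1) by (simp add: normal_cj)
      then show ?thesis using that by (simp add: cm_cj)
    qed
    \<comment> \<open>The actions of \<open>x\<close> and \<open>c\<close> on \<open>D\<close>
      commute, so this is the commutator of \<open>x\<close> with \<open>cm c z\<close>.\<close>
    have clJ: "cm c l \<in> J1" unfolding l_def using cm_cm_swap[OF cG xG zD] cj1[OF xG czJ] by simp
    define T where "T = {z [^] (i::int) \<otimes> l [^] (k::int) |i k. True}"
    have T: "subgroup T G" unfolding T_def by (rule subgroup_two_powers) simp_all
    define Y where "Y = J1 <#> T"
    have Y: "subgroup Y G" unfolding Y_def by (rule mult_norm_subgroup[OF J1(1) T])
    interpret Y: subgroup Y G by (rule Y)
    have YI: "r \<otimes> (z [^] i \<otimes> l [^] k) \<in> Y" if "r \<in> J1" for r and i k :: int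
      using that unfolding Y_def T_def set_mult_def by auto
    have YE: "\<exists>r\<in>J1. \<exists>i k. p = r \<otimes> (z [^] (i::int) \<otimes> l [^] (k::int))" if "p \<in> Y" for p
      using that unfolding Y_def T_def set_mult_def by auto
    have J1Y: "r \<in> Y" if "r \<in> J1" for r using YI[OF that, of 0 0] J1.mem_carrier[OF that] by simp
    have zY: "z \<in> Y" using YI[OF J1.one_closed, of 1 0] by simp
    have lY: "l \<in> Y" using YI[OF J1.one_closed, of 0 1] by simp
    have cmY: "cm g p \<in> Y" if g: "g \<in> carrier G" and gz: "cm g z \<in> Y" and gl: "cm g l \<in> Y" and p: "p \<in> Y" for g p
    proof -
      obtain r i k where r: "r \<in> J1" "p = r \<otimes> (z [^] (i::int) \<otimes> l [^] (k::int))" using YE[OF p] by (elim bexE exE)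
      have "cm g p = cm g r \<otimes> (cm g z [^] i \<otimes> cm g l [^] k)"
        using g r J1D[OF r(1)] by (simp add: cm_D_mult cm_D_pow D_pow)
      also have "\<dots> \<in> Y" by (rule Y.m_closed[OF J1Y[OF cj1[OF g r(1)]] Y.m_closed[OF subgroup_int_pow_closed[OF Y gz] subgroup_int_pow_closed[OF Y gl]]])
      finally show ?thesis .
    qed
    have nz: "g \<in> nzr Y" if g: "g \<in> carrier G" and gz: "cm g z \<in> Y" and gl: "cm g l \<in> Y" for g
    proof (rule nzrI[OF finite_subset[OF Y.subset fin] Y.subset g])
      fix q assume q: "q \<in> Y"
      have "cm g q \<otimes> q \<in> Y" by (rule Y.m_closed[OF cmY[OF g gz gl q] q])
      then show "cj g q \<in> Y" using g Y.mem_carrier[OF q] by (simp add: cj_cm)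
    qed
    have xY: "x \<in> nzr Y" using lY J1Y[OF xl] by (intro nz) (simp_all add: l_def)
    have cY: "c \<in> nzr Y" using J1Y[OF czJ] J1Y[OF clJ] by (intro nz) simp_all
    have "g \<in> nzr Y" if "g \<in> carrier G" for g by (rule all[OF nzr_subgroup[OF Y.subset] xY cY that])
    then have YN: "Y \<lhd> G" unfolding normal_cj using Y nzrD(1) by simp
    have "cm g h \<in> Y" if "g \<in> carrier G" "h \<in> carrier G" for g h
      using gen2_cm[OF gxc YN] zY that by (simp add: z_def)
    then have DY: "D \<subseteq> Y" by (rule D_min[OF YN])
    have "p \<in> J1" if p: "p \<in> J" for p
    proof -
      have "p \<in> Y" using DY JD[OF p] by (rule subsetD)
      from YE[OF this] obtain r i k where r: "r \<in> J1" "p = r \<otimes> (z [^] (i::int) \<otimes> l [^] (k::int))" by (elim bexE exE)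
      have rJ: "r \<in> J" using r(1) J1(3) by (simp add: psubset_eq subset_iff)
      have "inv r \<otimes> p \<in> J" by (rule J.m_closed[OF J.m_inv_closed[OF rJ] p])
      then have "z [^] i \<otimes> l [^] k \<in> J" using r J1.mem_carrier[OF r(1)] by (simp add: cancel_left_inv)
      then have ev: "even i \<and> even k" by (rule indep)
      then have "z [^] i \<in> J1" "l [^] k \<in> J1" using even_pow_D2[OF zD] even_pow_D2[OF lD] J1(2) by (simp_all add: subset_iff)
      then have "z [^] i \<otimes> l [^] k \<in> J1" by (rule J1.m_closed)
      then show ?thesis unfolding r(2) by (rule J1.m_closed[OF r(1)])
    qed
    then have "J \<subseteq> J1" by (rule subsetI)
    then show False using J1(3) by (simp add: less_le_not_le)
  qed
  obtain n where n: "\<And>k::int. x [^] k \<in> D \<longleftrightarrow> 2 ^ n dvd k" by (rule a_power_D) simp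
  have n2: "n \<ge> 2"
  proof (rule ccontr)
    assume "\<not> n \<ge> 2"
    then have "2 ^ n dvd (2::int)" by (cases n) simp_all
    then have "x [^] (2::int) \<in> D" using n by simp
    then show False using xx int_pow_double[of x 1] by simp
  qed
  have gen_D: "\<exists>i k. \<exists>d\<in>D2. p = z [^] (i::int) \<otimes> l [^] (k::int) \<otimes> d" if p: "p \<in> D" for p
  proof -
    obtain i q where q: "q \<in> K" "p = q \<otimes> z [^] (i::int)"
      using index_two_split[OF Ks zK zG DcG[OF p] splitK[OF zD p zK]] by (elim exE bexE)
    obtain k d where d: "d \<in> J" "q = d \<otimes> l [^] (k::int)"
      using index_two_split[OF Js lK(2) lG K.mem_carrier[OF q(1)] splitJ[OF lK(1) q(1) lK(2)]] by (elim exE bexE)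
    have "p = z [^] i \<otimes> l [^] k \<otimes> d" unfolding q(2) d(2) using JD[OF d(1)] by (simp add: D_ac D_pow)
    then show ?thesis using d(1) unfolding J_D2 by (intro exI bexI)
  qed
  have "noncyclic_derived G D m x c n"
  proof (rule noncyclic_derived.intro[OF metabelian_two_group_axioms], rule noncyclic_derived_axioms.intro)
    show "x \<in> carrier G" "c \<in> carrier G" by simp_all
    have M: "subgroup (cyc x) G" by (rule cyc_subgroup[OF xG])
    have MN: "cyc x \<lhd> G" by (rule above_D_normal[OF M cyc_D[OF xG]])
    have cM: "c \<otimes> c \<in> cyc x" using cyc_D[OF xG] KD[OF cc] by (rule subsetD)
    show "g \<in> cyc x \<or> (\<exists>u\<in>cyc x. g = c \<otimes> u)" if g: "g \<in> carrier G" for g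
    proof -
      have S: "subgroup (cyc x \<union> (\<lambda>m. c \<otimes> m) ` cyc x) G"
        using MN cM by (intro subgroup_extend_index_two[OF M cG _ _ finite_subset[OF subgroup.subset[OF M] fin]]) (simp_all add: normal_cj)
      have "g \<in> cyc x \<union> (\<lambda>m. c \<otimes> m) ` cyc x"
      proof (rule all[OF S _ _ g])
        show "x \<in> cyc x \<union> (\<lambda>m. c \<otimes> m) ` cyc x" using cyc_self[OF xG] by simp
        have "c \<otimes> \<one> \<in> (\<lambda>m. c \<otimes> m) ` cyc x" by (rule imageI[OF subgroup.one_closed[OF M]])
        then show "c \<in> cyc x \<union> (\<lambda>m. c \<otimes> m) ` cyc x" by simp
      qed
      then show ?thesis by (simp add: image_iff)
    qed
    show "c \<notin> cyc x"
    proof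
      assume "c \<in> cyc x"
      then obtain k p where kp: "c = x [^] (k::int) \<otimes> p" "p \<in> D" by (auto simp: cyc_def)
      have "z = cj (x [^] k) (cm x p)" unfolding z_def kp(1) using kp(2) by (simp add: cm_mult pow_commute)
      moreover have "cj (x [^] k) (cm x p) \<in> K" using K(1) K(4)[OF xG kp(2)] by (simp add: normal_cj)
      ultimately show False using zK by simp
    qed
    show "c \<otimes> c \<in> D" by (rule KD[OF cc])
    show "x [^] k \<in> D \<longleftrightarrow> 2 ^ n dvd k" for k :: int by (rule n)
    show "n \<ge> 2" by (rule n2)
    show "cm c p \<in> D2" if p: "p \<in> D" for p
    proof -
      obtain i k d where d: "d \<in> D2" "p = z [^] (i::int) \<otimes> l [^] (k::int) \<otimes> d" using gen_D[OF p] by (elim exE bexE)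
      have dD: "d \<in> D" using D2_D d(1) by (rule subsetD)
      have dK: "d \<in> K" using K(2) d(1) by (rule subsetD)
      have e: "cm c p = cm c z [^] i \<otimes> cm c l [^] k \<otimes> cm c d" using d dD by (simp add: cm_D_mult cm_D_pow D_pow)
      have "cm c z \<in> J" using cz by (simp add: z_def)
      then show ?thesis unfolding e J_D2[symmetric]
        by (rule J.m_closed[OF J.m_closed[OF subgroup_int_pow_closed[OF Js] subgroup_int_pow_closed[OF Js J(4)[OF cG lK(1)]]] J(4)[OF cG dK]])
    qed
    show "\<exists>d\<in>D2. x [^] ((2::int) ^ n) = cm x (cm x c) \<otimes> d"
    proof -
      have xD: "x [^] ((2::int) ^ n) \<in> D" using n by simp
      have xnJ: "x [^] ((2::int) ^ n) \<notin> J"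
      proof
        assume a: "x [^] ((2::int) ^ n) \<in> J"
        have "2 ^ n dvd w" using n KD[OF w(1)] by simp
        then obtain t where "w = 2 ^ n * t" by (rule dvdE)
        then have "x [^] w = (x [^] ((2::int) ^ n)) [^] t" by (simp add: int_pow_pow)
        then show False using w(2) subgroup_int_pow_closed[OF Js a] by simp
      qed
      \<comment> \<open>Both \<open>l\<close> and the power of \<open>x\<close> lie in
        \<open>K\<close> outside \<open>J\<close>, so they agree modulo \<open>J\<close>. The power
        is outside \<open>J\<close> because \<open>x^w\<close> is one of its powers.\<close>
      have "inv l \<in> K" "inv l \<notin> J" using lK K.m_inv_closed[OF lK(1)] J.m_inv_closed[of "inv l"] by auto
      then have "inv l \<otimes> x [^] ((2::int) ^ n) \<in> J" using xK xD xnJ by (intro J(5)) simp_all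
      then show ?thesis unfolding J_D2 z_def[symmetric] l_def[symmetric]
        by (intro bexI[of _ "inv l \<otimes> x [^] ((2::int) ^ n)"]) (simp_all add: cancel_left_inv)
    qed
    show "\<exists>i k. \<exists>d\<in>D2. p = cm x c [^] (i::int) \<otimes> cm x (cm x c) [^] (k::int) \<otimes> d" if "p \<in> D" for p
      using gen_D[OF that] by (simp add: z_def l_def)
    show "even i \<and> even k" if "cm x c [^] (i::int) \<otimes> cm x (cm x c) [^] (k::int) \<in> D2" for i k
      using indep[of i k] that by (simp add: z_def l_def J_D2)
  qed
  then show ?thesis by (intro exI)
qed

end

section \<open>Fusion\<close>

locale two_group_fusion = group +
  fixes m :: nat and F :: "'a set \<Rightarrow> 'a set \<Rightarrow> ('a \<Rightarrow> 'a) set"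
  assumes ord: "order G = 2 ^ m" and sat: "saturated_fusion_system 2 G F"
begin

section \<open>Morphisms of the fusion system\<close>

lemma fin: "finite (carrier G)"
  using ord by (metis order_gt_0_iff_finite zero_less_numeral zero_less_power)

lemma finite_subgroup: "subgroup Q G \<Longrightarrow> finite Q"
  using subgroup.subset fin by (rule finite_subset)

lemma fusion: "fusion_system G F" using sat by (simp add: saturated_fusion_system_def)

lemma F_sub: "subgroup P G \<Longrightarrow> subgroup Q G \<Longrightarrow>
    F P Q \<subseteq> {\<phi>. \<phi> \<in> hom (G\<lparr>carrier := P\<rparr>) (G\<lparr>carrier := Q\<rparr>) \<and> inj_on \<phi> P \<and> \<phi> \<in> extensional P} \<and> Hom_S G P Q \<subseteq> F P Q"
  using fusion unfolding fusion_system_def by (elim conjE) simp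

lemma F_mor:
  assumes "subgroup P G" "subgroup Q G" "\<phi> \<in> F P Q"
  shows "p \<in> P \<Longrightarrow> \<phi> p \<in> Q" "p \<in> P \<Longrightarrow> q \<in> P \<Longrightarrow> \<phi> (p \<otimes> q) = \<phi> p \<otimes> \<phi> q" "inj_on \<phi> P" "\<phi> \<in> extensional P"
proof -
  have "\<phi> \<in> hom (G\<lparr>carrier := P\<rparr>) (G\<lparr>carrier := Q\<rparr>) \<and> inj_on \<phi> P \<and> \<phi> \<in> extensional P"
    using F_sub[OF assms(1,2)] assms(3) by (simp add: subset_iff)
  then show "p \<in> P \<Longrightarrow> \<phi> p \<in> Q" "p \<in> P \<Longrightarrow> q \<in> P \<Longrightarrow> \<phi> (p \<otimes> q) = \<phi> p \<otimes> \<phi> q" "inj_on \<phi> P" "\<phi> \<in> extensional P"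
    by (auto simp: hom_def)
qed

lemma conjmap_cj: "conjmap G g P = restrict (cj g) P"
  by (simp add: conjmap_def cj_def fun_eq_iff restrict_def)

lemma F_conj: "subgroup P G \<Longrightarrow> subgroup Q G \<Longrightarrow> g \<in> carrier G \<Longrightarrow> cj g ` P \<subseteq> Q \<Longrightarrow> restrict (cj g) P \<in> F P Q"
proof -
  assume a: "subgroup P G" "subgroup Q G" "g \<in> carrier G" "cj g ` P \<subseteq> Q"
  have "(\<lambda>x. g \<otimes> x \<otimes> inv g) ` P \<subseteq> Q" using a(4) by (simp add: image_subset_iff cj_def)
  then have "restrict (cj g) P \<in> Hom_S G P Q"
    unfolding Hom_S_def conjmap_cj using a(3) by (intro CollectI exI[of _ g] conjI refl)
  then show ?thesis using F_sub[OF a(1,2)] by (simp add: subset_iff)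
qed

lemma F_comp: "subgroup P G \<Longrightarrow> subgroup Q G \<Longrightarrow> subgroup R G \<Longrightarrow> \<phi> \<in> F P Q \<Longrightarrow> \<psi> \<in> F Q R \<Longrightarrow> (\<lambda>x\<in>P. \<psi> (\<phi> x)) \<in> F P R"
  using fusion unfolding fusion_system_def comp_def by (elim conjE) simp

lemma F_inverse: "subgroup P G \<Longrightarrow> subgroup Q G \<Longrightarrow> \<phi> \<in> F P Q \<Longrightarrow> \<phi> \<in> F P (\<phi> ` P) \<and> restrict (inv_into P \<phi>) (\<phi> ` P) \<in> F (\<phi> ` P) P"
  using fusion unfolding fusion_system_def by (elim conjE) simp

text \<open>The inclusion of \<open>Q\<close> into \<open>R\<close> is conjugation by the identity,
  hence a morphism to compose with.\<close>

lemma F_enlarge: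
  assumes "subgroup P G" "subgroup Q G" "subgroup R G" "\<phi> \<in> F P Q" "Q \<subseteq> R" shows "\<phi> \<in> F P R"
proof -
  have c: "cj \<one> q = q" if "q \<in> Q" for q using subgroup.mem_carrier[OF assms(2) that] by (simp add: cj_def)
  then have "restrict (cj \<one>) Q \<in> F Q R" using assms(5) by (intro F_conj assms) (simp_all add: image_subset_iff subset_iff)
  from F_comp[OF assms(1-4) this] have "(\<lambda>x\<in>P. restrict (cj \<one>) Q (\<phi> x)) \<in> F P R" .
  moreover have "(\<lambda>x\<in>P. restrict (cj \<one>) Q (\<phi> x)) = \<phi>"
    using F_mor(1,4)[OF assms(1,2,4)] by (intro extensionalityI[of _ P]) (simp_all add: c)
  ultimately show ?thesis by simp
qed

lemma F_image_subgroup: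
  assumes "subgroup P G" "subgroup Q G" "\<phi> \<in> F P Q" shows "subgroup (\<phi> ` P) G"
proof -
  interpret P: subgroup P G by (rule assms(1))
  note m = F_mor[OF assms]
  have G: "\<phi> p \<in> carrier G" if "p \<in> P" for p using m(1)[OF that] subgroup.mem_carrier[OF assms(2)] by simp
  have "\<phi> \<one> \<otimes> \<phi> \<one> = \<phi> \<one> \<otimes> \<one>" using m(2)[of \<one> \<one>] G[of \<one>] by simp
  then have o: "\<phi> \<one> = \<one>" using G[of \<one>] by (simp only: l_cancel P.one_closed one_closed)
  have i: "inv (\<phi> p) = \<phi> (inv p)" if "p \<in> P" for p
    using m(2)[of "inv p" p] that G o by (intro inv_equality) simp_all
  show ?thesis
  proof
    show "\<phi> ` P \<subseteq> carrier G" using G by (rule image_subsetI)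
    show "\<one> \<in> \<phi> ` P" using imageI[OF P.one_closed, of \<phi>] o by simp
    fix u assume u: "u \<in> \<phi> ` P"
    then obtain p where p: "p \<in> P" "u = \<phi> p" by (rule imageE) simp
    show "inv u \<in> \<phi> ` P" using p i[OF p(1)] imageI[OF P.m_inv_closed[OF p(1)], of \<phi>] by simp
    fix v assume "v \<in> \<phi> ` P"
    then obtain q where q: "q \<in> P" "v = \<phi> q" by (rule imageE) simp
    show "u \<otimes> v \<in> \<phi> ` P" using p q m(2)[OF p(1) q(1)] imageI[OF P.m_closed[OF p(1) q(1)], of \<phi>] by simp
  qed
qed

lemma Hom_S_auto:
  assumes Q: "subgroup Q G" shows "Hom_S G Q Q = (\<lambda>g. restrict (cj g) Q) ` nzr Q"
proof -
  have "g \<in> nzr Q \<longleftrightarrow> g \<in> carrier G \<and> cj g ` Q \<subseteq> Q" for g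
    using nzrI[OF finite_subgroup[OF Q] subgroup.subset[OF Q], of g] nzrD[of g Q] by (auto simp: image_subset_iff)
  then show ?thesis unfolding Hom_S_def conjmap_cj by (auto simp: cj_def image_iff)
qed

lemma auto_surj:
  assumes Q: "subgroup Q G" and \<alpha>: "\<alpha> \<in> F Q Q" shows "\<alpha> ` Q = Q"
  using F_mor(1,3)[OF Q Q \<alpha>] by (intro endo_inj_surj finite_subgroup[OF Q]) auto

lemma N_phi_nzr:
  assumes "subgroup P G" "subgroup (\<phi> ` P) G"
  shows "N_phi G P \<phi> = {g \<in> nzr P. \<exists>h\<in>nzr (\<phi> ` P). \<forall>x\<in>P. \<phi> (cj g x) = cj h (\<phi> x)}"
  using assms unfolding N_phi_def by (simp add: cj_def normalizer_eq_nzr subgroup.subset)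

lemma N_phi_subgroup:
  assumes P: "subgroup P G" and \<phi>: "\<phi> \<in> F P (carrier G)"
  shows "subgroup (N_phi G P \<phi>) G" "P \<subseteq> N_phi G P \<phi>"
proof -
  note m = F_mor[OF P subgroup_self \<phi>]
  interpret P: subgroup P G by (rule P)
  have I: "subgroup (\<phi> ` P) G" by (rule F_image_subgroup[OF P subgroup_self \<phi>])
  note N = N_phi_nzr[OF P I]
  have s1: "subgroup (nzr P) G" by (rule nzr_subgroup[OF P.subset])
  have s2: "subgroup (nzr (\<phi> ` P)) G" by (rule nzr_subgroup[OF subgroup.subset[OF I]])
  show "subgroup (N_phi G P \<phi>) G"
    unfolding N
  proof
    show "{g \<in> nzr P. \<exists>h\<in>nzr (\<phi> ` P). \<forall>x\<in>P. \<phi> (cj g x) = cj h (\<phi> x)} \<subseteq> carrier G" using nzrD(2) by auto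
    show "\<one> \<in> {g \<in> nzr P. \<exists>h\<in>nzr (\<phi> ` P). \<forall>x\<in>P. \<phi> (cj g x) = cj h (\<phi> x)}"
      using subgroup.one_closed[OF s1] subgroup.one_closed[OF s2] m(1) by (auto intro!: bexI[of _ \<one>] simp: cj_def)
    fix g assume "g \<in> {g \<in> nzr P. \<exists>h\<in>nzr (\<phi> ` P). \<forall>x\<in>P. \<phi> (cj g x) = cj h (\<phi> x)}"
    then obtain h where g: "g \<in> nzr P" and h: "h \<in> nzr (\<phi> ` P)" and gh: "\<And>x. x \<in> P \<Longrightarrow> \<phi> (cj g x) = cj h (\<phi> x)" by auto
    have gG: "g \<in> carrier G" and hG: "h \<in> carrier G" using nzrD(2) g h by simp_all
    have ig: "inv g \<in> nzr P" by (rule subgroup.m_inv_closed[OF s1 g])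
    have "\<phi> (cj (inv g) x) = cj (inv h) (\<phi> x)" if x: "x \<in> P" for x
    proof -
      have x': "cj (inv g) x \<in> P" by (rule nzrD(1)[OF ig x])
      have "\<phi> x = cj h (\<phi> (cj (inv g) x))" using gh[OF x'] gG x by (simp add: cj_cj_inv)
      then show ?thesis using hG m(1)[OF x'] by (simp add: cj_inv_cj)
    qed
    then show "inv g \<in> {g \<in> nzr P. \<exists>h\<in>nzr (\<phi> ` P). \<forall>x\<in>P. \<phi> (cj g x) = cj h (\<phi> x)}"
      using ig subgroup.m_inv_closed[OF s2 h] by (simp, intro bexI[of _ "inv h"]) simp_all
    fix g' assume "g' \<in> {g \<in> nzr P. \<exists>h\<in>nzr (\<phi> ` P). \<forall>x\<in>P. \<phi> (cj g x) = cj h (\<phi> x)}"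
    then obtain h' where g': "g' \<in> nzr P" and h': "h' \<in> nzr (\<phi> ` P)" and gh': "\<And>x. x \<in> P \<Longrightarrow> \<phi> (cj g' x) = cj h' (\<phi> x)" by auto
    have gG': "g' \<in> carrier G" and hG': "h' \<in> carrier G" using nzrD(2) g' h' by simp_all
    have "\<phi> (cj (g \<otimes> g') x) = cj (h \<otimes> h') (\<phi> x)" if x: "x \<in> P" for x
      using gh[OF nzrD(1)[OF g' x]] gh'[OF x] gG gG' hG hG' m(1)[OF x] x by (simp add: mult_cj)
    then show "g \<otimes> g' \<in> {g \<in> nzr P. \<exists>h\<in>nzr (\<phi> ` P). \<forall>x\<in>P. \<phi> (cj g x) = cj h (\<phi> x)}"
      using subgroup.m_closed[OF s1 g g'] subgroup.m_closed[OF s2 h h'] by (simp, intro bexI[of _ "h \<otimes> h'"]) simp_all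
  qed
  show "P \<subseteq> N_phi G P \<phi>"
  proof
    fix g assume g: "g \<in> P"
    have "\<phi> (cj g x) = cj (\<phi> g) (\<phi> x)" if x: "x \<in> P" for x
    proof -
      have "\<phi> (cj g x) \<otimes> \<phi> g = \<phi> (cj g x \<otimes> g)" using g x by (simp add: m(2) cj_def)
      also have "cj g x \<otimes> g = g \<otimes> x" using g x by (simp add: cj_def m_assoc)
      also have "\<phi> (g \<otimes> x) = \<phi> g \<otimes> \<phi> x" using g x by (rule m(2))
      finally have "\<phi> (cj g x) = \<phi> g \<otimes> \<phi> x \<otimes> inv (\<phi> g)"
        using g x m(1) by (metis P.m_closed P.m_inv_closed cj_def inv_solve_right m_closed)
      then show ?thesis by (simp add: cj_def)
    qed
    moreover have "g \<in> nzr P" using subgroup_nzr[OF P finite_subgroup[OF P]] g by (rule subsetD)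
    moreover have "\<phi> g \<in> nzr (\<phi> ` P)" using subgroup_nzr[OF I finite_subgroup[OF I]] imageI[OF g] by (rule subsetD)
    ultimately show "g \<in> N_phi G P \<phi>" unfolding N by (simp, intro bexI[of _ "\<phi> g"]) simp_all
  qed
qed

section \<open>Downward induction on the order of subgroups\<close>

definition inner_on where "inner_on Q \<longleftrightarrow> (\<forall>\<phi>\<in>F Q (carrier G). \<exists>g\<in>carrier G. \<forall>x\<in>Q. \<phi> x = cj g x)"

lemma inner_onD: "inner_on Q \<Longrightarrow> \<phi> \<in> F Q (carrier G) \<Longrightarrow> \<exists>g\<in>carrier G. \<forall>x\<in>Q. \<phi> x = cj g x"
  by (simp add: inner_on_def)

text \<open>A fully normalized image is fully centralized, so the extension axiom applies. Because
  of \<open>g\<close> the domain of the extension is larger than \<open>P\<close>, and there all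
  morphisms are inner.\<close>

lemma extend_inner:
  assumes P: "subgroup P G" and \<phi>: "\<phi> \<in> F P (carrier G)" and fn: "fully_normalized G F (\<phi> ` P)"
    and g: "g \<in> N_phi G P \<phi>" "g \<notin> P"
    and big: "\<And>Q. subgroup Q G \<Longrightarrow> card P < card Q \<Longrightarrow> inner_on Q"
  shows "\<exists>k\<in>carrier G. \<forall>x\<in>P. \<phi> x = cj k x"
proof -
  have fc: "fully_centralized G F (\<phi> ` P)" using sat fn by (simp add: saturated_fusion_system_def)
  have "\<forall>P \<phi>. subgroup P G \<longrightarrow> \<phi> \<in> F P (carrier G) \<longrightarrow> fully_centralized G F (\<phi> ` P) \<longrightarrow>
        (\<exists>\<psi>\<in>F (N_phi G P \<phi>) (carrier G). \<forall>x\<in>P. \<psi> x = \<phi> x)"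
    using sat unfolding saturated_fusion_system_def by (elim conjE)
  then have "\<exists>\<psi>\<in>F (N_phi G P \<phi>) (carrier G). \<forall>x\<in>P. \<psi> x = \<phi> x" using P \<phi> fc by (elim allE impE)
  then obtain \<psi> where \<psi>: "\<psi> \<in> F (N_phi G P \<phi>) (carrier G)" "\<forall>x\<in>P. \<psi> x = \<phi> x" by (rule bexE)
  note N = N_phi_subgroup[OF P \<phi>]
  have "P \<subset> N_phi G P \<phi>" using N(2) g by (metis psubsetI)
  then have "card P < card (N_phi G P \<phi>)" by (rule psubset_card_mono[OF finite_subgroup[OF N(1)]])
  then have "inner_on (N_phi G P \<phi>)" by (rule big[OF N(1)])
  from inner_onD[OF this \<psi>(1)] obtain k where k: "k \<in> carrier G" "\<forall>x\<in>N_phi G P \<phi>. \<psi> x = cj k x" by (rule bexE)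
  have "\<phi> x = cj k x" if "x \<in> P" for x using bspec[OF k(2) subsetD[OF N(2) that]] bspec[OF \<psi>(2) that] by simp
  then show ?thesis using k(1) by (intro bexI ballI)
qed

text \<open>The automorphisms of \<open>R\<close> in \<open>F\<close> form an
  \<open>automizer\<close>: the odd index is the Sylow condition for fully normalized subgroups, and
  the extension property is \<open>extend_inner\<close> with \<open>R\<close> as its own
  image.\<close>

lemma fully_normalized_automizer:
  assumes no: "\<And>Q A r. \<not> nontrivial_automizer G m Q A r"
    and fn: "fully_normalized G F R"
    and big: "\<And>Q. subgroup Q G \<Longrightarrow> card R < card Q \<Longrightarrow> inner_on Q"
  shows "F R R = (\<lambda>g. restrict (cj g) R) ` nzr R"
proof (rule ccontr)
  assume ne: "F R R \<noteq> (\<lambda>g. restrict (cj g) R) ` nzr R"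
  have R: "subgroup R G" using fn by (simp add: fully_normalized_def)
  interpret R: subgroup R G by (rule R)
  obtain r where r: "card (F R R) = card (Hom_S G R R) * r" "\<not> 2 dvd r"
    using sat fn unfolding saturated_fusion_system_def by metis
  have "automizer G m R (F R R) r"
  proof (rule automizer.intro[OF is_group], rule automizer_axioms.intro)
    show "order G = 2 ^ m" by (rule ord)
    show "subgroup R G" by (rule R)
    show "F R R \<subseteq> Bij R"
      using F_mor(3,4)[OF R R] auto_surj[OF R] by (intro subsetI) (simp add: Bij_def bij_betw_def)
    show "\<alpha> (x \<otimes> y) = \<alpha> x \<otimes> \<alpha> y" if "\<alpha> \<in> F R R" "x \<in> R" "y \<in> R" for \<alpha> x y using F_mor(2)[OF R R that] .
    show "compose R \<alpha> \<beta> \<in> F R R" if "\<alpha> \<in> F R R" "\<beta> \<in> F R R" for \<alpha> \<beta>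
      using F_comp[OF R R R that(2,1)] by (simp add: compose_def)
    show "restrict (inv_into R \<alpha>) R \<in> F R R" if "\<alpha> \<in> F R R" for \<alpha>
      using F_inverse[OF R R that] auto_surj[OF R that] by simp
    show "restrict (cj g) R \<in> F R R" if "g \<in> nzr R" for g
      using nzrD[OF that] by (intro F_conj R) auto
    show "card (F R R) = card ((\<lambda>g. restrict (cj g) R) ` nzr R) * r" using r(1) by (simp add: Hom_S_auto[OF R])
    show "odd r" by (rule r(2))
    show "\<alpha> \<in> (\<lambda>g. restrict (cj g) R) ` nzr R"
      if a: "\<alpha> \<in> F R R" "g \<in> nzr R" "g \<notin> R" "h \<in> nzr R" "\<And>x. x \<in> R \<Longrightarrow> \<alpha> (cj g x) = cj h (\<alpha> x)" for \<alpha> g h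
    proof -
      have \<alpha>: "\<alpha> \<in> F R (carrier G)" by (rule F_enlarge[OF R R subgroup_self a(1) R.subset])
      have im: "\<alpha> ` R = R" by (rule auto_surj[OF R a(1)])
      have gN: "g \<in> N_phi G R \<alpha>" using a(2,4,5) R by (simp add: N_phi_nzr im) (rule bexI[of _ h], simp_all)
      have "fully_normalized G F (\<alpha> ` R)" using fn by (simp add: im)
      from extend_inner[OF R \<alpha> this gN a(3)] have "\<exists>k\<in>carrier G. \<forall>x\<in>R. \<alpha> x = cj k x" using big by simp
      then obtain k where k: "k \<in> carrier G" "\<forall>x\<in>R. \<alpha> x = cj k x" by (rule bexE)
      have "k \<in> nzr R"
      proof (rule nzrI[OF finite_subgroup[OF R] R.subset k(1)])
        show "cj k q \<in> R" if "q \<in> R" for q using F_mor(1)[OF R R a(1) that] k(2) that by simp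
      qed
      moreover have "\<alpha> = restrict (cj k) R"
        using k(2) F_mor(4)[OF R R a(1)] by (intro extensionalityI[of _ R]) simp_all
      ultimately show ?thesis by (intro image_eqI)
    qed
  qed
  then interpret automizer G m R "F R R" r .
  have "nontrivial_automizer G m R (F R R) r"
    by (rule nontrivial_automizer.intro[OF automizer_axioms], rule nontrivial_automizer_axioms.intro) (use ne in \<open>simp add: S_def\<close>)
  then show False using no by simp
qed

text \<open>All automorphisms of the fully normalized image being inner, the action of some
  \<open>g\<close> normalizing \<open>P\<close> from outside is carried by \<psi> to the action of
  an element \<open>h\<close>. So \<open>g\<close> lies in \<open>N_phi\<close>, and \<psi> extends
  to a larger subgroup. Only \<open>P = carrier G\<close> offers no such \<open>g\<close>; there
  \<psi> is itself an automorphism of the image.\<close>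

lemma inner_onto:
  assumes no: "\<And>Q A r. \<not> nontrivial_automizer G m Q A r"
    and P: "subgroup P G" and \<psi>: "\<psi> \<in> F P (carrier G)" and fn: "fully_normalized G F (\<psi> ` P)"
    and big: "\<And>Q. subgroup Q G \<Longrightarrow> card P < card Q \<Longrightarrow> inner_on Q"
  shows "\<exists>k\<in>carrier G. \<forall>x\<in>P. \<psi> x = cj k x"
proof -
  let ?R = "\<psi> ` P"
  have R: "subgroup ?R G" by (rule F_image_subgroup[OF P subgroup_self \<psi>])
  note m = F_mor[OF P subgroup_self \<psi>]
  have cR: "card ?R = card P" by (rule card_image[OF m(3)])
  have aut: "F ?R ?R = (\<lambda>g. restrict (cj g) ?R) ` nzr ?R"
    by (rule fully_normalized_automizer[OF no fn]) (simp add: cR big)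
  have autE: "\<exists>h\<in>nzr ?R. \<forall>u\<in>?R. \<alpha> u = cj h u" if "\<alpha> \<in> F ?R ?R" for \<alpha>
  proof -
    obtain h where "h \<in> nzr ?R" "\<alpha> = restrict (cj h) ?R" using \<open>\<alpha> \<in> F ?R ?R\<close> unfolding aut by (rule imageE) simp
    then show ?thesis by (intro bexI[of _ h] ballI) simp_all
  qed
  show ?thesis
  proof (cases "P = carrier G")
    case True
    then have "?R = P" using card_subset_eq[OF fin subgroup.subset[OF R]] cR by simp
    then have "\<psi> \<in> F ?R ?R" using \<psi> True by simp
    from autE[OF this] obtain h where h: "h \<in> nzr ?R" "\<forall>u\<in>?R. \<psi> u = cj h u" by (rule bexE)
    then show ?thesis using nzrD(2)[OF h(1)] unfolding \<open>?R = P\<close> by (intro bexI)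
  next
    case False
    obtain g where g: "g \<in> nzr P" "g \<notin> P" using normalizer_grows[OF two_is_prime_nat ord P False] by (rule bexE)
    have gP: "restrict (cj g) P \<in> F P P" using nzrD[OF g(1)] by (intro F_conj P) auto
    have \<psi>R: "\<psi> \<in> F P ?R" and iR: "restrict (inv_into P \<psi>) ?R \<in> F ?R P"
      using F_inverse[OF P subgroup_self \<psi>] by simp_all
    define \<alpha> where "\<alpha> = (\<lambda>u\<in>?R. (\<lambda>x\<in>P. \<psi> (restrict (cj g) P x)) (restrict (inv_into P \<psi>) ?R u))"
    have "\<alpha> \<in> F ?R ?R" unfolding \<alpha>_def by (rule F_comp[OF R P R iR F_comp[OF P P R gP \<psi>R]])
    from autE[OF this] obtain h where h: "h \<in> nzr ?R" "\<forall>u\<in>?R. \<alpha> u = cj h u" by (rule bexE)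
    have "\<psi> (cj g x) = cj h (\<psi> x)" if x: "x \<in> P" for x
    proof -
      have "\<alpha> (\<psi> x) = \<psi> (cj g x)" using x m(3) by (simp add: \<alpha>_def)
      then show ?thesis using h(2) x by simp
    qed
    then have "g \<in> N_phi G P \<psi>" unfolding N_phi_nzr[OF P R] using g(1) h(1) by (simp, intro bexI[of _ h]) simp_all
    then show ?thesis by (rule extend_inner[OF P \<psi> fn _ g(2)]) (rule big)
  qed
qed

text \<open>A morphism \<psi> from \<open>Q\<close> onto a fully normalized subgroup is inner, and
  so is \<psi> composed with the inverse of any given \<phi>, since both have the same fully
  normalized image. Hence \<phi> is inner.\<close>

lemma all_inner:
  assumes no: "\<And>Q A r. \<not> nontrivial_automizer G m Q A r"
  shows "subgroup Q G \<Longrightarrow> inner_on Q"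
proof (induction "card (carrier G) - card Q" arbitrary: Q rule: less_induct)
  case less
  note Q = less.prems
  have big: "inner_on Q'" if Q': "subgroup Q' G" "card Q < card Q'" for Q'
  proof (rule less.hyps[OF _ Q'(1)])
    have "card Q' \<le> card (carrier G)" by (rule card_mono[OF fin subgroup.subset[OF Q'(1)]])
    then show "card (carrier G) - card Q' < card (carrier G) - card Q" using Q'(2) by simp
  qed
  \<comment> \<open>The image with the largest normalizer is fully normalized, because everything
    conjugate to it in \<open>F\<close> is again an image of \<open>Q\<close>.\<close>
  let ?C = "(\<lambda>\<phi>. normalizer G (\<phi> ` Q)) ` F Q (carrier G)"
  have incl: "restrict (cj \<one>) Q \<in> F Q (carrier G)"
    using subgroup.mem_carrier[OF Q] by (intro F_conj Q subgroup_self) auto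
  have nsub: "normalizer G (\<phi> ` Q) \<subseteq> carrier G" if "\<phi> \<in> F Q (carrier G)" for \<phi>
    using normalizer_eq_nzr[OF subgroup.subset[OF F_image_subgroup[OF Q subgroup_self that]]] nzrD(2) by auto
  have "?C \<subseteq> Pow (carrier G)" using nsub by auto
  then have finC: "finite ?C" using fin by (simp add: finite_subset)
  have neC: "?C \<noteq> {}" using incl by auto
  obtain N where N: "N \<in> ?C" "\<forall>M\<in>?C. card M \<le> card N" using ex_max_card[OF finC neC] by (rule bexE)
  obtain \<psi> where \<psi>: "\<psi> \<in> F Q (carrier G)" "N = normalizer G (\<psi> ` Q)" using N(1) by (rule imageE) simp
  have mx: "card (normalizer G (\<phi> ` Q)) \<le> card (normalizer G (\<psi> ` Q))" if "\<phi> \<in> F Q (carrier G)" for \<phi>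
    using bspec[OF N(2) imageI[OF that]] by (simp add: \<psi>(2))
  let ?R = "\<psi> ` Q"
  have R: "subgroup ?R G" by (rule F_image_subgroup[OF Q subgroup_self \<psi>(1)])
  have \<psi>R: "\<psi> \<in> F Q ?R" using F_inverse[OF Q subgroup_self \<psi>(1)] by simp
  have fn: "fully_normalized G F ?R"
    unfolding fully_normalized_def
  proof (intro conjI R allI impI)
    fix T assume "F_conjugate G F ?R T"
    then obtain \<phi> where \<phi>: "\<phi> \<in> F ?R (carrier G)" "T = \<phi> ` ?R" unfolding F_conjugate_def by (rule bexE)
    have "(\<lambda>x\<in>Q. \<phi> (\<psi> x)) \<in> F Q (carrier G)" by (rule F_comp[OF Q R subgroup_self \<psi>R \<phi>(1)])
    moreover have "(\<lambda>x\<in>Q. \<phi> (\<psi> x)) ` Q = T" unfolding \<phi>(2) image_image by (rule image_cong) simp_all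
    ultimately show "card (normalizer G T) \<le> card (normalizer G ?R)" using mx by fastforce
  qed
  have "\<exists>g0\<in>carrier G. \<forall>x\<in>Q. \<psi> x = cj g0 x" by (rule inner_onto[OF no Q \<psi>(1) fn]) (rule big)
  then obtain g0 where g0: "g0 \<in> carrier G" "\<forall>x\<in>Q. \<psi> x = cj g0 x" by (rule bexE)
  show ?case unfolding inner_on_def
  proof
    fix \<phi> assume \<phi>: "\<phi> \<in> F Q (carrier G)"
    note m = F_mor[OF Q subgroup_self \<phi>]
    let ?Q1 = "\<phi> ` Q"
    have Q1: "subgroup ?Q1 G" by (rule F_image_subgroup[OF Q subgroup_self \<phi>])
    have c1: "card ?Q1 = card Q" by (rule card_image[OF m(3)])
    have i1: "restrict (inv_into Q \<phi>) ?Q1 \<in> F ?Q1 Q" using F_inverse[OF Q subgroup_self \<phi>] by simp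
    define \<psi>1 where "\<psi>1 = (\<lambda>u\<in>?Q1. \<psi> (restrict (inv_into Q \<phi>) ?Q1 u))"
    have \<psi>1: "\<psi>1 \<in> F ?Q1 (carrier G)" unfolding \<psi>1_def by (rule F_comp[OF Q1 Q subgroup_self i1 \<psi>(1)])
    have e: "\<psi>1 (\<phi> x) = \<psi> x" if "x \<in> Q" for x using that m(3) by (simp add: \<psi>1_def)
    have im: "\<psi>1 ` ?Q1 = ?R" unfolding image_image by (rule image_cong) (simp_all add: e)
    have "\<exists>g1\<in>carrier G. \<forall>u\<in>?Q1. \<psi>1 u = cj g1 u"
      by (rule inner_onto[OF no Q1 \<psi>1, unfolded im c1, OF fn]) (rule big)
    then obtain g1 where g1: "g1 \<in> carrier G" "\<forall>u\<in>?Q1. \<psi>1 u = cj g1 u" by (rule bexE)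
    have "\<phi> x = cj (inv g1 \<otimes> g0) x" if x: "x \<in> Q" for x
    proof -
      have "cj g1 (\<phi> x) = cj g0 x" using bspec[OF g1(2) imageI[OF x]] e[OF x] bspec[OF g0(2) x] by simp
      moreover have "cj (inv g1) (cj g1 (\<phi> x)) = \<phi> x" using g1(1) m(1)[OF x] by (simp add: cj_inv_cj)
      ultimately show ?thesis using g0(1) g1(1) subgroup.mem_carrier[OF Q x] by (simp add: mult_cj)
    qed
    then show "\<exists>g\<in>carrier G. \<forall>x\<in>Q. \<phi> x = cj g x" using g0(1) g1(1) by (intro bexI[of _ "inv g1 \<otimes> g0"]) simp_all
  qed
qed

lemma nilpotent_if_no_automizer:
  assumes no: "\<And>Q A r. \<not> nontrivial_automizer G m Q A r"
  shows "nilpotent_fusion_system G F"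
  unfolding nilpotent_fusion_system_def
proof (intro allI impI equalityI subsetI)
  fix P Q \<phi> assume P: "subgroup P G" and Q: "subgroup Q G"
  show "\<phi> \<in> F P Q" if "\<phi> \<in> Hom_S G P Q" using F_sub[OF P Q] that by (simp add: subset_iff)
  assume \<phi>: "\<phi> \<in> F P Q"
  have "\<phi> \<in> F P (carrier G)" by (rule F_enlarge[OF P Q subgroup_self \<phi> subgroup.subset[OF Q]])
  from inner_onD[OF all_inner[OF no P] this]
  obtain g where g: "g \<in> carrier G" "\<forall>x\<in>P. \<phi> x = cj g x" by (rule bexE)
  have "\<phi> = conjmap G g P"
    unfolding conjmap_cj using g(2) F_mor(4)[OF P Q \<phi>] by (intro extensionalityI[of _ P]) simp_all
  moreover have "(\<lambda>x. g \<otimes> x \<otimes> inv g) ` P \<subseteq> Q"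
    using F_mor(1)[OF P Q \<phi>] g(2) by (auto simp: cj_def)
  ultimately show "\<phi> \<in> Hom_S G P Q" unfolding Hom_S_def using g(1) by (simp, intro exI[of _ g]) simp
qed

end

text \<open>The two cyclic factors are abelian, so Ito's theorem makes the derived subgroup
  abelian.\<close>

lemma (in group) bicyclic_metabelian_derived:
  assumes ord: "order G = 2 ^ m" and bi: "bicyclic G" and nc: "\<not> cyclic_subgroup G (derived G (carrier G))"
  shows "\<exists>x y. bicyclic_metabelian G (derived G (carrier G)) m x y"
proof -
  let ?D = "derived G (carrier G)"
  obtain x y where xy: "x \<in> carrier G" "y \<in> carrier G" "carrier G = generate G {x} <#> generate G {y}"
    using bi unfolding bicyclic_def by (elim bexE)
  have fact: "\<exists>i j. g = x [^] (i::int) \<otimes> y [^] (j::int)" if "g \<in> carrier G" for g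
    using that xy(3) unfolding generate_pow[OF xy(1)] generate_pow[OF xy(2)] set_mult_def by auto
  have comm: "u \<otimes> v = v \<otimes> u" if uv: "w \<in> carrier G" "u \<in> {w [^] (k::int) |k. True}" "v \<in> {w [^] (k::int) |k. True}" for u v w
  proof -
    obtain i j where ij: "u = w [^] (i::int)" "v = w [^] (j::int)" using uv(2,3) by auto
    have "u \<otimes> v = w [^] (i + j)" "v \<otimes> u = w [^] (j + i)" using ij that(1) by (simp_all only: int_pow_mult)
    then show ?thesis by (simp add: add.commute)
  qed
  have DN: "?D \<lhd> G" by (rule derived_self_is_normal)
  have cmD: "cm g h \<in> ?D" if "g \<in> carrier G" "h \<in> carrier G" for g h
    unfolding derived_def cm_def using that by (intro generate.incl) blast
  have "metabelian_two_group G ?D m"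
  proof (rule metabelian_two_group.intro[OF is_group], rule metabelian_two_group_axioms.intro)
    show "order G = 2 ^ m" by (rule ord)
    show "?D \<lhd> G" by (rule DN)
    show "p \<otimes> q = q \<otimes> p" if "p \<in> ?D" "q \<in> ?D" for p q
    proof (rule ito[OF subgroup_powers[OF xy(1)] comm[OF xy(1)] subgroup_powers[OF xy(2)] comm[OF xy(2)] _ that])
      show "\<exists>a\<in>{x [^] (k::int) |k. True}. \<exists>b\<in>{y [^] (k::int) |k. True}. g = a \<otimes> b" if g: "g \<in> carrier G" for g
        using fact[OF g] by blast
    qed
    show "cm g h \<in> ?D" if "g \<in> carrier G" "h \<in> carrier G" for g h using that by (rule cmD)
  qed
  then interpret metabelian_two_group G ?D m .
  have "bicyclic_metabelian G ?D m x y"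
  proof (rule bicyclic_metabelian.intro[OF metabelian_two_group_axioms], rule bicyclic_metabelian_axioms.intro)
    show "x \<in> carrier G" "y \<in> carrier G" by (rule xy)+
    show "\<exists>i j. g = x [^] (i::int) \<otimes> y [^] (j::int)" if "g \<in> carrier G" for g using that by (rule fact)
    show "?D \<subseteq> N" if N: "N \<lhd> G" "\<And>g h. g \<in> carrier G \<Longrightarrow> h \<in> carrier G \<Longrightarrow> cm g h \<in> N" for N
      unfolding derived_def
    proof (rule generate_subgroup_incl[OF _ normal_imp_subgroup[OF N(1)]])
      show "derived_set G (carrier G) \<subseteq> N" using N(2) by (auto simp: cm_def)
    qed
    show "\<exists>p\<in>?D. \<forall>k::int. p \<noteq> d [^] k" if d: "d \<in> ?D" for d
    proof (rule ccontr)
      assume "\<not> ?thesis"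
      then have "?D \<subseteq> generate G {d}" unfolding generate_pow[OF DcG[OF d]] by blast
      moreover have "generate G {d} \<subseteq> ?D" using d by (intro generate_subgroup_incl[OF _ D_sub]) simp
      ultimately have "?D = generate G {d}" by (rule subset_antisym)
      then have "cyclic_subgroup G ?D" unfolding cyclic_subgroup_def by (rule bexI[OF _ d])
      then show False using nc by simp
    qed
  qed
  then show ?thesis by (intro exI)
qed

theorem theorem4p16:
  fixes P :: "('a, 'b) monoid_scheme"
    and F :: "'a set \<Rightarrow> 'a set \<Rightarrow> ('a \<Rightarrow> 'a) set"
  assumes "p_group 2 P"
    and "bicyclic P"
    and "\<not> cyclic_subgroup P (derived P (carrier P))"
    and "saturated_fusion_system 2 P F"
  shows "nilpotent_fusion_system P F"
proof -
  interpret group P using assms(1) by (simp add: p_group_def)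
  obtain m where m: "order P = 2 ^ m" using assms(1) unfolding p_group_def order_def by (elim conjE exE)
  interpret two_group_fusion P m F by unfold_locales (fact m assms(4))+
  let ?D = "derived P (carrier P)"
  obtain x y where "bicyclic_metabelian P ?D m x y" using bicyclic_metabelian_derived[OF m assms(2,3)] by (elim exE)
  then interpret bicyclic_metabelian P ?D m x y .
  obtain a c n where nd: "noncyclic_derived P ?D m a c n" using noncyclic_derived_exists by (elim exE)
  show ?thesis
  proof (rule nilpotent_if_no_automizer)
    show "\<not> nontrivial_automizer P m Q A r" for Q A r
    proof
      assume "nontrivial_automizer P m Q A r"
      then have "critical P ?D m a c n Q A r" by (rule critical.intro[OF nd])
      then show False by (rule critical.critical_false) (rule refl)
    qed
  qed
qed

end
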